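(* Let $A\in\mathbb{Z}^{d\times n}$ have rank $d$ with columns lying in an affine hyperplane of $\mathbb{Q}^d$ not containing the origin, let $\beta\in\mathbb{C}^d$, let $w\in\mathbb{R}^n$ be a generic weight vector, and let $v$ be a fake exponent of $H_A(\beta)$ with respect to $w$. Assume that $\mathcal{S}_w(v)$ contains a top-dimensional standard pair and that $\mathbb{C}[\operatorname{link}_v]$ is Cohen--Macaulay. Then $$H_{w,v}(t)=h_{\operatorname{link}_v}(t).$$ Consequently, $$\sum_{q\geq0}\dim_{\mathbb{C}}(Q_v^{\perp})_q\,t^q=h_{\operatorname{link}_v}(t)\quad\text{and}\quad\operatorname{frank}_w(v)=h_{\operatorname{link}_v}(1).$$ If, in addition, $B$ is a $\mathbb{Z}$-basis of $L=\ker_{\mathbb{Z}}(A)$ and $P=m(s)P_B$, then $$\sum_{q\geq0}\dim_{\mathbb{C}}C_v(q)\,t^q=h_{\operatorname{link}_v}(t),$$ and thus $\max\{q\mid C_v(q)\neq0\}=\deg h_{\operatorname{link}_v}(t)$ and $\dim_{\mathbb{C}}C_v=h_{\operatorname{link}_v}(1)$.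
   Context: Notation: $\mathbb{N}=\{0,1,2,\ldots\}$, $[n]=\{1,\ldots,n\}$, $L=\ker_{\mathbb{Z}}(A)$. The toric ideal is $I_A=\langle\partial^u-\partial^{u'}\mid Au=Au',\ u,u'\in\mathbb{N}^n\rangle\subseteq\mathbb{C}[\partial_1,\ldots,\partial_n]$. $\operatorname{in}_w(I_A)$ is the ideal generated by the $w$-initial forms (sums of terms of maximal $w$-weight) of elements of $I_A$; "$w$ generic" means in particular that $\operatorname{in}_w(I_A)$ is a monomial ideal. Let $D=\mathbb{C}\langle x_1,\ldots,x_n,\partial_1,\ldots,\partial_n\rangle$ be the Weyl algebra and $\vartheta_j=x_j\partial_j$. $H_A(\beta)$ is the left ideal of $D$ generated by $I_A$ and the Euler operators $\sum_j a_{ij}\vartheta_j-\beta_i$. The fake indicial ideal is $(D\cdot\operatorname{in}_w(I_A)\cap\mathbb{C}[\vartheta])+\langle A\vartheta-\beta\rangle\subseteq\mathbb{C}[\vartheta]$; a zero $v\in\mathbb{C}^n$ of it is called a fake exponent of $H_A(\beta)$ with respect to $w$. $\operatorname{nsupp}(z)=\{j\in[n]\mid z_j\in\mathbb{Z}_{<0}\}$ for $z\in\mathbb{C}^n$. For $u\in L$ put $I_u=\operatorname{nsupp}(v+u)$, so $I_0=\operatorname{nsupp}(v)$; put $V=[n]\setminus I_0$. A standard pair of a monomial ideal $M\subseteq\mathbb{C}[\partial]$ is a pair $(a,\sigma)$, $a\in\mathbb{N}^n$, $\sigma\subseteq[n]$, such that (i) $a_i=0$ for $i\in\sigma$; (ii)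 $\partial^a\prod_{j\in\sigma}\partial_j^{b_j}\notin M$ for all $b_j\in\mathbb{N}$; (iii) for every $\ell\notin\sigma$ there are $b_j\in\mathbb{N}$ ($j\in\sigma\cup\{\ell\}$) with $\partial^a\prod_{j\in\sigma\cup\{\ell\}}\partial_j^{b_j}\in M$. $\mathcal{S}(M)$ is the set of standard pairs. A standard pair of $\operatorname{in}_w(I_A)$ is top-dimensional if $|\sigma|=d$. Put $\mathcal{S}_w(v)=\{(a,\sigma)\in\mathcal{S}(\operatorname{in}_w(I_A))\mid v_j=a_j\text{ for every }j\notin\sigma\}$. (Known criterion: $v$ is a fake exponent iff $Av=\beta$ and $\mathcal{S}_w(v)\neq\emptyset$.) $\Delta_w(v)=\{\tau\subseteq[n]\mid\tau\subseteq\sigma\text{ for some }(a,\sigma)\in\mathcal{S}_w(v)\}$, and $\operatorname{link}_v=\{\tau\in\Delta_w(v)\mid\tau\cap I_0=\emptyset,\ \tau\cup I_0\in\Delta_w(v)\}$, regarded as a simplicial complex on the vertex set $V$ (some elements of $V$ may be nonfaces). For a simplicial complex $\Delta$ on $V$, $I_\Delta=\langle\prod_{i\in\tau}x_i\mid\tau\subseteq V,\ \tau\notin\Delta\rangle$ and $\mathbb{C}[\Delta]=\mathbb{C}[x_i\mid i\in V]/I_\Delta$. If $\dim\Delta=r-1$, the $h$-polynomial $h_\Delta(t)$ is defined by $\operatorname{Hilb}(\mathbb{C}[\Delta],t)=h_\Delta(t)/(1-t)^r$; equivalently $h_\Delta(t)=\sum_{j=-1}^{r-1}f_j(\Delta)t^{j+1}(1-t)^{r-1-j}$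 with $f_j(\Delta)$ the number of $j$-dimensional faces, $f_{-1}=1$. Let $\{\partial^{g_+^{(i)}}-\partial^{g_-^{(i)}}\mid i=1,\ldots,m\}$ be the reduced Gröbner basis of $I_A$ with respect to $w$, with $\partial^{g_+^{(i)}}\in\operatorname{in}_w(I_A)$; put $g^{(i)}=g_+^{(i)}-g_-^{(i)}$ and $G^{(i)}=I_{-g^{(i)}}\setminus I_0$. Let $T=\mathbb{C}[\theta_1,\ldots,\theta_n]$, $\langle A\theta\rangle=\langle\sum_j a_{ij}\theta_j\mid i=1,\ldots,d\rangle$, $M_\theta(v)=\langle\prod_{j\in G^{(i)}}\theta_j\mid i=1,\ldots,m\rangle$, $Q_v=\langle A\theta\rangle+M_\theta(v)\subseteq T$. $Q_v^\perp=\{f\in\mathbb{C}[z_1,\ldots,z_n]\mid\phi(\partial_z)\bullet f=0\text{ for all }\phi\in Q_v\}$, $(Q_v^\perp)_q$ is its degree-$q$ part, and $\operatorname{frank}_w(v)=\dim_{\mathbb{C}}Q_v^\perp$. Write $k=|I_0|$, $I_0=\{i_1,\ldots,i_k\}$. By row reduction, $\langle A\theta\rangle$ has generators $\theta_{i_p}-L_p(\theta_V)$ ($1\le p\le k$), $\ell_q(\theta_V)$ ($1\le q\le d-k$), with $L_p,\ell_q$ linear forms in the variables $\theta_j$, $j\in V$. Via $\theta_j\mapsto x_j$ regard $\ell_q\in\mathbb{C}[\operatorname{link}_v]$, and define $H_{w,v}(t)=\operatorname{Hilb}\bigl(\mathbb{C}[\operatorname{link}_v]/(\ell_1,\ldots,\ell_{d-|I_0|}),t\bigr)$;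 it is a polynomial independent of the choice of the $L_p,\ell_q$. Frobenius data. $C(w)=\sum_{i=1}^m\mathbb{N}g^{(i)}$. For a $\mathbb{Z}$-basis $B=\{b^{(1)},\ldots,b^{(h)}\}$ of $L$ ($h=n-d$), put $(Bs)_j=\sum_{k=1}^h b^{(k)}_js_k\in\mathbb{C}[s]=\mathbb{C}[s_1,\ldots,s_h]$ and $(Bs)^F=\prod_{j\in F}(Bs)_j$ for $F\subseteq[n]$. Let $$\operatorname{NS}_w(v)=\{I_u\mid u\in L,\ u'\in C(w)\text{ for every }u'\in L\text{ with }I_{u'}=I_u\},$$ let $\operatorname{NS}_w^c(v)=\{I_u\mid u\in L\}\setminus\operatorname{NS}_w(v)$, and $K=\bigcap_{I\in\operatorname{NS}_w(v)}I$. Define $$P=\langle(Bs)^{(I\cup J)\setminus K}\mid I\in\operatorname{NS}_w(v),\ J\in\operatorname{NS}_w^c(v)\rangle,\quad m(s)=(Bs)^{I_0\setminus K},\quad P_B=\langle(Bs)^{G^{(i)}}\mid i=1,\ldots,m\rangle$$ (ideals, resp. an element, of $\mathbb{C}[s]$). Series solutions. A series solution with exponent $v$ in the direction $w$ is a solution of $H_A(\beta)$ of the form $\phi=x^v\sum_{u\in L}g_u(\log x)x^u$ with $g_0\neq0$, where the $g_u\in\mathbb{C}[\log x_1,\ldots,\log x_n]$ have uniformly bounded degree and $\{u\mid g_u\neq0\}$ lies in a pointed rational cone on which $w\cdot u>0$ for $u\neq0$ (the usual convention for series in the direction $w$). $C_v$ is the vector space consisting of $0$ and all leading coefficients $g_0$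 of such solutions, and $C_v(q)=C_v\cap\mathbb{C}[\log x_1,\ldots,\log x_n]_q$. *)

theory Defs
  imports
    "HOL-Algebra.QuotRing"
    "HOL-Algebra.Ring_Divisibility"
    "HOL-Analysis.Analysis"
    "HOL-Library.Poly_Mapping"
    "HOL-Library.Extended_Nat"
    "HOL-Computational_Algebra.Polynomial_FPS"
begin

section \<open>Polynomials\<close>

type_synonym 'v cpoly = "('v \<Rightarrow>\<^sub>0 nat) \<Rightarrow>\<^sub>0 complex"

definition pconst :: "complex \<Rightarrow> 'v cpoly" where
  "pconst c = Poly_Mapping.single 0 c"

definition pmon :: "('v \<Rightarrow>\<^sub>0 nat) \<Rightarrow> 'v cpoly" where
  "pmon m = Poly_Mapping.single m 1"

definition pvar :: "'v \<Rightarrow> 'v cpoly" where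
  "pvar j = pmon (Poly_Mapping.single j 1)"

definition peval :: "('v \<Rightarrow> complex) \<Rightarrow> 'v cpoly \<Rightarrow> complex" where
  "peval z p = (\<Sum>m\<in>Poly_Mapping.keys p.
     Poly_Mapping.lookup p m *
     (\<Prod>j\<in>Poly_Mapping.keys m. z j ^ Poly_Mapping.lookup m j))"

definition mdeg :: "('v \<Rightarrow>\<^sub>0 nat) \<Rightarrow> nat" where
  "mdeg m = (\<Sum>j\<in>Poly_Mapping.keys m. Poly_Mapping.lookup m j)"

definition homog :: "nat \<Rightarrow> 'v cpoly \<Rightarrow> bool" where
  "homog q p \<longleftrightarrow> (\<forall>m\<in>Poly_Mapping.keys p. mdeg m = q)"

text \<open>The subring of polynomials that involve only the variables in \<open>V\<close>.\<close>

definition poly_ring :: "'v set \<Rightarrow> 'v cpoly ring" where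
  "poly_ring V =
     \<lparr>carrier = {p. \<forall>m\<in>Poly_Mapping.keys p. Poly_Mapping.keys m \<subseteq> V},
      mult = (*), one = 1, zero = 0, add = (+)\<rparr>"

definition cscale :: "complex \<Rightarrow> 'v cpoly \<Rightarrow> 'v cpoly" where
  "cscale c p = pconst c * p"

interpretation cpoly: vector_space cscale
  by unfold_locales
    (simp_all add: cscale_def pconst_def distrib_left distrib_right single_add
      mult.assoc[symmetric] mult_single)

definition fin_dim :: "'v cpoly set \<Rightarrow> bool" where
  "fin_dim S \<longleftrightarrow> (\<exists>E. finite E \<and> S \<subseteq> cpoly.span E)"

definition monomial_ideal :: "'v cpoly set \<Rightarrow> bool" where
  "monomial_ideal M \<longleftrightarrow> (\<exists>E. M = Idl\<^bsub>poly_ring UNIV\<^esub> (pmon ` E))"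

text \<open>\<open>pdiff \<phi> f\<close> is the polynomial \<open>\<phi>(\<partial>) \<bullet> f\<close>. The inner product vanishes unless the
  exponent of the operator is bounded by the exponent of the monomial it is applied to.\<close>

definition pdiff :: "'v cpoly \<Rightarrow> 'v cpoly \<Rightarrow> 'v cpoly" where
  "pdiff \<phi> f = (\<Sum>m\<in>Poly_Mapping.keys \<phi>. \<Sum>k\<in>Poly_Mapping.keys f.
     Poly_Mapping.single (k - m)
       (Poly_Mapping.lookup \<phi> m * Poly_Mapping.lookup f k *
        (\<Prod>j\<in>Poly_Mapping.keys m. \<Prod>i<Poly_Mapping.lookup m j.
           of_nat (Poly_Mapping.lookup k j) - of_nat i)))"


section \<open>Vectors\<close>

definition exp_vec :: "('n::finite \<Rightarrow>\<^sub>0 nat) \<Rightarrow> int ^ 'n" where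
  "exp_vec u = (\<chi> j. int (Poly_Mapping.lookup u j))"

definition cvec :: "int ^ 'n::finite \<Rightarrow> complex ^ 'n" where
  "cvec u = (\<chi> j. of_int (u $ j))"

definition rvec :: "int ^ 'n::finite \<Rightarrow> real ^ 'n" where
  "rvec u = (\<chi> j. of_int (u $ j))"

definition int_kernel :: "int ^ 'n::finite ^ 'd::finite \<Rightarrow> (int ^ 'n) set" where
  "int_kernel A = {u. A *v u = 0}"

definition is_Z_basis :: "nat \<Rightarrow> (nat \<Rightarrow> int ^ 'n::finite) \<Rightarrow> (int ^ 'n) set \<Rightarrow> bool" where
  "is_Z_basis h B L \<longleftrightarrow>
     L = {\<Sum>k<h. c k *s B k | c :: nat \<Rightarrow> int. True} \<and>
     (\<forall>c :: nat \<Rightarrow> int. (\<Sum>k<h. c k *s B k) = 0 \<longrightarrow> (\<forall>k<h. c k = 0))"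

definition columns_in_affine_hyperplane :: "int ^ 'n::finite ^ 'd::finite \<Rightarrow> bool" where
  "columns_in_affine_hyperplane A \<longleftrightarrow>
     (\<exists>(c :: rat ^ 'd) (b :: rat). c \<noteq> 0 \<and> b \<noteq> 0 \<and>
        (\<forall>j. (\<Sum>i\<in>UNIV. c $ i * of_int (A $ i $ j)) = b))"


section \<open>Toric ideals, initial ideals and Groebner bases\<close>

definition toric_ideal :: "int ^ 'n::finite ^ 'd::finite \<Rightarrow> 'n cpoly set" where
  "toric_ideal A = Idl\<^bsub>poly_ring UNIV\<^esub>
     {pmon u - pmon u' | u u'. A *v exp_vec u = A *v exp_vec u'}"

definition weight :: "real ^ 'n::finite \<Rightarrow> ('n \<Rightarrow>\<^sub>0 nat) \<Rightarrow> real" where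
  "weight w m = w \<bullet> rvec (exp_vec m)"

definition init_form :: "real ^ 'n::finite \<Rightarrow> 'n cpoly \<Rightarrow> 'n cpoly" where
  "init_form w f =
     (\<Sum>m\<in>{m \<in> Poly_Mapping.keys f. \<forall>m'\<in>Poly_Mapping.keys f. weight w m' \<le> weight w m}.
        Poly_Mapping.single m (Poly_Mapping.lookup f m))"

definition init_ideal :: "real ^ 'n::finite \<Rightarrow> 'n cpoly set \<Rightarrow> 'n cpoly set" where
  "init_ideal w I = Idl\<^bsub>poly_ring UNIV\<^esub> (init_form w ` I)"

definition reduced_groebner_basis ::
    "real ^ 'n::finite \<Rightarrow> 'n cpoly set \<Rightarrow> 'n cpoly set \<Rightarrow> bool" where
  "reduced_groebner_basis w I G \<longleftrightarrow>
     finite G \<and> G \<subseteq> I \<and>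
     Idl\<^bsub>poly_ring UNIV\<^esub> (init_form w ` G) = init_ideal w I \<and>
     (\<forall>g\<in>G. \<exists>m. init_form w g = pmon m \<and>
        pmon m \<notin> Idl\<^bsub>poly_ring UNIV\<^esub> (init_form w ` (G - {g})) \<and>
        (\<forall>m'\<in>Poly_Mapping.keys g - {m}. pmon m' \<notin> init_ideal w I))"

definition generic_weight :: "int ^ 'n::finite ^ 'd::finite \<Rightarrow> real ^ 'n \<Rightarrow> bool" where
  "generic_weight A w \<longleftrightarrow> monomial_ideal (init_ideal w (toric_ideal A))"


section \<open>The Weyl algebra\<close>

text \<open>An operator is stored by its coefficients in the basis \<open>x\<^sup>a \<partial>\<^sup>b\<close>, indexed by the pairs
  \<open>(a, b)\<close>. The product is \<open>weyl_mult\<close>, not the commutative product \<open>(*)\<close> that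
  \<^typ>\<open>'a \<Rightarrow>\<^sub>0 'b\<close> carries; it comes from the Leibniz rule
  \<open>\<partial>\<^sup>b x\<^sup>c = (\<Sum>k. (\<Prod>j. k\<^sub>j! binom(b\<^sub>j, k\<^sub>j) binom(c\<^sub>j, k\<^sub>j)) x\<^bsup>c-k\<^esup> \<partial>\<^bsup>b-k\<^esup>)\<close>.\<close>

type_synonym 'n weyl = "(('n \<Rightarrow>\<^sub>0 nat) \<times> ('n \<Rightarrow>\<^sub>0 nat)) \<Rightarrow>\<^sub>0 complex"

definition weyl_mult_mon ::
    "('n::finite \<Rightarrow>\<^sub>0 nat) \<times> ('n \<Rightarrow>\<^sub>0 nat) \<Rightarrow> ('n \<Rightarrow>\<^sub>0 nat) \<times> ('n \<Rightarrow>\<^sub>0 nat) \<Rightarrow> 'n weyl" where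
  "weyl_mult_mon = (\<lambda>(a, b) (c, e).
     (\<Sum>k\<in>{k. \<forall>j. Poly_Mapping.lookup k j \<le> Poly_Mapping.lookup b j \<and>
                   Poly_Mapping.lookup k j \<le> Poly_Mapping.lookup c j}.
        Poly_Mapping.single (a + (c - k), (b - k) + e)
          (\<Prod>j\<in>UNIV. fact (Poly_Mapping.lookup k j) *
             of_nat (Poly_Mapping.lookup b j choose Poly_Mapping.lookup k j) *
             of_nat (Poly_Mapping.lookup c j choose Poly_Mapping.lookup k j))))"

definition weyl_scale :: "complex \<Rightarrow> 'n weyl \<Rightarrow> 'n weyl" where
  "weyl_scale c P = Poly_Mapping.map ((*) c) P"

definition weyl_mult :: "'n::finite weyl \<Rightarrow> 'n weyl \<Rightarrow> 'n weyl" where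
  "weyl_mult P Q = (\<Sum>s\<in>Poly_Mapping.keys P. \<Sum>t\<in>Poly_Mapping.keys Q.
     weyl_scale (Poly_Mapping.lookup P s * Poly_Mapping.lookup Q t) (weyl_mult_mon s t))"

inductive_set weyl_left_ideal :: "'n::finite weyl set \<Rightarrow> 'n weyl set" for S where
  zero: "0 \<in> weyl_left_ideal S"
| mult: "Q \<in> S \<Longrightarrow> weyl_mult P Q \<in> weyl_left_ideal S"
| add: "P \<in> weyl_left_ideal S \<Longrightarrow> Q \<in> weyl_left_ideal S \<Longrightarrow> P + Q \<in> weyl_left_ideal S"

definition weyl_const :: "complex \<Rightarrow> 'n weyl" where
  "weyl_const c = Poly_Mapping.single (0, 0) c"

definition weyl_theta :: "'n \<Rightarrow> 'n weyl" where
  "weyl_theta j = Poly_Mapping.single (Poly_Mapping.single j 1, Poly_Mapping.single j 1) 1"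

text \<open>The inclusion of \<open>\<complex>[\<partial>]\<close> in the Weyl algebra.\<close>

definition weyl_of_partial :: "'n cpoly \<Rightarrow> 'n weyl" where
  "weyl_of_partial f =
     (\<Sum>b\<in>Poly_Mapping.keys f. Poly_Mapping.single (0, b) (Poly_Mapping.lookup f b))"

text \<open>The graph of the algebra homomorphism \<open>\<complex>[\<vartheta>] \<rightarrow> D\<close> that sends the variable \<open>j\<close> to
  \<open>\<vartheta>\<^sub>j = x\<^sub>j \<partial>\<^sub>j\<close>.\<close>

inductive theta_graph :: "'n::finite cpoly \<Rightarrow> 'n weyl \<Rightarrow> bool" where
  const: "theta_graph (pconst c) (weyl_const c)"
| var: "theta_graph (pvar j) (weyl_theta j)"
| add: "theta_graph p P \<Longrightarrow> theta_graph q Q \<Longrightarrow> theta_graph (p + q) (P + Q)"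
| mult: "theta_graph p P \<Longrightarrow> theta_graph q Q \<Longrightarrow> theta_graph (p * q) (weyl_mult P Q)"

definition row_form :: "int ^ 'n::finite ^ 'd::finite \<Rightarrow> 'd \<Rightarrow> 'n cpoly" where
  "row_form A i = (\<Sum>j\<in>UNIV. pconst (of_int (A $ i $ j)) * pvar j)"

definition euler_op :: "int ^ 'n::finite ^ 'd::finite \<Rightarrow> complex ^ 'd \<Rightarrow> 'd \<Rightarrow> 'n weyl" where
  "euler_op A \<beta> i =
     (\<Sum>j\<in>UNIV. weyl_scale (of_int (A $ i $ j)) (weyl_theta j)) - weyl_const (\<beta> $ i)"

definition hypergeometric_ideal ::
    "int ^ 'n::finite ^ 'd::finite \<Rightarrow> complex ^ 'd \<Rightarrow> 'n weyl set" where
  "hypergeometric_ideal A \<beta> =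
     weyl_left_ideal (weyl_of_partial ` toric_ideal A \<union> range (euler_op A \<beta>))"

definition fake_indicial_ideal ::
    "int ^ 'n::finite ^ 'd::finite \<Rightarrow> complex ^ 'd \<Rightarrow> real ^ 'n \<Rightarrow> 'n cpoly set" where
  "fake_indicial_ideal A \<beta> w = Idl\<^bsub>poly_ring UNIV\<^esub>
     ({p. \<exists>P\<in>weyl_left_ideal (weyl_of_partial ` init_ideal w (toric_ideal A)). theta_graph p P} \<union>
      {row_form A i - pconst (\<beta> $ i) | i. True})"

definition fake_exponent ::
    "int ^ 'n::finite ^ 'd::finite \<Rightarrow> complex ^ 'd \<Rightarrow> real ^ 'n \<Rightarrow> complex ^ 'n \<Rightarrow> bool" where
  "fake_exponent A \<beta> w v \<longleftrightarrow> (\<forall>p\<in>fake_indicial_ideal A \<beta> w. peval (($) v) p = 0)"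


section \<open>Standard pairs and the link\<close>

definition nsupp :: "complex ^ 'n::finite \<Rightarrow> 'n set" where
  "nsupp z = {j. \<exists>k::int. k < 0 \<and> z $ j = of_int k}"

definition nsupp_shift :: "complex ^ 'n::finite \<Rightarrow> int ^ 'n \<Rightarrow> 'n set" where
  "nsupp_shift v u = nsupp (v + cvec u)"

definition standard_pairs :: "'n cpoly set \<Rightarrow> (('n \<Rightarrow>\<^sub>0 nat) \<times> 'n set) set" where
  "standard_pairs M = {(a, \<sigma>).
     (\<forall>i\<in>\<sigma>. Poly_Mapping.lookup a i = 0) \<and>
     (\<forall>b. Poly_Mapping.keys b \<subseteq> \<sigma> \<longrightarrow> pmon (a + b) \<notin> M) \<and>
     (\<forall>l. l \<notin> \<sigma> \<longrightarrow> (\<exists>b. Poly_Mapping.keys b \<subseteq> insert l \<sigma> \<and> pmon (a + b) \<in> M))}"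

definition std_pairs_at ::
    "int ^ 'n::finite ^ 'd::finite \<Rightarrow> real ^ 'n \<Rightarrow> complex ^ 'n \<Rightarrow> (('n \<Rightarrow>\<^sub>0 nat) \<times> 'n set) set" where
  "std_pairs_at A w v = {(a, \<sigma>) \<in> standard_pairs (init_ideal w (toric_ideal A)).
     \<forall>j. j \<notin> \<sigma> \<longrightarrow> v $ j = of_nat (Poly_Mapping.lookup a j)}"

definition Delta_complex ::
    "int ^ 'n::finite ^ 'd::finite \<Rightarrow> real ^ 'n \<Rightarrow> complex ^ 'n \<Rightarrow> 'n set set" where
  "Delta_complex A w v = {\<tau>. \<exists>(a, \<sigma>)\<in>std_pairs_at A w v. \<tau> \<subseteq> \<sigma>}"

definition link_complex ::
    "int ^ 'n::finite ^ 'd::finite \<Rightarrow> real ^ 'n \<Rightarrow> complex ^ 'n \<Rightarrow> 'n set set" where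
  "link_complex A w v =
     {\<tau> \<in> Delta_complex A w v. \<tau> \<inter> nsupp v = {} \<and> \<tau> \<union> nsupp v \<in> Delta_complex A w v}"


section \<open>Stanley-Reisner rings, Hilbert series and the Cohen-Macaulay property\<close>

definition sr_ideal :: "'v set \<Rightarrow> 'v set set \<Rightarrow> 'v cpoly set" where
  "sr_ideal V \<Delta> = Idl\<^bsub>poly_ring V\<^esub> {\<Prod>i\<in>\<tau>. pvar i | \<tau>. \<tau> \<subseteq> V \<and> \<tau> \<notin> \<Delta>}"

definition sr_ring :: "'v set \<Rightarrow> 'v set set \<Rightarrow> 'v cpoly set ring" where
  "sr_ring V \<Delta> = poly_ring V Quot (sr_ideal V \<Delta>)"

definition graded_part :: "'v cpoly set \<Rightarrow> nat \<Rightarrow> 'v cpoly set" where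
  "graded_part S q = {p \<in> S. homog q p}"

text \<open>The Hilbert series of \<open>\<complex>[x\<^sub>i | i \<in> V] / J\<close> for a finite set \<open>V\<close> and a homogeneous ideal \<open>J\<close>:
  the degree-\<open>q\<close> part is the quotient of the two finite-dimensional spaces below.\<close>

definition hilbert_series :: "'v set \<Rightarrow> 'v cpoly set \<Rightarrow> int fps" where
  "hilbert_series V J = Abs_fps (\<lambda>q.
     int (cpoly.dim (graded_part (carrier (poly_ring V)) q)) - int (cpoly.dim (graded_part J q)))"

definition h_poly :: "'v set \<Rightarrow> 'v set set \<Rightarrow> int poly" where
  "h_poly V \<Delta> = (THE p. fps_of_poly p =
     hilbert_series V (sr_ideal V \<Delta>) * (1 - fps_X) ^ Max (card ` \<Delta>))"

definition regular_sequence :: "('a, 'b) ring_scheme \<Rightarrow> 'a list \<Rightarrow> bool" where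
  "regular_sequence R xs \<longleftrightarrow>
     set xs \<subseteq> carrier R \<and> Idl\<^bsub>R\<^esub> (set xs) \<noteq> carrier R \<and>
     (\<forall>i<length xs. \<forall>y\<in>carrier R.
        (xs ! i) \<otimes>\<^bsub>R\<^esub> y \<in> Idl\<^bsub>R\<^esub> (set (take i xs)) \<longrightarrow> y \<in> Idl\<^bsub>R\<^esub> (set (take i xs)))"

definition ideal_depth :: "('a, 'b) ring_scheme \<Rightarrow> 'a set \<Rightarrow> enat" where
  "ideal_depth R I = Sup {enat (length xs) | xs. regular_sequence R xs \<and> set xs \<subseteq> I}"

definition prime_height :: "('a, 'b) ring_scheme \<Rightarrow> 'a set \<Rightarrow> enat" where
  "prime_height R Q = Sup {enat k | k. \<exists>C :: nat \<Rightarrow> 'a set.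
     (\<forall>i\<le>k. primeideal (C i) R) \<and> (\<forall>i<k. C i \<subset> C (Suc i)) \<and> C k = Q}"

definition cohen_macaulay :: "('a, 'b) ring_scheme \<Rightarrow> bool" where
  "cohen_macaulay R \<longleftrightarrow> cring R \<and> noetherian_ring R \<and>
     (\<forall>M. maximalideal M R \<longrightarrow> ideal_depth R M = prime_height R M)"


section \<open>The ideal \<open>Q\<^sub>v\<close> and the Hilbert series \<open>H\<^sub>w\<^sub>,\<^sub>v\<close>\<close>

text \<open>From here on, \<open>g i\<close> for \<open>i < m\<close> are the vectors \<open>g\<^sub>+ - g\<^sub>-\<close> of a reduced Groebner basis.\<close>

definition G_set :: "complex ^ 'n::finite \<Rightarrow> int ^ 'n \<Rightarrow> 'n set" where
  "G_set v u = nsupp_shift v (- u) - nsupp v"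

definition Q_ideal ::
    "int ^ 'n::finite ^ 'd::finite \<Rightarrow> complex ^ 'n \<Rightarrow> nat \<Rightarrow> (nat \<Rightarrow> int ^ 'n) \<Rightarrow> 'n cpoly set" where
  "Q_ideal A v m g = Idl\<^bsub>poly_ring UNIV\<^esub>
     (range (row_form A) \<union> {\<Prod>j\<in>G_set v (g i). pvar j | i. i < m})"

definition Q_perp ::
    "int ^ 'n::finite ^ 'd::finite \<Rightarrow> complex ^ 'n \<Rightarrow> nat \<Rightarrow> (nat \<Rightarrow> int ^ 'n) \<Rightarrow> 'n cpoly set" where
  "Q_perp A v m g = {f. \<forall>\<phi>\<in>Q_ideal A v m g. pdiff \<phi> f = 0}"

definition frank ::
    "int ^ 'n::finite ^ 'd::finite \<Rightarrow> complex ^ 'n \<Rightarrow> nat \<Rightarrow> (nat \<Rightarrow> int ^ 'n) \<Rightarrow> nat" where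
  "frank A v m g = cpoly.dim (Q_perp A v m g)"

text \<open>\<open>\<theta>\<^sub>p - L p\<close> (\<open>p \<in> I\<^sub>0\<close>) and \<open>ell q\<close> (\<open>q < d - |I\<^sub>0|\<close>) generate \<open>\<langle>A\<theta>\<rangle>\<close>, where all \<open>L p\<close> and \<open>ell q\<close> are
  linear forms in the variables outside \<open>I\<^sub>0 = nsupp v\<close>.\<close>

definition row_reduction ::
    "int ^ 'n::finite ^ 'd::finite \<Rightarrow> complex ^ 'n \<Rightarrow> ('n \<Rightarrow> 'n cpoly) \<Rightarrow> (nat \<Rightarrow> 'n cpoly) \<Rightarrow> bool" where
  "row_reduction A v L ell \<longleftrightarrow>
     (\<forall>p\<in>nsupp v. L p \<in> graded_part (carrier (poly_ring (- nsupp v))) 1) \<and>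
     (\<forall>q < CARD('d) - card (nsupp v). ell q \<in> graded_part (carrier (poly_ring (- nsupp v))) 1) \<and>
     Idl\<^bsub>poly_ring UNIV\<^esub>
       ((\<lambda>p. pvar p - L p) ` nsupp v \<union> ell ` {..<CARD('d) - card (nsupp v)}) =
     Idl\<^bsub>poly_ring UNIV\<^esub> (range (row_form A))"

text \<open>\<open>\<complex>[link\<^sub>v] / (ell)\<close> is presented as the quotient of \<open>\<complex>[x\<^sub>i | i \<in> V]\<close> by the ideal generated by the
  Stanley-Reisner ideal and the \<open>ell q\<close>.\<close>

definition H_series ::
    "int ^ 'n::finite ^ 'd::finite \<Rightarrow> real ^ 'n \<Rightarrow> complex ^ 'n \<Rightarrow> (nat \<Rightarrow> 'n cpoly) \<Rightarrow> int fps" where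
  "H_series A w v ell = hilbert_series (- nsupp v) (Idl\<^bsub>poly_ring (- nsupp v)\<^esub>
     (sr_ideal (- nsupp v) (link_complex A w v) \<union> ell ` {..<CARD('d) - card (nsupp v)}))"


section \<open>Frobenius data\<close>

definition C_monoid :: "nat \<Rightarrow> (nat \<Rightarrow> int ^ 'n::finite) \<Rightarrow> (int ^ 'n) set" where
  "C_monoid m g = {\<Sum>i<m. int (c i) *s g i | c :: nat \<Rightarrow> nat. True}"

definition NS ::
    "int ^ 'n::finite ^ 'd::finite \<Rightarrow> complex ^ 'n \<Rightarrow> nat \<Rightarrow> (nat \<Rightarrow> int ^ 'n) \<Rightarrow> 'n set set" where
  "NS A v m g = {nsupp_shift v u | u. u \<in> int_kernel A \<and>
     (\<forall>u'\<in>int_kernel A. nsupp_shift v u' = nsupp_shift v u \<longrightarrow> u' \<in> C_monoid m g)}"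

definition NS_compl ::
    "int ^ 'n::finite ^ 'd::finite \<Rightarrow> complex ^ 'n \<Rightarrow> nat \<Rightarrow> (nat \<Rightarrow> int ^ 'n) \<Rightarrow> 'n set set" where
  "NS_compl A v m g = nsupp_shift v ` int_kernel A - NS A v m g"

definition K_set ::
    "int ^ 'n::finite ^ 'd::finite \<Rightarrow> complex ^ 'n \<Rightarrow> nat \<Rightarrow> (nat \<Rightarrow> int ^ 'n) \<Rightarrow> 'n set" where
  "K_set A v m g = \<Inter> (NS A v m g)"

definition Bs_prod :: "nat \<Rightarrow> (nat \<Rightarrow> int ^ 'n::finite) \<Rightarrow> 'n set \<Rightarrow> nat cpoly" where
  "Bs_prod h B F = (\<Prod>j\<in>F. \<Sum>k<h. pconst (of_int (B k $ j)) * pvar k)"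

definition P_ideal ::
    "int ^ 'n::finite ^ 'd::finite \<Rightarrow> complex ^ 'n \<Rightarrow> nat \<Rightarrow> (nat \<Rightarrow> int ^ 'n) \<Rightarrow>
     nat \<Rightarrow> (nat \<Rightarrow> int ^ 'n) \<Rightarrow> nat cpoly set" where
  "P_ideal A v m g h B = Idl\<^bsub>poly_ring {..<h}\<^esub>
     {Bs_prod h B ((I \<union> J) - K_set A v m g) | I J. I \<in> NS A v m g \<and> J \<in> NS_compl A v m g}"

definition m_elem ::
    "int ^ 'n::finite ^ 'd::finite \<Rightarrow> complex ^ 'n \<Rightarrow> nat \<Rightarrow> (nat \<Rightarrow> int ^ 'n) \<Rightarrow>
     nat \<Rightarrow> (nat \<Rightarrow> int ^ 'n) \<Rightarrow> nat cpoly" where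
  "m_elem A v m g h B = Bs_prod h B (nsupp v - K_set A v m g)"

definition PB_ideal ::
    "complex ^ 'n::finite \<Rightarrow> nat \<Rightarrow> (nat \<Rightarrow> int ^ 'n) \<Rightarrow>
     nat \<Rightarrow> (nat \<Rightarrow> int ^ 'n) \<Rightarrow> nat cpoly set" where
  "PB_ideal v m g h B = Idl\<^bsub>poly_ring {..<h}\<^esub> {Bs_prod h B (G_set v (g i)) | i. i < m}"


section \<open>Series solutions\<close>

text \<open>A function \<open>F\<close> on \<open>\<int>\<^sup>n\<close> stands for the formal series \<open>x\<^sup>v (\<Sum>u. F u (log x) x\<^sup>u)\<close>. Since
  \<open>\<partial>\<^sub>j (x\<^sup>s g(log x)) = x\<^bsup>s-e\<^sub>j\<^esup> ((s\<^sub>j + \<partial>/\<partial>log x\<^sub>j) g)(log x)\<close>, the coefficient of \<open>x\<^bsup>v+u\<^esup>\<close> in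
  \<open>x\<^sup>a \<partial>\<^sup>b F\<close> is \<open>(\<Prod>j. \<Prod>k=1..b\<^sub>j. v\<^sub>j + u\<^sub>j - a\<^sub>j + k + \<partial>/\<partial>log x\<^sub>j) F (u - a + b)\<close>.\<close>

definition weyl_act ::
    "complex ^ 'n::finite \<Rightarrow> 'n weyl \<Rightarrow> (int ^ 'n \<Rightarrow> 'n cpoly) \<Rightarrow> (int ^ 'n \<Rightarrow> 'n cpoly)" where
  "weyl_act v P F = (\<lambda>u. \<Sum>(a, b)\<in>Poly_Mapping.keys P.
     cscale (Poly_Mapping.lookup P (a, b))
       (pdiff
         (\<Prod>j\<in>UNIV. \<Prod>k\<in>{1..Poly_Mapping.lookup b j}.
            pconst (v $ j + of_int (u $ j - int (Poly_Mapping.lookup a j) + int k)) + pvar j)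
         (F (u - exp_vec a + exp_vec b))))"

definition rational_cone :: "(int ^ 'n::finite) set \<Rightarrow> (real ^ 'n) set" where
  "rational_cone R = {\<Sum>r\<in>R. c r *\<^sub>R rvec r | c. \<forall>r\<in>R. 0 \<le> c r}"

definition series_solution ::
    "int ^ 'n::finite ^ 'd::finite \<Rightarrow> complex ^ 'd \<Rightarrow> real ^ 'n \<Rightarrow> complex ^ 'n \<Rightarrow>
     (int ^ 'n \<Rightarrow> 'n cpoly) \<Rightarrow> bool" where
  "series_solution A \<beta> w v F \<longleftrightarrow>
     (\<forall>u. F u \<noteq> 0 \<longrightarrow> u \<in> int_kernel A) \<and>
     F 0 \<noteq> 0 \<and>
     (\<exists>N. \<forall>u. \<forall>m\<in>Poly_Mapping.keys (F u). mdeg m \<le> N) \<and>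
     (\<exists>R. finite R \<and>
        (\<forall>x. x \<in> rational_cone R \<and> - x \<in> rational_cone R \<longrightarrow> x = 0) \<and>
        (\<forall>x\<in>rational_cone R. x \<noteq> 0 \<longrightarrow> w \<bullet> x > 0) \<and>
        (\<forall>u. F u \<noteq> 0 \<longrightarrow> rvec u \<in> rational_cone R)) \<and>
     (\<forall>P\<in>hypergeometric_ideal A \<beta>. weyl_act v P F = (\<lambda>u. 0))"

definition leading_coeffs ::
    "int ^ 'n::finite ^ 'd::finite \<Rightarrow> complex ^ 'd \<Rightarrow> real ^ 'n \<Rightarrow> complex ^ 'n \<Rightarrow> 'n cpoly set" where
  "leading_coeffs A \<beta> w v = insert 0 {F 0 | F. series_solution A \<beta> w v F}"

end

theory Submission
  imports Defs
begin

text \<open>Write \<open>V\<close> for the complement of \<open>nsupp v\<close>. A set \<open>\<tau> \<subseteq> V\<close> is a face of the link if and only if it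
  contains no \<open>G_set v (g i)\<close>, so eliminating the variables of \<open>nsupp v\<close> by row reduction identifies the
  polynomial ring modulo \<open>Q_ideal\<close> with the Stanley-Reisner ring of the link modulo the \<open>d - |nsupp v|\<close>
  linear forms \<open>ell\<close>. The columns of \<open>A\<close> indexed by a standard pair are linearly independent; hence,
  modulo the Stanley-Reisner ideal and \<open>ell\<close>, every monomial can be rewritten with strictly larger support
  until it dies: the quotient is Artinian and the \<open>ell\<close> are a system of parameters. By the Cohen-Macaulay
  hypothesis they form a regular sequence (by the Koszul complex and graded Nakayama), which gives the
  \<open>h\<close>-polynomial. Macaulay duality turns the Hilbert function of the quotient into that of \<open>Q_perp\<close>.

  The coefficient of a series solution at \<open>- g i\<close> vanishes because \<open>w \<bullet> g i > 0\<close>, so the toric equations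
  at this exponent show that leading coefficients lie in \<open>Q_perp\<close>. Conversely let \<open>f \<in> Q_perp\<close>. Each
  \<open>\<partial>\<^sub>j\<close> with \<open>j\<close> in the support of some lattice vector is surjective on the common kernel of the row
  forms, so \<open>f\<close> is the image of some \<open>q\<close> under the product of \<open>\<partial>\<^sub>j\<close>, \<open>j \<in> nsupp v - K\<close>. The identity
  \<open>P = m(s) P\<^sub>B\<close> makes \<open>q\<close> vanish under all products over \<open>(I \<union> J) - K\<close>, and hence the Frobenius
  coefficients obtained by applying Gamma quotients in \<open>\<partial>\<close> to \<open>q\<close> solve the system with leading
  coefficient \<open>f\<close>.\<close>

abbreviation lookup where "lookup \<equiv> Poly_Mapping.lookup"
abbreviation keys where "keys \<equiv> Poly_Mapping.keys"
abbreviation single where "single \<equiv> Poly_Mapping.single"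

lemma poly_sum_single: "p = (\<Sum>m\<in>keys p. single m (lookup p m))"
proof (rule poly_mapping_eqI)
  fix k
  show "lookup p k = lookup (\<Sum>m\<in>keys p. single m (lookup p m)) k"
    by (simp add: lookup_sum lookup_single when_def in_keys_iff sum.delta)
qed

lemma cpoly_induct [case_names zero single add]:
  assumes "P 0" "\<And>m c. P (single m c)" "\<And>p q. P p \<Longrightarrow> P q \<Longrightarrow> P (p + q)"
  shows "P (p :: 'v cpoly)"
proof -
  have "P (\<Sum>m\<in>X. single m (lookup p m))" if "finite X" for X
    using that by (induction X rule: finite_induct) (auto intro: assms)
  then show ?thesis
    using poly_sum_single[of p] by (metis finite_keys)
qed

lemma keys_add_nat: "keys (a + b :: 'v \<Rightarrow>\<^sub>0 nat) = keys a \<union> keys b"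
  by (auto simp: in_keys_iff lookup_add)

lemma exponent_minus_single_add: "lookup a j > 0 \<Longrightarrow> a - single j 1 + single j (1::nat) = a"
  by (rule poly_mapping_eqI) (auto simp: lookup_add lookup_minus lookup_single when_def)

lemma keys_mult_mem:
  assumes "m \<in> keys (p * q)"
  obtains a b where "a \<in> keys p" "b \<in> keys q" "m = a + b"
  using keys_mult[of p q] assms by blast

lemma lookup_single_mult_add [simp]:
  "lookup (single a c * p) (a + b) = c * lookup p b" for a :: "'v \<Rightarrow>\<^sub>0 nat" and p :: "'v cpoly"
  by (induction p rule: cpoly_induct)
    (auto simp: mult_single lookup_single when_def distrib_left lookup_add)

lemma pconst_0 [simp]: "pconst 0 = 0" and pconst_1 [simp]: "pconst 1 = 1"
  and pconst_add: "pconst (a + b) = pconst a + pconst b"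
  and pconst_mult: "pconst (a * b) = pconst a * pconst b"
  and pconst_uminus: "pconst (- a) = - pconst a"
  and pconst_diff: "pconst (a - b) = pconst a - pconst b"
  by (simp_all add: pconst_def single_add mult_single single_uminus single_diff)

lemma pmon_0 [simp]: "pmon 0 = 1"
  by (simp add: pmon_def)

lemma pmon_add: "pmon (a + b) = pmon a * pmon b"
  by (simp add: pmon_def mult_single)

lemma single_eq_pconst_pmon: "single m c = pconst c * pmon m"
  by (simp add: pconst_def pmon_def mult_single)

lemma keys_pmon [simp]: "keys (pmon m) = {m}"
  by (simp add: pmon_def)

lemma keys_pvar [simp]: "keys (pvar j) = {single j 1}"
  by (simp add: pvar_def)

lemma keys_pconst: "keys (pconst c) \<subseteq> {0}"
  by (simp add: pconst_def)

lemma lookup_cscale [simp]: "lookup (cscale c p) m = c * lookup p m"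
  using lookup_single_mult_add[of 0 c p m] by (simp add: cscale_def pconst_def)

lemma cscale_mult_left: "cscale c p * q = cscale c (p * q)"
  and cscale_mult_right: "p * cscale c q = cscale c (p * q)"
  by (simp_all add: cscale_def mult_ac)

lemma pmon_prod_single: "pmon (\<Sum>i\<in>X. f i) = (\<Prod>i\<in>X. pmon (f i))"
  by (induction X rule: infinite_finite_induct) (auto simp: pmon_add)

lemma prod_pvar: "(\<Prod>i\<in>X. pvar i) = pmon (\<Sum>i\<in>X. single i 1)"
  by (simp add: pvar_def pmon_prod_single)

lemma lookup_indicator: "finite X \<Longrightarrow> lookup (\<Sum>i\<in>X. single i (1::nat)) j = (if j \<in> X then 1 else 0)"
  by (simp add: lookup_sum lookup_single when_def)

lemma keys_indicator: "finite X \<Longrightarrow> keys (\<Sum>i\<in>X. single i (1::nat)) = X"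
  using lookup_indicator[of X] by (auto simp: in_keys_iff split: if_splits)

lemma exp_dvd_iff: "(\<exists>b. e = a + b) \<longleftrightarrow> (\<forall>j. lookup a j \<le> lookup e j)" for a e :: "'v \<Rightarrow>\<^sub>0 nat"
proof
  assume "\<forall>j. lookup a j \<le> lookup e j"
  then have "e = a + (e - a)" by (intro poly_mapping_eqI) (simp add: lookup_add lookup_minus)
  then show "\<exists>b. e = a + b" by blast
qed (auto simp: lookup_add)

lemma indicator_dvd_iff:
  assumes "finite X"
  shows "(\<exists>b. m = (\<Sum>i\<in>X. single i (1::nat)) + b) \<longleftrightarrow> X \<subseteq> keys m"
  unfolding exp_dvd_iff lookup_indicator[OF assms] by (auto simp: in_keys_iff Suc_le_eq)

section \<open>Ideals of the polynomial rings\<close>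

lemma carrier_poly_ring: "carrier (poly_ring V) = {p. \<forall>m\<in>keys p. keys m \<subseteq> V}"
  and poly_ring_simps [simp]: "mult (poly_ring V) = (*)" "one (poly_ring V) = 1"
    "zero (poly_ring V) = 0" "add (poly_ring V) = (+)"
  by (simp_all add: poly_ring_def)

abbreviation Polys :: "'v set \<Rightarrow> 'v cpoly set" where
  "Polys V \<equiv> carrier (poly_ring V)"

lemma Polys_UNIV [simp]: "p \<in> Polys UNIV"
  by (simp add: carrier_poly_ring)

lemma Polys_0 [simp]: "0 \<in> Polys V" and Polys_1 [simp]: "1 \<in> Polys V"
  by (auto simp: carrier_poly_ring)

lemma Polys_add: "p \<in> Polys V \<Longrightarrow> q \<in> Polys V \<Longrightarrow> p + q \<in> Polys V"
  using Poly_Mapping.keys_add[of p q] by (auto simp: carrier_poly_ring)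

lemma Polys_mult: "p \<in> Polys V \<Longrightarrow> q \<in> Polys V \<Longrightarrow> p * q \<in> Polys V"
  by (fastforce simp: carrier_poly_ring keys_add_nat elim!: keys_mult_mem)

lemma Polys_uminus: "p \<in> Polys V \<Longrightarrow> - p \<in> Polys V"
  by (simp add: carrier_poly_ring)

lemma Polys_diff: "p \<in> Polys V \<Longrightarrow> q \<in> Polys V \<Longrightarrow> p - q \<in> Polys V"
  using Polys_add[of p V "- q"] Polys_uminus[of q V] by simp

lemma Polys_pconst [simp]: "pconst c \<in> Polys V"
  using keys_pconst[of c] by (auto simp: carrier_poly_ring)

lemma Polys_pvar [simp]: "pvar j \<in> Polys V \<longleftrightarrow> j \<in> V"
  by (auto simp: carrier_poly_ring)

lemma Polys_pmon [simp]: "pmon m \<in> Polys V \<longleftrightarrow> keys m \<subseteq> V"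
  by (auto simp: carrier_poly_ring)

lemma Polys_single: "keys m \<subseteq> V \<Longrightarrow> single m c \<in> Polys V"
  by (auto simp: carrier_poly_ring)

lemma Polys_sum: "(\<And>x. x \<in> X \<Longrightarrow> f x \<in> Polys V) \<Longrightarrow> sum f X \<in> Polys V"
  by (induction X rule: infinite_finite_induct) (auto intro: Polys_add)

lemma Polys_prod: "(\<And>x. x \<in> X \<Longrightarrow> f x \<in> Polys V) \<Longrightarrow> prod f X \<in> Polys V"
  by (induction X rule: infinite_finite_induct) (auto intro: Polys_mult)

lemma Polys_power: "p \<in> Polys V \<Longrightarrow> p ^ k \<in> Polys V"
  by (induction k) (auto intro: Polys_mult)

lemmas Polys_intros = Polys_add Polys_mult Polys_uminus Polys_diff Polys_sum Polys_prod Polys_power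

lemma poly_ring_cring: "cring (poly_ring V)"
proof (rule cringI)
  show "abelian_group (poly_ring V)"
  proof (rule abelian_groupI)
    fix x assume x_Polys: "x \<in> Polys V"
    have "- x \<in> Polys V" using x_Polys by (rule Polys_uminus)
    then show "\<exists>y\<in>Polys V. y \<oplus>\<^bsub>poly_ring V\<^esub> x = \<zero>\<^bsub>poly_ring V\<^esub>"
      by (intro bexI[of _ "- x"]) simp_all
  qed (simp_all add: Polys_add add_ac)
  show "comm_monoid (poly_ring V)"
    by (rule comm_monoidI) (simp_all add: Polys_mult mult_ac)
qed (simp_all add: distrib_right)

interpretation poly_ring: cring "poly_ring V" for V
  by (rule poly_ring_cring)

lemma a_inv_poly_ring: "p \<in> Polys V \<Longrightarrow> a_inv (poly_ring V) p = - p"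
  by (rule poly_ring.minus_equality) (auto simp: Polys_uminus)

lemma poly_ideal_iff:
  "ideal J (poly_ring V) \<longleftrightarrow> J \<subseteq> Polys V \<and> 0 \<in> J \<and> (\<forall>a\<in>J. \<forall>b\<in>J. a + b \<in> J) \<and>
     (\<forall>c\<in>Polys V. \<forall>a\<in>J. c * a \<in> J)" (is "?L \<longleftrightarrow> ?R")
proof
  assume ?L
  then interpret ideal J "poly_ring V" .
  show ?R
    using a_subset zero_closed a_closed I_l_closed by simp
next
  assume R: ?R
  show ?L
  proof (rule idealI)
    show "ring (poly_ring V)" by (rule poly_ring.ring_axioms)
    show "subgroup J (add_monoid (poly_ring V))"
    proof (rule poly_ring.add.subgroupI)
      show "a_inv (poly_ring V) a \<in> J" if "a \<in> J" for a
      proof -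
        have "(- 1) * a \<in> J" using R that Polys_uminus[OF Polys_1] by blast
        then show ?thesis using a_inv_poly_ring that R by (metis mult_minus1 subset_iff)
      qed
    qed (use R in auto)
    show "a \<otimes>\<^bsub>poly_ring V\<^esub> x \<in> J" if "a \<in> J" "x \<in> Polys V" for a x
      using R that by (metis poly_ring_simps(1) mult.commute)
  qed (use R in auto)
qed

lemma Polys_ideal: "ideal (Polys V) (poly_ring V)"
  by (rule poly_ring.oneideal)

context
  fixes V :: "'v set" and J :: "'v cpoly set"
  assumes ideal_J: "ideal J (poly_ring V)"
begin

lemma ideal_sub_Polys: "p \<in> J \<Longrightarrow> p \<in> Polys V"
  and ideal_0: "0 \<in> J"
  and ideal_add: "p \<in> J \<Longrightarrow> q \<in> J \<Longrightarrow> p + q \<in> J"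
  and ideal_mult: "c \<in> Polys V \<Longrightarrow> p \<in> J \<Longrightarrow> c * p \<in> J"
  using ideal_J by (auto simp: poly_ideal_iff)

lemma ideal_mult_right: "c \<in> Polys V \<Longrightarrow> p \<in> J \<Longrightarrow> p * c \<in> J"
  using ideal_mult by (simp add: mult.commute)

lemma ideal_uminus: "p \<in> J \<Longrightarrow> - p \<in> J"
  using ideal_mult[of "- 1" p] Polys_uminus[OF Polys_1, of V] by simp

lemma ideal_diff: "p \<in> J \<Longrightarrow> q \<in> J \<Longrightarrow> p - q \<in> J"
  using ideal_add[of p "- q"] ideal_uminus[of q] by simp

lemma ideal_sum: "(\<And>x. x \<in> X \<Longrightarrow> f x \<in> J) \<Longrightarrow> sum f X \<in> J"
  by (induction X rule: infinite_finite_induct) (auto intro: ideal_add ideal_0)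

lemma ideal_cscale: "p \<in> J \<Longrightarrow> cscale c p \<in> J"
  by (simp add: cscale_def ideal_mult)

lemma ideal_subspace: "cpoly.subspace J"
  by (rule cpoly.subspaceI) (auto intro: ideal_0 ideal_add ideal_cscale)

lemma ideal_span: "S \<subseteq> J \<Longrightarrow> cpoly.span S \<subseteq> J"
  by (rule cpoly.span_minimal[OF _ ideal_subspace])

lemma ideal_if_monomials:
  assumes "\<And>m. m \<in> keys p \<Longrightarrow> pmon m \<in> J"
  shows "p \<in> J"
proof -
  have "(\<Sum>m\<in>keys p. pconst (lookup p m) * pmon m) \<in> J"
    by (intro ideal_sum ideal_mult assms Polys_pconst)
  then show ?thesis by (simp only: single_eq_pconst_pmon[symmetric] poly_sum_single[symmetric])
qed

end

lemmas Polys_subspace = ideal_subspace[OF Polys_ideal]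

lemma Idl_ideal: "S \<subseteq> Polys V \<Longrightarrow> ideal (Idl\<^bsub>poly_ring V\<^esub> S) (poly_ring V)"
  by (rule poly_ring.genideal_ideal)

lemma Idl_gen: "S \<subseteq> Polys V \<Longrightarrow> s \<in> S \<Longrightarrow> s \<in> Idl\<^bsub>poly_ring V\<^esub> S"
  using poly_ring.genideal_self by blast

lemma Idl_least: "ideal J (poly_ring V) \<Longrightarrow> S \<subseteq> J \<Longrightarrow> Idl\<^bsub>poly_ring V\<^esub> S \<subseteq> J"
  by (rule poly_ring.genideal_minimal)

lemma Idl_mono: "S \<subseteq> S' \<Longrightarrow> S' \<subseteq> Polys V \<Longrightarrow> Idl\<^bsub>poly_ring V\<^esub> S \<subseteq> Idl\<^bsub>poly_ring V\<^esub> S'"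
  by (rule Idl_least) (auto intro: Idl_ideal Idl_gen)

lemma Idl_of_ideal: "ideal J (poly_ring V) \<Longrightarrow> Idl\<^bsub>poly_ring V\<^esub> J = J"
  using Idl_least[of J V J] Idl_gen[of J V] ideal_sub_Polys[of J V] by blast

inductive_set linear_combinations :: "'v set \<Rightarrow> 'v cpoly set \<Rightarrow> 'v cpoly set" for V S where
  zero: "0 \<in> linear_combinations V S"
| step: "c \<in> Polys V \<Longrightarrow> s \<in> S \<Longrightarrow> p \<in> linear_combinations V S \<Longrightarrow> c * s + p \<in> linear_combinations V S"

lemma linear_combinations_ideal:
  assumes "S \<subseteq> Polys V"
  shows "ideal (linear_combinations V S) (poly_ring V)"
  unfolding poly_ideal_iff
proof (intro conjI ballI subsetI)
  fix p assume "p \<in> linear_combinations V S"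
  then show "p \<in> Polys V"
    using assms by induction (auto intro!: Polys_add Polys_mult)
next
  fix p q assume "p \<in> linear_combinations V S" "q \<in> linear_combinations V S"
  then show "p + q \<in> linear_combinations V S"
    by induction (auto simp: add.assoc intro: linear_combinations.step)
next
  fix d p assume d_Polys: "d \<in> Polys V" and "p \<in> linear_combinations V S"
  from this(2) show "d * p \<in> linear_combinations V S"
  proof induction
    case (step c s p)
    then have "(d * c) * s + d * p \<in> linear_combinations V S"
      using d_Polys by (intro linear_combinations.step Polys_mult)
    then show ?case by (simp add: distrib_left mult.assoc)
  qed (simp add: linear_combinations.zero)
qed (rule linear_combinations.zero)

lemma Idl_induct [consumes 2, case_names zero mult add]:
  assumes "p \<in> Idl\<^bsub>poly_ring V\<^esub> S" "S \<subseteq> Polys V" "P 0"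
    and mult: "\<And>c s. c \<in> Polys V \<Longrightarrow> s \<in> S \<Longrightarrow> P (c * s)"
    and add: "\<And>p q. p \<in> Polys V \<Longrightarrow> q \<in> Polys V \<Longrightarrow> P p \<Longrightarrow> P q \<Longrightarrow> P (p + q)"
  shows "P p"
proof -
  have "S \<subseteq> linear_combinations V S"
    using linear_combinations.step[OF Polys_1 _ linear_combinations.zero] by auto
  then have "p \<in> linear_combinations V S"
    using Idl_least[OF linear_combinations_ideal] assms(1,2) by blast
  then show ?thesis
  proof induction
    case (step c s p)
    then have "p \<in> Polys V" "c * s \<in> Polys V"
      using ideal_sub_Polys[OF linear_combinations_ideal] assms(2) by (auto intro: Polys_mult)
    with step show ?case by (auto intro: add mult)
  qed fact
qed

lemma Idl_Un_linear_combinations: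
  fixes r :: nat
  assumes ideal_J: "ideal J (poly_ring V)" and l_Polys: "\<And>j. j < r \<Longrightarrow> l j \<in> Polys V"
  shows "Idl\<^bsub>poly_ring V\<^esub> (J \<union> l ` {..<r}) = {a + (\<Sum>j<r. c j * l j) | a c. a \<in> J \<and> (\<forall>j. c j \<in> Polys V)}"
    (is "?L = ?R")
proof
  have gens_Polys: "J \<union> l ` {..<r} \<subseteq> Polys V" using ideal_sub_Polys[OF ideal_J] l_Polys by auto
  show "?L \<subseteq> ?R"
  proof
    fix p assume "p \<in> ?L"
    then show "p \<in> ?R" using gens_Polys
    proof (induction rule: Idl_induct)
      case zero
      show ?case using ideal_0[OF ideal_J] by (intro CollectI exI[of _ 0] exI[of _ "\<lambda>_. 0"]) auto
    next
      case (mult d s)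
      then consider (in_ideal) "s \<in> J" | (generator) i where "i < r" "s = l i" by auto
      then show ?case
      proof cases
        case in_ideal
        then show ?thesis
          using mult(1)
          by (intro CollectI exI[of _ "d * s"] exI[of _ "\<lambda>_. 0"]) (auto intro: ideal_mult[OF ideal_J])
      next
        case generator
        then have "d * s = 0 + (\<Sum>j<r. (if j = i then d else 0) * l j)"
          by (simp add: if_distrib[of "\<lambda>x. x * _"] cong: if_cong)
        then show ?thesis
          using ideal_0[OF ideal_J] mult(1)
          by (intro CollectI exI[of _ 0] exI[of _ "\<lambda>j. if j = i then d else 0"]) auto
      qed
    next
      case (add p q)
      then obtain a c b d where "p = a + (\<Sum>j<r. c j * l j)" "q = b + (\<Sum>j<r. d j * l j)"
        "a \<in> J" "b \<in> J" "\<forall>j. c j \<in> Polys V" "\<forall>j. d j \<in> Polys V"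
        by blast
      then show ?case
        by (intro CollectI exI[of _ "a + b"] exI[of _ "\<lambda>j. c j + d j"])
          (auto simp: algebra_simps sum.distrib intro: ideal_add[OF ideal_J] Polys_add)
    qed
  qed
  show "?R \<subseteq> ?L"
    using Idl_gen[OF gens_Polys]
    by (auto intro!: ideal_add[OF Idl_ideal[OF gens_Polys]] ideal_sum[OF Idl_ideal[OF gens_Polys]]
      ideal_mult[OF Idl_ideal[OF gens_Polys]])
qed

lemma Idl_insert:
  assumes ideal_J: "ideal J (poly_ring V)" and y_Polys: "y \<in> Polys V"
  shows "Idl\<^bsub>poly_ring V\<^esub> (insert y J) = {a + c * y | a c. a \<in> J \<and> c \<in> Polys V}"
proof -
  have "insert y J = J \<union> (\<lambda>_. y) ` {..<1::nat}" by auto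
  then have "Idl\<^bsub>poly_ring V\<^esub> (insert y J) = {a + (\<Sum>j<1::nat. c j * y) | a c. a \<in> J \<and> (\<forall>j. c j \<in> Polys V)}"
    using Idl_Un_linear_combinations[OF ideal_J, of 1 "\<lambda>_. y"] y_Polys by (simp only:)
  also have "\<dots> = {a + c * y | a c. a \<in> J \<and> c \<in> Polys V}"
  proof (intro equalityI subsetI)
    fix p assume "p \<in> {a + c * y | a c. a \<in> J \<and> c \<in> Polys V}"
    then obtain a c where "p = a + c * y" "a \<in> J" "c \<in> Polys V" by blast
    then show "p \<in> {a + (\<Sum>j<1::nat. c j * y) | a c. a \<in> J \<and> (\<forall>j. c j \<in> Polys V)}"
      by (intro CollectI exI[of _ a] exI[of _ "\<lambda>_. c"]) simp
  qed auto
  finally show ?thesis .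
qed

lemma Idl_Un_lessThan_Suc:
  assumes ideal_J: "ideal J (poly_ring V)" and l_Polys: "\<And>j. j < Suc r \<Longrightarrow> l j \<in> Polys V"
  shows "Idl\<^bsub>poly_ring V\<^esub> (J \<union> l ` {..<Suc r}) =
    Idl\<^bsub>poly_ring V\<^esub> (insert (l r) (Idl\<^bsub>poly_ring V\<^esub> (J \<union> l ` {..<r})))"
      (is "?L = Idl\<^bsub>poly_ring V\<^esub> (insert _ ?I)")
proof (rule antisym)
  have sub_r: "J \<union> l ` {..<r} \<subseteq> Polys V" and sub_Suc: "J \<union> l ` {..<Suc r} \<subseteq> Polys V"
    using ideal_sub_Polys[OF ideal_J] l_Polys by auto
  have sub_insert: "insert (l r) ?I \<subseteq> Polys V"
    using ideal_sub_Polys[OF Idl_ideal[OF sub_r]] l_Polys by auto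
  show "?L \<subseteq> Idl\<^bsub>poly_ring V\<^esub> (insert (l r) ?I)"
    using Idl_gen[OF sub_r]
    by (intro Idl_least Idl_ideal[OF sub_insert] subsetI Idl_gen[OF sub_insert]) (auto simp: less_Suc_eq)
  have "l r \<in> ?L" by (rule Idl_gen[OF sub_Suc]) auto
  moreover have "?I \<subseteq> ?L" by (rule Idl_mono[OF _ sub_Suc]) auto
  ultimately show "Idl\<^bsub>poly_ring V\<^esub> (insert (l r) ?I) \<subseteq> ?L"
    by (intro Idl_least Idl_ideal[OF sub_Suc]) auto
qed

lemma monomial_ideal_eq:
  assumes "E \<subseteq> {m. keys m \<subseteq> V}"
  shows "Idl\<^bsub>poly_ring V\<^esub> (pmon ` E) = {p \<in> Polys V. \<forall>m\<in>keys p. \<exists>e\<in>E. \<exists>b. m = e + b}" (is "?L = ?R")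
proof
  have gens_Polys: "pmon ` E \<subseteq> Polys V" using assms by auto
  note ideal_Idl = Idl_ideal[OF gens_Polys]
  show "?L \<subseteq> ?R"
  proof
    fix p assume "p \<in> ?L"
    then have "\<forall>m\<in>keys p. \<exists>e\<in>E. \<exists>b. m = e + b"
      using gens_Polys
    proof (induction rule: Idl_induct)
      case (mult c s)
      then show ?case by (fastforce elim!: keys_mult_mem simp: add.commute)
    next
      case (add p q)
      then show ?case using Poly_Mapping.keys_add[of p q] by blast
    qed simp
    then show "p \<in> ?R" using ideal_sub_Polys[OF ideal_Idl \<open>p \<in> ?L\<close>] by blast
  qed
  show "?R \<subseteq> ?L"
  proof
    fix p assume p_in: "p \<in> ?R"
    show "p \<in> ?L"
    proof (rule ideal_if_monomials[OF ideal_Idl])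
      fix m assume m_key: "m \<in> keys p"
      then obtain e b where divisor: "e \<in> E" "m = e + b" using p_in by blast
      moreover have "keys m \<subseteq> V" using p_in m_key by (auto simp: carrier_poly_ring)
      ultimately have "pmon b \<in> Polys V" by (simp add: keys_add_nat)
      then have "pmon b * pmon e \<in> ?L"
        using Idl_gen[OF gens_Polys] divisor(1) by (intro ideal_mult[OF ideal_Idl]) auto
      then show "pmon m \<in> ?L" by (simp add: divisor(2) pmon_add mult.commute)
    qed
  qed
qed

section \<open>Grading\<close>

lemma mdeg_superset: "finite X \<Longrightarrow> keys m \<subseteq> X \<Longrightarrow> mdeg m = (\<Sum>j\<in>X. lookup m j)"
  unfolding mdeg_def by (rule sum.mono_neutral_left) (auto simp: in_keys_iff)

lemma mdeg_0 [simp]: "mdeg 0 = 0"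
  by (simp add: mdeg_def)

lemma mdeg_add: "mdeg (a + b) = mdeg a + mdeg b"
  using mdeg_superset[of "keys a \<union> keys b" a] mdeg_superset[of "keys a \<union> keys b" b]
    mdeg_superset[of "keys a \<union> keys b" "a + b"]
  by (simp add: keys_add_nat lookup_add sum.distrib)

lemma mdeg_single [simp]: "mdeg (single j k) = k"
  by (cases "k = 0") (auto simp: mdeg_def)

lemma mdeg_eq_0_iff: "mdeg m = 0 \<longleftrightarrow> m = 0"
  unfolding mdeg_def
  by (metis (no_types, lifting) finite_keys in_keys_iff keys_eq_empty equals0I sum.empty sum_eq_0_iff)

lemma homog_0 [simp]: "homog q 0"
  by (simp add: homog_def)

lemma homog_add: "homog q p \<Longrightarrow> homog q p' \<Longrightarrow> homog q (p + p')"
  using Poly_Mapping.keys_add[of p p'] by (auto simp: homog_def)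

lemma homog_uminus: "homog q p \<Longrightarrow> homog q (- p)"
  by (simp add: homog_def)

lemma homog_diff: "homog q p \<Longrightarrow> homog q p' \<Longrightarrow> homog q (p - p')"
  using homog_add[of q p "- p'"] homog_uminus by auto

lemma homog_sum: "(\<And>x. x \<in> X \<Longrightarrow> homog q (f x)) \<Longrightarrow> homog q (sum f X)"
  by (induction X rule: infinite_finite_induct) (auto intro: homog_add)

lemma homog_mult: "homog a p \<Longrightarrow> homog b q \<Longrightarrow> homog (a + b) (p * q)"
  by (auto simp: homog_def mdeg_add elim!: keys_mult_mem)

lemma homog_pconst [simp]: "homog 0 (pconst c)"
  using keys_pconst[of c] by (auto simp: homog_def)

lemma homog_1 [simp]: "homog 0 1"
  by (simp add: homog_def)

lemma homog_pvar [simp]: "homog 1 (pvar j)"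
  by (simp add: homog_def)

lemma homog_cscale: "homog q p \<Longrightarrow> homog q (cscale c p)"
  using homog_mult[of 0 "pconst c" q p] by (simp add: cscale_def)

lemma homog_single: "homog (mdeg m) (single m c)"
  by (auto simp: homog_def)

lemma homog_prod: "finite X \<Longrightarrow> (\<And>x. x \<in> X \<Longrightarrow> homog (d x) (f x)) \<Longrightarrow> homog (sum d X) (prod f X)"
  by (induction X rule: finite_induct) (auto intro: homog_mult)

lemma homog_power: "homog d f \<Longrightarrow> homog (k * d) (f ^ k)"
  by (induction k) (auto intro: homog_mult)

definition homog_component :: "nat \<Rightarrow> 'v cpoly \<Rightarrow> 'v cpoly" where
  "homog_component q p = (\<Sum>m\<in>{m \<in> keys p. mdeg m = q}. single m (lookup p m))"

lemma lookup_homog_component: "lookup (homog_component q p) m = (if mdeg m = q then lookup p m else 0)"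
proof -
  have "finite {m \<in> keys p. mdeg m = q}" by simp
  then show ?thesis
    by (auto simp: homog_component_def lookup_sum lookup_single when_def in_keys_iff)
qed

lemma homog_component_add: "homog_component q (p + p') = homog_component q p + homog_component q p'"
  by (rule poly_mapping_eqI) (simp add: lookup_homog_component lookup_add)

lemma homog_component_0 [simp]: "homog_component q 0 = 0"
  by (rule poly_mapping_eqI) (simp add: lookup_homog_component)

lemma homog_component_uminus: "homog_component q (- p) = - homog_component q p"
  by (rule poly_mapping_eqI) (simp add: lookup_homog_component)

lemma homog_component_diff: "homog_component q (p - p') = homog_component q p - homog_component q p'"
  by (rule poly_mapping_eqI) (simp add: lookup_homog_component lookup_minus)

lemma homog_component_sum: "homog_component q (sum f X) = (\<Sum>x\<in>X. homog_component q (f x))"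
  by (induction X rule: infinite_finite_induct) (auto simp: homog_component_add)

lemma homog_homog_component: "homog q (homog_component q p)"
  by (auto simp: homog_def in_keys_iff lookup_homog_component split: if_splits)

lemma homog_component_homog: "homog e p \<Longrightarrow> homog_component q p = (if q = e then p else 0)"
  by (rule poly_mapping_eqI) (auto simp: lookup_homog_component homog_def in_keys_iff)

lemma homog_component_mult_homog:
  assumes "homog e b"
  shows "homog_component q (a * b) = (if e \<le> q then homog_component (q - e) a * b else 0)"
proof (induction a rule: cpoly_induct)
  case (single m c)
  have homog_product: "homog (mdeg m + e) (single m c * b)"
    by (intro homog_mult homog_single assms)
  show ?case
    by (auto simp: homog_component_homog[OF homog_product] homog_component_homog[OF homog_single])
qed (auto simp: distrib_right homog_component_add)

lemma sum_homog_component: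
  assumes "\<And>m. m \<in> keys p \<Longrightarrow> mdeg m \<le> N"
  shows "(\<Sum>q\<le>N. homog_component q p) = p"
  using assms by (intro poly_mapping_eqI) (auto simp: lookup_sum lookup_homog_component in_keys_iff)

lemma keys_mdeg_bound: "\<exists>N. \<forall>m\<in>keys p. mdeg m \<le> N"
  using finite_keys[of p] by (meson finite_imageI finite_nat_set_iff_bounded_le imageI)

lemma Polys_homog_component: "p \<in> Polys V \<Longrightarrow> homog_component q p \<in> Polys V"
  by (auto simp: carrier_poly_ring in_keys_iff lookup_homog_component split: if_splits)

definition homog_closed :: "'v cpoly set \<Rightarrow> bool" where
  "homog_closed J \<longleftrightarrow> (\<forall>p\<in>J. \<forall>q. homog_component q p \<in> J)"

lemma homog_closed_Idl:
  assumes "S \<subseteq> Polys V" and gens_homog: "\<And>s. s \<in> S \<Longrightarrow> \<exists>e. homog e s"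
  shows "homog_closed (Idl\<^bsub>poly_ring V\<^esub> S)"
  unfolding homog_closed_def
proof (intro ballI allI)
  fix p q assume "p \<in> Idl\<^bsub>poly_ring V\<^esub> S"
  then show "homog_component q p \<in> Idl\<^bsub>poly_ring V\<^esub> S"
    using assms(1)
  proof (induction rule: Idl_induct)
    case (mult c s)
    then obtain e where s_homog: "homog e s" using gens_homog by blast
    show ?case
      using mult ideal_0[OF Idl_ideal[OF assms(1)]]
      by (auto simp: homog_component_mult_homog[OF s_homog] intro!: ideal_mult[OF Idl_ideal[OF assms(1)]]
          intro: Idl_gen[OF assms(1)] Polys_homog_component)
  qed (auto simp: homog_component_add intro: ideal_add[OF Idl_ideal[OF assms(1)]]
    ideal_0[OF Idl_ideal[OF assms(1)]])
qed

lemma homog_closed_Idl_Un: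
  assumes graded_J: "ideal J (poly_ring V)" "homog_closed J"
    and S_homog: "S \<subseteq> Polys V" "\<And>s. s \<in> S \<Longrightarrow> \<exists>e. homog e s"
  shows "homog_closed (Idl\<^bsub>poly_ring V\<^esub> (J \<union> S))"
proof -
  let ?H = "{p \<in> J. \<exists>e. homog e p}"
  have gens_Polys: "?H \<union> S \<subseteq> Polys V" using ideal_sub_Polys[OF graded_J(1)] S_homog by auto
  have union_Polys: "J \<union> S \<subseteq> Polys V" using ideal_sub_Polys[OF graded_J(1)] S_homog by auto
  have "J \<subseteq> Idl\<^bsub>poly_ring V\<^esub> (?H \<union> S)"
  proof
    fix p assume p_in: "p \<in> J"
    obtain N where mdeg_bound: "\<forall>m\<in>keys p. mdeg m \<le> N" using keys_mdeg_bound by blast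
    have "homog_component q p \<in> Idl\<^bsub>poly_ring V\<^esub> (?H \<union> S)" for q
      using graded_J p_in homog_homog_component[of q p]
      by (intro Idl_gen[OF gens_Polys]) (auto simp: homog_closed_def)
    then have "(\<Sum>q\<le>N. homog_component q p) \<in> Idl\<^bsub>poly_ring V\<^esub> (?H \<union> S)"
      by (intro ideal_sum[OF Idl_ideal[OF gens_Polys]])
    then show "p \<in> Idl\<^bsub>poly_ring V\<^esub> (?H \<union> S)" using sum_homog_component[of p N] mdeg_bound by simp
  qed
  then have "Idl\<^bsub>poly_ring V\<^esub> (J \<union> S) = Idl\<^bsub>poly_ring V\<^esub> (?H \<union> S)"
    using Idl_gen[OF gens_Polys] by (intro antisym Idl_least Idl_ideal gens_Polys Idl_mono union_Polys) auto
  then show ?thesis using homog_closed_Idl[OF gens_Polys] S_homog by auto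
qed

section \<open>Substitution\<close>

definition psubst :: "('v \<Rightarrow> 'u cpoly) \<Rightarrow> 'v cpoly \<Rightarrow> 'u cpoly" where
  "psubst \<sigma> p = (\<Sum>m\<in>keys p. pconst (lookup p m) * (\<Prod>j\<in>keys m. \<sigma> j ^ lookup m j))"

lemma prod_power_superset:
  "finite X \<Longrightarrow> keys m \<subseteq> X \<Longrightarrow> (\<Prod>j\<in>keys m. \<sigma> j ^ lookup m j) = (\<Prod>j\<in>X. \<sigma> j ^ lookup m j)"
  for \<sigma> :: "_ \<Rightarrow> 'a::comm_semiring_1"
  by (rule prod.mono_neutral_left) (auto simp: in_keys_iff)

lemma prod_power_add:
  "(\<Prod>j\<in>keys (a + b). \<sigma> j ^ lookup (a + b) j) =
   (\<Prod>j\<in>keys a. \<sigma> j ^ lookup a j) * (\<Prod>j\<in>keys b. \<sigma> j ^ lookup b j)"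
  for \<sigma> :: "_ \<Rightarrow> 'a::comm_semiring_1"
  using prod_power_superset[of "keys a \<union> keys b" a \<sigma>] prod_power_superset[of "keys a \<union> keys b" b \<sigma>]
  by (simp add: keys_add_nat lookup_add power_add prod.distrib)

lemma psubst_0 [simp]: "psubst \<sigma> 0 = 0"
  by (simp add: psubst_def)

lemma psubst_add: "psubst \<sigma> (p + q) = psubst \<sigma> p + psubst \<sigma> q"
  unfolding psubst_def by (rule setsum_keys_plus_distrib) (auto simp: pconst_add distrib_right)

lemma psubst_single: "psubst \<sigma> (single m c) = pconst c * (\<Prod>j\<in>keys m. \<sigma> j ^ lookup m j)"
  by (cases "c = 0") (auto simp: psubst_def)

lemma psubst_pconst [simp]: "psubst \<sigma> (pconst c) = pconst c"
  using psubst_single[of \<sigma> 0 c] by (simp add: pconst_def)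

lemma psubst_1 [simp]: "psubst \<sigma> 1 = 1"
  using psubst_pconst[of \<sigma> 1] by simp

lemma psubst_pvar [simp]: "psubst \<sigma> (pvar j) = \<sigma> j"
  by (simp add: pvar_def pmon_def psubst_single)

lemma psubst_mult: "psubst \<sigma> (p * q) = psubst \<sigma> p * psubst \<sigma> q"
proof (induction p rule: cpoly_induct)
  case (single m c)
  show ?case
    by (induction q rule: cpoly_induct)
      (simp_all add: mult_single psubst_single prod_power_add pconst_mult mult_ac, simp add: algebra_simps
        psubst_add)
qed (auto simp: distrib_right psubst_add)

lemma psubst_uminus: "psubst \<sigma> (- p) = - psubst \<sigma> p"
  using psubst_add[of \<sigma> p "- p"] by (simp add: eq_neg_iff_add_eq_0 add.commute)

lemma psubst_diff: "psubst \<sigma> (p - q) = psubst \<sigma> p - psubst \<sigma> q"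
  using psubst_add[of \<sigma> p "- q"] by (simp add: psubst_uminus)

lemma psubst_sum: "psubst \<sigma> (sum f X) = (\<Sum>x\<in>X. psubst \<sigma> (f x))"
  by (induction X rule: infinite_finite_induct) (auto simp: psubst_add)

lemma psubst_prod: "psubst \<sigma> (prod f X) = (\<Prod>x\<in>X. psubst \<sigma> (f x))"
  by (induction X rule: infinite_finite_induct) (auto simp: psubst_mult)

lemma psubst_cscale: "psubst \<sigma> (cscale c p) = cscale c (psubst \<sigma> p)"
  by (simp add: cscale_def psubst_mult)

lemma psubst_power: "psubst \<sigma> (p ^ k) = psubst \<sigma> p ^ k"
  by (induction k) (simp_all add: psubst_mult)

lemma psubst_psubst: "psubst \<sigma> (psubst \<tau> p) = psubst (\<lambda>j. psubst \<sigma> (\<tau> j)) p"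
  by (induction p rule: cpoly_induct)
    (simp_all add: psubst_add psubst_single psubst_mult psubst_prod psubst_power)

lemma pvar_power: "pvar j ^ k = pmon (single j k)"
  by (induction k) (auto simp: pvar_def pmon_add[symmetric] single_add[symmetric] add.commute)

lemma prod_pvar_power: "(\<Prod>j\<in>keys m. pvar j ^ lookup m j) = pmon m"
proof -
  have "(\<Sum>j\<in>keys m. single j (lookup m j)) = m"
    by (rule poly_mapping_eqI) (simp add: lookup_sum lookup_single when_def in_keys_iff sum.delta)
  then show ?thesis by (simp add: pvar_power pmon_prod_single[symmetric])
qed

lemma psubst_id_on:
  assumes "p \<in> Polys V" "\<And>j. j \<in> V \<Longrightarrow> \<sigma> j = pvar j"
  shows "psubst \<sigma> p = p"
proof -
  have "(\<Prod>j\<in>keys m. \<sigma> j ^ lookup m j) = pmon m" if "m \<in> keys p" for m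
    unfolding prod_pvar_power[symmetric] using assms that
    by (intro prod.cong arg_cong[where f = "\<lambda>x. x ^ _"]) (auto simp: carrier_poly_ring)
  then have "psubst \<sigma> p = (\<Sum>m\<in>keys p. single m (lookup p m))"
    unfolding psubst_def by (intro sum.cong) (auto simp: single_eq_pconst_pmon)
  then show ?thesis using poly_sum_single[of p] by simp
qed

lemma cpoly_mult_eq_0D:
  fixes p q :: "'v::countable cpoly"
  assumes "p * q = 0"
  shows "p = 0 \<or> q = 0"
proof -
  let ?rename = "psubst (\<lambda>j. pvar (to_nat j)) :: 'v cpoly \<Rightarrow> nat cpoly"
  have "psubst (\<lambda>k. pvar (from_nat k)) (?rename p) = p" for p
    unfolding psubst_psubst by (simp add: psubst_id_on[of _ UNIV])
  then have "?rename p = 0 \<Longrightarrow> p = 0" for p by (metis psubst_0)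
  moreover have "?rename p * ?rename q = 0" using assms by (simp add: psubst_mult[symmetric])
  then have "?rename p = 0 \<or> ?rename q = 0" by simp
  ultimately show ?thesis by blast
qed

lemma psubst_in_Polys:
  assumes "\<And>j. \<sigma> j \<in> Polys V"
  shows "psubst \<sigma> p \<in> Polys V"
  unfolding psubst_def by (intro Polys_intros Polys_pconst assms)

lemma homog_psubst:
  assumes "\<And>j. homog 1 (\<sigma> j)" "homog q p"
  shows "homog q (psubst \<sigma> p)"
  unfolding psubst_def
proof (rule homog_sum)
  fix m assume m_key: "m \<in> keys p"
  have "homog (0 + (\<Sum>j\<in>keys m. lookup m j * 1)) (pconst (lookup p m) * (\<Prod>j\<in>keys m. \<sigma> j ^ lookup m j))"
    by (intro homog_mult homog_pconst homog_prod homog_power assms) auto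
  then show "homog q (pconst (lookup p m) * (\<Prod>j\<in>keys m. \<sigma> j ^ lookup m j))"
    using assms(2) m_key by (simp add: homog_def mdeg_def)
qed

section \<open>Dimension counts\<close>

lemma (in vector_space) span_Int_span_Diff:
  assumes independent_B: "independent B" and "C \<subseteq> B"
  shows "span C \<inter> span (B - C) = {0}"
proof (intro equalityI subsetI)
  fix x assume x_in: "x \<in> span C \<inter> span (B - C)"
  have "representation B x b = 0" for b
    using x_in \<open>C \<subseteq> B\<close> representation_extend[OF independent_B, of x C]
      representation_extend[OF independent_B, of x "B - C"]
      representation_ne_zero[of C x b] representation_ne_zero[of "B - C" x b] by fastforce
  moreover have "x \<in> span B" using x_in span_mono[OF \<open>C \<subseteq> B\<close>] by blast
  ultimately show "x \<in> {0}" using sum_nonzero_representation_eq[OF independent_B, of x] by simp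
qed (simp add: span_zero)

lemma (in vector_space) dim_singleton_0: "dim {0} = 0"
  using dim_le_card[of "{0}" "{}"] by simp

lemma (in vector_space) subspace_dim_0:
  assumes "subspace S" "S \<subseteq> span E" "finite E" "dim S = 0"
  shows "S = {0}"
proof -
  obtain B where basis_B: "B \<subseteq> S" "independent B" "S \<subseteq> span B" "card B = dim S"
    by (rule basis_exists)
  then have "B = {}" using independent_span_bound[OF assms(3) basis_B(2)] assms(2,4) by auto
  then show ?thesis using basis_B(3) subspace_0[OF assms(1)] by auto
qed

lemma (in vector_space_pair) rank_nullity:
  assumes linear_f: "Vector_Spaces.linear s1 s2 f" and subspace_U: "vs1.subspace U"
    and U_span: "finite E" "U \<subseteq> vs1.span E"
  shows "vs2.dim (f ` U) + vs1.dim {u \<in> U. f u = 0} = vs1.dim U"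
proof -
  interpret f: Vector_Spaces.linear s1 s2 f by fact
  let ?K = "{u \<in> U. f u = 0}"
  have subspace_K: "vs1.subspace ?K" using subspace_U by (auto simp: vs1.subspace_def f.zero f.add f.scale)
  obtain B where basis_B: "B \<subseteq> ?K" "vs1.independent B" "?K \<subseteq> vs1.span B" "card B = vs1.dim ?K"
    by (rule vs1.basis_exists)
  then obtain C where basis_C: "B \<subseteq> C" "C \<subseteq> U" "vs1.independent C" "U \<subseteq> vs1.span C"
    using vs1.maximal_independent_subset_extend[of B U] by blast
  have finite_C: "finite C"
    using vs1.independent_span_bound[OF U_span(1) basis_C(3)] basis_C(2) U_span(2) by blast
  have spanD: "vs1.span (C - B) \<subseteq> U" using basis_C(2) by (intro vs1.span_minimal[OF _ subspace_U]) auto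
  have "x = 0" if "x \<in> vs1.span (C - B)" "f x = 0" for x
    using that spanD basis_B(3) vs1.span_Int_span_Diff[OF basis_C(3,1)] by blast
  then have inj_on_complement: "inj_on f (vs1.span (C - B))"
    by (subst f.inj_on_iff_eq_0) (auto simp: vs1.subspace_span)
  have "f ` U \<subseteq> vs2.span (f ` (C - B))"
  proof clarify
    fix u assume "u \<in> U"
    then have "u \<in> vs1.span (B \<union> (C - B))" using basis_C(1,4) by (auto simp: Un_absorb1)
    then obtain k d where "u = k + d" "k \<in> vs1.span B" "d \<in> vs1.span (C - B)"
      unfolding vs1.span_Un by blast
    moreover from this have "f k = 0" using vs1.span_minimal[OF basis_B(1) subspace_K] by blast
    ultimately show "f u \<in> vs2.span (f ` (C - B))" by (auto simp: f.add f.span_image)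
  qed
  moreover have "f ` (C - B) \<subseteq> f ` U" using basis_C(2) by blast
  moreover have "vs2.independent (f ` (C - B))"
    using vs1.independent_mono[OF basis_C(3)] by (intro f.independent_injective_image inj_on_complement) auto
  ultimately have "vs2.dim (f ` U) = card (f ` (C - B))" by (intro vs2.dim_unique) auto
  also have "\<dots> = card (C - B)"
    by (rule card_image) (rule inj_on_subset[OF inj_on_complement vs1.span_superset])
  also have "\<dots> = vs1.dim U - vs1.dim ?K"
    using card_Diff_subset[OF finite_subset[OF basis_C(1) finite_C] basis_C(1)] basis_B(4)
      vs1.basis_card_eq_dim[OF basis_C(2,4,3)] by simp
  finally show ?thesis
    using basis_B(4) card_mono[OF finite_C basis_C(1)] vs1.basis_card_eq_dim[OF basis_C(2,4,3)] by simp
qed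

lemma (in vector_space) subspace_is_kernel:
  assumes subspace_W: "subspace W"
  obtains \<pi> where "Vector_Spaces.linear scale scale \<pi>" "\<And>x. \<pi> x = 0 \<longleftrightarrow> x \<in> W"
proof -
  interpret endo: vector_space_pair scale scale by unfold_locales
  obtain B where basis_B: "B \<subseteq> W" "independent B" "W \<subseteq> span B" "card B = dim W" by (rule basis_exists)
  obtain C where basis_C: "B \<subseteq> C" "C \<subseteq> UNIV" "independent C" "UNIV \<subseteq> span C"
    using basis_B(2) by (rule maximal_independent_subset_extend[OF subset_UNIV])
  obtain \<pi> where projection: "Vector_Spaces.linear scale scale \<pi>" "\<And>x. x \<in> C \<Longrightarrow> \<pi> x = (if x \<in> B then 0 else x)"
    using endo.linear_independent_extend[OF basis_C(3), of "\<lambda>x. if x \<in> B then 0 else x"] by blast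
  have zero_on_B: "\<pi> x = 0" if "x \<in> span B" for x
    by (rule endo.linear_eq_0_on_span[OF projection(1) _ that]) (use basis_C(1) projection(2) in auto)
  have id_off_B: "\<pi> x = x" if "x \<in> span (C - B)" for x
    using endo.linear_eq_on_span[OF projection(1) linear_id _ that] projection(2) by auto
  show ?thesis
  proof
    fix x
    have "x \<in> span (B \<union> (C - B))" using basis_C(1,4) by (auto simp: Un_absorb1)
    then obtain b d where decomposition: "x = b + d" "b \<in> span B" "d \<in> span (C - B)" unfolding span_Un by blast
    then have "\<pi> x = d" using zero_on_B id_off_B by (simp add: endo.linear_add[OF projection(1)])
    then show "\<pi> x = 0 \<longleftrightarrow> x \<in> W"
      using decomposition zero_on_B basis_B span_minimal[OF basis_B(1) subspace_W] by auto
  qed (rule projection(1))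
qed

text \<open>Rank-nullity for \<open>f\<close> followed by a projection with kernel \<open>Y\<close>.\<close>

lemma (in vector_space) dim_sum_image:
  assumes linear_f: "Vector_Spaces.linear scale scale f" and subspace_U: "subspace U"
    and subspace_Y: "subspace Y"
    and U_span: "finite E" "U \<subseteq> span E" and Y_span: "finite E'" "Y \<subseteq> span E'"
  shows "dim {y + f u | y u. y \<in> Y \<and> u \<in> U} + dim {u \<in> U. f u \<in> Y} = dim Y + dim U"
proof -
  interpret endo: vector_space_pair scale scale by unfold_locales
  obtain \<pi> where projection: "Vector_Spaces.linear scale scale \<pi>" "\<And>x. \<pi> x = 0 \<longleftrightarrow> x \<in> Y"
    using subspace_is_kernel[OF subspace_Y] by blast
  let ?S = "{y + f u | y u. y \<in> Y \<and> u \<in> U}"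
  have "?S = {y + z | y z. y \<in> Y \<and> z \<in> f ` U}" by blast
  then have subspace_S: "subspace ?S"
    using subspace_sums[OF subspace_Y endo.linear_subspace_image[OF linear_f subspace_U]] by simp
  have Y_sub_S: "Y \<subseteq> ?S"
    using subspace_0[OF subspace_U] endo.linear_0[OF linear_f] by (force intro: exI[of _ 0])
  have "f ` U \<subseteq> span (f ` E)" using U_span(2) endo.linear_span_image[OF linear_f, of E] by blast
  then have "?S \<subseteq> span (E' \<union> f ` E)" unfolding span_Un using Y_span(2) by blast
  then have "dim (\<pi> ` ?S) + dim {x \<in> ?S. \<pi> x = 0} = dim ?S"
    using U_span(1) Y_span(1) by (intro endo.rank_nullity[OF projection(1) subspace_S]) auto
  moreover have "{x \<in> ?S. \<pi> x = 0} = Y" using Y_sub_S projection(2) by blast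
  moreover have "\<pi> ` ?S = (\<pi> \<circ> f) ` U"
  proof -
    have "\<pi> (y + f u) = \<pi> (f u)" if "y \<in> Y" for y u
      using that projection(2) by (simp add: endo.linear_add[OF projection(1)])
    then show ?thesis using subspace_0[OF subspace_Y] by (force simp: image_iff)
  qed
  moreover have "dim ((\<pi> \<circ> f) ` U) + dim {u \<in> U. (\<pi> \<circ> f) u = 0} = dim U"
    by (rule endo.rank_nullity[OF Vector_Spaces.linear_compose[OF linear_f projection(1)] subspace_U U_span])
  ultimately show ?thesis using projection(2) by simp
qed

lemma (in vector_space) dim_le_dim_annihilator:
  assumes linear_\<beta>: "\<And>\<phi>. Vector_Spaces.linear scale (*) (\<beta> \<phi>)"
    and basis_X: "finite X" "independent X" and subspace_S: "subspace S" "finite E" "S \<subseteq> span E"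
  shows "dim S \<le> dim {f \<in> S. \<forall>\<phi>\<in>X. \<beta> \<phi> f = 0} + card X"
proof -
  interpret endo: vector_space_pair scale scale by unfold_locales
  define \<Psi> where "\<Psi> f = (\<Sum>\<phi>\<in>X. scale (\<beta> \<phi> f) \<phi>)" for f
  have "Vector_Spaces.linear scale scale \<Psi>"
    using linear_\<beta> by (auto simp: \<Psi>_def Vector_Spaces.linear_iff scale_left_distrib sum.distrib scale_sum_right)
  then have "dim (\<Psi> ` S) + dim {f \<in> S. \<Psi> f = 0} = dim S"
    by (rule endo.rank_nullity[OF _ subspace_S])
  moreover have "\<Psi> f = 0 \<longleftrightarrow> (\<forall>\<phi>\<in>X. \<beta> \<phi> f = 0)" for f
    using independentD[OF basis_X(2,1) subset_refl, of "\<lambda>\<phi>. \<beta> \<phi> f"] by (auto simp: \<Psi>_def)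
  moreover have "\<Psi> ` S \<subseteq> span X"
    by (auto simp: \<Psi>_def intro!: span_sum span_scale intro: span_base)
  then have "dim (\<Psi> ` S) \<le> card X" using basis_X(1) by (rule dim_le_card)
  ultimately show ?thesis by simp
qed

text \<open>Both inequalities come from \<open>dim_le_dim_annihilator\<close>: imposing the conditions of a basis of \<open>W\<close>,
  and then the remaining conditions of a basis of \<open>T\<close>, which leave only \<open>0\<close>.\<close>

lemma (in vector_space) dim_annihilator:
  assumes bilinear_\<beta>: "\<And>\<phi>. Vector_Spaces.linear scale (*) (\<beta> \<phi>)"
    "\<And>f. Vector_Spaces.linear scale (*) (\<lambda>\<phi>. \<beta> \<phi> f)"
    and subspace_T: "subspace T" "finite E" "T \<subseteq> span E" and subspace_W: "subspace W" "W \<subseteq> T"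
    and nondegenerate: "\<And>f. f \<in> T \<Longrightarrow> (\<And>\<phi>. \<phi> \<in> T \<Longrightarrow> \<beta> \<phi> f = 0) \<Longrightarrow> f = 0"
  shows "dim {f \<in> T. \<forall>\<phi>\<in>W. \<beta> \<phi> f = 0} + dim W = dim T"
proof -
  interpret functional: vector_space_pair scale "(*)" by unfold_locales (auto simp: algebra_simps)
  have vanish_span: "\<beta> \<phi> f = 0" if "\<phi> \<in> span X" "\<forall>\<phi>\<in>X. \<beta> \<phi> f = 0" for \<phi> f X
    by (rule functional.linear_eq_0_on_span[OF bilinear_\<beta>(2)[of f] _ that(1)]) (use that(2) in blast)
  obtain B where basis_B: "B \<subseteq> W" "independent B" "W \<subseteq> span B" "card B = dim W"
    by (rule basis_exists)
  obtain C where basis_C: "B \<subseteq> C" "C \<subseteq> T" "independent C" "T \<subseteq> span C"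
    using basis_B(1) subspace_W(2) basis_B(2) by (rule maximal_independent_subset_extend[OF subset_trans])
  have finite_C: "finite C"
    using independent_span_bound[OF subspace_T(2) basis_C(3)] basis_C(2) subspace_T(3) by blast
  then have finite_B: "finite B" using basis_C(1) by (rule finite_subset[rotated])
  let ?ann = "\<lambda>X. {f \<in> T. \<forall>\<phi>\<in>X. \<beta> \<phi> f = 0}"
  have ann_W: "?ann W = ?ann B" using basis_B(1,3) vanish_span by blast
  have "dim T \<le> dim (?ann B) + card B"
    by (rule dim_le_dim_annihilator[OF bilinear_\<beta>(1) finite_B basis_B(2) subspace_T])
  moreover have "subspace (?ann B)"
    using subspace_T(1) bilinear_\<beta>(1)
    by (auto simp: subspace_def functional.linear_0 functional.linear_add functional.linear_scale)
  then have "dim (?ann B) \<le> dim {f \<in> ?ann B. \<forall>\<phi>\<in>C - B. \<beta> \<phi> f = 0} + card (C - B)"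
    using independent_mono[OF basis_C(3)] subspace_T(2,3) finite_C
    by (intro dim_le_dim_annihilator[OF bilinear_\<beta>(1)]) auto
  moreover have "{f \<in> ?ann B. \<forall>\<phi>\<in>C - B. \<beta> \<phi> f = 0} \<subseteq> {0}"
    using nondegenerate vanish_span[of _ C] basis_C(4) by blast
  then have "dim {f \<in> ?ann B. \<forall>\<phi>\<in>C - B. \<beta> \<phi> f = 0} = 0"
    using dim_le_card[of _ "{}"] by simp
  moreover have "card (C - B) + card B = dim T"
    using finite_B basis_C(1) card_mono[OF finite_C basis_C(1)] basis_card_eq_dim[OF basis_C(2,4,3)]
    by (simp add: card_Diff_subset)
  ultimately show ?thesis using basis_B(4) unfolding ann_W by simp
qed

interpretation cpoly_pair: vector_space_pair cscale cscale
  by unfold_locales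

lemma linear_cscaleI:
  "(\<And>p q. f (p + q) = f p + f q) \<Longrightarrow> (\<And>c p. f (cscale c p) = cscale c (f p)) \<Longrightarrow>
   Vector_Spaces.linear cscale cscale (f :: 'v cpoly \<Rightarrow> 'u cpoly)"
  by (simp add: Vector_Spaces.linear_iff cpoly.vector_space_axioms)

lemma linear_sum_keys: "Vector_Spaces.linear cscale cscale (\<lambda>p. \<Sum>m\<in>keys p. cscale (lookup p m) (f m))"
proof (rule linear_cscaleI)
  show "(\<Sum>m\<in>keys (p + q). cscale (lookup (p + q) m) (f m)) =
      (\<Sum>m\<in>keys p. cscale (lookup p m) (f m)) + (\<Sum>m\<in>keys q. cscale (lookup q m) (f m))" for p q
    by (rule setsum_keys_plus_distrib) (auto simp: cpoly.scale_left_distrib)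
  show "(\<Sum>m\<in>keys (cscale c p). cscale (lookup (cscale c p) m) (f m)) =
      cscale c (\<Sum>m\<in>keys p. cscale (lookup p m) (f m))" for c p
    unfolding cpoly.scale_sum_right by (rule sum.mono_neutral_cong_left) (auto simp: in_keys_iff)
qed

lemma homog_component_cscale: "homog_component q (cscale c p) = cscale c (homog_component q p)"
  by (rule poly_mapping_eqI) (simp add: lookup_homog_component)

lemma linear_homog_component: "Vector_Spaces.linear cscale cscale (homog_component q)"
  by (rule linear_cscaleI) (auto simp: homog_component_add homog_component_cscale)

lemma finite_exponents: "finite V \<Longrightarrow> finite {m :: 'v \<Rightarrow>\<^sub>0 nat. keys m \<subseteq> V \<and> mdeg m = q}"
proof -
  assume finite_V: "finite V"
  let ?M = "{m :: 'v \<Rightarrow>\<^sub>0 nat. keys m \<subseteq> V \<and> mdeg m = q}"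
  have "lookup ` ?M \<subseteq> {f. \<forall>x. (x \<in> V \<longrightarrow> f x \<in> {..q}) \<and> (x \<notin> V \<longrightarrow> f x = 0)}"
  proof clarify
    fix m :: "'v \<Rightarrow>\<^sub>0 nat" and x assume keys_m: "keys m \<subseteq> V" "q = mdeg m"
    have "lookup m x \<le> (\<Sum>j\<in>keys m. lookup m j)" if "x \<in> keys m"
      using that by (intro member_le_sum) auto
    then show "(x \<in> V \<longrightarrow> lookup m x \<in> {..mdeg m}) \<and> (x \<notin> V \<longrightarrow> lookup m x = 0)"
      using keys_m by (cases "x \<in> keys m") (auto simp: mdeg_def in_keys_iff)
  qed
  moreover have "finite {f. \<forall>x. (x \<in> V \<longrightarrow> f x \<in> {..q}) \<and> (x \<notin> V \<longrightarrow> f x = (0::nat))}"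
    by (rule finite_set_of_finite_funs[OF finite_V]) simp
  ultimately have "finite (lookup ` ?M)" by (rule finite_subset)
  then show ?thesis
    by (rule finite_imageD) (rule inj_onI, simp only: poly_mapping_eq_iff)
qed

lemma graded_part_subspace: "cpoly.subspace S \<Longrightarrow> cpoly.subspace (graded_part S q)"
  unfolding cpoly.subspace_def by (auto simp: graded_part_def homog_add homog_cscale)

lemma span_pmon_keys: "p \<in> cpoly.span (pmon ` keys p)"
proof -
  have "(\<Sum>m\<in>keys p. cscale (lookup p m) (pmon m)) \<in> cpoly.span (pmon ` keys p)"
    by (intro cpoly.span_sum cpoly.span_scale cpoly.span_base) auto
  then show ?thesis by (simp add: cscale_def single_eq_pconst_pmon[symmetric] poly_sum_single[symmetric])
qed

lemma graded_part_finite_span: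
  fixes V :: "'n::finite set"
  shows "\<exists>E. finite E \<and> graded_part (Polys V) q \<subseteq> cpoly.span E"
proof (intro exI conjI subsetI)
  show "finite (pmon ` {m. keys m \<subseteq> V \<and> mdeg m = q})" by (simp add: finite_exponents)
  fix p assume "p \<in> graded_part (Polys V) q"
  then have "pmon ` keys p \<subseteq> pmon ` {m. keys m \<subseteq> V \<and> mdeg m = q}"
    by (auto simp: graded_part_def homog_def carrier_poly_ring)
  then show "p \<in> cpoly.span (pmon ` {m. keys m \<subseteq> V \<and> mdeg m = q})"
    using span_pmon_keys cpoly.span_mono by blast
qed

lemma graded_part_mono: "S \<subseteq> S' \<Longrightarrow> graded_part S q \<subseteq> graded_part S' q"
  by (auto simp: graded_part_def)

lemma homog_component_homog_component: "homog_component q (homog_component r p) =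
  (if q = r then homog_component r p else 0)"
  by (rule homog_component_homog[OF homog_homog_component])

lemma homog_component_image_graded:
  assumes "homog_closed S"
  shows "homog_component q ` S = graded_part S q"
proof (intro equalityI subsetI)
  show "x \<in> graded_part S q" if "x \<in> homog_component q ` S" for x
    using that assms homog_homog_component by (auto simp: graded_part_def homog_closed_def)
  show "x \<in> homog_component q ` S" if "x \<in> graded_part S q" for x
    using that homog_component_homog[of q x q] by (auto simp: graded_part_def image_iff intro!: bexI[of _ x])
qed

lemma fin_dim_if_graded_bounded:
  fixes S :: "'n::finite cpoly set"
  assumes homog_closed_S: "homog_closed S" and trivial: "\<And>q. q \<ge> N \<Longrightarrow> graded_part S q \<subseteq> {0}"
  shows "fin_dim S"
proof -
  have "mdeg m < N" if "p \<in> S" "m \<in> keys p" for p m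
  proof (rule ccontr)
    assume "\<not> mdeg m < N"
    moreover have "homog_component (mdeg m) p \<in> graded_part S (mdeg m)"
      using homog_component_image_graded[OF homog_closed_S] that(1) by blast
    ultimately have "homog_component (mdeg m) p = 0" using trivial[of "mdeg m"] by auto
    then have "lookup (homog_component (mdeg m) p) m = 0" by simp
    then show False using that(2) by (simp add: lookup_homog_component in_keys_iff)
  qed
  then have "S \<subseteq> cpoly.span (\<Union>q<N. pmon ` {m. keys m \<subseteq> UNIV \<and> mdeg m = q})" (is "_ \<subseteq> cpoly.span ?E")
    using span_pmon_keys by (fastforce intro!: subsetD[OF cpoly.span_mono span_pmon_keys])
  moreover have "finite ?E" by (simp add: finite_exponents[of UNIV, simplified])
  ultimately show ?thesis unfolding fin_dim_def by blast
qed

lemma dim_eq_sum_graded: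
  fixes S :: "'n::finite cpoly set"
  assumes "cpoly.subspace S" "homog_closed S" and "\<And>q. q \<ge> N \<Longrightarrow> graded_part S q \<subseteq> {0}"
  shows "cpoly.dim S = (\<Sum>q<N. cpoly.dim (graded_part S q))"
  using assms
proof (induction N arbitrary: S)
  case 0
  have "p = 0" if "p \<in> S" for p
  proof -
    have "homog_component q p = 0" for q
      using 0(3)[of q] homog_component_image_graded[OF 0(2), of q] that by blast
    then show ?thesis
      using keys_mdeg_bound[of p] sum_homog_component[of p] by (metis (no_types, lifting) sum.neutral)
  qed
  then have "S = {0}" using cpoly.subspace_0[OF 0(1)] by blast
  then show ?case by (simp add: cpoly.dim_singleton_0)
next
  case (Suc N)
  let ?K = "{p \<in> S. homog_component N p = 0}"
  have graded_K: "graded_part ?K q = (if q = N then {0} else graded_part S q)" for q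
    using Suc.prems(1) by (auto simp: graded_part_def homog_component_homog cpoly.subspace_0)
  have "cpoly.subspace ?K"
    using Suc.prems(1) by (auto simp: cpoly.subspace_def homog_component_add homog_component_cscale)
  moreover have "homog_closed ?K"
    using Suc.prems(2) by (auto simp: homog_closed_def homog_component_homog_component)
  ultimately have "cpoly.dim ?K = (\<Sum>q<N. cpoly.dim (graded_part ?K q))"
  proof (rule Suc.IH)
    show "graded_part ?K q \<subseteq> {0}" if "N \<le> q" for q
      using Suc.prems(3)[of q] that by (simp add: graded_K)
  qed
  also have "\<dots> = (\<Sum>q<N. cpoly.dim (graded_part S q))" by (simp add: graded_K)
  finally have "cpoly.dim ?K = (\<Sum>q<N. cpoly.dim (graded_part S q))" .
  moreover obtain E where "finite E" "S \<subseteq> cpoly.span E"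
    using fin_dim_if_graded_bounded[OF Suc.prems(2,3)] unfolding fin_dim_def by blast
  then have "cpoly.dim (homog_component N ` S) + cpoly.dim ?K = cpoly.dim S"
    by (rule cpoly_pair.rank_nullity[OF linear_homog_component Suc.prems(1)])
  ultimately show ?case by (simp add: homog_component_image_graded[OF Suc.prems(2)])
qed

definition has_hilbert_poly :: "'v cpoly set \<Rightarrow> int poly \<Rightarrow> bool" where
  "has_hilbert_poly S H \<longleftrightarrow> cpoly.subspace S \<and> homog_closed S \<and>
     (\<forall>q. int (cpoly.dim (graded_part S q)) = coeff H q)"

context
  fixes S :: "'n::finite cpoly set" and H :: "int poly"
  assumes hilbert_poly_H: "has_hilbert_poly S H"
begin

lemma hilbert_poly_series: "Abs_fps (\<lambda>q. int (cpoly.dim (graded_part S q))) = fps_of_poly H"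
  using hilbert_poly_H by (intro fps_ext) (simp add: has_hilbert_poly_def)

lemma graded_part_trivial_iff: "graded_part S q = {0} \<longleftrightarrow> coeff H q = 0"
proof
  assume "graded_part S q = {0}"
  then show "coeff H q = 0"
    using hilbert_poly_H unfolding has_hilbert_poly_def by (metis cpoly.dim_singleton_0 of_nat_0)
next
  assume "coeff H q = 0"
  then have "int (cpoly.dim (graded_part S q)) = 0" using hilbert_poly_H by (simp only: has_hilbert_poly_def)
  then have "cpoly.dim (graded_part S q) = 0" by simp
  moreover obtain E where "finite E" "graded_part (Polys (UNIV :: 'n set)) q \<subseteq> cpoly.span E"
    using graded_part_finite_span by blast
  then have "finite E" "graded_part S q \<subseteq> cpoly.span E" by (auto simp: graded_part_def)
  moreover have "cpoly.subspace (graded_part S q)"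
    using hilbert_poly_H by (simp add: has_hilbert_poly_def graded_part_subspace)
  ultimately show "graded_part S q = {0}" by (intro cpoly.subspace_dim_0)
qed

lemma graded_part_above_degree: "q \<ge> Suc (degree H) \<Longrightarrow> graded_part S q \<subseteq> {0}"
  by (simp add: graded_part_trivial_iff[THEN iffD2] coeff_eq_0)

lemma hilbert_poly_fin_dim: "fin_dim S"
  using hilbert_poly_H fin_dim_if_graded_bounded[OF _ graded_part_above_degree]
  by (simp add: has_hilbert_poly_def)

lemma hilbert_poly_dim: "int (cpoly.dim S) = poly H 1"
proof -
  have "cpoly.dim S = (\<Sum>q<Suc (degree H). cpoly.dim (graded_part S q))"
    using hilbert_poly_H graded_part_above_degree by (intro dim_eq_sum_graded) (auto simp: has_hilbert_poly_def)
  then show ?thesis using hilbert_poly_H by (simp add: has_hilbert_poly_def poly_altdef lessThan_Suc_atMost)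
qed

lemma hilbert_poly_support:
  assumes "S \<noteq> {0}"
  shows "finite {q. graded_part S q \<noteq> {0}}" "{q. graded_part S q \<noteq> {0}} \<noteq> {}"
    "Max {q. graded_part S q \<noteq> {0}} = degree H"
proof -
  have "H \<noteq> 0"
  proof
    assume "H = 0"
    then have "cpoly.dim S = 0" using hilbert_poly_dim by simp
    then show False
      using hilbert_poly_fin_dim hilbert_poly_H assms cpoly.subspace_dim_0
      by (auto simp: has_hilbert_poly_def fin_dim_def)
  qed
  then have lead_coeff_nonzero: "coeff H (degree H) \<noteq> 0" by simp
  have "{q. coeff H q \<noteq> 0} \<subseteq> {..degree H}" by (auto simp: le_degree)
  then show finite_support: "finite {q. graded_part S q \<noteq> {0}}"
    unfolding graded_part_trivial_iff by (rule finite_subset) simp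
  show "{q. graded_part S q \<noteq> {0}} \<noteq> {}"
    unfolding graded_part_trivial_iff using lead_coeff_nonzero by blast
  show "Max {q. graded_part S q \<noteq> {0}} = degree H"
    using finite_support lead_coeff_nonzero
    unfolding graded_part_trivial_iff by (intro Max_eqI) (auto simp: le_degree)
qed

end

section \<open>Polynomial differential operators\<close>

definition multi_fact :: "('n::finite \<Rightarrow>\<^sub>0 nat) \<Rightarrow> complex" where
  "multi_fact m = (\<Prod>j\<in>UNIV. fact (lookup m j))"

lemma multi_fact_nonzero [simp]: "multi_fact m \<noteq> 0"
  by (simp add: multi_fact_def)

lemma falling_prod: "(\<Prod>i<a. of_nat (b + a) - of_nat i) = (fact (b + a) / fact b :: complex)"
proof (induction a)
  case (Suc a)
  have "(\<Prod>i<Suc a. of_nat (b + Suc a) - of_nat i) =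
    (of_nat (b + Suc a) - of_nat 0) * (\<Prod>i<a. of_nat (b + Suc a) - of_nat (Suc i) :: complex)"
    by (rule prod.lessThan_Suc_shift)
  also have "(\<Prod>i<a. of_nat (b + Suc a) - of_nat (Suc i)) = (\<Prod>i<a. of_nat (b + a) - of_nat i :: complex)"
    by (rule prod.cong) auto
  finally show ?case using Suc by simp
qed simp

lemma falling_prod_monomial:
  fixes k m :: "'n::finite \<Rightarrow>\<^sub>0 nat"
  shows "(\<Prod>j\<in>keys m. \<Prod>i<lookup m j. of_nat (lookup (k + m) j) - of_nat i) = multi_fact (k + m) / multi_fact k"
proof -
  have "(\<Prod>j\<in>keys m. \<Prod>i<lookup m j. of_nat (lookup (k + m) j) - of_nat i) =
    (\<Prod>j\<in>UNIV. \<Prod>i<lookup m j. of_nat (lookup (k + m) j) - of_nat i :: complex)"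
    by (rule prod.mono_neutral_left) (auto simp: in_keys_iff)
  also have "\<dots> = (\<Prod>j\<in>UNIV. fact (lookup (k + m) j) / fact (lookup k j))"
    by (rule prod.cong[OF refl]) (simp only: lookup_add falling_prod)
  finally show ?thesis by (simp add: multi_fact_def prod_dividef)
qed

lemma lookup_pdiff:
  fixes f :: "'n::finite cpoly"
  shows "lookup (pdiff \<phi> f) k =
    (\<Sum>m\<in>keys \<phi>. lookup \<phi> m * lookup f (k + m) * (multi_fact (k + m) / multi_fact k))"
proof -
  let ?ff = "\<lambda>l m. \<Prod>j\<in>keys m. \<Prod>i<lookup m j. of_nat (lookup l j) - of_nat i :: complex"
  have term_coeff: "(lookup (single (l - m) (lookup \<phi> m * lookup f l * ?ff l m)) k) =
     (if l = k + m then lookup \<phi> m * lookup f (k + m) * (multi_fact (k + m) / multi_fact k) else 0)" for l m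
  proof (cases "\<forall>j. lookup m j \<le> lookup l j")
    case True
    then have "l - m = k \<longleftrightarrow> l = k + m"
      by (auto simp: poly_mapping_eq_iff fun_eq_iff lookup_add lookup_minus)
        (metis le_add_diff_inverse2)
    then show ?thesis by (auto simp: lookup_single when_def falling_prod_monomial)
  next
    case False
    then obtain j where exponent_too_small: "lookup l j < lookup m j" by (auto simp: not_le)
    then have "j \<in> keys m" by (auto simp: in_keys_iff)
    with exponent_too_small have "?ff l m = 0" by (intro prod_zero) (auto intro!: bexI[of _ j])
    moreover have "l \<noteq> k + m" using exponent_too_small by (auto simp: lookup_add)
    ultimately show ?thesis by (simp only: single_zero mult_zero_right lookup_zero if_False)
  qed
  have "lookup (pdiff \<phi> f) k = (\<Sum>m\<in>keys \<phi>. \<Sum>l\<in>keys f.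
     (if l = k + m then lookup \<phi> m * lookup f (k + m) * (multi_fact (k + m) / multi_fact k) else 0))"
    unfolding pdiff_def lookup_sum term_coeff ..
  also have "\<dots> = (\<Sum>m\<in>keys \<phi>. lookup \<phi> m * lookup f (k + m) * (multi_fact (k + m) / multi_fact k))"
    by (rule sum.cong[OF refl]) (auto simp: in_keys_iff sum.delta)
  finally show ?thesis .
qed

lemma pdiff_add_left: "pdiff (\<phi> + \<psi>) f = pdiff \<phi> f + pdiff \<psi> f" for f :: "'n::finite cpoly"
  by (rule poly_mapping_eqI, unfold lookup_pdiff lookup_add[of "pdiff _ _"])
    (rule setsum_keys_plus_distrib, auto simp: algebra_simps)

lemma pdiff_add_right: "pdiff \<phi> (f + g) = pdiff \<phi> f + pdiff \<phi> g" for f :: "'n::finite cpoly"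
  by (rule poly_mapping_eqI) (simp add: lookup_pdiff lookup_add sum.distrib distrib_left distrib_right
    add_divide_distrib)

lemma pdiff_0_left [simp]: "pdiff 0 f = 0"
  by (simp add: pdiff_def)

lemma pdiff_0_right [simp]: "pdiff \<phi> 0 = 0"
  by (simp add: pdiff_def)

lemma lookup_pdiff_single:
  "lookup (pdiff (single m c) f) k = c * lookup f (k + m) * (multi_fact (k + m) / multi_fact k)"
  for f :: "'n::finite cpoly"
  by (cases "c = 0") (auto simp: lookup_pdiff)

lemma pdiff_mult: "pdiff (\<phi> * \<psi>) f = pdiff \<phi> (pdiff \<psi> f)" for f :: "'n::finite cpoly"
proof (induction \<phi> rule: cpoly_induct)
  case (single m c)
  show ?case
  proof (induction \<psi> rule: cpoly_induct)
    case (single m' c')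
    show ?case
      by (rule poly_mapping_eqI) (simp add: mult_single lookup_pdiff_single add.assoc)
  qed (auto simp: distrib_left pdiff_add_left pdiff_add_right)
qed (auto simp: distrib_right pdiff_add_left)

lemma pdiff_commute: "pdiff \<phi> (pdiff \<psi> f) = pdiff \<psi> (pdiff \<phi> f)" for f :: "'n::finite cpoly"
  by (metis pdiff_mult mult.commute)

lemma pdiff_pconst: "pdiff (pconst c) f = cscale c f" for f :: "'n::finite cpoly"
  by (rule poly_mapping_eqI) (simp add: pconst_def lookup_pdiff_single)

lemma pdiff_1 [simp]: "pdiff 1 f = f" for f :: "'n::finite cpoly"
  using pdiff_pconst[of 1 f] by (simp add: cpoly.scale_one)

lemma pdiff_uminus_left: "pdiff (- \<phi>) f = - pdiff \<phi> f" for f :: "'n::finite cpoly"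
  by (rule sym) (simp only: neg_eq_iff_add_eq_0 pdiff_add_left[symmetric] right_minus pdiff_0_left)

lemma pdiff_uminus_right: "pdiff \<phi> (- f) = - pdiff \<phi> f" for f :: "'n::finite cpoly"
  by (rule sym) (simp only: neg_eq_iff_add_eq_0 pdiff_add_right[symmetric] right_minus pdiff_0_right)

lemma pdiff_diff_left: "pdiff (\<phi> - \<psi>) f = pdiff \<phi> f - pdiff \<psi> f" for f :: "'n::finite cpoly"
  using pdiff_add_left[of \<phi> "- \<psi>" f] by (simp add: pdiff_uminus_left)

lemma pdiff_diff_right: "pdiff \<phi> (f - g) = pdiff \<phi> f - pdiff \<phi> g" for f :: "'n::finite cpoly"
  using pdiff_add_right[of \<phi> f "- g"] by (simp add: pdiff_uminus_right)

lemma pdiff_sum_left: "pdiff (sum h X) f = (\<Sum>x\<in>X. pdiff (h x) f)" for f :: "'n::finite cpoly"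
  by (induction X rule: infinite_finite_induct) (auto simp: pdiff_add_left)

lemma pdiff_sum_right: "pdiff \<phi> (sum h X) = (\<Sum>x\<in>X. pdiff \<phi> (h x))" for h :: "_ \<Rightarrow> 'n::finite cpoly"
  by (induction X rule: infinite_finite_induct) (auto simp: pdiff_add_right)

lemma pdiff_cscale_left: "pdiff (cscale c \<phi>) f = cscale c (pdiff \<phi> f)" for f :: "'n::finite cpoly"
  by (simp add: cscale_def pdiff_mult pdiff_pconst[unfolded cscale_def])

lemma pdiff_cscale_right: "pdiff \<phi> (cscale c f) = cscale c (pdiff \<phi> f)" for f :: "'n::finite cpoly"
  by (metis pdiff_pconst pdiff_commute)

lemma keys_pdiff_bound:
  fixes f :: "'n::finite cpoly"
  assumes "\<forall>m\<in>keys f. mdeg m \<le> N"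
  shows "\<forall>m\<in>keys (pdiff \<phi> f). mdeg m \<le> N"
proof
  fix k assume "k \<in> keys (pdiff \<phi> f)"
  then have "(\<Sum>m\<in>keys \<phi>. lookup \<phi> m * lookup f (k + m) * (multi_fact (k + m) / multi_fact k)) \<noteq> 0"
    by (simp add: in_keys_iff lookup_pdiff)
  then obtain m where "lookup f (k + m) \<noteq> 0"
    by (metis (no_types, lifting) mult_eq_0_iff sum.neutral)
  then have "mdeg (k + m) \<le> N" using assms by (simp add: in_keys_iff)
  then show "mdeg k \<le> N" by (simp add: mdeg_add)
qed

lemma pdiff_power_eq_0:
  fixes f :: "'n::finite cpoly"
  assumes "\<forall>m\<in>keys f. mdeg m \<le> N"
  shows "pdiff (pvar j ^ Suc N) f = 0"
proof (rule poly_mapping_eqI)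
  have "pvar j ^ k = single (single j k) 1" for k
    by (induction k) (auto simp: pvar_def pmon_def mult_single single_add[symmetric] add.commute)
  moreover have "lookup f (k + single j (Suc N)) = 0" for k
  proof (rule ccontr)
    assume "lookup f (k + single j (Suc N)) \<noteq> 0"
    then have "mdeg (k + single j (Suc N)) \<le> N" using assms by (simp add: in_keys_iff)
    then show False by (simp add: mdeg_add)
  qed
  ultimately show "lookup (pdiff (pvar j ^ Suc N) f) k = lookup 0 k" for k
    by (simp only: lookup_pdiff_single) simp
qed

lemma multi_fact_single: "multi_fact (k + single i 1) = of_nat (lookup k i + 1) * multi_fact k"
proof -
  have "multi_fact (k + single i 1) =
    (\<Prod>j\<in>UNIV. (if j = i then of_nat (lookup k i + 1) else 1) * fact (lookup k j))"
    unfolding multi_fact_def by (intro prod.cong refl) (auto simp: lookup_add lookup_single when_def)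
  then show ?thesis by (simp add: prod.distrib multi_fact_def)
qed

lemma lookup_pdiff_pvar: "lookup (pdiff (pvar i) f) k = of_nat (lookup k i + 1) * lookup f (k + single i 1)"
  for f :: "'n::finite cpoly"
  unfolding pvar_def pmon_def lookup_pdiff_single multi_fact_single by simp

lemma pdiff_pvar_single:
  fixes a :: "'n::finite \<Rightarrow>\<^sub>0 nat"
  shows "pdiff (pvar i) (single a c) = single (a - single i 1) (of_nat (lookup a i) * c)"
proof (rule poly_mapping_eqI)
  fix k
  have shift: "a = k + single i 1 \<longleftrightarrow> a - single i 1 = k \<and> lookup a i > 0"
  proof (intro iffI conjI)
    assume "a - single i 1 = k \<and> lookup a i > 0"
    then show "a = k + single i 1" using exponent_minus_single_add[of a i] by simp
  qed (auto simp: lookup_add)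
  show "lookup (pdiff (pvar i) (single a c)) k = lookup (single (a - single i 1) (of_nat (lookup a i) * c)) k"
  proof (cases "a = k + single i 1")
    case True
    then show ?thesis unfolding lookup_pdiff_pvar by (simp add: lookup_add)
  next
    case False
    then have "lookup a i = 0" if "a - single i 1 = k" using shift that by simp
    with False show ?thesis unfolding lookup_pdiff_pvar by (auto simp: lookup_single when_def)
  qed
qed

lemma pdiff_pvar_mult_pvar:
  fixes f :: "'n::finite cpoly"
  shows "pdiff (pvar i) (pvar k * f) = (if i = k then f else 0) + pvar k * pdiff (pvar i) f"
proof (induction f rule: cpoly_induct)
  case (single a c)
  have product: "pvar k * single b d = single (b + single k 1) d" for b d
    by (simp add: pvar_def pmon_def mult_single add.commute)
  show ?case
  proof (cases "lookup a i = 0")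
    case True
    then show ?thesis by (simp add: product pdiff_pvar_single lookup_add lookup_single when_def)
  next
    case False
    have "a + single k 1 - single i 1 = (a - single i 1) + single k 1"
      using False by (intro poly_mapping_eqI) (auto simp: lookup_add lookup_minus lookup_single when_def)
    moreover have "a - single k 1 + single k 1 = a" if "i = k"
      using exponent_minus_single_add[of a k] False that by simp
    ultimately show ?thesis
      by (auto simp: product pdiff_pvar_single lookup_add lookup_single when_def single_add[symmetric]
        distrib_right add.commute)
  qed
next
  case (add p q)
  then show ?case by (simp add: distrib_left pdiff_add_right)
qed simp

section \<open>Duality between an ideal and its solution space\<close>

definition apolar :: "'n::finite cpoly \<Rightarrow> 'n cpoly \<Rightarrow> complex" where
  "apolar \<phi> f = lookup (pdiff \<phi> f) 0"

interpretation cfun: vector_space_pair cscale "(*) :: complex \<Rightarrow> complex \<Rightarrow> complex"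
  by unfold_locales (auto simp: algebra_simps)

lemma apolar_add_left: "apolar (\<phi> + \<psi>) f = apolar \<phi> f + apolar \<psi> f"
  and apolar_add_right: "apolar \<phi> (f + g) = apolar \<phi> f + apolar \<phi> g"
  and apolar_diff_right: "apolar \<phi> (f - g) = apolar \<phi> f - apolar \<phi> g"
  and apolar_cscale_left: "apolar (cscale c \<phi>) f = c * apolar \<phi> f"
  and apolar_cscale_right: "apolar \<phi> (cscale c f) = c * apolar \<phi> f"
  and apolar_0 [simp]: "apolar 0 f = 0" "apolar \<phi> 0 = 0"
  by (simp_all add: apolar_def pdiff_add_left pdiff_add_right lookup_add pdiff_diff_right lookup_minus
      pdiff_cscale_left pdiff_cscale_right)

lemma apolar_pmon: "apolar (pmon m) f = lookup f m * multi_fact m"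
  by (simp add: apolar_def pmon_def lookup_pdiff_single multi_fact_def)

lemma lookup_pdiff_apolar: "lookup (pdiff \<phi> f) k * multi_fact k = apolar (pmon k * \<phi>) f"
  by (simp add: pdiff_mult apolar_def) (simp add: pmon_def lookup_pdiff_single multi_fact_def)

lemma dim_apolar_annihilator:
  fixes W :: "'n::finite cpoly set"
  assumes subspace_W: "cpoly.subspace W" "W \<subseteq> graded_part (Polys UNIV) q"
  shows "cpoly.dim {f \<in> graded_part (Polys UNIV) q. \<forall>\<phi>\<in>W. apolar \<phi> f = 0} + cpoly.dim W =
    cpoly.dim (graded_part (Polys (UNIV :: 'n set)) q)"
proof -
  let ?T = "graded_part (Polys (UNIV :: 'n set)) q"
  obtain E where E_spans: "finite E" "?T \<subseteq> cpoly.span E" using graded_part_finite_span by blast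
  show ?thesis
  proof (rule cpoly.dim_annihilator[OF _ _ graded_part_subspace[OF Polys_subspace] E_spans subspace_W])
    show "Vector_Spaces.linear cscale (*) (apolar \<phi>)" "Vector_Spaces.linear cscale (*) (\<lambda>\<phi>. apolar \<phi> f)"
      for \<phi> f :: "'n cpoly"
      using cfun.vector_space_pair_axioms unfolding vector_space_pair_def
      by (simp_all add: Vector_Spaces.linear_iff apolar_add_left apolar_add_right apolar_cscale_left
        apolar_cscale_right)
    fix f assume annihilated: "f \<in> ?T" "\<And>\<phi>. \<phi> \<in> ?T \<Longrightarrow> apolar \<phi> f = 0"
    have "keys f = {}"
    proof (rule equals0I)
      fix m assume m_key: "m \<in> keys f"
      then have "pmon m \<in> ?T" using annihilated(1) by (simp add: graded_part_def homog_def)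
      then have "lookup f m * multi_fact m = 0" using annihilated(2) apolar_pmon by metis
      then show False using m_key by (simp add: in_keys_iff)
    qed
    then show "f = 0" by simp
  qed
qed

lemma apolar_homog_component: "homog q f \<Longrightarrow> apolar \<phi> f = apolar (homog_component q \<phi>) f"
proof (induction \<phi> rule: cpoly_induct)
  case (single a c)
  show ?case
  proof (cases "mdeg a = q")
    case True
    then show ?thesis using homog_component_homog[OF homog_single[of a c], of q] by simp
  next
    case False
    then have "lookup f a = 0" using single by (auto simp: homog_def in_keys_iff)
    then have "apolar (single a c) f = 0" by (simp add: apolar_def lookup_pdiff_single)
    moreover have "homog_component q (single a c) = 0"
      using homog_component_homog[OF homog_single[of a c], of q] False by simp
    ultimately show ?thesis by simp
  qed
qed (auto simp: homog_component_add apolar_add_left)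

lemma pdiff_homog_component:
  fixes f :: "'n::finite cpoly"
  assumes "homog a \<phi>"
  shows "pdiff \<phi> (homog_component e f) = (if a \<le> e then homog_component (e - a) (pdiff \<phi> f) else 0)"
proof (rule poly_mapping_eqI)
  fix k
  have "lookup (pdiff \<phi> (homog_component e f)) k =
    (\<Sum>b\<in>keys \<phi>. if mdeg k + a = e then lookup \<phi> b * lookup f (k + b) *
      (multi_fact (k + b) / multi_fact k) else 0)"
    unfolding lookup_pdiff
    using assms by (intro sum.cong refl) (auto simp: lookup_homog_component mdeg_add homog_def)
  also have "\<dots> = (if mdeg k + a = e then lookup (pdiff \<phi> f) k else 0)" by (simp add: lookup_pdiff)
  also have "\<dots> = lookup (if a \<le> e then homog_component (e - a) (pdiff \<phi> f) else 0) k"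
    by (auto simp: lookup_homog_component)
  finally show "lookup (pdiff \<phi> (homog_component e f)) k =
    lookup (if a \<le> e then homog_component (e - a) (pdiff \<phi> f) else 0) k" .
qed

definition inverse_system :: "'n::finite cpoly set \<Rightarrow> 'n cpoly set" where
  "inverse_system J = {f. \<forall>\<phi>\<in>J. pdiff \<phi> f = 0}"

lemma Q_perp_inverse_system: "Q_perp A v m g = inverse_system (Q_ideal A v m g)"
  by (simp add: Q_perp_def inverse_system_def)

lemma inverse_system_subspace: "cpoly.subspace (inverse_system J)"
  unfolding inverse_system_def cpoly.subspace_def by (auto simp: pdiff_add_right pdiff_cscale_right)

lemma one_in_inverse_system:
  assumes "\<And>\<phi>. \<phi> \<in> J \<Longrightarrow> lookup \<phi> 0 = 0"
  shows "1 \<in> inverse_system J"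
proof -
  have "lookup (pdiff \<phi> 1) k = 0" if "\<phi> \<in> J" for \<phi> k
    unfolding lookup_pdiff
  proof (intro sum.neutral ballI)
    fix b assume "b \<in> keys \<phi>"
    then have "b \<noteq> 0" using assms[OF that] by (auto simp: in_keys_iff)
    then have "mdeg (k + b) \<noteq> 0" using mdeg_eq_0_iff[of b] by (simp add: mdeg_add)
    then have "k + b \<noteq> 0" by auto
    then have "lookup (1 :: 'a cpoly) (k + b) = 0" by (simp add: lookup_one)
    then show "lookup \<phi> b * lookup 1 (k + b) * (multi_fact (k + b) / multi_fact k) = 0"
      by (simp only: mult_zero_left mult_zero_right)
  qed
  then show ?thesis by (simp add: inverse_system_def poly_mapping_eqI)
qed

lemma inverse_system_homog_closed:
  assumes homog_closed_J: "homog_closed J"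
  shows "homog_closed (inverse_system J)"
  unfolding homog_closed_def inverse_system_def
proof (intro ballI allI CollectI)
  fix f e \<phi> assume f_in: "f \<in> {f. \<forall>\<phi>\<in>J. pdiff \<phi> f = 0}" and \<phi>_in: "\<phi> \<in> J"
  obtain N where mdeg_bound: "\<forall>a\<in>keys \<phi>. mdeg a \<le> N" using keys_mdeg_bound by blast
  have "pdiff (homog_component a \<phi>) (homog_component e f) = 0" for a
  proof -
    have "pdiff (homog_component a \<phi>) f = 0" using f_in homog_closed_J \<phi>_in by (auto simp: homog_closed_def)
    then show ?thesis using pdiff_homog_component[OF homog_homog_component, of a \<phi> e f] by simp
  qed
  then have "pdiff (\<Sum>a\<le>N. homog_component a \<phi>) (homog_component e f) = 0" by (simp add: pdiff_sum_left)
  then show "pdiff \<phi> (homog_component e f) = 0" using sum_homog_component[of \<phi> N] mdeg_bound by simp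
qed

lemma graded_inverse_system:
  assumes graded_J: "ideal J (poly_ring UNIV)" "homog_closed J"
  shows "graded_part (inverse_system J) q =
    {f \<in> graded_part (Polys UNIV) q. \<forall>\<phi>\<in>graded_part J q. apolar \<phi> f = 0}" (is "_ = ?R")
proof (intro equalityI subsetI)
  show "f \<in> ?R" if "f \<in> graded_part (inverse_system J) q" for f
    using that by (auto simp: graded_part_def inverse_system_def apolar_def)
  fix f assume f_in: "f \<in> ?R"
  then have homog_f: "homog q f" by (simp add: graded_part_def)
  have "lookup (pdiff \<phi> f) k = 0" if \<phi>_in: "\<phi> \<in> J" for \<phi> k
  proof -
    have "pmon k * \<phi> \<in> J" using \<phi>_in by (intro ideal_mult[OF graded_J(1)]) auto
    then have "homog_component q (pmon k * \<phi>) \<in> graded_part J q"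
      using graded_J(2) homog_homog_component by (auto simp: graded_part_def homog_closed_def)
    then have "apolar (homog_component q (pmon k * \<phi>)) f = 0" using f_in by blast
    then have "lookup (pdiff \<phi> f) k * multi_fact k = 0"
      using apolar_homog_component[OF homog_f] lookup_pdiff_apolar by metis
    then show ?thesis by simp
  qed
  then show "f \<in> graded_part (inverse_system J) q"
    using homog_f by (simp add: graded_part_def inverse_system_def poly_mapping_eqI)
qed

lemma dim_graded_inverse_system:
  fixes J :: "'n::finite cpoly set"
  assumes graded_J: "ideal J (poly_ring UNIV)" "homog_closed J"
  shows "int (cpoly.dim (graded_part (inverse_system J) q)) = fps_nth (hilbert_series UNIV J) q"
proof -
  have "graded_part J q \<subseteq> graded_part (Polys UNIV) q" by (rule graded_part_mono) auto
  then have "cpoly.dim (graded_part (inverse_system J) q) + cpoly.dim (graded_part J q) =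
    cpoly.dim (graded_part (Polys (UNIV :: 'n set)) q)"
    unfolding graded_inverse_system[OF graded_J]
    by (rule dim_apolar_annihilator[OF graded_part_subspace[OF ideal_subspace[OF graded_J(1)]]])
  then show ?thesis by (simp add: hilbert_series_def)
qed

section \<open>Koszul complexes\<close>

definition koszul_sign :: "nat \<Rightarrow> nat set \<Rightarrow> 'a::comm_ring_1" where
  "koszul_sign j U = (- 1) ^ card {i \<in> U. i < j}"

definition koszul_diff :: "nat \<Rightarrow> (nat \<Rightarrow> 'a::comm_ring_1) \<Rightarrow> (nat set \<Rightarrow> 'a) \<Rightarrow> nat set \<Rightarrow> 'a" where
  "koszul_diff r l f U = (\<Sum>j\<in>{..<r} - U. koszul_sign j U * l j * f (insert j U))"

definition koszul_ext :: "nat \<Rightarrow> (nat set \<Rightarrow> 'a::comm_ring_1) \<Rightarrow> nat set \<Rightarrow> 'a" where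
  "koszul_ext j f U = (if j \<in> U then koszul_sign j U * f (U - {j}) else 0)"

lemma koszul_sign_square [simp]: "koszul_sign j U * koszul_sign j U = 1"
  by (simp add: koszul_sign_def power_mult_distrib[symmetric])

lemma koszul_sign_square_left [simp]: "koszul_sign j U * (koszul_sign j U * x) = x"
  by (simp add: mult.assoc[symmetric])

lemma koszul_sign_insert:
  assumes "finite U" "k \<notin> U"
  shows "koszul_sign j (insert k U) = (if k < j then - koszul_sign j U else koszul_sign j U)"
proof (cases "k < j")
  case True
  then have "{i \<in> insert k U. i < j} = insert k {i \<in> U. i < j}" by auto
  then show ?thesis using assms True by (simp add: koszul_sign_def)
next
  case False
  then have "{i \<in> insert k U. i < j} = {i \<in> U. i < j}" by auto
  then show ?thesis using False by (simp add: koszul_sign_def)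
qed

lemma koszul_sign_insert_self: "koszul_sign j (insert j U) = koszul_sign j U"
  unfolding koszul_sign_def by (rule arg_cong[where f = "\<lambda>X. (- 1) ^ card X"]) auto

lemma koszul_diff_diff: "koszul_diff r l (\<lambda>U. f U - g U) U = koszul_diff r l f U - koszul_diff r l g U"
  by (simp add: koszul_diff_def right_diff_distrib sum_subtractf)

lemma koszul_diff_scale: "koszul_diff r l (\<lambda>U. c * f U) U = c * koszul_diff r l f U"
  by (simp add: koszul_diff_def sum_distrib_left mult_ac)

lemma koszul_diff_sum: "koszul_diff r l (\<lambda>U. \<Sum>x\<in>X. f x U) U = (\<Sum>x\<in>X. koszul_diff r l (f x) U)"
  unfolding koszul_diff_def sum_distrib_left by (rule sum.swap)

lemma koszul_sign_insert_swap:
  assumes "finite W" "j \<noteq> k" "j \<notin> W" "k \<notin> W"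
  shows "koszul_sign k (insert j W) * koszul_sign j (insert k W) = - (koszul_sign k W * koszul_sign j W)"
  using assms by (cases j k rule: linorder_cases) (auto simp: koszul_sign_insert)

lemma cpoly_eq_uminus_selfD: "(S :: 'v cpoly) = - S \<Longrightarrow> S = 0"
proof (rule poly_mapping_eqI)
  fix k assume "S = - S"
  then have "lookup S k = - lookup S k" by (metis lookup_uminus)
  then show "lookup S k = lookup 0 k" by simp
qed

lemma koszul_diff_koszul_diff:
  fixes f :: "nat set \<Rightarrow> 'v cpoly"
  assumes finite_U: "finite U"
  shows "koszul_diff r l (koszul_diff r l f) U = 0"
proof -
  define X where "X = {..<r} - U"
  define t where "t j k =
    (if j = k then 0 else koszul_sign j U * l j *
    (koszul_sign k (insert j U) * l k * f (insert k (insert j U))))" for j k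
  have expand: "koszul_diff r l (koszul_diff r l f) U = (\<Sum>j\<in>X. \<Sum>k\<in>X. t j k)"
  proof -
    have "(\<Sum>k\<in>{..<r} - insert j U. koszul_sign j U * l j *
      (koszul_sign k (insert j U) * l k * f (insert k (insert j U)))) =
      (\<Sum>k\<in>X. t j k)" if "j \<in> X" for j
      using that by (intro sum.mono_neutral_cong_left) (auto simp: X_def t_def)
    then show ?thesis unfolding koszul_diff_def sum_distrib_left X_def[symmetric] by (rule sum.cong[OF refl])
  qed
  have antisymmetric: "t j k = - t k j" if "j \<in> X" "k \<in> X" for j k
    using that finite_U
    by (cases j k rule: linorder_cases) (auto simp: t_def X_def koszul_sign_insert insert_commute mult_ac)
  have "(\<Sum>j\<in>X. \<Sum>k\<in>X. t j k) = (\<Sum>k\<in>X. \<Sum>j\<in>X. t j k)" by (rule sum.swap)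
  also have "\<dots> = (\<Sum>k\<in>X. \<Sum>j\<in>X. - t k j)"
    by (intro sum.cong refl antisymmetric)
  finally have "(\<Sum>j\<in>X. \<Sum>k\<in>X. t j k) = - (\<Sum>j\<in>X. \<Sum>k\<in>X. t j k)" by (simp add: sum_negf)
  then show ?thesis using expand cpoly_eq_uminus_selfD by metis
qed

lemma koszul_ext_homotopy_notin:
  assumes j_notin_U: "j < r" "j \<notin> U"
  shows "koszul_diff r l (koszul_ext j f) U + koszul_ext j (koszul_diff r l f) U = l j * f U"
proof -
  have "koszul_sign k U * l k * koszul_ext j f (insert k U) = (if k = j then l j * f U else 0)"
    if "k \<in> {..<r} - U" for k
  proof -
    have "koszul_sign j U * l j * (koszul_sign j U * f U) = (koszul_sign j U * koszul_sign j U) * (l j * f U)"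
      by (simp add: mult_ac)
    then show ?thesis using j_notin_U(2) that by (auto simp: koszul_ext_def koszul_sign_insert_self)
  qed
  then have "koszul_diff r l (koszul_ext j f) U = (\<Sum>k\<in>{..<r} - U. if k = j then l j * f U else 0)"
    unfolding koszul_diff_def by (intro sum.cong refl)
  then show ?thesis using j_notin_U by (simp add: koszul_ext_def)
qed

lemma koszul_ext_homotopy_insert:
  assumes j_notin_W: "j < r" "j \<notin> W" and finite_W: "finite W"
  shows "koszul_diff r l (koszul_ext j f) (insert j W) + koszul_ext j (koszul_diff r l f) (insert j W) =
    l j * f (insert j W)"
proof -
  let ?U = "insert j W"
  let ?S = "\<Sum>k\<in>{..<r} - ?U. koszul_sign k W * l k * f (insert k W)"
  have "koszul_sign k ?U * l k * koszul_ext j f (insert k ?U) =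
    - (koszul_sign j W * (koszul_sign k W * l k * f (insert k W)))"
    if k_in: "k \<in> {..<r} - ?U" for k
  proof -
    have "insert k ?U - {j} = insert k W" using j_notin_W k_in by auto
    then have "koszul_sign k ?U * l k * koszul_ext j f (insert k ?U) =
      (koszul_sign k ?U * koszul_sign j (insert k ?U)) * (l k * f (insert k W))"
      by (simp add: koszul_ext_def mult_ac)
    also have "koszul_sign k ?U * koszul_sign j (insert k ?U) = - (koszul_sign k W * koszul_sign j W)"
      using koszul_sign_insert_swap[OF finite_W, of j k] j_notin_W k_in
      by (simp add: insert_commute[of k j] koszul_sign_insert_self)
    finally show ?thesis by (simp add: mult_ac)
  qed
  then have "koszul_diff r l (koszul_ext j f) ?U = - (koszul_sign j W * ?S)"
    unfolding koszul_diff_def sum_distrib_left sum_negf[symmetric] by (intro sum.cong refl)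
  moreover have "koszul_ext j (koszul_diff r l f) ?U = koszul_sign j W * ?S + l j * f ?U"
  proof -
    have "{..<r} - W = insert j ({..<r} - ?U)" using j_notin_W by auto
    then have "koszul_diff r l f W = (\<Sum>k\<in>insert j ({..<r} - ?U). koszul_sign k W * l k * f (insert k W))"
      by (simp only: koszul_diff_def)
    also have "\<dots> = koszul_sign j W * l j * f ?U + ?S" by (subst sum.insert) auto
    finally have "koszul_diff r l f W = koszul_sign j W * l j * f ?U + ?S" .
    moreover have "?U - {j} = W" using j_notin_W(2) by auto
    ultimately show ?thesis by (simp add: koszul_ext_def koszul_sign_insert_self distrib_left mult.assoc)
  qed
  ultimately show ?thesis by simp
qed

text \<open>Multiplication by \<open>l j\<close> is null-homotopic; hence the ideal generated by the \<open>l j\<close> annihilates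
  Koszul homology.\<close>

lemma koszul_ext_homotopy:
  assumes "j < r" "finite U"
  shows "koszul_diff r l (koszul_ext j f) U + koszul_ext j (koszul_diff r l f) U = l j * f U"
proof (cases "j \<in> U")
  case True
  then show ?thesis
    using koszul_ext_homotopy_insert[of j r "U - {j}" l f] assms by (simp add: insert_absorb)
qed (rule koszul_ext_homotopy_notin[OF assms(1)])

lemma koszul_sign_Polys: "koszul_sign j U \<in> Polys V"
  unfolding koszul_sign_def by (intro Polys_power Polys_uminus Polys_1)

lemma koszul_diff_Polys: "(\<And>j. j < r \<Longrightarrow> l j \<in> Polys V) \<Longrightarrow> (\<And>U. f U \<in> Polys V) \<Longrightarrow> koszul_diff r l f U \<in> Polys V"
  unfolding koszul_diff_def by (intro Polys_sum Polys_mult koszul_sign_Polys) auto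

lemma koszul_ext_Polys: "(\<And>U. f U \<in> Polys V) \<Longrightarrow> koszul_ext j f U \<in> Polys V"
  unfolding koszul_ext_def by (auto intro: Polys_mult koszul_sign_Polys)

definition koszul_boundary ::
  "'v set \<Rightarrow> nat \<Rightarrow> (nat \<Rightarrow> 'v cpoly) \<Rightarrow> 'v cpoly set \<Rightarrow> nat \<Rightarrow> (nat set \<Rightarrow> 'v cpoly) \<Rightarrow> bool" where
  "koszul_boundary V r l J i f \<longleftrightarrow>
    (\<exists>g. (\<forall>U. g U \<in> Polys V) \<and> (\<forall>U\<subseteq>{..<r}. card U = i \<longrightarrow> f U - koszul_diff r l g U \<in> J))"

definition koszul_exact :: "'v set \<Rightarrow> nat \<Rightarrow> (nat \<Rightarrow> 'v cpoly) \<Rightarrow> 'v cpoly set \<Rightarrow> nat \<Rightarrow> bool" where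
  "koszul_exact V r l J i \<longleftrightarrow> (\<forall>f. (\<forall>U. f U \<in> Polys V) \<longrightarrow>
     (\<forall>U\<subseteq>{..<r}. Suc (card U) = i \<longrightarrow> koszul_diff r l f U \<in> J) \<longrightarrow> koszul_boundary V r l J i f)"

lemma koszul_diff_mem:
  assumes ideal_J: "ideal J (poly_ring V)" and l_Polys: "\<And>j. j < r \<Longrightarrow> l j \<in> Polys V"
    and h_in_J: "\<And>W. W \<subseteq> {..<r} \<Longrightarrow> card W = Suc (card U) \<Longrightarrow> h W \<in> J" and U_subset: "U \<subseteq> {..<r}"
  shows "koszul_diff r l h U \<in> J"
proof -
  have "finite U" using U_subset finite_subset by blast
  then show ?thesis unfolding koszul_diff_def
    using U_subset
    by (intro ideal_sum[OF ideal_J] ideal_mult[OF ideal_J] Polys_mult koszul_sign_Polys l_Polys h_in_J) auto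
qed

lemma koszul_boundary_ideal_multiple:
  assumes ideal_J: "ideal J (poly_ring V)" and l_Polys: "\<And>j. j < r \<Longrightarrow> l j \<in> Polys V"
    and f_Polys: "\<And>U. f U \<in> Polys V" and cycle: "\<And>U. U \<subseteq> {..<r} \<Longrightarrow> Suc (card U) = i \<Longrightarrow> koszul_diff r l f U \<in> J"
    and x_in: "x \<in> Idl\<^bsub>poly_ring V\<^esub> (J \<union> l ` {..<r})"
  shows "koszul_boundary V r l J i (\<lambda>U. x * f U)"
proof -
  obtain a c where a_in: "a \<in> J" and c_Polys: "\<And>j. c j \<in> Polys V" and x_eq: "x = a + (\<Sum>j<r. c j * l j)"
    using x_in Idl_Un_linear_combinations[OF ideal_J, of r l] l_Polys by blast
  define g where "g U = (\<Sum>j<r. c j * koszul_ext j f U)" for U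
  have ext_J: "koszul_ext j (koszul_diff r l f) U \<in> J" if U_subset: "U \<subseteq> {..<r}" "card U = i" for j U
  proof (cases "j \<in> U")
    case True
    have "finite U" using U_subset(1) finite_subset by blast
    then have "Suc (card (U - {j})) = i" using True U_subset(2) by (metis card_Suc_Diff1)
    then have "koszul_diff r l f (U - {j}) \<in> J" using U_subset(1) by (intro cycle) auto
    then show ?thesis using True by (simp add: koszul_ext_def ideal_mult[OF ideal_J koszul_sign_Polys])
  qed (simp add: koszul_ext_def ideal_0[OF ideal_J])
  have "x * f U - koszul_diff r l g U \<in> J" if U_subset: "U \<subseteq> {..<r}" "card U = i" for U
  proof -
    have "finite U" using U_subset(1) finite_subset by blast
    then have "(\<Sum>j<r. c j * l j) * f U =
      (\<Sum>j<r. c j * (koszul_diff r l (koszul_ext j f) U + koszul_ext j (koszul_diff r l f) U))"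
      by (simp add: sum_distrib_right mult.assoc koszul_ext_homotopy)
    also have "\<dots> = koszul_diff r l g U + (\<Sum>j<r. c j * koszul_ext j (koszul_diff r l f) U)"
      by (simp add: g_def[abs_def] koszul_diff_sum koszul_diff_scale distrib_left sum.distrib)
    finally have "x * f U - koszul_diff r l g U = f U * a + (\<Sum>j<r. c j * koszul_ext j (koszul_diff r l f) U)"
      by (simp add: x_eq algebra_simps)
    then show ?thesis
      using f_Polys a_in c_Polys ext_J[OF U_subset]
      by (auto intro!: ideal_add[OF ideal_J] ideal_mult[OF ideal_J] ideal_sum[OF ideal_J])
  qed
  moreover have "g U \<in> Polys V" for U
    unfolding g_def using c_Polys f_Polys by (intro Polys_sum Polys_mult koszul_ext_Polys)
  ultimately show ?thesis unfolding koszul_boundary_def by blast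
qed

text \<open>The connecting map of \<open>0 \<rightarrow> R/J \<rightarrow> R/J \<rightarrow> R/(J, y) \<rightarrow> 0\<close>: exactness over \<open>(J, y)\<close> in degree
  \<open>i + 1\<close> makes multiplication by \<open>y\<close> injective on homology in degree \<open>i\<close>.\<close>

lemma koszul_boundary_cancel:
  assumes ideal_J: "ideal J (poly_ring V)" and l_Polys: "\<And>j. j < r \<Longrightarrow> l j \<in> Polys V"
    and y_Polys: "y \<in> Polys V" and regular: "\<And>p. p \<in> Polys V \<Longrightarrow> y * p \<in> J \<Longrightarrow> p \<in> J"
    and exact: "koszul_exact V r l (Idl\<^bsub>poly_ring V\<^esub> (insert y J)) (Suc i)"
    and f_Polys: "\<And>U. f U \<in> Polys V" and boundary_yf: "koszul_boundary V r l J i (\<lambda>U. y * f U)"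
  shows "koszul_boundary V r l J i f"
proof -
  obtain g where g_Polys: "\<And>U. g U \<in> Polys V"
    and yf_boundary_mod_J: "\<And>U. U \<subseteq> {..<r} \<Longrightarrow> card U = i \<Longrightarrow> y * f U - koszul_diff r l g U \<in> J"
    using boundary_yf unfolding koszul_boundary_def by blast
  have "koszul_diff r l g U \<in> Idl\<^bsub>poly_ring V\<^esub> (insert y J)" if "U \<subseteq> {..<r}" "Suc (card U) = Suc i" for U
  proof -
    have "koszul_diff r l g U = - (y * f U - koszul_diff r l g U) + f U * y" by (simp add: mult.commute)
    then show ?thesis
      unfolding Idl_insert[OF ideal_J y_Polys]
      using ideal_uminus[OF ideal_J yf_boundary_mod_J] that f_Polys by blast
  qed
  then have "koszul_boundary V r l (Idl\<^bsub>poly_ring V\<^esub> (insert y J)) (Suc i) g"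
    using exact g_Polys unfolding koszul_exact_def by blast
  then obtain h where "\<And>U. U \<subseteq> {..<r} \<Longrightarrow> card U = Suc i \<Longrightarrow>
    g U - koszul_diff r l h U \<in> Idl\<^bsub>poly_ring V\<^esub> (insert y J)"
    unfolding koszul_boundary_def by blast
  then have "\<forall>U. \<exists>k. k \<in> Polys V \<and> (U \<subseteq> {..<r} \<longrightarrow> card U = Suc i \<longrightarrow> g U - koszul_diff r l h U - k * y \<in> J)"
    unfolding Idl_insert[OF ideal_J y_Polys]
    using Polys_0 by (smt (verit) add_diff_cancel_right' mem_Collect_eq)
  then obtain k where g_boundary_mod_J: "\<And>U. k U \<in> Polys V"
    "\<And>U. U \<subseteq> {..<r} \<Longrightarrow> card U = Suc i \<Longrightarrow> g U - koszul_diff r l h U - k U * y \<in> J" by metis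
  have "f U - koszul_diff r l k U \<in> J" if U_subset: "U \<subseteq> {..<r}" "card U = i" for U
  proof (rule regular)
    show "f U - koszul_diff r l k U \<in> Polys V"
      using f_Polys g_boundary_mod_J(1) l_Polys by (intro Polys_diff koszul_diff_Polys) auto
    have "koszul_diff r l (\<lambda>U. g U - koszul_diff r l h U - k U * y) U \<in> J"
      using g_boundary_mod_J(2) U_subset by (intro koszul_diff_mem[OF ideal_J l_Polys]) auto
    moreover have "finite U" using U_subset finite_subset by blast
    ultimately have "koszul_diff r l g U - y * koszul_diff r l k U \<in> J"
      by (simp add: koszul_diff_diff koszul_diff_koszul_diff mult.commute[of _ y] koszul_diff_scale)
    then have "(y * f U - koszul_diff r l g U) + (koszul_diff r l g U - y * koszul_diff r l k U) \<in> J"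
      by (rule ideal_add[OF ideal_J yf_boundary_mod_J[OF U_subset]])
    then show "y * (f U - koszul_diff r l k U) \<in> J" by (simp add: right_diff_distrib)
  qed
  then show ?thesis unfolding koszul_boundary_def using g_boundary_mod_J(1) by blast
qed

lemma koszul_exact_step:
  assumes ideal_J: "ideal J (poly_ring V)" and l_Polys: "\<And>j. j < r \<Longrightarrow> l j \<in> Polys V"
    and y_Polys: "y \<in> Polys V" and regular: "\<And>p. p \<in> Polys V \<Longrightarrow> y * p \<in> J \<Longrightarrow> p \<in> J"
    and nilpotent: "y ^ N \<in> Idl\<^bsub>poly_ring V\<^esub> (J \<union> l ` {..<r})"
    and exact: "koszul_exact V r l (Idl\<^bsub>poly_ring V\<^esub> (insert y J)) (Suc i)"
  shows "koszul_exact V r l J i"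
  unfolding koszul_exact_def
proof (intro allI impI)
  fix f assume f_Polys: "\<forall>U. f U \<in> Polys V" and cycle: "\<forall>U\<subseteq>{..<r}. Suc (card U) = i \<longrightarrow> koszul_diff r l f U \<in> J"
  have "koszul_boundary V r l J i (\<lambda>U. y ^ N * f U)"
    by (rule koszul_boundary_ideal_multiple[OF ideal_J l_Polys _ _ nilpotent]) (use f_Polys cycle in auto)
  then show "koszul_boundary V r l J i f"
  proof (induction N)
    case (Suc N)
    have "koszul_boundary V r l J i (\<lambda>U. y ^ N * f U)"
    proof (rule koszul_boundary_cancel[OF ideal_J l_Polys y_Polys regular exact])
      show "y ^ N * f U \<in> Polys V" for U using f_Polys y_Polys by (intro Polys_mult Polys_power) auto
      show "koszul_boundary V r l J i (\<lambda>U. y * (y ^ N * f U))" using Suc.prems by (simp add: mult.assoc)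
    qed
    then show ?case by (rule Suc.IH)
  qed simp
qed

lemma koszul_exact_regular_sequence:
  assumes ideal_J: "\<And>k. k \<le> s \<Longrightarrow> ideal (J k) (poly_ring V)" and l_Polys: "\<And>j. j < r \<Longrightarrow> l j \<in> Polys V"
    and y_Polys: "\<And>k. k < s \<Longrightarrow> y k \<in> Polys V"
    and J_Suc: "\<And>k. k < s \<Longrightarrow> J (Suc k) = Idl\<^bsub>poly_ring V\<^esub> (insert (y k) (J k))"
    and regular: "\<And>k p. k < s \<Longrightarrow> p \<in> Polys V \<Longrightarrow> y k * p \<in> J k \<Longrightarrow> p \<in> J k"
    and nilpotent: "\<And>k. k < s \<Longrightarrow> \<exists>N. y k ^ N \<in> Idl\<^bsub>poly_ring V\<^esub> (J 0 \<union> l ` {..<r})"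
    and i_large: "i + s > r"
  shows "koszul_exact V r l (J 0) i"
proof -
  have mono: "J 0 \<subseteq> J k" if "k \<le> s" for k
    using that
  proof (induction k)
    case (Suc k)
    have "J k \<subseteq> J (Suc k)"
      using J_Suc[of k] Idl_gen[of "insert (y k) (J k)" V] ideal_sub_Polys[OF ideal_J[of k]] y_Polys[of k]
        Suc.prems by auto
    then show ?case using Suc by auto
  qed simp
  have "koszul_exact V r l (J k) i" if "k \<le> s" "i + (s - k) > r" for k i
    using that
  proof (induction "s - k" arbitrary: k i)
    case 0
    have "card U \<noteq> i" if "U \<subseteq> {..<r}" for U
      using card_mono[OF _ that] 0 by auto
    then show ?case unfolding koszul_exact_def koszul_boundary_def using Polys_0 by blast
  next
    case (Suc d)
    then have k_less: "k < s" by auto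
    have "koszul_exact V r l (J (Suc k)) (Suc i)" using Suc by (intro Suc.hyps) auto
    moreover obtain N where "y k ^ N \<in> Idl\<^bsub>poly_ring V\<^esub> (J 0 \<union> l ` {..<r})" using nilpotent k_less by blast
    then have "y k ^ N \<in> Idl\<^bsub>poly_ring V\<^esub> (J k \<union> l ` {..<r})"
      using Idl_mono[of "J 0 \<union> l ` {..<r}" "J k \<union> l ` {..<r}" V] mono[of k] k_less
        ideal_sub_Polys[OF ideal_J[of k]] l_Polys by auto
    ultimately show ?case
      using k_less J_Suc[OF k_less] by (intro koszul_exact_step[OF ideal_J l_Polys y_Polys regular]) auto
  qed
  from this[of 0 i] i_large show ?thesis by simp
qed

section \<open>Regular sequences of linear forms and Hilbert series\<close>

definition homog_below :: "nat \<Rightarrow> 'v cpoly \<Rightarrow> bool" where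
  "homog_below e p \<longleftrightarrow> p = 0 \<or> (\<exists>d. e = Suc d \<and> homog d p)"

lemma homog_below_uminus: "homog_below e p \<Longrightarrow> homog_below e (- p)"
  by (auto simp: homog_below_def homog_uminus)

lemma homog_below_mult: "homog_below e p \<Longrightarrow> homog 1 l \<Longrightarrow> homog e (p * l)"
  using homog_mult[of _ p 1 l] by (auto simp: homog_below_def)

definition koszul_syzygy :: "'v set \<Rightarrow> nat \<Rightarrow> (nat \<Rightarrow> 'v cpoly) \<Rightarrow> 'v cpoly set \<Rightarrow> nat \<Rightarrow> (nat \<Rightarrow> 'v cpoly) \<Rightarrow> bool"
  where
  "koszul_syzygy V r l J e p \<longleftrightarrow> (\<exists>q. (\<forall>j k. q j k = - q k j) \<and>
     (\<forall>j k. q j k \<in> Polys V \<and> homog_below e (q j k)) \<and> (\<forall>j<r. p j - (\<Sum>k<r. q j k * l k) \<in> J))"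

definition syzygies_koszul :: "'v set \<Rightarrow> nat \<Rightarrow> (nat \<Rightarrow> 'v cpoly) \<Rightarrow> 'v cpoly set \<Rightarrow> bool" where
  "syzygies_koszul V r l J \<longleftrightarrow> (\<forall>e p. (\<forall>j<r. p j \<in> Polys V \<and> homog e (p j)) \<longrightarrow>
     (\<Sum>j<r. p j * l j) \<in> J \<longrightarrow> koszul_syzygy V r l J e p)"

lemma koszul_diff_empty: "koszul_diff r l f {} = (\<Sum>j<r. f {j} * l j)"
  by (simp add: koszul_diff_def koszul_sign_def mult.commute)

lemma koszul_diff_singleton:
  "koszul_diff r l g {j} = (\<Sum>k<r. (if j < k then - g {j, k} else if k < j then g {j, k} else 0) * l k)"
proof -
  have "koszul_sign k {j} * l k * g {k, j} =
    (if j < k then - g {j, k} else if k < j then g {j, k} else 0) * l k"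
    if "k \<in> {..<r} - {j}" for k
  proof -
    have "{i. i = j \<and> i < k} = (if j < k then {j} else {})" by auto
    then show ?thesis using that by (auto simp: koszul_sign_def insert_commute[of k j] mult.commute)
  qed
  then have "koszul_diff r l g {j} =
    (\<Sum>k\<in>{..<r} - {j}. (if j < k then - g {j, k} else if k < j then g {j, k} else 0) * l k)"
    unfolding koszul_diff_def by (intro sum.cong refl)
  also have "\<dots> = (\<Sum>k<r. (if j < k then - g {j, k} else if k < j then g {j, k} else 0) * l k)"
    by (rule sum.mono_neutral_left) auto
  finally show ?thesis .
qed

lemma koszul_exact_syzygies_koszul:
  assumes graded_J: "ideal J (poly_ring V)" "homog_closed J"
    and l_linear: "\<And>j. j < r \<Longrightarrow> l j \<in> Polys V \<and> homog 1 (l j)"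
    and exact: "koszul_exact V r l J 1"
  shows "syzygies_koszul V r l J"
  unfolding syzygies_koszul_def
proof (intro allI impI)
  fix e p assume p_homog: "\<forall>j<r. p j \<in> Polys V \<and> homog e (p j)" and syzygy: "(\<Sum>j<r. p j * l j) \<in> J"
  define f where "f U = (if \<exists>j<r. U = {j} then p (the_elem U) else 0)" for U
  have f_singleton: "f {j} = p j" if "j < r" for j using that by (auto simp: f_def)
  have "koszul_diff r l f U \<in> J" if "U \<subseteq> {..<r}" "Suc (card U) = 1" for U
  proof -
    have "U = {}" using that finite_subset[of U "{..<r}"] by auto
    then show ?thesis using syzygy by (simp add: koszul_diff_empty f_singleton)
  qed
  moreover have "f U \<in> Polys V" for U using p_homog by (auto simp: f_def)
  ultimately have "koszul_boundary V r l J 1 f" using exact unfolding koszul_exact_def by blast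
  then obtain g where f_boundary_mod_J: "\<And>U. g U \<in> Polys V"
    "\<And>U. U \<subseteq> {..<r} \<Longrightarrow> card U = 1 \<Longrightarrow> f U - koszul_diff r l g U \<in> J"
    unfolding koszul_boundary_def by blast
  define hc where "hc x = (if e = 0 then 0 else homog_component (e - 1) x)" for x :: "'a cpoly"
  have hc_mult: "homog_component e (x * l k) = hc x * l k" if "k < r" for x k
    using homog_component_mult_homog[of 1 "l k" e x] l_linear that by (auto simp: hc_def)
  have hc_below: "homog_below e (hc x)" for x
    by (cases e) (auto simp: homog_below_def hc_def homog_homog_component)
  define q where "q j k = (if j < k then - hc (g {j, k}) else if k < j then hc (g {j, k}) else 0)"
    for j k :: nat
  have "p j - (\<Sum>k<r. q j k * l k) \<in> J" if j_less: "j < r" for j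
  proof -
    have "homog_component e (koszul_diff r l g {j}) = (\<Sum>k<r. q j k * l k)"
      unfolding koszul_diff_singleton homog_component_sum
      by (intro sum.cong) (auto simp: hc_mult q_def hc_def homog_component_uminus)
    moreover have "homog_component e (p j) = p j"
      using p_homog j_less homog_component_homog[of e "p j" e] by simp
    moreover have "homog_component e (f {j} - koszul_diff r l g {j}) \<in> J"
      using graded_J(2) f_boundary_mod_J(2)[of "{j}"] j_less by (auto simp: homog_closed_def)
    ultimately show ?thesis using f_singleton j_less by (simp add: homog_component_diff)
  qed
  moreover have "q j k \<in> Polys V" "homog_below e (q j k)" for j k
    using f_boundary_mod_J(1) hc_below
    by (auto simp: q_def hc_def homog_below_uminus intro!: Polys_uminus Polys_homog_component)
      (simp_all add: homog_below_def)
  moreover have "q j k = - q k j" for j k by (auto simp: q_def insert_commute)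
  ultimately show "koszul_syzygy V r l J e p" unfolding koszul_syzygy_def by blast
qed

lemma syzygies_koszul_SucE:
  assumes koszul: "syzygies_koszul V (Suc r) l J"
    and p_homog: "\<And>j. j < r \<Longrightarrow> p j \<in> Polys V \<and> homog e (p j)" and syzygy: "(\<Sum>j<r. p j * l j) \<in> J"
    and ideal_J: "ideal J (poly_ring V)"
  obtains q where "\<forall>j k. q j k = - q k j" "\<forall>j k. q j k \<in> Polys V \<and> homog_below e (q j k)"
    "\<forall>j<r. p j - (\<Sum>k<r. q j k * l k) - q j r * l r \<in> J" "(\<Sum>k<r. q k r * l k) \<in> J"
proof -
  define p' where "p' j = (if j < r then p j else 0)" for j
  have "(\<Sum>j<Suc r. p' j * l j) \<in> J" using syzygy by (simp add: p'_def)
  moreover have "\<forall>j<Suc r. p' j \<in> Polys V \<and> homog e (p' j)" using p_homog by (simp add: p'_def)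
  ultimately have "koszul_syzygy V (Suc r) l J e p'" using koszul unfolding syzygies_koszul_def by blast
  then obtain q where alternating_q: "\<And>j k. q j k = - q k j" "\<And>j k. q j k \<in> Polys V"
    "\<And>j k. homog_below e (q j k)"
    and p'_eq: "\<And>j. j < Suc r \<Longrightarrow> p' j - (\<Sum>k<Suc r. q j k * l k) \<in> J"
    unfolding koszul_syzygy_def by blast
  have "q r r = 0" using alternating_q(1)[of r r] by (rule cpoly_eq_uminus_selfD)
  then have "- (\<Sum>k<r. q r k * l k) \<in> J" using p'_eq[of r] by (simp add: p'_def)
  then have "(\<Sum>k<r. q k r * l k) \<in> J" by (subst alternating_q(1)) (simp add: sum_negf)
  moreover have "p j - (\<Sum>k<r. q j k * l k) - q j r * l r \<in> J" if "j < r" for j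
    using p'_eq[of j] that by (simp add: p'_def algebra_simps)
  ultimately show ?thesis using that[of q] alternating_q by blast
qed

lemma koszul_syzygy_absorb_column:
  assumes ideal_J: "ideal J (poly_ring V)" and l_linear: "l r \<in> Polys V" "homog 1 (l r)"
    and antisym: "\<forall>j k. q j k = - q k j"
    and q_homog_below: "\<forall>j k. q j k \<in> Polys V \<and> homog_below (Suc e) (q j k)"
    and p_eq: "\<forall>j<r. p j - (\<Sum>k<r. q j k * l k) - q j r * l r \<in> J"
    and column: "koszul_syzygy V r l J e (\<lambda>j. q j r)"
  shows "koszul_syzygy V r l J (Suc e) p"
proof -
  have q_homog: "homog e (q j k)" for j k
    using q_homog_below[rule_format, of j k] by (auto simp: homog_below_def)
  obtain q' where alternating_q': "\<And>j k. q' j k = - q' k j" "\<And>j k. q' j k \<in> Polys V"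
    "\<And>j k. homog_below e (q' j k)"
    and column_eq: "\<And>j. j < r \<Longrightarrow> q j r - (\<Sum>k<r. q' j k * l k) \<in> J"
    using column unfolding koszul_syzygy_def by blast
  define q'' where "q'' j k = q j k + q' j k * l r" for j k
  have "p j - (\<Sum>k<r. q'' j k * l k) \<in> J" if j_less: "j < r" for j
  proof -
    have "p j - (\<Sum>k<r. q'' j k * l k) =
      (p j - (\<Sum>k<r. q j k * l k) - q j r * l r) + l r * (q j r - (\<Sum>k<r. q' j k * l k))"
      by (simp add: q''_def algebra_simps sum.distrib sum_distrib_left)
    moreover have "l r * (q j r - (\<Sum>k<r. q' j k * l k)) \<in> J"
      by (rule ideal_mult[OF ideal_J l_linear(1) column_eq[OF j_less]])
    ultimately show ?thesis using p_eq j_less by (simp only: ideal_add[OF ideal_J])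
  qed
  moreover have "q'' j k = - q'' k j" for j k
    unfolding q''_def by (subst antisym[rule_format], subst alternating_q'(1)) simp
  moreover have "q'' j k \<in> Polys V" for j k
    unfolding q''_def using q_homog_below alternating_q'(2) l_linear(1) by (intro Polys_add Polys_mult) auto
  moreover have "homog_below (Suc e) (q'' j k)" for j k
    using homog_add[OF q_homog homog_below_mult[OF alternating_q'(3) l_linear(2)]]
    by (simp add: homog_below_def q''_def)
  ultimately show ?thesis unfolding koszul_syzygy_def by blast
qed

text \<open>Graded Nakayama: the last column of \<open>q\<close> is again a syzygy, of smaller degree.\<close>

lemma syzygies_koszul_SucD:
  assumes ideal_J: "ideal J (poly_ring V)" and l_linear: "\<And>j. j < Suc r \<Longrightarrow> l j \<in> Polys V \<and> homog 1 (l j)"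
    and koszul: "syzygies_koszul V (Suc r) l J"
  shows "syzygies_koszul V r l J"
proof -
  have "koszul_syzygy V r l J e p"
    if "\<And>j. j < r \<Longrightarrow> p j \<in> Polys V \<and> homog e (p j)" "(\<Sum>j<r. p j * l j) \<in> J" for e p
    using that
  proof (induction e arbitrary: p)
    case (0 p)
    from koszul 0 ideal_J obtain q where alternating_q: "\<forall>j k. q j k = - q k j"
      "\<forall>j k. q j k \<in> Polys V \<and> homog_below 0 (q j k)"
      "\<forall>j<r. p j - (\<Sum>k<r. q j k * l k) - q j r * l r \<in> J" "(\<Sum>k<r. q k r * l k) \<in> J"
      by (rule syzygies_koszul_SucE)
    have "q j k = 0" for j k using alternating_q(2) by (simp add: homog_below_def)
    then have "\<forall>j<r. p j - (\<Sum>k<r. q j k * l k) \<in> J" using alternating_q(3) by simp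
    with alternating_q(1,2) show ?case unfolding koszul_syzygy_def by blast
  next
    case (Suc e p)
    from koszul Suc.prems ideal_J obtain q where alternating_q: "\<forall>j k. q j k = - q k j"
      "\<forall>j k. q j k \<in> Polys V \<and> homog_below (Suc e) (q j k)"
      "\<forall>j<r. p j - (\<Sum>k<r. q j k * l k) - q j r * l r \<in> J"
      and column_syzygy: "(\<Sum>k<r. q k r * l k) \<in> J"
      by (rule syzygies_koszul_SucE)
    have "homog e (q j r)" for j
      using alternating_q(2)[rule_format, of j r] by (auto simp: homog_below_def)
    then have "koszul_syzygy V r l J e (\<lambda>j. q j r)"
      using alternating_q(2) column_syzygy by (intro Suc.IH) blast+
    then show ?case
      using l_linear[OF lessI] by (intro koszul_syzygy_absorb_column[OF ideal_J _ _ alternating_q]) auto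
  qed
  then show ?thesis unfolding syzygies_koszul_def by blast
qed

lemma syzygies_koszul_regular:
  assumes graded_J: "ideal J (poly_ring V)" "homog_closed J"
    and l_linear: "\<And>j. j < Suc r \<Longrightarrow> l j \<in> Polys V \<and> homog 1 (l j)"
    and koszul: "syzygies_koszul V (Suc r) l J"
    and p_homog: "p \<in> Polys V" "homog e p" "p * l r \<in> Idl\<^bsub>poly_ring V\<^esub> (J \<union> l ` {..<r})"
  shows "p \<in> Idl\<^bsub>poly_ring V\<^esub> (J \<union> l ` {..<r})"
proof -
  have repr: "Idl\<^bsub>poly_ring V\<^esub> (J \<union> l ` {..<r}) = {a + (\<Sum>j<r. c j * l j) | a c. a \<in> J \<and> (\<forall>j. c j \<in> Polys V)}"
    using l_linear by (intro Idl_Un_linear_combinations[OF graded_J(1)]) auto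
  obtain a c where Idl_decomposition: "a \<in> J" "\<And>j. c j \<in> Polys V" "p * l r = a + (\<Sum>j<r. c j * l j)"
    using p_homog(3) unfolding repr by blast
  have "homog (e + 1) (p * l r)" using p_homog l_linear[of r] by (intro homog_mult) auto
  then have "p * l r = homog_component (e + 1) (p * l r)"
    using homog_component_homog[of "e + 1" "p * l r" "e + 1"] by simp
  also have "\<dots> = homog_component (e + 1) a + (\<Sum>j<r. homog_component e (c j) * l j)"
    unfolding Idl_decomposition(3) homog_component_add homog_component_sum
    using l_linear
    by (intro arg_cong2[where f = "(+)"] refl sum.cong) (auto simp: homog_component_mult_homog[of 1])
  finally have homogeneous: "p * l r = homog_component (e + 1) a + (\<Sum>j<r. homog_component e (c j) * l j)" .
  define p' where "p' j = (if j < r then - homog_component e (c j) else p)" for j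
  have "(\<Sum>j<Suc r. p' j * l j) = homog_component (e + 1) a"
    using homogeneous by (simp add: p'_def sum_negf)
  also have "\<dots> \<in> J" using graded_J(2) Idl_decomposition(1) by (simp add: homog_closed_def)
  finally have "(\<Sum>j<Suc r. p' j * l j) \<in> J" .
  moreover have "\<forall>j<Suc r. p' j \<in> Polys V \<and> homog e (p' j)"
    using p_homog Idl_decomposition(2)
    by (auto simp: p'_def intro!: Polys_uminus Polys_homog_component homog_uminus homog_homog_component)
  ultimately have "koszul_syzygy V (Suc r) l J e p'"
    using koszul unfolding syzygies_koszul_def by blast
  then obtain q where alternating_q: "\<And>j k. q j k = - q k j" "\<And>j k. q j k \<in> Polys V"
    "\<And>j. j < Suc r \<Longrightarrow> p' j - (\<Sum>k<Suc r. q j k * l k) \<in> J"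
    unfolding koszul_syzygy_def by blast
  have "q r r = 0" using alternating_q(1)[of r r] by (rule cpoly_eq_uminus_selfD)
  then have "p - (\<Sum>k<r. q r k * l k) \<in> J" using alternating_q(3)[of r] by (simp add: p'_def)
  moreover have "p = (p - (\<Sum>k<r. q r k * l k)) + (\<Sum>k<r. q r k * l k)" by simp
  ultimately show ?thesis unfolding repr using alternating_q(2) by blast
qed

lemma graded_part_Idl_insert:
  assumes graded_J: "ideal J (poly_ring V)" "homog_closed J" and l_homog: "l \<in> Polys V" "homog d l"
  shows "graded_part (Idl\<^bsub>poly_ring V\<^esub> (insert l J)) q =
    (if d \<le> q then {y + u * l | y u. y \<in> graded_part J q \<and>
      u \<in> graded_part (Polys V) (q - d)} else graded_part J q)"
    (is "_ = ?R")
proof (intro equalityI subsetI)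
  fix p assume p_in: "p \<in> graded_part (Idl\<^bsub>poly_ring V\<^esub> (insert l J)) q"
  then obtain a c where Idl_decomposition: "a \<in> J" "c \<in> Polys V" "p = a + c * l"
    unfolding graded_part_def Idl_insert[OF graded_J(1) l_homog(1)] by blast
  have "p = homog_component q p" using p_in homog_component_homog[of q p q] by (simp add: graded_part_def)
  also have "\<dots> = homog_component q a + (if d \<le> q then homog_component (q - d) c * l else 0)"
    by (simp add: Idl_decomposition(3) homog_component_add homog_component_mult_homog[OF l_homog(2)])
  finally have "p = homog_component q a + (if d \<le> q then homog_component (q - d) c * l else 0)" .
  moreover have "homog_component q a \<in> graded_part J q"
    using graded_J(2) Idl_decomposition(1) homog_homog_component
    by (auto simp: graded_part_def homog_closed_def)
  moreover have "homog_component (q - d) c \<in> graded_part (Polys V) (q - d)"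
    using Polys_homog_component[OF Idl_decomposition(2)] homog_homog_component by (auto simp: graded_part_def)
  ultimately show "p \<in> ?R" by auto
next
  fix p assume p_in: "p \<in> ?R"
  obtain y u where decomposition: "p = y + u * l" "y \<in> J" "homog q y" "u \<in> Polys V" "homog q (u * l)"
  proof (cases "d \<le> q")
    case True
    with p_in obtain y u where decomposition: "p = y + u * l" "y \<in> J" "homog q y" "u \<in> Polys V"
      "homog (q - d) u"
      by (auto simp: graded_part_def)
    then have "homog q (u * l)" using homog_mult[OF decomposition(5) l_homog(2)] True by simp
    with decomposition show thesis using that by blast
  next
    case False
    with p_in show thesis using that[of p 0] by (auto simp: graded_part_def)
  qed
  then show "p \<in> graded_part (Idl\<^bsub>poly_ring V\<^esub> (insert l J)) q"
    unfolding graded_part_def Idl_insert[OF graded_J(1) l_homog(1)] using homog_add by blast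
qed

lemma hilbert_series_insert:
  fixes V :: "'n::finite set"
  assumes graded_J: "ideal J (poly_ring V)" "homog_closed J" and l_homog: "l \<in> Polys V" "homog d l"
    and regular: "\<And>e p. p \<in> Polys V \<Longrightarrow> homog e p \<Longrightarrow> p * l \<in> J \<Longrightarrow> p \<in> J"
  shows "hilbert_series V (Idl\<^bsub>poly_ring V\<^esub> (insert l J)) = hilbert_series V J * (1 - fps_X ^ d)"
proof (rule fps_ext)
  fix q
  let ?I = "Idl\<^bsub>poly_ring V\<^esub> (insert l J)"
  let ?dim = "\<lambda>S q. cpoly.dim (graded_part S q)"
  have "?dim ?I q + ?dim J (q - d) = ?dim J q + ?dim (Polys V) (q - d)" if "d \<le> q"
  proof -
    have mult_l: "Vector_Spaces.linear cscale cscale (\<lambda>p. p * l)"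
      by (rule linear_cscaleI) (auto simp: distrib_right cscale_mult_left)
    obtain E where E_spans: "finite E" "graded_part (Polys V) (q - d) \<subseteq> cpoly.span E"
      using graded_part_finite_span by blast
    obtain E' where E'_spans: "finite E'" "graded_part (Polys V) q \<subseteq> cpoly.span E'"
      using graded_part_finite_span by blast
    have "graded_part J q \<subseteq> cpoly.span E'"
      using E'_spans(2) graded_part_mono[of J "Polys V" q] ideal_sub_Polys[OF graded_J(1)] by blast
    moreover have "{u \<in> graded_part (Polys V) (q - d). u * l \<in> graded_part J q} = graded_part J (q - d)"
      using regular[of _ "q - d"] ideal_sub_Polys[OF graded_J(1)] ideal_mult_right[OF graded_J(1) l_homog(1)]
        homog_mult[of "q - d" _ d l] l_homog(2) that
      by (auto simp: graded_part_def)
    ultimately show ?thesis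
      using cpoly.dim_sum_image[OF mult_l graded_part_subspace[OF Polys_subspace]
        graded_part_subspace[OF ideal_subspace[OF graded_J(1)]] E_spans E'_spans(1), of q] that
      by (simp add: graded_part_Idl_insert[OF graded_J l_homog])
  qed
  then show "fps_nth (hilbert_series V ?I) q = fps_nth (hilbert_series V J * (1 - fps_X ^ d)) q"
    by (auto simp: hilbert_series_def right_diff_distrib fps_X_power_mult_right_nth
      graded_part_Idl_insert[OF graded_J l_homog])
qed

lemma hilbert_series_syzygies_koszul:
  fixes V :: "'n::finite set"
  assumes graded_J: "ideal J (poly_ring V)" "homog_closed J"
    and l_linear: "\<And>j. j < r \<Longrightarrow> l j \<in> Polys V \<and> homog 1 (l j)"
    and koszul: "syzygies_koszul V r l J"
  shows "hilbert_series V (Idl\<^bsub>poly_ring V\<^esub> (J \<union> l ` {..<r})) = hilbert_series V J * (1 - fps_X) ^ r"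
  using l_linear koszul
proof (induction r)
  case 0
  have "Idl\<^bsub>poly_ring V\<^esub> J = J"
    using Idl_least[OF graded_J(1)] Idl_gen[of J V] ideal_sub_Polys[OF graded_J(1)] by blast
  then show ?case by simp
next
  case (Suc r)
  let ?I = "Idl\<^bsub>poly_ring V\<^esub> (J \<union> l ` {..<r})"
  have last_linear: "l j \<in> Polys V" "homog 1 (l j)" if "j < Suc r" for j
    using Suc.prems(1)[OF that] by auto
  have ideal_Idl: "ideal ?I (poly_ring V)"
    using ideal_sub_Polys[OF graded_J(1)] last_linear by (intro Idl_ideal) auto
  have "homog_closed ?I"
  proof (rule homog_closed_Idl_Un[OF graded_J])
    show "l ` {..<r} \<subseteq> Polys V" using last_linear(1) by auto
    show "\<exists>e. homog e s" if "s \<in> l ` {..<r}" for s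
      using that last_linear(2) by (metis imageE lessThan_iff less_SucI)
  qed
  then have "hilbert_series V (Idl\<^bsub>poly_ring V\<^esub> (insert (l r) ?I)) = hilbert_series V ?I * (1 - fps_X ^ 1)"
    using last_linear[OF lessI]
    by (rule hilbert_series_insert[OF ideal_Idl]) (rule syzygies_koszul_regular[OF graded_J Suc.prems])
  moreover have "hilbert_series V ?I = hilbert_series V J * (1 - fps_X) ^ r"
    using Suc.prems(1) syzygies_koszul_SucD[OF graded_J(1) Suc.prems] by (intro Suc.IH) auto
  ultimately show ?case
    using last_linear by (simp add: Idl_Un_lessThan_Suc[OF graded_J(1)] mult.assoc mult.commute)
qed

section \<open>Stanley-Reisner rings\<close>

definition simplicial_complex :: "'v set set \<Rightarrow> bool" where
  "simplicial_complex \<Delta> \<longleftrightarrow> (\<forall>\<tau>\<in>\<Delta>. \<forall>\<tau>'\<subseteq>\<tau>. \<tau>' \<in> \<Delta>)"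

lemma simplicial_complex_Pow: "simplicial_complex (Pow F)"
  by (auto simp: simplicial_complex_def)

lemma sr_ideal_eq:
  fixes V :: "'n::finite set"
  assumes simplicial_\<Delta>: "simplicial_complex \<Delta>"
  shows "sr_ideal V \<Delta> = {p \<in> Polys V. \<forall>m\<in>keys p. keys m \<notin> \<Delta>}"
proof -
  define E where "E = {(\<Sum>i\<in>\<tau>. single i (1::nat)) | \<tau>. \<tau> \<subseteq> V \<and> \<tau> \<notin> \<Delta>}"
  have gens: "{\<Prod>i\<in>\<tau>. pvar i | \<tau>. \<tau> \<subseteq> V \<and> \<tau> \<notin> \<Delta>} = pmon ` E"
    unfolding E_def prod_pvar by blast
  have "E \<subseteq> {m. keys m \<subseteq> V}"
    unfolding E_def by (auto simp: keys_indicator[OF finite, simplified])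
  then have "sr_ideal V \<Delta> = {p \<in> Polys V. \<forall>m\<in>keys p. \<exists>e\<in>E. \<exists>b. m = e + b}"
    unfolding sr_ideal_def gens by (rule monomial_ideal_eq)
  moreover have "(\<exists>e\<in>E. \<exists>b. m = e + b) \<longleftrightarrow> keys m \<notin> \<Delta>" if "keys m \<subseteq> V" for m
  proof -
    have "(\<exists>e\<in>E. \<exists>b. m = e + b) \<longleftrightarrow> (\<exists>\<tau>. \<tau> \<subseteq> V \<and> \<tau> \<notin> \<Delta> \<and> \<tau> \<subseteq> keys m)"
      unfolding E_def using indicator_dvd_iff[OF finite, of m] by blast
    then show ?thesis using that simplicial_\<Delta> unfolding simplicial_complex_def by blast
  qed
  ultimately show ?thesis by (auto simp: carrier_poly_ring)
qed

lemma sr_ideal_gens_sub: "{\<Prod>i\<in>\<tau>. pvar i | \<tau>. \<tau> \<subseteq> V \<and> \<tau> \<notin> \<Delta>} \<subseteq> Polys V"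
  by (auto intro!: Polys_prod)

lemma sr_ideal_ideal: "ideal (sr_ideal V \<Delta>) (poly_ring V)"
  unfolding sr_ideal_def by (rule Idl_ideal[OF sr_ideal_gens_sub])

lemma homog_prod_pvar: "homog (card X) (\<Prod>i\<in>X. pvar (i :: 'n::finite))"
  using homog_prod[of X "\<lambda>_. 1" pvar, OF _ homog_pvar] by simp

lemma sr_ideal_homog_closed: "homog_closed (sr_ideal (V :: 'n::finite set) \<Delta>)"
  unfolding sr_ideal_def using homog_prod_pvar by (intro homog_closed_Idl[OF sr_ideal_gens_sub]) blast

lemma sr_ideal_Pow: "sr_ideal V (Pow F) = {p \<in> Polys V. \<forall>m\<in>keys p. \<not> keys m \<subseteq> F}" for V :: "'n::finite set"
  by (simp add: sr_ideal_eq[OF simplicial_complex_Pow])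

lemma sr_ideal_antimono: "\<Delta> \<subseteq> \<Delta>' \<Longrightarrow> sr_ideal V \<Delta>' \<subseteq> sr_ideal V \<Delta>"
  unfolding sr_ideal_def by (rule Idl_mono[OF _ sr_ideal_gens_sub]) blast

lemma lookup_psubst_restrict:
  "lookup (psubst (\<lambda>j. if j \<in> F then pvar j else 0) p) m = (if keys m \<subseteq> F then lookup p m else 0)"
proof (induction p rule: cpoly_induct)
  case (single a c)
  let ?\<rho> = "\<lambda>j. if j \<in> F then pvar j else 0"
  have "psubst ?\<rho> (single a c) = (if keys a \<subseteq> F then single a c else 0)"
  proof (cases "keys a \<subseteq> F")
    case True
    then show ?thesis using psubst_id_on[OF Polys_single[of a F c], of ?\<rho>] by simp
  next
    case False
    then obtain j where "j \<in> keys a" "j \<notin> F" by blast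
    then have "(\<Prod>j\<in>keys a. ?\<rho> j ^ lookup a j) = 0"
      by (intro prod_zero bexI[of _ j]) (auto simp: in_keys_iff zero_power)
    then show ?thesis using False by (simp add: psubst_single)
  qed
  then show ?case by (simp add: lookup_single when_def)
qed (simp_all add: psubst_add lookup_add)

lemma sr_ideal_Pow_primeideal: "primeideal (sr_ideal V (Pow F)) (poly_ring V)" for V :: "'n::finite set"
proof (rule primeidealI[OF sr_ideal_ideal poly_ring_cring])
  let ?restrict = "psubst (\<lambda>j. if j \<in> F then pvar j else 0) :: 'n cpoly \<Rightarrow> 'n cpoly"
  have mem_iff: "p \<in> sr_ideal V (Pow F) \<longleftrightarrow> ?restrict p = 0" if "p \<in> Polys V" for p
    using that unfolding sr_ideal_Pow poly_mapping_eq_iff fun_eq_iff lookup_psubst_restrict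
    by (auto simp: in_keys_iff)
  have "1 \<notin> sr_ideal V (Pow F)" by (simp add: sr_ideal_Pow)
  then show "Polys V \<noteq> sr_ideal V (Pow F)" using Polys_1 by blast
  fix p q assume product_in: "p \<in> Polys V" "q \<in> Polys V" "p \<otimes>\<^bsub>poly_ring V\<^esub> q \<in> sr_ideal V (Pow F)"
  then have "?restrict p * ?restrict q = 0" by (simp add: mem_iff Polys_mult psubst_mult[symmetric])
  then show "p \<in> sr_ideal V (Pow F) \<or> q \<in> sr_ideal V (Pow F)"
    using product_in(1,2) by (auto simp: mem_iff dest: cpoly_mult_eq_0D)
qed

lemma sr_ideal_irrelevant_maximalideal: "maximalideal (sr_ideal V {{}}) (poly_ring V)" for V :: "'n::finite set"
proof (rule maximalidealI[OF sr_ideal_ideal])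
  have irrelevant: "sr_ideal V {{}} = {p \<in> Polys V. 0 \<notin> keys p}"
    using sr_ideal_Pow[of V "{}"] by auto
  then have "1 \<notin> sr_ideal V {{}}" by simp
  then show "Polys V \<noteq> sr_ideal V {{}}" using Polys_1 by blast
  fix J assume ideal_J: "ideal J (poly_ring V)" "sr_ideal V {{}} \<subseteq> J" "J \<subseteq> Polys V"
  show "J = sr_ideal V {{}} \<or> J = Polys V"
  proof (cases "J \<subseteq> sr_ideal V {{}}")
    case False
    then obtain p where constant_term: "p \<in> J" "0 \<in> keys p" using ideal_J(3) unfolding irrelevant by blast
    let ?c = "lookup p 0"
    have "lookup (p - pconst ?c) 0 = 0" by (simp add: lookup_minus pconst_def)
    moreover have "p - pconst ?c \<in> Polys V"
      using ideal_J(3) constant_term(1) by (intro Polys_diff Polys_pconst) blast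
    ultimately have "p - pconst ?c \<in> J" using ideal_J(2) unfolding irrelevant by (auto simp: in_keys_iff)
    then have "pconst ?c \<in> J" using ideal_diff[OF ideal_J(1) constant_term(1), of "p - pconst ?c"] by simp
    then have "pconst (inverse ?c) * pconst ?c \<in> J" by (rule ideal_mult[OF ideal_J(1) Polys_pconst])
    then have "1 \<in> J" using constant_term(2) by (simp add: pconst_mult[symmetric] in_keys_iff)
    then show ?thesis using ideal.one_imp_carrier[OF ideal_J(1)] by simp
  qed (use ideal_J(2) in auto)
qed

section \<open>Quotient rings, depth and height\<close>

context ring
begin

lemma quotient_mem_iff:
  assumes ideal_I: "ideal I R" and ideal_J: "ideal J R" "I \<subseteq> J" and x_in: "x \<in> carrier R"
  shows "I +> x \<in> (+>) I ` J \<longleftrightarrow> x \<in> J"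
proof
  interpret J: ideal J R by fact
  assume "I +> x \<in> (+>) I ` J"
  then obtain y where coset_eq: "y \<in> J" "I +> x = I +> y" by blast
  then have "x \<ominus> y \<in> J"
    using quotient_eq_iff_same_a_r_cos[OF ideal_I x_in, of y] J.Icarr ideal_J(2) by blast
  then have "(x \<ominus> y) \<oplus> y \<in> J" using coset_eq(1) by (rule J.a_closed)
  then show "x \<in> J" using x_in J.Icarr[OF coset_eq(1)] by (simp add: a_minus_def a_assoc l_neg)
qed blast

lemma carrier_FactRing: "carrier (R Quot I) = (+>) I ` carrier R"
  unfolding FactRing_def by (auto simp: A_RCOSETS_def')

lemma quotient_vimage:
  assumes ideal_I: "ideal I R" and ideal_J: "ideal J (R Quot I)"
  shows "ideal {x \<in> carrier R. I +> x \<in> J} R" "I \<subseteq> {x \<in> carrier R. I +> x \<in> J}"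
    "(+>) I ` {x \<in> carrier R. I +> x \<in> J} = J"
proof -
  show "ideal {x \<in> carrier R. I +> x \<in> J} R"
    by (rule ring_hom_ring.ideal_vimage[OF ideal.rcos_ring_hom_ring[OF ideal_I] ideal_J])
  have "I \<in> J" using additive_subgroup.zero_closed[OF ideal.axioms(1)[OF ideal_J]] by (simp add: FactRing_def)
  then show "I \<subseteq> {x \<in> carrier R. I +> x \<in> J}"
    using ideal.Icarr[OF ideal_I] a_rcos_zero[OF ideal_I] by auto
  show "(+>) I ` {x \<in> carrier R. I +> x \<in> J} = J"
    using ideal.Icarr[OF ideal_J] unfolding carrier_FactRing by blast
qed

lemma genideal_FactRing:
  assumes ideal_I: "ideal I R" and X_sub_carrier: "X \<subseteq> carrier R"
  shows "Idl\<^bsub>R Quot I\<^esub> ((+>) I ` X) = (+>) I ` (Idl (I \<union> X))"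
proof
  interpret Q: ring "R Quot I" by (rule ideal.quotient_is_ring[OF ideal_I])
  have gens_sub_carrier: "I \<union> X \<subseteq> carrier R" using ideal.Icarr[OF ideal_I] X_sub_carrier by auto
  show "Idl\<^bsub>R Quot I\<^esub> ((+>) I ` X) \<subseteq> (+>) I ` (Idl (I \<union> X))"
    using genideal_self[OF gens_sub_carrier]
    by (intro Q.genideal_minimal ring_ideal_imp_quot_ideal[OF ideal_I] genideal_ideal[OF gens_sub_carrier]) auto
  have image: "(+>) I ` X \<subseteq> carrier (R Quot I)" using X_sub_carrier by (auto simp: carrier_FactRing)
  note vimage = quotient_vimage[OF ideal_I Q.genideal_ideal[OF image]]
  have "Idl (I \<union> X) \<subseteq> {x \<in> carrier R. I +> x \<in> Idl\<^bsub>R Quot I\<^esub> ((+>) I ` X)}"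
    using vimage(2) Q.genideal_self[OF image] X_sub_carrier by (intro genideal_minimal vimage(1)) auto
  then show "(+>) I ` (Idl (I \<union> X)) \<subseteq> Idl\<^bsub>R Quot I\<^esub> ((+>) I ` X)" by auto
qed

lemma carrier_FactRing_neq:
  assumes "ideal I R" "ideal J R" "I \<subseteq> J" "carrier R \<noteq> J"
  shows "carrier (R Quot I) \<noteq> (+>) I ` J"
proof
  assume "carrier (R Quot I) = (+>) I ` J"
  then have "x \<in> J" if "x \<in> carrier R" for x
    using quotient_mem_iff[OF assms(1-3) that] that by (auto simp: carrier_FactRing)
  then show False using ideal.Icarr[OF assms(2)] assms(4) by blast
qed

lemma maximalideal_FactRing:
  assumes ideal_I: "ideal I R" and maximal_M: "maximalideal M R" "I \<subseteq> M"
  shows "maximalideal ((+>) I ` M) (R Quot I)"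
proof -
  interpret M: maximalideal M R by fact
  show ?thesis
  proof (rule maximalidealI[OF ring_ideal_imp_quot_ideal[OF ideal_I M.is_ideal]])
    show "carrier (R Quot I) \<noteq> (+>) I ` M"
      by (rule carrier_FactRing_neq[OF ideal_I M.is_ideal maximal_M(2) M.I_notcarr])
    fix J assume ideal_J: "ideal J (R Quot I)" "(+>) I ` M \<subseteq> J" "J \<subseteq> carrier (R Quot I)"
    define J' where "J' = {x \<in> carrier R. I +> x \<in> J}"
    have ideal_J': "ideal J' R" "(+>) I ` J' = J"
      using quotient_vimage[OF ideal_I ideal_J(1)] by (simp_all add: J'_def)
    have "M \<subseteq> J'" using ideal_J(2) M.Icarr by (auto simp: J'_def)
    then consider "J' = M" | "J' = carrier R"
      using M.I_maximal[OF ideal_J'(1)] ideal.Icarr[OF ideal_J'(1)] by blast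
    then show "J = (+>) I ` M \<or> J = carrier (R Quot I)"
      using ideal_J'(2) by cases (auto simp: carrier_FactRing)
  qed
qed

lemma regular_sequence_Nil: "ideal I R \<Longrightarrow> I \<noteq> carrier R \<Longrightarrow> regular_sequence R []"
  using genideal_minimal[of I "{}"] ideal.Icarr[of I R] by (auto simp: regular_sequence_def)

lemma ideal_depthE:
  assumes "ideal I R" "I \<noteq> carrier R" "enat r \<le> ideal_depth R I"
  obtains xs where "regular_sequence R xs" "set xs \<subseteq> I" "r \<le> length xs"
proof (cases r)
  case 0
  then show ?thesis using that[of "[]"] regular_sequence_Nil[OF assms(1,2)] by simp
next
  case (Suc k)
  then have "enat k < ideal_depth R I" using assms(3) by (metis enat_ord_simps(2) lessI less_le_trans)
  then obtain xs where "regular_sequence R xs" "set xs \<subseteq> I" "k < length xs"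
    unfolding ideal_depth_def less_Sup_iff by auto
  then show ?thesis using that Suc by auto
qed

end

context cring
begin

lemma primeideal_FactRing:
  assumes ideal_I: "ideal I R" and prime_P: "primeideal P R" "I \<subseteq> P"
  shows "primeideal ((+>) I ` P) (R Quot I)"
proof -
  interpret P: primeideal P R by fact
  interpret \<pi>: ring_hom_ring R "R Quot I" "(+>) I" by (rule ideal.rcos_ring_hom_ring[OF ideal_I])
  note mem_iff = quotient_mem_iff[OF ideal_I P.is_ideal prime_P(2)]
  show ?thesis
  proof (rule primeidealI[OF ring_ideal_imp_quot_ideal[OF ideal_I P.is_ideal]
    ideal.quotient_is_cring[OF ideal_I is_cring]])
    show "carrier (R Quot I) \<noteq> (+>) I ` P"
      by (rule carrier_FactRing_neq[OF ideal_I P.is_ideal prime_P(2) P.I_notcarr])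
    fix a b assume "a \<in> carrier (R Quot I)" "b \<in> carrier (R Quot I)"
      and product_in: "a \<otimes>\<^bsub>R Quot I\<^esub> b \<in> (+>) I ` P"
    then obtain x y where representatives: "x \<in> carrier R" "y \<in> carrier R" "a = I +> x" "b = I +> y"
      unfolding carrier_FactRing by blast
    then have "x \<otimes> y \<in> P" using product_in mem_iff[of "x \<otimes> y"] by simp
    then show "a \<in> (+>) I ` P \<or> b \<in> (+>) I ` P"
      using P.I_prime[OF representatives(1,2)] representatives(3,4) by auto
  qed
qed

lemma regular_sequence_FactRing_lift:
  assumes ideal_I: "ideal I R" and J_sub_carrier: "J \<subseteq> carrier R"
    and regular_xs: "regular_sequence (R Quot I) xs" "set xs \<subseteq> (+>) I ` J"
  obtains y where "\<And>k. k < length xs \<Longrightarrow> y k \<in> J"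
    "\<And>k x. k < length xs \<Longrightarrow> x \<in> carrier R \<Longrightarrow> y k \<otimes> x \<in> Idl (I \<union> y ` {..<k}) \<Longrightarrow> x \<in> Idl (I \<union> y ` {..<k})"
proof -
  interpret \<pi>: ring_hom_ring R "R Quot I" "(+>) I" by (rule ideal.rcos_ring_hom_ring[OF ideal_I])
  have "\<forall>k<length xs. \<exists>z. z \<in> J \<and> xs ! k = I +> z" using regular_xs(2) nth_mem by blast
  then obtain y where lift_y: "\<And>k. k < length xs \<Longrightarrow> y k \<in> J" "\<And>k. k < length xs \<Longrightarrow> xs ! k = I +> y k"
    by metis
  show ?thesis
  proof (rule that[OF lift_y(1)])
    fix k x assume k_less: "k < length xs" and x_in: "x \<in> carrier R"
      and product_in_Idl: "y k \<otimes> x \<in> Idl (I \<union> y ` {..<k})"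
    have gens_sub_carrier: "I \<union> y ` {..<k} \<subseteq> carrier R"
      using ideal.Icarr[OF ideal_I] lift_y(1) J_sub_carrier k_less by auto
    have "set (take k xs) = (\<lambda>i. xs ! i) ` {0..<k}" using k_less by (simp add: nth_image)
    also have "\<dots> = (+>) I ` y ` {..<k}"
      unfolding image_image using k_less lift_y(2) by (intro image_cong) auto
    finally have Idl_take: "Idl\<^bsub>R Quot I\<^esub> (set (take k xs)) = (+>) I ` (Idl (I \<union> y ` {..<k}))"
      using genideal_FactRing[OF ideal_I, of "y ` {..<k}"] gens_sub_carrier by simp
    note mem_iff = quotient_mem_iff[OF ideal_I genideal_ideal[OF gens_sub_carrier]]
    have I_sub: "I \<subseteq> Idl (I \<union> y ` {..<k})" using genideal_self[OF gens_sub_carrier] by blast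
    have "y k \<in> carrier R" using lift_y(1)[OF k_less] J_sub_carrier by blast
    then have "xs ! k \<otimes>\<^bsub>R Quot I\<^esub> (I +> x) = I +> (y k \<otimes> x)" using lift_y(2)[OF k_less] x_in by simp
    then have "xs ! k \<otimes>\<^bsub>R Quot I\<^esub> (I +> x) \<in> Idl\<^bsub>R Quot I\<^esub> (set (take k xs))"
      using imageI[OF product_in_Idl, of "(+>) I"] unfolding Idl_take by simp
    then have "I +> x \<in> Idl\<^bsub>R Quot I\<^esub> (set (take k xs))"
      using regular_xs(1) k_less x_in unfolding regular_sequence_def carrier_FactRing by blast
    then show "x \<in> Idl (I \<union> y ` {..<k})" unfolding Idl_take mem_iff[OF I_sub x_in] .
  qed
qed

end

lemma prime_height_ge:
  assumes "\<And>i. i \<le> k \<Longrightarrow> primeideal (C i) R" "\<And>i. i < k \<Longrightarrow> C i \<subset> C (Suc i)"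
  shows "enat k \<le> prime_height R (C k)"
  unfolding prime_height_def by (rule Sup_upper) (use assms in blast)

section \<open>Cohen-Macaulay Stanley-Reisner rings\<close>

context
  fixes V :: "'n::finite set" and \<Delta> :: "'n set set" and F :: "'n set"
  assumes simplicial_\<Delta>: "simplicial_complex \<Delta>" and face_F: "F \<in> \<Delta>" "F \<subseteq> V"
begin

text \<open>Removing the vertices of \<open>F\<close> one at a time gives a chain of face primes.\<close>

lemma sr_ring_irrelevant_height:
  "enat (card F) \<le> prime_height (sr_ring V \<Delta>) ((+>\<^bsub>poly_ring V\<^esub>) (sr_ideal V \<Delta>) ` sr_ideal V {{}})"
proof -
  let ?\<pi> = "(+>\<^bsub>poly_ring V\<^esub>) (sr_ideal V \<Delta>)"
  obtain f where "bij_betw f {0..<card F} F" using ex_bij_betw_nat_finite[OF finite[of F]] by auto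
  then have enum_F: "F = f ` {0..<card F}" "inj_on f {0..<card F}" by (auto simp: bij_betw_def)
  define G where "G i = f ` {i..<card F}" for i
  have "G i \<subseteq> F" for i by (subst enum_F(1)) (auto simp: G_def)
  then have "Pow (G i) \<subseteq> \<Delta>" for i using simplicial_\<Delta> face_F(1) unfolding simplicial_complex_def by blast
  then have sr_ideal_sub: "sr_ideal V \<Delta> \<subseteq> sr_ideal V (Pow (G i))" for i by (rule sr_ideal_antimono)
  have "?\<pi> ` sr_ideal V (Pow (G i)) \<subset> ?\<pi> ` sr_ideal V (Pow (G (Suc i)))" if i_less: "i < card F" for i
  proof
    have "G (Suc i) \<subseteq> G i" by (auto simp: G_def)
    then show "?\<pi> ` sr_ideal V (Pow (G i)) \<subseteq> ?\<pi> ` sr_ideal V (Pow (G (Suc i)))"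
      by (intro image_mono sr_ideal_antimono Pow_mono)
    have "f i \<notin> G (Suc i)" using enum_F(2) i_less by (auto simp: G_def dest: inj_onD)
    moreover have "f i \<in> F" using i_less by (subst enum_F(1)) auto
    then have "f i \<in> V" "f i \<in> G i" using face_F(2) i_less by (auto simp: G_def)
    ultimately have "pvar (f i) \<in> sr_ideal V (Pow (G (Suc i)))" "pvar (f i) \<notin> sr_ideal V (Pow (G i))"
      by (auto simp: sr_ideal_Pow)
    moreover have "?\<pi> (pvar (f i)) \<in> ?\<pi> ` sr_ideal V (Pow (G j)) \<longleftrightarrow> pvar (f i) \<in> sr_ideal V (Pow (G j))" for j
      by (rule poly_ring.quotient_mem_iff[OF sr_ideal_ideal sr_ideal_ideal sr_ideal_sub]) (simp add: \<open>f i \<in> V\<close>)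
    ultimately show "?\<pi> ` sr_ideal V (Pow (G i)) \<noteq> ?\<pi> ` sr_ideal V (Pow (G (Suc i)))" by metis
  qed
  then have "enat (card F) \<le> prime_height (sr_ring V \<Delta>) (?\<pi> ` sr_ideal V (Pow (G (card F))))"
    unfolding sr_ring_def
    by (intro prime_height_ge poly_ring.primeideal_FactRing sr_ideal_ideal sr_ideal_Pow_primeideal sr_ideal_sub)
  then show ?thesis by (simp add: G_def)
qed

lemma cohen_macaulay_regular_sequence:
  assumes cohen_mac: "cohen_macaulay (sr_ring V \<Delta>)"
  obtains (regular) y where "\<And>k. k < card F \<Longrightarrow> y k \<in> sr_ideal V {{}}"
    "\<And>k p. k < card F \<Longrightarrow> p \<in> Polys V \<Longrightarrow> y k * p \<in> Idl\<^bsub>poly_ring V\<^esub> (sr_ideal V \<Delta> \<union> y ` {..<k}) \<Longrightarrow>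
       p \<in> Idl\<^bsub>poly_ring V\<^esub> (sr_ideal V \<Delta> \<union> y ` {..<k})"
proof -
  let ?R = "poly_ring V Quot sr_ideal V \<Delta>"
  define M where "M = (+>\<^bsub>poly_ring V\<^esub>) (sr_ideal V \<Delta>) ` sr_ideal V {{}}"
  have "sr_ideal V \<Delta> \<subseteq> sr_ideal V {{}}"
    using simplicial_\<Delta> face_F(1) by (intro sr_ideal_antimono) (auto simp: simplicial_complex_def)
  then have maximal_M: "maximalideal M ?R"
    unfolding M_def by (intro poly_ring.maximalideal_FactRing sr_ideal_ideal sr_ideal_irrelevant_maximalideal)
  then have "ideal_depth ?R M = prime_height ?R M"
    using cohen_mac by (simp add: cohen_macaulay_def sr_ring_def)
  then have "enat (card F) \<le> ideal_depth ?R M"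
    using sr_ring_irrelevant_height by (simp add: sr_ring_def M_def)
  then obtain xs where regular_xs: "regular_sequence ?R xs" "set xs \<subseteq> M" "card F \<le> length xs"
    using ring.ideal_depthE[OF ideal.quotient_is_ring[OF sr_ideal_ideal], of M V \<Delta> "card F"]
      maximalideal.axioms(1)[OF maximal_M] maximalideal.I_notcarr[OF maximal_M] by metis
  show ?thesis
  proof (rule poly_ring.regular_sequence_FactRing_lift[OF sr_ideal_ideal _ regular_xs(1)
    regular_xs(2)[unfolded M_def]])
    show "sr_ideal V {{}} \<subseteq> Polys V" using ideal_sub_Polys[OF sr_ideal_ideal] by blast
    show thesis
      if "\<And>k. k < length xs \<Longrightarrow> y k \<in> sr_ideal V {{}}"
        "\<And>k x. k < length xs \<Longrightarrow> x \<in> Polys V \<Longrightarrow>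
          y k \<otimes>\<^bsub>poly_ring V\<^esub> x \<in> Idl\<^bsub>poly_ring V\<^esub> (sr_ideal V \<Delta> \<union> y ` {..<k}) \<Longrightarrow>
          x \<in> Idl\<^bsub>poly_ring V\<^esub> (sr_ideal V \<Delta> \<union> y ` {..<k})" for y
      using that regular_xs(3) by (intro regular[of y]) simp_all
  qed
qed

lemma irrelevant_power_in_ideal:
  assumes ideal_J: "ideal J (poly_ring V)" and y_in: "y \<in> sr_ideal V {{}}"
    and monomials: "\<And>m. keys m \<subseteq> V \<Longrightarrow> mdeg m > N \<Longrightarrow> pmon m \<in> J"
  shows "y ^ Suc N \<in> J"
proof (rule ideal_if_monomials[OF ideal_J])
  have y_Polys: "y \<in> Polys V" and no_constant_term: "0 \<notin> keys y" using y_in sr_ideal_Pow[of V "{}"] by auto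
  have power_degree_ge: "k \<le> mdeg m" if "m \<in> keys (y ^ k)" for k m
    using that
  proof (induction k arbitrary: m)
    case (Suc k)
    then obtain a b where product_key: "a \<in> keys y" "b \<in> keys (y ^ k)" "m = a + b"
      by (auto elim: keys_mult_mem)
    then have "mdeg a \<noteq> 0" using no_constant_term mdeg_eq_0_iff by metis
    then show ?case using Suc.IH[OF product_key(2)] product_key(3) by (simp add: mdeg_add)
  qed simp
  fix m assume m_in: "m \<in> keys (y ^ Suc N)"
  then have "keys m \<subseteq> V" using Polys_power[OF y_Polys, of "Suc N"] unfolding carrier_poly_ring by blast
  then show "pmon m \<in> J" using power_degree_ge[OF m_in] by (intro monomials) simp_all
qed

text \<open>A power of each member of the regular sequence lies in the ideal of the linear forms, so the Koszul
  complex of the linear forms sees the whole depth of the ring.\<close>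

lemma hilbert_series_cohen_macaulay:
  assumes cohen_mac: "cohen_macaulay (sr_ring V \<Delta>)"
    and l_linear: "\<And>j. j < card F \<Longrightarrow> l j \<in> Polys V \<and> homog 1 (l j)"
    and artinian: "\<And>m. keys m \<subseteq> V \<Longrightarrow> mdeg m > N \<Longrightarrow>
      pmon m \<in> Idl\<^bsub>poly_ring V\<^esub> (sr_ideal V \<Delta> \<union> l ` {..<card F})"
  shows "hilbert_series V (Idl\<^bsub>poly_ring V\<^esub> (sr_ideal V \<Delta> \<union> l ` {..<card F})) =
    hilbert_series V (sr_ideal V \<Delta>) * (1 - fps_X) ^ card F"
proof -
  let ?I = "sr_ideal V \<Delta>" and ?r = "card F"
  note ideal_sr = sr_ideal_ideal[of V \<Delta>]
  obtain y where regular_y: "\<And>k. k < ?r \<Longrightarrow> y k \<in> sr_ideal V {{}}"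
    "\<And>k p. k < ?r \<Longrightarrow> p \<in> Polys V \<Longrightarrow> y k * p \<in> Idl\<^bsub>poly_ring V\<^esub> (?I \<union> y ` {..<k}) \<Longrightarrow>
       p \<in> Idl\<^bsub>poly_ring V\<^esub> (?I \<union> y ` {..<k})"
    using cohen_macaulay_regular_sequence[OF cohen_mac] by blast
  have y_Polys: "y k \<in> Polys V" if "k < ?r" for k
    using ideal_sub_Polys[OF sr_ideal_ideal regular_y(1)[OF that]] .
  have ideal_Idl: "ideal (Idl\<^bsub>poly_ring V\<^esub> (?I \<union> l ` {..<?r})) (poly_ring V)"
    using ideal_sub_Polys[OF ideal_sr] l_linear by (intro Idl_ideal) auto
  let ?J = "\<lambda>k. Idl\<^bsub>poly_ring V\<^esub> (?I \<union> y ` {..<k})"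
  have J_0: "?J 0 = ?I" by (simp add: Idl_of_ideal[OF ideal_sr])
  have "koszul_exact V ?r l (?J 0) 1"
  proof (rule koszul_exact_regular_sequence[where s = ?r and J = ?J and y = y])
    show "ideal (?J k) (poly_ring V)" if "k \<le> ?r" for k
      using ideal_sub_Polys[OF ideal_sr] y_Polys that by (intro Idl_ideal) auto
    show "?J (Suc k) = Idl\<^bsub>poly_ring V\<^esub> (insert (y k) (?J k))" if "k < ?r" for k
      using y_Polys that by (intro Idl_Un_lessThan_Suc[OF ideal_sr]) auto
    show "\<exists>N. y k ^ N \<in> Idl\<^bsub>poly_ring V\<^esub> (?J 0 \<union> l ` {..<?r})" if "k < ?r" for k
      unfolding J_0 using irrelevant_power_in_ideal[OF ideal_Idl regular_y(1)[OF that] artinian] by blast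
  qed (use l_linear y_Polys regular_y(2) in auto)
  then have "syzygies_koszul V ?r l ?I"
    unfolding J_0 using l_linear by (intro koszul_exact_syzygies_koszul ideal_sr sr_ideal_homog_closed) auto
  then show ?thesis
    using l_linear by (intro hilbert_series_syzygies_koszul ideal_sr sr_ideal_homog_closed) auto
qed

end

section \<open>Integer kernels\<close>

lemma int_kernel_iff: "u \<in> int_kernel A \<longleftrightarrow> (\<forall>k. (\<Sum>j\<in>UNIV. A $ k $ j * u $ j) = 0)"
  by (simp add: int_kernel_def matrix_vector_mult_def vec_eq_iff)

lemma int_kernel_of_int:
  assumes "u \<in> int_kernel A"
  shows "(\<Sum>j\<in>UNIV. of_int (A $ k $ j) * of_int (u $ j)) = (0 :: 'a::ring_1)"
proof -
  have "of_int (\<Sum>j\<in>UNIV. A $ k $ j * u $ j) = (0 :: 'a)" using assms by (simp add: int_kernel_iff)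
  then show ?thesis by simp
qed

lemma common_denominator:
  fixes c :: "'a \<Rightarrow> rat"
  assumes "finite X"
  shows "\<exists>N::int. N > 0 \<and> (\<forall>j\<in>X. \<exists>z. of_int N * c j = of_int z)"
  using assms
proof (induction X rule: finite_induct)
  case empty
  show ?case by (intro exI[of _ 1]) simp
next
  case (insert x X)
  then obtain N where denominator_N: "N > 0" "\<forall>j\<in>X. \<exists>z. of_int N * c j = of_int z" by blast
  obtain a b where fraction: "quotient_of (c x) = (a, b)" by fastforce
  then have fraction_eq: "b > 0" "c x = of_int a / of_int b"
    using quotient_of_denom_pos quotient_of_div by blast+
  have "\<exists>z. of_int (b * N) * c j = of_int z" if j_in: "j \<in> insert x X" for j
  proof (cases "j = x")
    case True
    then have "of_int (b * N) * c j = of_int (N * a)" using fraction_eq by simp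
    then show ?thesis by blast
  next
    case False
    then obtain z where "of_int N * c j = of_int z" using denominator_N(2) j_in False by auto
    then have "of_int (b * N) * c j = of_int (b * z)" by (simp add: mult.assoc)
    then show ?thesis by blast
  qed
  then show ?case using denominator_N fraction_eq by (intro exI[of _ "b * N"]) simp
qed

lemma rational_kernel_integral:
  fixes A :: "int ^ 'n::finite ^ 'd::finite" and c :: "'n \<Rightarrow> rat"
  assumes c_in_kernel: "\<And>k. (\<Sum>j\<in>UNIV. of_int (A $ k $ j) * c j) = 0"
  shows "\<exists>N u. N > 0 \<and> u \<in> int_kernel A \<and> (\<forall>j. of_int (u $ j) = of_int N * c j)"
proof -
  obtain N where denominator_N: "N > 0" "\<forall>j\<in>UNIV. \<exists>z. of_int N * c j = of_int z"
    using common_denominator[of "UNIV :: 'n set" c] by auto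
  obtain z where z_numerator: "\<And>j. of_int N * c j = of_int (z j)" using bchoice[OF denominator_N(2)] by auto
  have "(\<Sum>j\<in>UNIV. A $ k $ j * z j) = 0" for k
  proof -
    have "of_int (\<Sum>j\<in>UNIV. A $ k $ j * z j) = (\<Sum>j\<in>UNIV. of_int N * (of_int (A $ k $ j) * c j))"
      by (simp add: z_numerator[symmetric] mult_ac)
    also have "\<dots> = 0" by (simp add: sum_distrib_left[symmetric] c_in_kernel)
    finally show ?thesis by (simp only: of_int_eq_0_iff)
  qed
  then have "(\<chi> j. z j) \<in> int_kernel A" by (simp add: int_kernel_iff)
  then show ?thesis using denominator_N z_numerator by (intro exI[of _ N] exI[of _ "\<chi> j. z j"]) simp
qed

definition rat_column :: "int ^ 'n::finite ^ 'd::finite \<Rightarrow> 'n \<Rightarrow> rat ^ 'd" where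
  "rat_column A j = (\<chi> k. of_int (A $ k $ j))"

definition independent_columns :: "int ^ 'n::finite ^ 'd::finite \<Rightarrow> 'n set \<Rightarrow> bool" where
  "independent_columns A \<sigma> \<longleftrightarrow> (\<forall>u\<in>int_kernel A. (\<forall>j. j \<notin> \<sigma> \<longrightarrow> u $ j = 0) \<longrightarrow> u = 0)"

lemma independent_columns_mono: "independent_columns A \<sigma> \<Longrightarrow> \<tau> \<subseteq> \<sigma> \<Longrightarrow> independent_columns A \<tau>"
  by (auto simp: independent_columns_def)

lemma independent_columns_rational:
  fixes A :: "int ^ 'n::finite ^ 'd::finite"
  assumes indep_\<sigma>: "independent_columns A \<sigma>" and relation_c: "(\<Sum>j\<in>\<sigma>. c j *s rat_column A j) = 0"
    and j_in: "j \<in> \<sigma>"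
  shows "c j = 0"
proof -
  define c' where "c' j = (if j \<in> \<sigma> then c j else 0)" for j
  have "(\<Sum>j\<in>UNIV. of_int (A $ k $ j) * c' j) = 0" for k
  proof -
    have "(\<Sum>j\<in>UNIV. of_int (A $ k $ j) * c' j) = (\<Sum>j\<in>\<sigma>. of_int (A $ k $ j) * c j)"
      by (rule sum.mono_neutral_cong_right) (auto simp: c'_def)
    also have "\<dots> = (\<Sum>j\<in>\<sigma>. c j *s rat_column A j) $ k" by (simp add: rat_column_def mult.commute)
    finally show ?thesis using relation_c by simp
  qed
  then obtain N u where scaled_relation: "N > 0" "u \<in> int_kernel A" "\<And>j. of_int (u $ j) = of_int N * c' j"
    using rational_kernel_integral[of A c'] by auto
  have "u $ j = 0" if "j \<notin> \<sigma>" for j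
  proof -
    have "of_int (u $ j) = (0 :: rat)" using scaled_relation(3)[of j] that by (simp add: c'_def)
    then show ?thesis by simp
  qed
  then have "u = 0" using indep_\<sigma> scaled_relation(2) by (auto simp: independent_columns_def)
  then have "of_int N * c' j = 0" using scaled_relation(3)[of j] by simp
  then show ?thesis using scaled_relation(1) j_in by (simp add: c'_def)
qed

lemma independent_columns_inj_on:
  assumes indep_\<sigma>: "independent_columns A \<sigma>" shows "inj_on (rat_column A) \<sigma>"
proof (rule inj_onI, rule ccontr)
  fix x y assume equal_columns: "x \<in> \<sigma>" "y \<in> \<sigma>" "rat_column A x = rat_column A y" "x \<noteq> y"
  define c :: "_ \<Rightarrow> rat" where "c j = (if j = x then 1 else if j = y then - 1 else 0)" for j
  have "(\<Sum>j\<in>\<sigma>. c j *s rat_column A j) = (\<Sum>j\<in>{x, y}. c j *s rat_column A j)"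
    using equal_columns by (intro sum.mono_neutral_right) (auto simp: c_def)
  also have "\<dots> = 0" using equal_columns by (simp add: c_def)
  finally have "c x = 0" by (rule independent_columns_rational[OF indep_\<sigma> _ equal_columns(1)])
  then show False by (simp add: c_def)
qed

lemma independent_rat_column_image:
  assumes indep_\<sigma>: "independent_columns A \<sigma>" shows "vec.independent (rat_column A ` \<sigma>)"
proof (rule vec.independent_if_scalars_zero)
  fix f x assume relation_f: "(\<Sum>x\<in>rat_column A ` \<sigma>. f x *s x) = 0" and "x \<in> rat_column A ` \<sigma>"
  then obtain j where x_column: "j \<in> \<sigma>" "x = rat_column A j" by blast
  have "(\<Sum>j\<in>\<sigma>. f (rat_column A j) *s rat_column A j) = 0"
    using relation_f by (simp add: sum.reindex[OF independent_columns_inj_on[OF indep_\<sigma>]])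
  then show "f x = 0"
    using independent_columns_rational[OF indep_\<sigma> _ x_column(1), of "\<lambda>j. f (rat_column A j)"] x_column(2)
    by simp
qed simp

lemma row_combination:
  fixes A :: "int ^ 'n::finite ^ 'd::finite"
  assumes indep_\<sigma>: "independent_columns A \<sigma>" and i_in: "i \<in> \<sigma>"
  obtains r :: "'d \<Rightarrow> complex" where
    "\<And>j. j \<in> \<sigma> \<Longrightarrow> (\<Sum>k\<in>UNIV. r k * of_int (A $ k $ j)) = (if j = i then 1 else 0)"
proof -
  define k0 :: 'd where "k0 = undefined"
  obtain f where dual_map: "Vector_Spaces.linear (*s) (*s) f"
    "\<forall>x\<in>rat_column A ` \<sigma>. f x = (if x = rat_column A i then axis k0 1 else (0 :: rat ^ 'd))"
    using vec.linear_independent_extend[OF independent_rat_column_image[OF indep_\<sigma>],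
      of "\<lambda>x. if x = rat_column A i then axis k0 1 else (0 :: rat ^ 'd)"] by blast
  define r :: "'d \<Rightarrow> complex" where "r k = of_rat (matrix f $ k0 $ k)" for k
  have "(\<Sum>k\<in>UNIV. r k * of_int (A $ k $ j)) = (if j = i then 1 else (0::complex))" if j_in: "j \<in> \<sigma>" for j
  proof -
    have "(\<Sum>k\<in>UNIV. r k * of_int (A $ k $ j)) = of_rat (\<Sum>k\<in>UNIV. matrix f $ k0 $ k * of_int (A $ k $ j))"
      by (simp add: r_def of_rat_sum of_rat_mult)
    also have "(\<Sum>k\<in>UNIV. matrix f $ k0 $ k * of_int (A $ k $ j)) = (matrix f *v rat_column A j) $ k0"
      by (simp add: matrix_vector_mult_def rat_column_def)
    also have "\<dots> = f (rat_column A j) $ k0" by (simp add: matrix_works[OF dual_map(1)])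
    also have "\<dots> = (if j = i then 1 else 0)"
      using dual_map(2) j_in i_in independent_columns_inj_on[OF indep_\<sigma>] by (auto simp: axis_def dest: inj_onD)
    finally show ?thesis by simp
  qed
  then show ?thesis by (rule that)
qed

lemma card_independent_columns:
  fixes A :: "int ^ 'n::finite ^ 'd::finite"
  assumes indep_T: "independent_columns A T"
  shows "card T \<le> CARD('d)"
proof -
  have "card T = card (rat_column A ` T)"
    by (rule card_image[OF independent_columns_inj_on[OF indep_T], symmetric])
  also have "\<dots> \<le> vec.dim (rat_column A ` T)"
    using vec.independent_bound_general[OF independent_rat_column_image[OF indep_T]] by simp
  also have "\<dots> \<le> CARD('d)"
    using vec.dim_subset_UNIV[of "rat_column A ` T"] by (simp add: vec.dimension_def card_cart_basis)
  finally show ?thesis .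
qed

lemma circuit_through:
  fixes A :: "int ^ 'n::finite ^ 'd::finite"
  assumes indep_\<sigma>: "independent_columns A \<sigma>" "card \<sigma> = CARD('d)" and j_notin: "j \<notin> \<sigma>"
  obtains u where "u \<in> int_kernel A" "u $ j \<noteq> 0" "\<And>i. i \<notin> insert j \<sigma> \<Longrightarrow> u $ i = 0"
proof -
  have "\<not> independent_columns A (insert j \<sigma>)"
    using card_independent_columns[of A "insert j \<sigma>"] indep_\<sigma>(2) j_notin by auto
  then obtain u where dependency: "u \<in> int_kernel A" "\<forall>i. i \<notin> insert j \<sigma> \<longrightarrow> u $ i = 0" "u \<noteq> 0"
    unfolding independent_columns_def by blast
  have "u $ j \<noteq> 0"
  proof
    assume "u $ j = 0"
    then have "\<forall>i. i \<notin> \<sigma> \<longrightarrow> u $ i = 0" using dependency(2) by auto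
    then show False using indep_\<sigma>(1) dependency unfolding independent_columns_def by blast
  qed
  then show ?thesis using that dependency by blast
qed

section \<open>Toric ideals\<close>

definition exponent_of :: "('n::finite \<Rightarrow> nat) \<Rightarrow> ('n \<Rightarrow>\<^sub>0 nat)" where
  "exponent_of f = Abs_poly_mapping f"

lemma lookup_exponent_of [simp]: "lookup (exponent_of f) j = f j"
  by (simp add: exponent_of_def)

lemma exp_vec_nth [simp]: "exp_vec a $ j = int (lookup a j)"
  by (simp add: exp_vec_def)

lemma exp_vec_add: "exp_vec (a + b) = exp_vec a + exp_vec b"
  by (simp add: vec_eq_iff lookup_add)

lemma exp_vec_diff_kernel: "exp_vec a - exp_vec b \<in> int_kernel A \<longleftrightarrow> A *v exp_vec a = A *v exp_vec b"
  by (simp add: int_kernel_def matrix_vector_mult_diff_distrib)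

lemma weight_add: "weight w (a + b) = weight w a + weight w b"
proof -
  have "rvec (exp_vec (a + b)) = rvec (exp_vec a) + rvec (exp_vec b)"
    by (simp add: rvec_def vec_eq_iff lookup_add)
  then show ?thesis by (simp add: weight_def inner_add_right)
qed

lemma toric_ideal_gens_sub: "{pmon u - pmon u' | u u'. A *v exp_vec u = A *v exp_vec u'} \<subseteq> Polys UNIV"
  by auto

lemma toric_ideal_binomial: "A *v exp_vec a = A *v exp_vec b \<Longrightarrow> pmon a - pmon b \<in> toric_ideal A"
  unfolding toric_ideal_def by (rule Idl_gen[OF toric_ideal_gens_sub]) blast

lemma toric_ideal_span:
  assumes "p \<in> toric_ideal A"
  shows "p \<in> cpoly.span {pmon a - pmon b | a b. A *v exp_vec a = A *v exp_vec b}" (is "_ \<in> cpoly.span ?S")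
  using assms[unfolded toric_ideal_def] toric_ideal_gens_sub
proof (induction rule: Idl_induct)
  case (mult c s)
  then obtain a b where s_binomial: "s = pmon a - pmon b" "A *v exp_vec a = A *v exp_vec b" by blast
  have "c * (pmon a - pmon b) \<in> cpoly.span ?S"
  proof (induction c rule: cpoly_induct)
    case (single k x)
    have "single k x * (pmon a - pmon b) = cscale x (pmon (k + a) - pmon (k + b))"
      by (simp add: single_eq_pconst_pmon cscale_def pmon_add right_diff_distrib mult_ac)
    moreover have "pmon (k + a) - pmon (k + b) \<in> ?S"
    proof (rule CollectI, rule exI[of _ "k + a"], rule exI[of _ "k + b"], rule conjI[OF refl])
      show "A *v exp_vec (k + a) = A *v exp_vec (k + b)"
        using s_binomial(2) by (simp add: exp_vec_add matrix_vector_right_distrib)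
    qed
    ultimately show ?case by (simp add: cpoly.span_scale cpoly.span_base)
  qed (auto simp: distrib_right cpoly.span_add cpoly.span_zero)
  then show ?case by (simp add: s_binomial)
qed (auto intro: cpoly.span_zero cpoly.span_add)

lemma toric_ideal_binomialD:
  assumes "pmon a - pmon b \<in> toric_ideal A"
  shows "A *v exp_vec a = A *v exp_vec b"
proof (rule ccontr)
  assume images_neq: "A *v exp_vec a \<noteq> A *v exp_vec b"
  define f where "f p = (\<Sum>m\<in>keys p. cscale (lookup p m) (if A *v exp_vec m = A *v exp_vec a then 1 else 0))"
    for p :: "'a cpoly"
  have linear: "Vector_Spaces.linear cscale cscale f" unfolding f_def by (rule linear_sum_keys)
  have f_pmon: "f (pmon m) = (if A *v exp_vec m = A *v exp_vec a then 1 else 0)" for m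
    by (simp add: f_def pmon_def cpoly.scale_one)
  have "f (pmon a - pmon b) = 0"
    by (rule cpoly_pair.linear_eq_0_on_span[OF linear _ toric_ideal_span[OF assms]])
      (auto simp: cpoly_pair.linear_diff[OF linear] f_pmon)
  then show False using images_neq by (simp add: cpoly_pair.linear_diff[OF linear] f_pmon)
qed

lemma lookup_init_form:
  "lookup (init_form w f) m = (if m \<in> keys f \<and> (\<forall>m'\<in>keys f. weight w m' \<le> weight w m) then lookup f m else 0)"
proof -
  have "finite {m \<in> keys f. \<forall>m'\<in>keys f. weight w m' \<le> weight w m}" by simp
  then show ?thesis
    unfolding init_form_def lookup_sum by (simp add: lookup_single when_def sum.delta)
qed

lemma init_ideal_gens_sub: "init_form w ` I \<subseteq> Polys UNIV" by auto

lemma init_ideal_ideal: "ideal (init_ideal w I) (poly_ring UNIV)"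
  unfolding init_ideal_def by (rule Idl_ideal[OF init_ideal_gens_sub])

lemma lookup_binomial:
  assumes "a \<noteq> b"
  shows "lookup (pmon a - pmon b) m = (if m = a then 1 else if m = b then - 1 else 0)"
    and "keys (pmon a - pmon b) = {a, b}"
proof -
  show coeff: "lookup (pmon a - pmon b) m = (if m = a then 1 else if m = b then - 1 else 0)" for m
    using assms by (auto simp: lookup_minus pmon_def lookup_single when_def)
  show "keys (pmon a - pmon b) = {a, b}"
    by (auto simp: in_keys_iff coeff split: if_splits)
qed

locale toric_groebner =
  fixes A :: "int ^ 'n::finite ^ 'd::finite" and w :: "real ^ 'n" and m :: nat
    and gp gm :: "nat \<Rightarrow> ('n \<Rightarrow>\<^sub>0 nat)" and g :: "nat \<Rightarrow> int ^ 'n"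
  assumes hyper: "columns_in_affine_hyperplane A"
    and generic: "generic_weight A w"
    and groebner_basis: "reduced_groebner_basis w (toric_ideal A) {pmon (gp i) - pmon (gm i) | i. i < m}"
    and g_def: "\<forall>i<m. g i = exp_vec (gp i) - exp_vec (gm i)"
begin

abbreviation "initial_ideal \<equiv> init_ideal w (toric_ideal A)"

lemma initial_ideal_monomial: "p \<in> initial_ideal \<Longrightarrow> a \<in> keys p \<Longrightarrow> pmon a \<in> initial_ideal"
proof -
  assume p_in: "p \<in> initial_ideal" "a \<in> keys p"
  obtain E where "initial_ideal = Idl\<^bsub>poly_ring UNIV\<^esub> (pmon ` E)"
    using generic unfolding generic_weight_def monomial_ideal_def by blast
  then have initial_ideal: "initial_ideal = {p \<in> Polys UNIV. \<forall>m\<in>keys p. \<exists>e\<in>E. \<exists>b. m = e + b}"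
    using monomial_ideal_eq[of E UNIV] by simp
  then show "pmon a \<in> initial_ideal" using p_in by auto
qed

lemma initial_ideal_mult: "pmon a \<in> initial_ideal \<Longrightarrow> pmon (a + b) \<in> initial_ideal"
  using ideal_mult[OF init_ideal_ideal, of "pmon b" "pmon a"] by (simp add: pmon_add mult.commute)

lemma binomial_leading:
  assumes "A *v exp_vec a = A *v exp_vec b" "a \<noteq> b" "weight w a \<ge> weight w b"
  shows "pmon a \<in> initial_ideal"
proof -
  have "init_form w (pmon a - pmon b) \<in> initial_ideal"
    unfolding init_ideal_def
    using toric_ideal_binomial[OF assms(1)] by (intro Idl_gen[OF init_ideal_gens_sub]) blast
  moreover have "a \<in> keys (init_form w (pmon a - pmon b))"
    using assms by (simp add: in_keys_iff lookup_init_form lookup_binomial)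
  ultimately show ?thesis by (rule initial_ideal_monomial)
qed

lemma
  assumes i_less: "i < m"
  shows gp_neq_gm: "gp i \<noteq> gm i" and weight_gp: "weight w (gm i) < weight w (gp i)"
    and init_gp: "init_form w (pmon (gp i) - pmon (gm i)) = pmon (gp i)"
    and gp_minimal: "pmon (gp i) \<notin> Idl\<^bsub>poly_ring UNIV\<^esub> (init_form w `
       ({pmon (gp i) - pmon (gm i) | i. i < m} - {pmon (gp i) - pmon (gm i)}))"
    and gp_gm_kernel: "A *v exp_vec (gp i) = A *v exp_vec (gm i)"
proof -
  let ?G = "{pmon (gp i) - pmon (gm i) | i. i < m}"
  let ?g = "pmon (gp i) - pmon (gm i)"
  have g_in_G: "?g \<in> ?G" using i_less by blast
  then obtain k where leading_k: "init_form w ?g = pmon k"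
    "pmon k \<notin> Idl\<^bsub>poly_ring UNIV\<^esub> (init_form w ` (?G - {?g}))"
    using groebner_basis unfolding reduced_groebner_basis_def by blast
  have lead_coeff_k: "lookup (init_form w ?g) k = 1" by (simp only: leading_k(1)) (simp add: pmon_def)
  show gp_neq: "gp i \<noteq> gm i"
  proof
    assume "gp i = gm i"
    then show False using lead_coeff_k by (simp add: lookup_init_form)
  qed
  have "k = gp i"
    using lead_coeff_k by (auto simp: lookup_init_form lookup_binomial[OF gp_neq] split: if_splits)
  with leading_k show "init_form w ?g = pmon (gp i)"
    "pmon (gp i) \<notin> Idl\<^bsub>poly_ring UNIV\<^esub> (init_form w ` (?G - {?g}))"
    by auto
  then have "lookup (init_form w ?g) (gm i) = 0" using gp_neq by (simp add: pmon_def lookup_single when_def)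
  then show "weight w (gm i) < weight w (gp i)"
    using gp_neq by (auto simp: lookup_init_form lookup_binomial[OF gp_neq] split: if_splits)
  have "?g \<in> toric_ideal A" using groebner_basis g_in_G unfolding reduced_groebner_basis_def by blast
  then show "A *v exp_vec (gp i) = A *v exp_vec (gm i)" by (rule toric_ideal_binomialD)
qed

lemma pmon_in_initial_ideal_iff: "pmon e \<in> initial_ideal \<longleftrightarrow> (\<exists>i<m. \<forall>j. lookup (gp i) j \<le> lookup e j)"
proof -
  have "init_form w ` {pmon (gp i) - pmon (gm i) | i. i < m} =
    (\<lambda>i. init_form w (pmon (gp i) - pmon (gm i))) ` {..<m}"
    by auto
  also have "\<dots> = (\<lambda>i. pmon (gp i)) ` {..<m}" by (intro image_cong refl) (simp add: init_gp)
  also have "\<dots> = pmon ` gp ` {..<m}" by (simp add: image_image)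
  finally have "initial_ideal = Idl\<^bsub>poly_ring UNIV\<^esub> (pmon ` gp ` {..<m})"
    using groebner_basis unfolding reduced_groebner_basis_def by metis
  then have "initial_ideal = {p \<in> Polys UNIV. \<forall>m'\<in>keys p. \<exists>e\<in>gp ` {..<m}. \<exists>b. m' = e + b}"
    using monomial_ideal_eq[of "gp ` {..<m}" UNIV] by simp
  then have "pmon e \<in> initial_ideal \<longleftrightarrow> (\<exists>i<m. \<exists>b. e = gp i + b)" by auto
  then show ?thesis by (simp only: exp_dvd_iff)
qed

lemma gp_divides_gp:
  assumes "i < m" "k < m" and gp_i: "gp i = gp k + c"
  shows "c = 0"
proof (rule ccontr)
  assume "c \<noteq> 0"
  let ?g = "\<lambda>i. pmon (gp i) - pmon (gm i)" and ?G = "{pmon (gp i) - pmon (gm i) | i. i < m}"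
  have "?g k \<noteq> ?g i"
  proof
    assume "?g k = ?g i"
    then have "pmon (gp k) = pmon (gp i)" using init_gp[OF \<open>k < m\<close>] init_gp[OF \<open>i < m\<close>] by simp
    then have "keys (pmon (gp k)) = keys (pmon (gp i))" by simp
    then show False using gp_i \<open>c \<noteq> 0\<close> by simp
  qed
  then have "?g k \<in> ?G - {?g i}" using \<open>k < m\<close> by auto
  then have "init_form w (?g k) \<in> Idl\<^bsub>poly_ring UNIV\<^esub> (init_form w ` (?G - {?g i}))"
    by (intro Idl_gen[OF init_ideal_gens_sub] imageI)
  then have "pmon c * pmon (gp k) \<in> Idl\<^bsub>poly_ring UNIV\<^esub> (init_form w ` (?G - {?g i}))"
    unfolding init_gp[OF \<open>k < m\<close>] by (intro ideal_mult[OF Idl_ideal[OF init_ideal_gens_sub]]) auto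
  then show False using gp_minimal[OF \<open>i < m\<close>] gp_i by (simp add: pmon_add mult.commute)
qed

lemma gp_gm_disjoint:
  assumes i_less: "i < m"
  shows "lookup (gp i) j = 0 \<or> lookup (gm i) j = 0"
proof (rule ccontr)
  assume "\<not> ?thesis"
  then obtain a b where gp_eq: "gp i = a + single j 1" and gm_eq: "gm i = b + single j 1"
    using exponent_minus_single_add[of "gp i" j] exponent_minus_single_add[of "gm i" j] by (metis not_gr_zero)
  have "A *v exp_vec a = A *v exp_vec b"
    using gp_gm_kernel[OF i_less] unfolding gp_eq gm_eq exp_vec_add matrix_vector_right_distrib by simp
  moreover have "a \<noteq> b" using gp_neq_gm[OF i_less] gp_eq gm_eq by auto
  moreover have "weight w b \<le> weight w a" using weight_gp[OF i_less] unfolding gp_eq gm_eq weight_add by simp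
  ultimately have "pmon a \<in> initial_ideal" by (rule binomial_leading)
  then obtain k c where "k < m" "a = gp k + c"
    unfolding pmon_in_initial_ideal_iff exp_dvd_iff[symmetric] by blast
  then have "c + single j 1 = 0" using gp_divides_gp[OF i_less \<open>k < m\<close>] gp_eq by (simp add: add.assoc)
  then have "lookup (c + single j 1) j = 0" by simp
  then show False by (simp add: lookup_add)
qed

lemma finite_fiber: "finite {e. A *v exp_vec e = b}"
proof -
  obtain c :: "rat ^ 'd" and \<delta> :: rat where grading_row: "\<delta> \<noteq> 0" "\<And>j. (\<Sum>i\<in>UNIV. c $ i * of_int (A $ i $ j)) = \<delta>"
    using hyper unfolding columns_in_affine_hyperplane_def by blast
  define D where "D = (\<Sum>i\<in>UNIV. c $ i * of_int (b $ i)) / \<delta>"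
  have mdeg_eq_D: "of_nat (mdeg e) = D" if "A *v exp_vec e = b" for e
  proof -
    have "(\<Sum>i\<in>UNIV. c $ i * of_int (b $ i)) =
      (\<Sum>i\<in>UNIV. c $ i * (\<Sum>j\<in>UNIV. of_int (A $ i $ j) * of_nat (lookup e j)))"
      by (simp add: that[symmetric] matrix_vector_mult_def)
    also have "\<dots> = (\<Sum>i\<in>UNIV. \<Sum>j\<in>UNIV. c $ i * of_int (A $ i $ j) * of_nat (lookup e j))"
      by (simp add: sum_distrib_left mult.assoc)
    also have "\<dots> = (\<Sum>j\<in>UNIV. \<Sum>i\<in>UNIV. c $ i * of_int (A $ i $ j) * of_nat (lookup e j))"
      by (rule sum.swap)
    also have "\<dots> = (\<Sum>j\<in>UNIV. \<delta> * of_nat (lookup e j))"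
      by (simp add: sum_distrib_right[symmetric] grading_row(2))
    also have "\<dots> = \<delta> * of_nat (mdeg e)"
      using mdeg_superset[of UNIV e] by (simp add: sum_distrib_left)
    finally show ?thesis using grading_row(1) by (simp add: D_def)
  qed
  show ?thesis
  proof (cases "\<exists>e. A *v exp_vec e = b")
    case True
    then obtain e0 where "A *v exp_vec e0 = b" by blast
    then have "mdeg e = mdeg e0" if "A *v exp_vec e = b" for e
      using mdeg_eq_D[OF that] mdeg_eq_D by (metis of_nat_eq_iff)
    then have "{e. A *v exp_vec e = b} \<subseteq> {e. keys e \<subseteq> UNIV \<and> mdeg e = mdeg e0}" by auto
    then show ?thesis by (rule finite_subset) (rule finite_exponents, simp)
  qed simp
qed

lemma C_monoid_0: "0 \<in> C_monoid m g"
  unfolding C_monoid_def by (intro CollectI exI[of _ "\<lambda>_. 0"]) simp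

lemma C_monoid_add_g:
  assumes "u \<in> C_monoid m g" "i < m" shows "u + g i \<in> C_monoid m g"
proof -
  obtain c where combination_c: "u = (\<Sum>i<m. int (c i) *s g i)" using assms(1) unfolding C_monoid_def by blast
  have "u + g i = (\<Sum>k<m. int (if k = i then c k + 1 else c k) *s g k)"
  proof -
    have "(\<Sum>k<m. int (if k = i then c k + 1 else c k) *s g k) =
      (\<Sum>k<m. int (c k) *s g k + (if k = i then g k else 0))"
      by (intro sum.cong refl) (simp add: vec_eq_iff algebra_simps)
    also have "\<dots> = u + g i" using assms(2) by (simp add: sum.distrib combination_c)
    finally show ?thesis by simp
  qed
  then show ?thesis unfolding C_monoid_def
    by (intro CollectI exI[of _ "\<lambda>k. if k = i then c k + 1 else c k"]) simp
qed

lemma reduction_to_standard: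
  assumes "A *v exp_vec e = A *v exp_vec e0" "pmon e0 \<notin> initial_ideal"
  shows "exp_vec e - exp_vec e0 \<in> C_monoid m g"
  using assms(1)
proof (induction "card {e'. A *v exp_vec e' = A *v exp_vec e0 \<and> weight w e' < weight w e}"
    arbitrary: e rule: less_induct)
  case less
  show ?case
  proof (cases "e = e0")
    case True
    then show ?thesis using C_monoid_0 by simp
  next
    case False
    have "weight w e \<ge> weight w e0"
      using binomial_leading[of e0 e] less.prems False assms(2) by (metis linear)
    then have "pmon e \<in> initial_ideal" using binomial_leading[of e e0] less.prems False by blast
    then obtain i where gp_divides: "i < m" "\<forall>j. lookup (gp i) j \<le> lookup e j"
      unfolding pmon_in_initial_ideal_iff by blast
    then obtain b where e_eq: "e = gp i + b" using exp_dvd_iff[of e "gp i"] by blast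
    define e' where "e' = gm i + b"
    have image_eq: "A *v exp_vec e' = A *v exp_vec e0"
      using less.prems gp_gm_kernel[OF gp_divides(1)]
      by (simp add: e_eq e'_def exp_vec_add matrix_vector_right_distrib)
    have weight_less: "weight w e' < weight w e"
      using weight_gp[OF gp_divides(1)] by (simp add: e_eq e'_def weight_add)
    have "exp_vec e' - exp_vec e0 \<in> C_monoid m g"
    proof (rule less.hyps[OF _ image_eq])
      have "finite {e'. A *v exp_vec e' = A *v exp_vec e0 \<and> weight w e' < weight w e}"
        by (rule finite_subset[OF _ finite_fiber[of "A *v exp_vec e0"]]) auto
      moreover have "{x. A *v exp_vec x = A *v exp_vec e0 \<and> weight w x < weight w e'} \<subset>
        {e'. A *v exp_vec e' = A *v exp_vec e0 \<and> weight w e' < weight w e}"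
        using weight_less image_eq by (auto intro!: psubsetI)
      ultimately show "card {x. A *v exp_vec x = A *v exp_vec e0 \<and> weight w x < weight w e'} <
        card {e'. A *v exp_vec e' = A *v exp_vec e0 \<and> weight w e' < weight w e}"
        by (rule psubset_card_mono)
    qed
    then have "exp_vec e' - exp_vec e0 + g i \<in> C_monoid m g" by (rule C_monoid_add_g[OF _ gp_divides(1)])
    moreover have "exp_vec e' - exp_vec e0 + g i = exp_vec e - exp_vec e0"
      using g_def gp_divides(1) by (simp add: e_eq e'_def exp_vec_add)
    ultimately show ?thesis by simp
  qed
qed

lemma standard_pair_independent_columns:
  assumes std_pair: "(a, \<sigma>) \<in> standard_pairs initial_ideal"
  shows "independent_columns A \<sigma>"
  unfolding independent_columns_def
proof (intro ballI impI, rule ccontr)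
  fix u assume dependency: "u \<in> int_kernel A" "\<forall>j. j \<notin> \<sigma> \<longrightarrow> u $ j = 0" "u \<noteq> 0"
  define p where "p = exponent_of (\<lambda>j. nat (u $ j))"
  define q where "q = exponent_of (\<lambda>j. nat (- (u $ j)))"
  have u_eq: "u = exp_vec p - exp_vec q" by (simp add: vec_eq_iff p_def q_def)
  have keys: "keys p \<subseteq> \<sigma>" "keys q \<subseteq> \<sigma>" using dependency(2) by (auto simp: in_keys_iff p_def q_def)
  have "A *v exp_vec p = A *v exp_vec q" using dependency(1) unfolding u_eq exp_vec_diff_kernel .
  moreover have "p \<noteq> q" using dependency(3) u_eq by auto
  ultimately have "pmon p \<in> initial_ideal \<or> pmon q \<in> initial_ideal"
    using binomial_leading[of p q] binomial_leading[of q p] by (metis linorder_le_cases)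
  then obtain b where "keys b \<subseteq> \<sigma>" "pmon b \<in> initial_ideal" using keys by blast
  then have "pmon (a + b) \<in> initial_ideal" using initial_ideal_mult[of b a] by (simp add: add.commute)
  then show False using std_pair \<open>keys b \<subseteq> \<sigma>\<close> by (simp add: standard_pairs_def)
qed

end

section \<open>The link\<close>

definition nat_part :: "complex ^ 'n::finite \<Rightarrow> 'n set" where
  "nat_part v = {j. \<exists>k::nat. v $ j = of_nat k}"

definition nat_val :: "complex ^ 'n::finite \<Rightarrow> 'n \<Rightarrow> nat" where
  "nat_val v j = (THE k. v $ j = of_nat k)"

lemma of_nat_nat_val: "j \<in> nat_part v \<Longrightarrow> v $ j = of_nat (nat_val v j)"
  unfolding nat_part_def nat_val_def by (auto intro: the1I2)

lemma nat_val_eq: "v $ j = of_nat k \<Longrightarrow> nat_val v j = k"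
  unfolding nat_val_def by (rule the_equality) auto

lemma nat_part_nsupp: "j \<in> nat_part v \<Longrightarrow> j \<notin> nsupp v"
proof
  assume "j \<in> nat_part v" "j \<in> nsupp v"
  then obtain k :: nat and z :: int where "v $ j = of_nat k" "z < 0" "v $ j = of_int z"
    unfolding nat_part_def nsupp_def by blast
  then have "of_int (int k) = (of_int z :: complex)" by simp
  then show False using \<open>z < 0\<close> by (simp only: of_int_eq_iff)
qed

lemma nat_part_if_int: "v $ j = of_int z \<Longrightarrow> j \<notin> nsupp v \<Longrightarrow> j \<in> nat_part v \<and> z = int (nat_val v j)"
proof -
  assume v_j_int: "v $ j = of_int z" and j_notin_nsupp: "j \<notin> nsupp v"
  then have "z \<ge> 0" unfolding nsupp_def by force
  then have "v $ j = of_nat (nat z)" using v_j_int by simp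
  moreover from this have "nat_val v j = nat z" by (rule nat_val_eq)
  ultimately show ?thesis
    using \<open>z \<ge> 0\<close> unfolding nat_part_def by (intro conjI CollectI exI[of _ "nat z"]) simp_all
qed

context toric_groebner
begin

lemma G_set_eq:
  assumes i_less: "i < m"
  shows "G_set v (g i) = {j \<in> nat_part v. nat_val v j < lookup (gp i) j}"
proof (intro equalityI subsetI)
  have g_component: "g i $ j = int (lookup (gp i) j) - int (lookup (gm i) j)" for j using g_def i_less by simp
  fix j
  {
    assume "j \<in> G_set v (g i)"
    then obtain k where negative_k: "k < 0" "v $ j - of_int (g i $ j) = of_int k"
      and j_notin_nsupp: "j \<notin> nsupp v"
      by (auto simp: G_set_def nsupp_shift_def nsupp_def cvec_def)
    then have "v $ j = of_int (k + g i $ j)" by (simp add: algebra_simps)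
    then have "j \<in> nat_part v" "k + g i $ j = int (nat_val v j)"
      using nat_part_if_int[OF _ j_notin_nsupp] by blast+
    then show "j \<in> {j \<in> nat_part v. nat_val v j < lookup (gp i) j}"
      using negative_k(1) g_component[of j] by auto
  next
    assume small_nat_val: "j \<in> {j \<in> nat_part v. nat_val v j < lookup (gp i) j}"
    then have "lookup (gm i) j = 0" using gp_gm_disjoint[OF i_less, of j] by auto
    then have "int (nat_val v j) - g i $ j < 0" using small_nat_val g_component[of j] by auto
    moreover have "v $ j - of_int (g i $ j) = of_int (int (nat_val v j) - g i $ j)"
      using of_nat_nat_val[of j v] small_nat_val by simp
    ultimately have "j \<in> nsupp_shift v (- g i)"
      unfolding nsupp_shift_def nsupp_def cvec_def
      by (intro CollectI exI[of _ "int (nat_val v j) - g i $ j"]) simp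
    then show "j \<in> G_set v (g i)" using small_nat_val nat_part_nsupp[of j v] by (simp add: G_set_def)
  }
qed

lemma std_pairs_at_nat_val: "(a, \<sigma>) \<in> std_pairs_at A w v \<Longrightarrow> j \<notin> \<sigma> \<Longrightarrow> j \<in> nat_part v \<and> nat_val v j = lookup a j"
  using nat_val_eq[of v j] unfolding std_pairs_at_def nat_part_def by auto

lemma nsupp_sub_std_pairs_at: "(a, \<sigma>) \<in> std_pairs_at A w v \<Longrightarrow> nsupp v \<subseteq> \<sigma>"
  using std_pairs_at_nat_val[of a \<sigma> v] nat_part_nsupp[of _ v] by blast

lemma std_pairs_at_independent_columns: "(a, \<sigma>) \<in> std_pairs_at A w v \<Longrightarrow> independent_columns A \<sigma>"
  using standard_pair_independent_columns unfolding std_pairs_at_def by blast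

lemma link_complex_iff: "\<tau> \<in> link_complex A w v \<longleftrightarrow>
    \<tau> \<inter> nsupp v = {} \<and> (\<exists>a \<sigma>. (a, \<sigma>) \<in> std_pairs_at A w v \<and> \<tau> \<union> nsupp v \<subseteq> \<sigma>)"
  unfolding link_complex_def Delta_complex_def by blast

lemma simplicial_link_complex: "simplicial_complex (link_complex A w v)"
  unfolding simplicial_complex_def
proof (intro ballI allI impI)
  fix \<tau> \<tau>' assume "\<tau> \<in> link_complex A w v" "\<tau>' \<subseteq> \<tau>"
  then show "\<tau>' \<in> link_complex A w v" unfolding link_complex_iff by blast
qed

lemma link_complex_sub: "\<tau> \<in> link_complex A w v \<Longrightarrow> \<tau> \<subseteq> - nsupp v"
  unfolding link_complex_iff by blast

lemma link_complex_independent_columns: "\<tau> \<in> link_complex A w v \<Longrightarrow> independent_columns A (\<tau> \<union> nsupp v)"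
  unfolding link_complex_iff using std_pairs_at_independent_columns independent_columns_mono by blast

definition G_free :: "complex ^ 'n \<Rightarrow> 'n set \<Rightarrow> bool" where
  "G_free v \<sigma> \<longleftrightarrow> (\<forall>i<m. \<not> G_set v (g i) \<subseteq> \<sigma>)"

lemma ex_multiple_in_initial_ideal_iff:
  assumes a_eq_nat_val: "\<And>j. j \<notin> \<sigma> \<Longrightarrow> j \<in> nat_part v \<and> lookup a j = nat_val v j"
  shows "(\<exists>b. keys b \<subseteq> \<sigma> \<and> pmon (a + b) \<in> initial_ideal) \<longleftrightarrow> \<not> G_free v \<sigma>"
proof
  assume "\<exists>b. keys b \<subseteq> \<sigma> \<and> pmon (a + b) \<in> initial_ideal"
  then obtain b i where keys_b: "keys b \<subseteq> \<sigma>" and gp_divides: "i < m" "\<forall>j. lookup (gp i) j \<le> lookup (a + b) j"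
    unfolding pmon_in_initial_ideal_iff by blast
  have "j \<in> \<sigma>" if j_in: "j \<in> G_set v (g i)" for j
  proof (rule ccontr)
    assume "j \<notin> \<sigma>"
    then have "lookup (a + b) j = nat_val v j" using a_eq_nat_val keys_b by (auto simp: lookup_add in_keys_iff)
    then show False using gp_divides(2)[rule_format, of j] j_in unfolding G_set_eq[OF gp_divides(1)] by simp
  qed
  then show "\<not> G_free v \<sigma>" using gp_divides(1) unfolding G_free_def by blast
next
  assume "\<not> G_free v \<sigma>"
  then obtain i where G_set_sub_\<sigma>: "i < m" "G_set v (g i) \<subseteq> \<sigma>" unfolding G_free_def by blast
  define b where "b = exponent_of (\<lambda>j. if j \<in> \<sigma> then lookup (gp i) j else 0)"
  have "lookup (gp i) j \<le> lookup (a + b) j" for j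
  proof (cases "j \<in> \<sigma>")
    case False
    then show ?thesis
      using a_eq_nat_val[OF False] G_set_sub_\<sigma>(2)
      unfolding G_set_eq[OF G_set_sub_\<sigma>(1)] by (auto simp: lookup_add)
  qed (simp add: lookup_add b_def)
  then have "pmon (a + b) \<in> initial_ideal" unfolding pmon_in_initial_ideal_iff using G_set_sub_\<sigma>(1) by blast
  moreover have "keys b \<subseteq> \<sigma>" by (auto simp: b_def in_keys_iff split: if_splits)
  ultimately show "\<exists>b. keys b \<subseteq> \<sigma> \<and> pmon (a + b) \<in> initial_ideal" by blast
qed

lemma std_pairs_at_G_free:
  assumes "(a, \<sigma>) \<in> std_pairs_at A w v"
  shows "G_free v \<sigma>"
proof -
  have "\<not> (\<exists>b. keys b \<subseteq> \<sigma> \<and> pmon (a + b) \<in> initial_ideal)"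
    using assms by (auto simp: std_pairs_at_def standard_pairs_def)
  then show ?thesis using ex_multiple_in_initial_ideal_iff[of \<sigma> v a] std_pairs_at_nat_val[OF assms] by auto
qed

lemma maximal_G_free_std_pairs_at:
  assumes G_free_\<sigma>: "- nat_part v \<subseteq> \<sigma>" "G_free v \<sigma>" and maximal: "\<And>l. l \<notin> \<sigma> \<Longrightarrow> \<not> G_free v (insert l \<sigma>)"
  shows "(exponent_of (\<lambda>j. if j \<in> \<sigma> then 0 else nat_val v j), \<sigma>) \<in> std_pairs_at A w v"
proof -
  let ?a = "exponent_of (\<lambda>j. if j \<in> \<sigma> then 0 else nat_val v j)"
  have off_\<sigma>: "j \<in> nat_part v \<and> lookup ?a j = nat_val v j" if "j \<notin> \<sigma>" for j using G_free_\<sigma>(1) that by auto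
  have "\<not> (\<exists>b. keys b \<subseteq> \<sigma> \<and> pmon (?a + b) \<in> initial_ideal)"
    using G_free_\<sigma>(2) ex_multiple_in_initial_ideal_iff[of \<sigma> v ?a] off_\<sigma> by blast
  moreover have "\<exists>b. keys b \<subseteq> insert l \<sigma> \<and> pmon (?a + b) \<in> initial_ideal" if "l \<notin> \<sigma>" for l
    using maximal[OF that] ex_multiple_in_initial_ideal_iff[of "insert l \<sigma>" v ?a] off_\<sigma> by auto
  ultimately have "(?a, \<sigma>) \<in> standard_pairs initial_ideal" by (auto simp: standard_pairs_def)
  then show ?thesis using off_\<sigma> of_nat_nat_val by (auto simp: std_pairs_at_def)
qed

lemma link_complex_iff_G_free:
  assumes \<tau>_disjoint: "\<tau> \<inter> nsupp v = {}"
  shows "\<tau> \<in> link_complex A w v \<longleftrightarrow> G_free v \<tau>"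
proof
  assume "\<tau> \<in> link_complex A w v"
  then obtain a \<sigma> where "(a, \<sigma>) \<in> std_pairs_at A w v" "\<tau> \<subseteq> \<sigma>" unfolding link_complex_iff by blast
  then show "G_free v \<tau>" using std_pairs_at_G_free unfolding G_free_def by blast
next
  assume "G_free v \<tau>"
  define S where "S = {\<sigma>. \<tau> \<union> - nat_part v \<subseteq> \<sigma> \<and> G_free v \<sigma>}"
  have "\<tau> \<union> - nat_part v \<in> S"
    using \<open>G_free v \<tau>\<close> G_set_eq unfolding S_def G_free_def by fastforce
  then obtain \<sigma> where maximal_\<sigma>: "\<sigma> \<in> S" "\<And>\<sigma>'. \<sigma>' \<in> S \<Longrightarrow> \<sigma> \<subseteq> \<sigma>' \<Longrightarrow> \<sigma>' = \<sigma>"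
    using finite_has_maximal2[of S "\<tau> \<union> - nat_part v"] by (metis finite)
  have "\<not> G_free v (insert l \<sigma>)" if "l \<notin> \<sigma>" for l
    using maximal_\<sigma>(1) maximal_\<sigma>(2)[of "insert l \<sigma>"] that unfolding S_def by blast
  then obtain a where "(a, \<sigma>) \<in> std_pairs_at A w v"
    using maximal_G_free_std_pairs_at[of v \<sigma>] maximal_\<sigma>(1) unfolding S_def by blast
  moreover have "\<tau> \<union> nsupp v \<subseteq> \<sigma>" using maximal_\<sigma>(1) nat_part_nsupp[of _ v] unfolding S_def by blast
  ultimately show "\<tau> \<in> link_complex A w v" unfolding link_complex_iff using \<tau>_disjoint by blast
qed

lemma same_nsupp_C_monoid:
  assumes std_pair: "(a, \<sigma>) \<in> std_pairs_at A w v" and same_nsupp: "u \<in> int_kernel A" "nsupp_shift v u = nsupp v"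
  shows "u \<in> C_monoid m g"
proof -
  define b where "b = exponent_of (\<lambda>j. if j \<in> \<sigma> then nat \<bar>u $ j\<bar> else 0)"
  define e where "e = exponent_of (\<lambda>j. nat (int (lookup (a + b) j) + u $ j))"
  have nonneg: "int (lookup (a + b) j) + u $ j \<ge> 0" for j
  proof (cases "j \<in> \<sigma>")
    case True
    then show ?thesis by (simp add: lookup_add b_def)
  next
    case False
    have a_eq_nat_val: "j \<in> nat_part v" "nat_val v j = lookup a j"
      using std_pairs_at_nat_val[OF std_pair False] by auto
    then have "j \<notin> nsupp (v + cvec u)" using nat_part_nsupp same_nsupp(2) unfolding nsupp_shift_def by blast
    moreover have "(v + cvec u) $ j = of_int (int (lookup a j) + u $ j)"
      using of_nat_nat_val[OF a_eq_nat_val(1)] a_eq_nat_val(2) by (simp add: cvec_def)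
    ultimately have "\<not> int (lookup a j) + u $ j < 0" unfolding nsupp_def by blast
    then show ?thesis using False by (simp add: lookup_add b_def)
  qed
  have exponent_diff: "exp_vec e - exp_vec (a + b) = u"
    using nonneg by (simp add: vec_eq_iff e_def)
  then have "A *v exp_vec e = A *v exp_vec (a + b)" using same_nsupp(1) exp_vec_diff_kernel by metis
  moreover have "keys b \<subseteq> \<sigma>" by (auto simp: b_def in_keys_iff split: if_splits)
  then have "pmon (a + b) \<notin> initial_ideal" using std_pair by (auto simp: std_pairs_at_def standard_pairs_def)
  ultimately show ?thesis using reduction_to_standard exponent_diff by metis
qed

end

section \<open>Linear forms and row reduction\<close>

definition linear_coeff :: "'v cpoly \<Rightarrow> 'v \<Rightarrow> complex" where
  "linear_coeff p j = lookup p (single j 1)"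

lemma single_one_inj: "single i (1::nat) = single j 1 \<longleftrightarrow> i = j"
proof
  assume "single i (1::nat) = single j 1"
  then have "keys (single i (1::nat)) = keys (single j (1::nat))" by (simp only:)
  then show "i = j" by simp
qed simp

lemma linear_coeff_pvar [simp]: "linear_coeff (pvar i) j = (if i = j then 1 else 0)"
  unfolding linear_coeff_def pvar_def pmon_def lookup_single single_one_inj by (simp add: when_def)

lemma linear_coeff_0 [simp]: "linear_coeff 0 j = 0"
  and linear_coeff_add: "linear_coeff (p + q) j = linear_coeff p j + linear_coeff q j"
  and linear_coeff_diff: "linear_coeff (p - q) j = linear_coeff p j - linear_coeff q j"
  and linear_coeff_cscale: "linear_coeff (cscale c p) j = c * linear_coeff p j"
  by (simp_all add: linear_coeff_def lookup_add lookup_minus)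

lemma linear_coeff_sum: "linear_coeff (sum f X) j = (\<Sum>x\<in>X. linear_coeff (f x) j)"
  by (induction X rule: infinite_finite_induct) (auto simp: linear_coeff_add)

lemma mdeg_1_single:
  assumes "mdeg a = 1"
  obtains j where "a = single j 1"
proof -
  have "a \<noteq> 0" using assms by auto
  then obtain j where j_key: "j \<in> keys a" by (metis keys_eq_empty equals0I)
  define b where "b = a - single j 1"
  have a_eq: "a = single j 1 + b"
    using exponent_minus_single_add[of a j] j_key by (simp add: b_def in_keys_iff add.commute)
  then have "mdeg a = 1 + mdeg b" using mdeg_add[of "single j 1" b] by simp
  then have "b = 0" using assms mdeg_eq_0_iff[of b] by simp
  then show ?thesis using that a_eq by simp
qed

definition linear_form :: "('n::finite \<Rightarrow> complex) \<Rightarrow> 'n cpoly" where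
  "linear_form c = (\<Sum>i\<in>UNIV. cscale (c i) (pvar i))"
lemma homog_linear_form: "homog 1 (linear_form c)"
  unfolding linear_form_def by (intro homog_sum homog_cscale homog_pvar)

lemma linear_coeff_linear_form [simp]: "linear_coeff (linear_form c) j = c j"
  by (simp add: linear_form_def linear_coeff_sum linear_coeff_cscale if_distrib sum.delta cong: if_cong)

lemma linear_form_eqI:
  assumes "homog 1 p" "homog 1 q" "\<And>j. linear_coeff p j = linear_coeff q j"
  shows "p = q"
proof (rule poly_mapping_eqI)
  fix a
  show "lookup p a = lookup q a"
  proof (cases "mdeg a = 1")
    case True
    then obtain j where "a = single j 1" by (rule mdeg_1_single)
    then show ?thesis using assms(3)[of j] by (simp add: linear_coeff_def)
  next
    case False
    then have "a \<notin> keys p" "a \<notin> keys q" using assms(1,2) unfolding homog_def by blast+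
    then show ?thesis by (simp add: in_keys_iff)
  qed
qed

lemma linear_form_expand: "homog 1 p \<Longrightarrow> p = linear_form (linear_coeff p)"
  by (rule linear_form_eqI[OF _ homog_linear_form]) simp_all

lemma linear_form_Polys:
  fixes p :: "'n::finite cpoly"
  assumes "homog 1 p" "\<And>j. j \<notin> V \<Longrightarrow> linear_coeff p j = 0"
  shows "p \<in> Polys V"
proof -
  have "cscale (linear_coeff p j) (pvar j) \<in> Polys V" for j
    using assms(2)[of j] by (cases "j \<in> V") (auto simp: cscale_def intro!: Polys_mult)
  then have "linear_form (linear_coeff p) \<in> Polys V" unfolding linear_form_def by (intro Polys_sum)
  then show ?thesis using linear_form_expand[OF assms(1)] by simp
qed

lemma row_form_linear_form: "row_form A i = linear_form (\<lambda>j. of_int (A $ i $ j))"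
  by (simp add: row_form_def linear_form_def cscale_def)

lemma Idl_degree_1:
  assumes S_homog: "S \<subseteq> Polys V" "\<And>s. s \<in> S \<Longrightarrow> homog 1 s" and p_in: "p \<in> Idl\<^bsub>poly_ring V\<^esub> S" "homog 1 p"
  shows "p \<in> cpoly.span S"
proof -
  have "homog_component 1 p \<in> cpoly.span S"
    using p_in(1) S_homog(1)
  proof (induction rule: Idl_induct)
    case (mult c s)
    have "homog_component 0 c = pconst (lookup c 0)"
      by (rule poly_mapping_eqI) (auto simp: lookup_homog_component pconst_def lookup_single when_def
        mdeg_eq_0_iff)
    then have "homog_component 1 (c * s) = cscale (lookup c 0) s"
      using homog_component_mult_homog[OF S_homog(2)[OF mult(2)], of 1 c] by (simp add: cscale_def)
    then show ?case using mult by (simp add: cpoly.span_scale cpoly.span_base)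
  qed (auto simp: homog_component_add cpoly.span_zero cpoly.span_add)
  then show ?thesis using homog_component_homog[OF p_in(2), of 1] by simp
qed

lemma row_form_homog: "homog 1 (row_form A k)"
  unfolding row_form_linear_form by (rule homog_linear_form)

lemma linear_coeff_row_form: "linear_coeff (row_form A k) j = of_int (A $ k $ j)"
  by (simp add: row_form_linear_form)

definition row_comb :: "int ^ 'n::finite ^ 'd::finite \<Rightarrow> ('d \<Rightarrow> complex) \<Rightarrow> 'n cpoly" where
  "row_comb A r = (\<Sum>k\<in>UNIV. cscale (r k) (row_form A k))"

lemma row_comb_span: "row_comb A r \<in> cpoly.span (range (row_form A))"
  unfolding row_comb_def by (intro cpoly.span_sum cpoly.span_scale cpoly.span_base) auto

lemma row_comb_homog: "homog 1 (row_comb A r)"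
  unfolding row_comb_def by (intro homog_sum homog_cscale row_form_homog)

lemma linear_coeff_row_comb: "linear_coeff (row_comb A r) j = (\<Sum>k\<in>UNIV. r k * of_int (A $ k $ j))"
  unfolding row_comb_def by (simp add: linear_coeff_sum linear_coeff_cscale linear_coeff_row_form)

lemma pivot_row_comb:
  assumes "independent_columns A \<sigma>" "i \<in> \<sigma>"
  obtains r where "\<And>j. j \<in> \<sigma> \<Longrightarrow> linear_coeff (row_comb A r) j = (if j = i then 1 else 0)"
  using row_combination[OF assms] unfolding linear_coeff_row_comb by blast

lemma row_forms_sub_Polys: "range (row_form A) \<subseteq> Polys UNIV" by auto

lemma row_span_homog: "p \<in> cpoly.span (range (row_form A)) \<Longrightarrow> homog 1 p"
proof -
  assume "p \<in> cpoly.span (range (row_form A))"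
  moreover have "range (row_form A) \<subseteq> {p. homog 1 p}" by (intro image_subsetI CollectI row_form_homog)
  moreover have "cpoly.subspace {p :: 'a cpoly. homog 1 p}"
    by (auto simp: cpoly.subspace_def homog_add homog_cscale)
  ultimately show "homog 1 p" using cpoly.span_minimal by blast
qed

lemma linear_coeff_sum_pvar: "finite I \<Longrightarrow>
  linear_coeff (\<Sum>p\<in>I. cscale (c p) (pvar p)) j = (if j \<in> I then c j else 0)"
  by (simp add: linear_coeff_sum linear_coeff_cscale if_distrib sum.delta cong: if_cong)

lemma inj_pvar: "inj pvar"
  by (rule injI) (metis linear_coeff_pvar zero_neq_one)

lemma independent_pvar: "finite I \<Longrightarrow> cpoly.independent (pvar ` I)"
proof (rule cpoly.independent_if_scalars_zero)
  fix c x assume "finite I" and relation_c: "(\<Sum>x\<in>pvar ` I. cscale (c x) x) = 0" and "x \<in> pvar ` I"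
  then obtain j where x_eq: "j \<in> I" "x = pvar j" by blast
  have "(\<Sum>i\<in>I. cscale (c (pvar i)) (pvar i)) = 0"
    using relation_c by (simp add: sum.reindex[OF inj_on_subset[OF inj_pvar]])
  then show "c x = 0" using linear_coeff_sum_pvar[OF \<open>finite I\<close>, of "\<lambda>i. c (pvar i)" j] x_eq by simp
qed simp

text \<open>The forms \<open>\<rho> p\<close> are the rows of a reduced echelon form with pivot columns \<open>I\<close>.\<close>

locale pivot_forms =
  fixes U :: "'n::finite cpoly set" and I :: "'n set" and \<rho> :: "'n \<Rightarrow> 'n cpoly"
  assumes subspace_U: "cpoly.subspace U" and \<rho>_in_U: "\<And>p. p \<in> I \<Longrightarrow> \<rho> p \<in> U"
    and pivot: "\<And>p j. p \<in> I \<Longrightarrow> j \<in> I \<Longrightarrow> linear_coeff (\<rho> p) j = (if j = p then 1 else 0)"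
begin

definition reduced :: "'n cpoly set" where
  "reduced = {x \<in> U. \<forall>p\<in>I. linear_coeff x p = 0}"

lemma subspace_reduced: "cpoly.subspace reduced"
  using subspace_U by (auto simp: reduced_def cpoly.subspace_def linear_coeff_add linear_coeff_cscale)

lemma reduction_in_reduced:
  assumes "x \<in> U"
  shows "x - (\<Sum>p\<in>I. cscale (linear_coeff x p) (\<rho> p)) \<in> reduced"
proof -
  have "linear_coeff (\<Sum>p\<in>I. cscale (linear_coeff x p) (\<rho> p)) j = linear_coeff x j" if "j \<in> I" for j
  proof -
    have "linear_coeff (\<Sum>p\<in>I. cscale (linear_coeff x p) (\<rho> p)) j =
      (\<Sum>p\<in>I. if p = j then linear_coeff x p else 0)"
      unfolding linear_coeff_sum linear_coeff_cscale using pivot[OF _ that] by (intro sum.cong refl) simp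
    then show ?thesis using that by simp
  qed
  moreover have "(\<Sum>p\<in>I. cscale (linear_coeff x p) (\<rho> p)) \<in> U"
    using subspace_U \<rho>_in_U by (intro cpoly.subspace_sum cpoly.subspace_scale)
  ultimately show ?thesis
    using assms cpoly.subspace_diff[OF subspace_U] by (simp add: reduced_def linear_coeff_diff)
qed

lemma dim_reduced:
  assumes "finite E" "U \<subseteq> cpoly.span E"
  shows "cpoly.dim reduced + card I \<le> cpoly.dim U"
proof -
  define f where "f x = (\<Sum>p\<in>I. cscale (linear_coeff x p) (pvar p))" for x :: "'n cpoly"
  have "Vector_Spaces.linear cscale cscale f"
    by (rule linear_cscaleI) (auto simp: f_def linear_coeff_add linear_coeff_cscale cpoly.scale_left_distrib
      sum.distrib cpoly.scale_sum_right)
  then have "cpoly.dim (f ` U) + cpoly.dim {u \<in> U. f u = 0} = cpoly.dim U"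
    by (rule cpoly_pair.rank_nullity[OF _ subspace_U assms])
  moreover have "f u = 0 \<longleftrightarrow> (\<forall>p\<in>I. linear_coeff u p = 0)" for u
  proof
    assume "f u = 0"
    moreover have "linear_coeff (f u) p = linear_coeff u p" if "p \<in> I" for p
      using that by (simp add: f_def linear_coeff_sum_pvar)
    ultimately show "\<forall>p\<in>I. linear_coeff u p = 0" by simp
  qed (simp add: f_def)
  then have "{u \<in> U. f u = 0} = reduced" by (simp add: reduced_def)
  moreover have "cpoly.dim (f ` U) = card I"
  proof (rule cpoly.dim_unique[OF _ _ independent_pvar])
    have "f (\<rho> p) = (\<Sum>j\<in>I. if j = p then pvar j else 0)" if "p \<in> I" for p
      unfolding f_def using pivot[OF that] by (intro sum.cong refl) (auto simp: cpoly.scale_one)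
    then have "f (\<rho> p) = pvar p" if "p \<in> I" for p using that by simp
    then show "pvar ` I \<subseteq> f ` U" using \<rho>_in_U by force
    show "f ` U \<subseteq> cpoly.span (pvar ` I)"
      by (auto simp: f_def intro!: cpoly.span_sum cpoly.span_scale intro: cpoly.span_base)
    show "card (pvar ` I) = card I" by (rule card_image[OF inj_on_subset[OF inj_pvar subset_UNIV]])
  qed simp
  ultimately show ?thesis by simp
qed

end

lemma (in vector_space) spanning_sequence:
  assumes subspace_N: "subspace N" "finite E" "N \<subseteq> span E" and "dim N \<le> k"
  obtains e :: "nat \<Rightarrow> 'b" where "\<And>q. e q \<in> N" "N \<subseteq> span (e ` {..<k})"
proof -
  obtain B where basis_B: "B \<subseteq> N" "independent B" "N \<subseteq> span B" "card B = dim N" by (rule basis_exists)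
  have "finite B" using independent_span_bound[OF subspace_N(2) basis_B(2)] basis_B(1) subspace_N(3) by blast
  then obtain h where "bij_betw h {0..<card B} B" using ex_bij_betw_nat_finite by blast
  then have B_enum: "B = h ` {0..<card B}" by (auto simp: bij_betw_def)
  define e where "e q = (if q < card B then h q else 0)" for q
  have "h q \<in> N" if "q < card B" for q using that basis_B(1) by (subst (asm) B_enum) auto
  then have "e q \<in> N" for q using subspace_0[OF subspace_N(1)] by (simp add: e_def)
  moreover have "B \<subseteq> e ` {..<k}"
    using basis_B(4) \<open>dim N \<le> k\<close> by (subst B_enum) (force simp: e_def)
  then have "N \<subseteq> span (e ` {..<k})" using basis_B(3) span_mono by blast
  ultimately show ?thesis using that by blast
qed

lemma pivot_forms_row_span:
  assumes "independent_columns A I"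
  obtains r where "pivot_forms (cpoly.span (range (row_form A))) I (\<lambda>p. row_comb A (r p))"
proof -
  have "\<exists>r. \<forall>j\<in>I. linear_coeff (row_comb A r) j = (if j = p then 1 else 0)" if p_in: "p \<in> I" for p
    using pivot_row_comb[OF assms p_in] by metis
  then obtain r where "\<And>p j. p \<in> I \<Longrightarrow> j \<in> I \<Longrightarrow> linear_coeff (row_comb A (r p)) j = (if j = p then 1 else 0)"
    by metis
  then have "pivot_forms (cpoly.span (range (row_form A))) I (\<lambda>p. row_comb A (r p))"
    by unfold_locales (simp_all add: row_comb_span)
  then show ?thesis by (rule that)
qed

lemma Idl_eq_if_span_eq:
  assumes "S \<subseteq> Polys V" "S' \<subseteq> Polys V" "S \<subseteq> cpoly.span S'" "S' \<subseteq> cpoly.span S"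
  shows "Idl\<^bsub>poly_ring V\<^esub> S = Idl\<^bsub>poly_ring V\<^esub> S'"
proof -
  have "cpoly.span T \<subseteq> Idl\<^bsub>poly_ring V\<^esub> T" if "T \<subseteq> Polys V" for T
    using Idl_gen[OF that] by (intro ideal_span[OF Idl_ideal[OF that]]) auto
  then show ?thesis using assms by (intro antisym Idl_least Idl_ideal) blast+
qed

lemma row_reduction_exists:
  fixes A :: "int ^ 'n::finite ^ 'd::finite"
  assumes "independent_columns A (nsupp v)"
  shows "\<exists>L ell. row_reduction A v L ell"
proof -
  let ?I = "nsupp v" and ?U = "cpoly.span (range (row_form A))" and ?k = "CARD('d) - card (nsupp v)"
  obtain r where "pivot_forms ?U ?I (\<lambda>p. row_comb A (r p))"
    using pivot_forms_row_span[OF assms] by blast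
  then interpret pivot_forms ?U ?I "\<lambda>p. row_comb A (r p)" .
  have "cpoly.dim ?U \<le> CARD('d)"
    using cpoly.dim_le_card[of ?U "range (row_form A)"] card_image_le[of "UNIV :: 'd set" "row_form A"] by simp
  then have "cpoly.dim reduced \<le> ?k" using dim_reduced[of "range (row_form A)"] by simp
  moreover have "reduced \<subseteq> ?U" by (auto simp: reduced_def)
  ultimately obtain ell :: "nat \<Rightarrow> 'n cpoly" where ell_spans: "\<And>q. ell q \<in> reduced"
    "reduced \<subseteq> cpoly.span (ell ` {..<?k})"
    using cpoly.spanning_sequence[OF subspace_reduced, of "range (row_form A)" ?k] by auto
  define L where "L p = pvar p - row_comb A (r p)" for p
  have L_homog: "homog 1 (L p)" for p unfolding L_def by (intro homog_diff homog_pvar row_comb_homog)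
  have "L p \<in> Polys (- ?I)" if "p \<in> ?I" for p
    using pivot[OF that] by (intro linear_form_Polys[OF L_homog]) (auto simp: L_def linear_coeff_diff)
  then have "\<forall>p\<in>?I. L p \<in> graded_part (Polys (- ?I)) 1" using L_homog by (simp add: graded_part_def)
  moreover have "homog 1 (ell q)" for q using row_span_homog ell_spans(1) unfolding reduced_def by blast
  then have "\<forall>q<?k. ell q \<in> graded_part (Polys (- ?I)) 1"
    using ell_spans(1) linear_form_Polys[of _ "- ?I"] by (auto simp: graded_part_def reduced_def)
  moreover have "Idl\<^bsub>poly_ring UNIV\<^esub> ((\<lambda>p. pvar p - L p) ` ?I \<union> ell ` {..<?k}) =
    Idl\<^bsub>poly_ring UNIV\<^esub> (range (row_form A))" (is "Idl\<^bsub>_\<^esub> ?G = _")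
  proof (rule Idl_eq_if_span_eq)
    show "?G \<subseteq> ?U" using ell_spans(1) by (auto simp: L_def row_comb_span reduced_def)
    show "range (row_form A) \<subseteq> cpoly.span ?G"
    proof clarify
      fix k
      let ?R = "\<Sum>p\<in>?I. cscale (linear_coeff (row_form A k) p) (row_comb A (r p))"
      have "row_form A k \<in> ?U" by (rule cpoly.span_base[OF rangeI])
      then have "row_form A k - ?R \<in> cpoly.span (ell ` {..<?k})"
        using reduction_in_reduced ell_spans(2) by blast
      then have "row_form A k - ?R \<in> cpoly.span ?G" using cpoly.span_mono[OF Un_upper2] by blast
      moreover have "?R \<in> cpoly.span ?G"
        by (intro cpoly.span_sum cpoly.span_scale cpoly.span_base) (auto simp: L_def)
      ultimately have "(row_form A k - ?R) + ?R \<in> cpoly.span ?G" by (rule cpoly.span_add)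
      then show "row_form A k \<in> cpoly.span ?G" by simp
    qed
  qed auto
  ultimately show ?thesis unfolding row_reduction_def by blast
qed

section \<open>Elimination of variables\<close>

definition eliminate :: "'v set \<Rightarrow> ('v \<Rightarrow> 'v cpoly) \<Rightarrow> 'v cpoly \<Rightarrow> 'v cpoly" where
  "eliminate I L = psubst (\<lambda>j. if j \<in> I then L j else pvar j)"

lemma eliminate_id: "p \<in> Polys (- I) \<Longrightarrow> eliminate I L p = p"
  unfolding eliminate_def by (rule psubst_id_on) auto

lemma linear_eliminate: "Vector_Spaces.linear cscale cscale (eliminate I L)"
  by (rule linear_cscaleI) (simp_all add: eliminate_def psubst_add psubst_cscale)

lemma ideal_diff_eliminate:
  assumes ideal_J: "ideal J (poly_ring UNIV)" and L_relation: "\<And>j. j \<in> I \<Longrightarrow> pvar j - L j \<in> J"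
  shows "p - eliminate I L p \<in> J"
proof -
  let ?\<psi> = "eliminate I L"
  have mult: "x * y - ?\<psi> (x * y) \<in> J" if "x - ?\<psi> x \<in> J" "y - ?\<psi> y \<in> J" for x y
  proof -
    have "x * y - ?\<psi> (x * y) = y * (x - ?\<psi> x) + ?\<psi> x * (y - ?\<psi> y)"
      by (simp add: eliminate_def psubst_mult algebra_simps)
    then show ?thesis using that by (simp only:) (intro ideal_add[OF ideal_J] ideal_mult[OF ideal_J] Polys_UNIV)
  qed
  have const: "pconst c - ?\<psi> (pconst c) \<in> J" for c using ideal_0[OF ideal_J] by (simp add: eliminate_def)
  have variable: "pvar j - ?\<psi> (pvar j) \<in> J" for j
    using L_relation ideal_0[OF ideal_J] by (simp add: eliminate_def)
  have power: "x ^ k - ?\<psi> (x ^ k) \<in> J" if "x - ?\<psi> x \<in> J" for x k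
    by (induction k) (use const[of 1] that mult in auto)
  have prod: "prod f X - ?\<psi> (prod f X) \<in> J" if "\<And>x. f x - ?\<psi> (f x) \<in> J" for f :: "'a \<Rightarrow> 'a cpoly" and X
    by (induction X rule: infinite_finite_induct) (use const[of 1] that mult in auto)
  show ?thesis
  proof (induction p rule: cpoly_induct)
    case (single a c)
    have "single a c = pconst c * (\<Prod>j\<in>keys a. pvar j ^ lookup a j)"
      by (simp only: prod_pvar_power single_eq_pconst_pmon)
    then show ?case using mult[OF const prod[OF power[OF variable]]] by simp
  next
    case (add p q)
    have "(p + q) - ?\<psi> (p + q) = (p - ?\<psi> p) + (q - ?\<psi> q)" by (simp add: eliminate_def psubst_add)
    then show ?case using add ideal_add[OF ideal_J] by metis
  qed (simp add: ideal_0[OF ideal_J] eliminate_def)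
qed

context
  fixes I :: "'n::finite set" and L :: "'n \<Rightarrow> 'n cpoly"
  assumes L_linear: "\<And>p. p \<in> I \<Longrightarrow> L p \<in> graded_part (Polys (- I)) 1"
begin

lemma eliminate_Polys: "eliminate I L p \<in> Polys (- I)"
  unfolding eliminate_def using L_linear by (intro psubst_in_Polys) (simp add: graded_part_def)

lemma homog_eliminate: "homog q p \<Longrightarrow> homog q (eliminate I L p)"
  unfolding eliminate_def using L_linear homog_pvar by (intro homog_psubst) (auto simp: graded_part_def)

lemma eliminate_generator: "p \<in> I \<Longrightarrow> eliminate I L (pvar p - L p) = 0"
  using L_linear[of p] eliminate_id[of "L p" I L] by (simp add: graded_part_def eliminate_def psubst_diff)

lemma eliminate_image_graded_part:
  assumes "\<And>p. p \<in> Q \<Longrightarrow> eliminate I L p \<in> J" "J \<subseteq> Q" "J \<subseteq> Polys (- I)"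
  shows "eliminate I L ` graded_part Q q = graded_part J q"
proof (intro equalityI subsetI)
  fix x assume x_in: "x \<in> graded_part J q"
  then have "x = eliminate I L x" using assms(3) by (auto simp: graded_part_def eliminate_id)
  then show "x \<in> eliminate I L ` graded_part Q q" using x_in assms(2) by (auto simp: graded_part_def)
qed (use assms(1) homog_eliminate in \<open>auto simp: graded_part_def\<close>)

lemma hilbert_series_eliminate:
  assumes ideal_Q: "ideal Q (poly_ring UNIV)" "\<And>p. p \<in> I \<Longrightarrow> pvar p - L p \<in> Q"
    and image_in_J: "J \<subseteq> Polys (- I)" "J \<subseteq> Q" "\<And>p. p \<in> Q \<Longrightarrow> eliminate I L p \<in> J"
  shows "hilbert_series UNIV Q = hilbert_series (- I) J"
proof -
  have "int (cpoly.dim (graded_part (Polys (UNIV :: 'n set)) q)) - int (cpoly.dim (graded_part Q q)) =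
     int (cpoly.dim (graded_part (Polys (- I)) q)) - int (cpoly.dim (graded_part J q))" for q
  proof -
    let ?T = "graded_part (Polys (UNIV :: 'n set)) q" and ?Q = "graded_part Q q" and ?\<psi> = "eliminate I L"
    obtain E where E_spans: "finite E" "?T \<subseteq> cpoly.span E" using graded_part_finite_span by blast
    have "?Q \<subseteq> cpoly.span E" using E_spans(2) by (auto simp: graded_part_def)
    then have "cpoly.dim (?\<psi> ` ?Q) + cpoly.dim {u \<in> ?Q. ?\<psi> u = 0} = cpoly.dim ?Q"
      by (rule cpoly_pair.rank_nullity[OF linear_eliminate
        graded_part_subspace[OF ideal_subspace[OF ideal_Q(1)]] E_spans(1)])
    moreover have "cpoly.dim (?\<psi> ` ?T) + cpoly.dim {u \<in> ?T. ?\<psi> u = 0} = cpoly.dim ?T"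
      by (rule cpoly_pair.rank_nullity[OF linear_eliminate graded_part_subspace[OF Polys_subspace] E_spans])
    moreover have "u \<in> Q" if "?\<psi> u = 0" for u
      using ideal_diff_eliminate[OF ideal_Q(1), of I L u] ideal_Q(2) that by simp
    then have "{u \<in> ?Q. ?\<psi> u = 0} = {u \<in> ?T. ?\<psi> u = 0}" by (auto simp: graded_part_def)
    moreover have "?\<psi> ` ?Q = graded_part J q"
      by (rule eliminate_image_graded_part[OF image_in_J(3,2,1)])
    moreover have "?\<psi> ` ?T = graded_part (Polys (- I)) q"
      by (rule eliminate_image_graded_part) (auto simp: eliminate_Polys)
    ultimately show ?thesis by simp
  qed
  then show ?thesis by (simp add: hilbert_series_def)
qed

end

lemma row_reductionD:
  fixes A :: "int ^ 'n::finite ^ 'd::finite"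
  assumes "row_reduction A v L ell"
  shows "\<And>p. p \<in> nsupp v \<Longrightarrow> L p \<in> graded_part (Polys (- nsupp v)) 1"
    and "\<And>q. q < CARD('d) - card (nsupp v) \<Longrightarrow> ell q \<in> Polys (- nsupp v) \<and> homog 1 (ell q)"
    and "Idl\<^bsub>poly_ring UNIV\<^esub> ((\<lambda>p. pvar p - L p) ` nsupp v \<union> ell ` {..<CARD('d) - card (nsupp v)}) =
      Idl\<^bsub>poly_ring UNIV\<^esub> (range (row_form A))"
  using assms by (simp_all add: row_reduction_def graded_part_def)

text \<open>Eliminating the variables of \<open>nsupp v\<close> kills the generators \<open>\<theta>\<^sub>p - L p\<close> and fixes everything else.\<close>

lemma row_reduction_span:
  fixes A :: "int ^ 'n::finite ^ 'd::finite"
  assumes row_red: "row_reduction A v L ell"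
    and p_in_row_span: "p \<in> cpoly.span (range (row_form A))" "p \<in> Polys (- nsupp v)"
  shows "p \<in> cpoly.span (ell ` {..<CARD('d) - card (nsupp v)})"
proof -
  let ?X = "(\<lambda>p. pvar p - L p) ` nsupp v" and ?Y = "ell ` {..<CARD('d) - card (nsupp v)}"
  let ?\<psi> = "eliminate (nsupp v) L"
  note L_linear = row_reductionD(1)[OF row_red] and ell_linear = row_reductionD(2)[OF row_red]
  have "p \<in> Idl\<^bsub>poly_ring UNIV\<^esub> (?X \<union> ?Y)"
    unfolding row_reductionD(3)[OF row_red]
    using ideal_span[OF Idl_ideal[OF row_forms_sub_Polys], of "range (row_form A)" A]
      Idl_gen[OF row_forms_sub_Polys] p_in_row_span(1) by blast
  moreover have "homog 1 s" if "s \<in> ?X \<union> ?Y" for s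
    using that L_linear ell_linear
    by (auto simp: graded_part_def intro!: homog_diff homog_pvar[unfolded One_nat_def])
  ultimately have "p \<in> cpoly.span (?X \<union> ?Y)"
    using row_span_homog[OF p_in_row_span(1)] by (intro Idl_degree_1[of _ UNIV]) auto
  then have "?\<psi> p \<in> cpoly.span (?\<psi> ` (?X \<union> ?Y))"
    using cpoly_pair.linear_span_image[OF linear_eliminate, of "nsupp v" L "?X \<union> ?Y"] by blast
  moreover have "?\<psi> ` (?X \<union> ?Y) \<subseteq> insert 0 ?Y"
    using ell_linear eliminate_generator[of "nsupp v" L, OF L_linear] by (auto simp: eliminate_id)
  ultimately have "?\<psi> p \<in> cpoly.span (insert 0 ?Y)" using cpoly.span_mono by blast
  then show ?thesis using p_in_row_span(2) by (simp add: eliminate_id cpoly.span_insert_0)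
qed

section \<open>The Hilbert series of the link modulo linear forms\<close>

lemma h_poly_eqI:
  assumes H_eq: "H = hilbert_series V (sr_ideal V \<Delta>) * (1 - fps_X) ^ Max (card ` \<Delta>)"
    and H_vanishes: "\<And>q. q > N \<Longrightarrow> fps_nth H q = 0"
  shows "fps_of_poly (h_poly V \<Delta>) = H"
proof -
  define p where "p = (\<Sum>q\<le>N. Polynomial.monom (fps_nth H q) q)"
  have "coeff p q = fps_nth H q" for q
    using H_vanishes[of q] by (auto simp: p_def coeff_sum not_le)
  then have p_eq_H: "fps_of_poly p = H" by (intro fps_ext) simp
  then have "h_poly V \<Delta> = p"
    unfolding h_poly_def H_eq[symmetric] by (intro the_equality) (auto simp: fps_of_poly_eq_iff)
  then show ?thesis using p_eq_H by simp
qed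

definition link_ideal ::
    "int ^ 'n::finite ^ 'd::finite \<Rightarrow> real ^ 'n \<Rightarrow> complex ^ 'n \<Rightarrow> (nat \<Rightarrow> 'n cpoly) \<Rightarrow> 'n cpoly set" where
  "link_ideal A w v ell = Idl\<^bsub>poly_ring (- nsupp v)\<^esub>
     (sr_ideal (- nsupp v) (link_complex A w v) \<union> ell ` {..<CARD('d) - card (nsupp v)})"

lemma H_series_link_ideal: "H_series A w v ell = hilbert_series (- nsupp v) (link_ideal A w v ell)"
  by (simp add: H_series_def link_ideal_def)

context
  fixes A :: "int ^ 'n::finite ^ 'd::finite" and v L ell
  assumes row_red: "row_reduction A v L ell"
begin

lemma link_ideal_gens_sub:
  "sr_ideal (- nsupp v) (link_complex A w v) \<union> ell ` {..<CARD('d) - card (nsupp v)} \<subseteq> Polys (- nsupp v)"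
  using ideal_sub_Polys[OF sr_ideal_ideal] row_reductionD(2)[OF row_red] by auto

lemma link_ideal_ideal: "ideal (link_ideal A w v ell) (poly_ring (- nsupp v))"
  unfolding link_ideal_def by (rule Idl_ideal[OF link_ideal_gens_sub])

lemma sr_ideal_sub_link_ideal: "sr_ideal (- nsupp v) (link_complex A w v) \<subseteq> link_ideal A w v ell"
  unfolding link_ideal_def using Idl_gen[OF link_ideal_gens_sub] by blast

lemma row_span_sub_link_ideal:
  assumes "p \<in> cpoly.span (range (row_form A))" "p \<in> Polys (- nsupp v)"
  shows "p \<in> link_ideal A w v ell"
proof -
  have "ell ` {..<CARD('d) - card (nsupp v)} \<subseteq> link_ideal A w v ell"
    unfolding link_ideal_def using Idl_gen[OF link_ideal_gens_sub] by blast
  then show ?thesis using ideal_span[OF link_ideal_ideal] row_reduction_span[OF row_red assms] by blast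
qed

end

lemma exists_exponent_ge_2:
  fixes a :: "'n::finite \<Rightarrow>\<^sub>0 nat"
  assumes "mdeg a > CARD('n)"
  obtains j where "lookup a j \<ge> 2"
proof (rule ccontr)
  assume "\<not> thesis"
  then have "lookup a j \<le> 1" for j using that[of j] by linarith
  then have "(\<Sum>j\<in>UNIV. lookup a j) \<le> (\<Sum>j\<in>(UNIV :: 'n set). 1)" by (intro sum_mono)
  then show False using assms mdeg_superset[of UNIV a] by simp
qed

context toric_groebner
begin

context
  fixes v L ell
  assumes row_red: "row_reduction A v L ell"
begin

lemma link_pivot_form:
  assumes F_in: "F \<in> link_complex A w v" and j_in: "j \<in> F"
  obtains c where "pvar j + (\<Sum>i\<in>- nsupp v - F. cscale (c i) (pvar i)) \<in> link_ideal A w v ell"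
proof -
  obtain r where pivot_r: "\<And>i. i \<in> F \<union> nsupp v \<Longrightarrow> linear_coeff (row_comb A r) i = (if i = j then 1 else 0)"
    by (rule pivot_row_comb[OF link_complex_independent_columns[OF F_in] UnI1[OF j_in]]) blast
  let ?\<rho> = "row_comb A r"
  have j_notin_nsupp: "j \<in> - nsupp v" using link_complex_sub[OF F_in] j_in by blast
  have "?\<rho> \<in> Polys (- nsupp v)"
    using pivot_r j_notin_nsupp by (intro linear_form_Polys[OF row_comb_homog]) auto
  then have "?\<rho> \<in> link_ideal A w v ell" by (rule row_span_sub_link_ideal[OF row_red row_comb_span])
  moreover have "?\<rho> = pvar j + (\<Sum>i\<in>- nsupp v - F. cscale (linear_coeff ?\<rho> i) (pvar i))"
  proof -
    have "?\<rho> = (\<Sum>i\<in>UNIV. cscale (linear_coeff ?\<rho> i) (pvar i))"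
      unfolding linear_form_def[symmetric] by (rule linear_form_expand[OF row_comb_homog])
    also have "\<dots> = (\<Sum>i\<in>insert j (- nsupp v - F). cscale (linear_coeff ?\<rho> i) (pvar i))"
      using pivot_r by (intro sum.mono_neutral_right) auto
    also have "\<dots> =
      cscale (linear_coeff ?\<rho> j) (pvar j) + (\<Sum>i\<in>- nsupp v - F. cscale (linear_coeff ?\<rho> i) (pvar i))"
      using j_in by simp
    finally show ?thesis using pivot_r[of j] j_in by (simp add: cpoly.scale_one)
  qed
  ultimately show ?thesis using that by metis
qed

text \<open>A pivot form trades a multiple variable of a face for variables outside the face, so the support
  grows until it is no longer a face.\<close>

lemma large_monomial_in_link_ideal:
  assumes "keys a \<subseteq> - nsupp v" "mdeg a > CARD('n)"
  shows "pmon a \<in> link_ideal A w v ell"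
  using assms
proof (induction "card (- nsupp v - keys a)" arbitrary: a rule: less_induct)
  case less
  note ideal_link = link_ideal_ideal[OF row_red, of w]
  show ?case
  proof (cases "keys a \<in> link_complex A w v")
    case False
    then have "pmon a \<in> sr_ideal (- nsupp v) (link_complex A w v)"
      using less.prems by (simp add: sr_ideal_eq[OF simplicial_link_complex])
    then show ?thesis using sr_ideal_sub_link_ideal[OF row_red] by blast
  next
    case True
    obtain j where multiple_j: "lookup a j \<ge> 2" using exists_exponent_ge_2[OF less.prems(2)] .
    then have "j \<in> keys a" by (auto simp: in_keys_iff)
    then obtain c where form: "pvar j + (\<Sum>i\<in>- nsupp v - keys a. cscale (c i) (pvar i)) \<in> link_ideal A w v ell"
      using link_pivot_form[OF True] by blast
    define b where "b = a - single j 1"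
    have a_eq: "a = b + single j 1" using exponent_minus_single_add[of a j] multiple_j by (simp add: b_def)
    have keys_b: "keys b = keys a"
      using multiple_j by (auto simp: b_def in_keys_iff lookup_minus lookup_single when_def split: if_splits)
    let ?rest = "\<Sum>i\<in>- nsupp v - keys a. cscale (c i) (pmon (b + single i 1))"
    have "?rest \<in> link_ideal A w v ell"
    proof (rule ideal_sum[OF ideal_link], rule ideal_cscale[OF ideal_link])
      fix i assume i_in: "i \<in> - nsupp v - keys a"
      have keys_i: "keys (b + single i 1) = insert i (keys a)" by (simp add: keys_add_nat keys_b)
      show "pmon (b + single i 1) \<in> link_ideal A w v ell"
      proof (rule less.hyps)
        have "- nsupp v - keys (b + single i 1) \<subset> - nsupp v - keys a" unfolding keys_i using i_in by auto
        then show "card (- nsupp v - keys (b + single i 1)) < card (- nsupp v - keys a)"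
          by (rule psubset_card_mono[rotated]) simp
        show "keys (b + single i 1) \<subseteq> - nsupp v" unfolding keys_i using i_in less.prems by auto
        show "CARD('n) < mdeg (b + single i 1)" using less.prems(2) unfolding a_eq mdeg_add by simp
      qed
    qed
    moreover have "pmon b * (pvar j + (\<Sum>i\<in>- nsupp v - keys a. cscale (c i) (pvar i))) = pmon a + ?rest"
      by (subst a_eq) (simp add: distrib_left sum_distrib_left cscale_mult_right pmon_add pvar_def)
    then have "pmon a + ?rest \<in> link_ideal A w v ell"
      using ideal_mult[OF ideal_link _ form, of "pmon b"] keys_b less.prems(1) by simp
    ultimately have "(pmon a + ?rest) - ?rest \<in> link_ideal A w v ell" by (intro ideal_diff[OF ideal_link])
    then show ?thesis by simp
  qed
qed

lemma H_series_nth_eq_0: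
  assumes "q > CARD('n)"
  shows "fps_nth (H_series A w v ell) q = 0"
proof -
  have "pmon a \<in> link_ideal A w v ell" if "p \<in> graded_part (Polys (- nsupp v)) q" "a \<in> keys p" for p a
    using that assms
    by (intro large_monomial_in_link_ideal) (auto simp: graded_part_def homog_def carrier_poly_ring)
  then have "graded_part (Polys (- nsupp v)) q \<subseteq> graded_part (link_ideal A w v ell) q"
    using ideal_if_monomials[OF link_ideal_ideal[OF row_red]] by (auto simp: graded_part_def)
  then have "graded_part (Polys (- nsupp v)) q = graded_part (link_ideal A w v ell) q"
    using ideal_sub_Polys[OF link_ideal_ideal[OF row_red]] by (auto simp: graded_part_def)
  then show ?thesis by (simp add: H_series_link_ideal hilbert_series_def)
qed

end

lemma Max_card_link_complex:
  assumes std_pair: "(a, \<sigma>) \<in> std_pairs_at A w v" "card \<sigma> = CARD('d)"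
  shows "\<sigma> - nsupp v \<in> link_complex A w v" "card (\<sigma> - nsupp v) = CARD('d) - card (nsupp v)"
    "Max (card ` link_complex A w v) = CARD('d) - card (nsupp v)"
proof -
  have nsupp_sub: "nsupp v \<subseteq> \<sigma>" by (rule nsupp_sub_std_pairs_at[OF std_pair(1)])
  show facet: "\<sigma> - nsupp v \<in> link_complex A w v" unfolding link_complex_iff using std_pair(1) nsupp_sub by blast
  show card_facet: "card (\<sigma> - nsupp v) = CARD('d) - card (nsupp v)"
    using std_pair(2) nsupp_sub by (simp add: card_Diff_subset)
  have "card \<tau> \<le> CARD('d) - card (nsupp v)" if "\<tau> \<in> link_complex A w v" for \<tau>
  proof -
    have "card \<tau> + card (nsupp v) = card (\<tau> \<union> nsupp v)"
      using link_complex_sub[OF that] by (intro card_Un_disjoint[symmetric]) auto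
    also have "\<dots> \<le> CARD('d)" by (rule card_independent_columns[OF link_complex_independent_columns[OF that]])
    finally show ?thesis by simp
  qed
  then show "Max (card ` link_complex A w v) = CARD('d) - card (nsupp v)"
    using facet card_facet by (intro Max_eqI) (auto intro: rev_image_eqI)
qed

lemma H_series_eq_h_poly:
  assumes std_pair: "(a, \<sigma>) \<in> std_pairs_at A w v" "card \<sigma> = CARD('d)"
    and cohen_mac: "cohen_macaulay (sr_ring (- nsupp v) (link_complex A w v))"
    and row_red: "row_reduction A v L ell"
  shows "H_series A w v ell = fps_of_poly (h_poly (- nsupp v) (link_complex A w v))"
proof -
  note facet = Max_card_link_complex[OF std_pair]
  have "H_series A w v ell = hilbert_series (- nsupp v) (sr_ideal (- nsupp v) (link_complex A w v)) *
      (1 - fps_X) ^ card (\<sigma> - nsupp v)"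
    unfolding H_series_link_ideal link_ideal_def facet(2)[symmetric]
  proof (rule hilbert_series_cohen_macaulay[OF simplicial_link_complex facet(1) link_complex_sub[OF facet(1)]
    cohen_mac])
    show "ell j \<in> Polys (- nsupp v) \<and> homog 1 (ell j)" if "j < card (\<sigma> - nsupp v)" for j
      using row_reductionD(2)[OF row_red] that unfolding facet(2) .
    show "pmon a \<in> Idl\<^bsub>poly_ring (- nsupp v)\<^esub>
        (sr_ideal (- nsupp v) (link_complex A w v) \<union> ell ` {..<card (\<sigma> - nsupp v)})"
      if "keys a \<subseteq> - nsupp v" "CARD('n) < mdeg a" for a
      using large_monomial_in_link_ideal[OF row_red that] unfolding link_ideal_def facet(2) .
  qed
  then have "fps_of_poly (h_poly (- nsupp v) (link_complex A w v)) = H_series A w v ell"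
    unfolding facet(2) facet(3)[symmetric] by (rule h_poly_eqI) (rule H_series_nth_eq_0[OF row_red])
  then show ?thesis by simp
qed

end

section \<open>The ideal \<open>Q\<close>\<close>

lemma Q_ideal_gens_sub: "range (row_form A) \<union> {\<Prod>j\<in>G_set v (g i). pvar j | i. i < m} \<subseteq> Polys UNIV"
  by auto

lemma Q_ideal_ideal: "ideal (Q_ideal A v m g) (poly_ring UNIV)"
  unfolding Q_ideal_def by (rule Idl_ideal[OF Q_ideal_gens_sub])

lemma Q_ideal_homog_closed: "homog_closed (Q_ideal A v m g)"
  unfolding Q_ideal_def
proof (rule homog_closed_Idl[OF Q_ideal_gens_sub])
  fix s assume "s \<in> range (row_form A) \<union> {\<Prod>j\<in>G_set v (g i). pvar j | i. i < m}"
  then show "\<exists>e. homog e s" using row_form_homog homog_prod_pvar by blast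
qed

lemma row_form_in_Q_ideal: "row_form A k \<in> Q_ideal A v m g"
  unfolding Q_ideal_def by (rule Idl_gen[OF Q_ideal_gens_sub]) auto

lemma G_prod_in_Q_ideal: "i < m \<Longrightarrow> (\<Prod>j\<in>G_set v (g i). pvar j) \<in> Q_ideal A v m g"
  unfolding Q_ideal_def by (rule Idl_gen[OF Q_ideal_gens_sub]) auto

lemma G_set_sub: "G_set v u \<subseteq> - nsupp v"
  by (auto simp: G_set_def)

context toric_groebner
begin

lemma sr_ideal_sub_Q_ideal: "sr_ideal (- nsupp v) (link_complex A w v) \<subseteq> Q_ideal A v m g"
proof
  fix s assume s_in: "s \<in> sr_ideal (- nsupp v) (link_complex A w v)"
  show "s \<in> Q_ideal A v m g"
  proof (rule ideal_if_monomials[OF Q_ideal_ideal])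
    fix a assume "a \<in> keys s"
    then have "keys a \<notin> link_complex A w v" "keys a \<subseteq> - nsupp v"
      using s_in by (auto simp: sr_ideal_eq[OF simplicial_link_complex] carrier_poly_ring)
    then obtain i where G_set_sub: "i < m" "G_set v (g i) \<subseteq> keys a"
      using link_complex_iff_G_free[of "keys a" v] unfolding G_free_def by blast
    then obtain b where "a = (\<Sum>j\<in>G_set v (g i). single j 1) + b"
      using indicator_dvd_iff[of "G_set v (g i)" a] by auto
    then have "pmon a = pmon b * (\<Prod>j\<in>G_set v (g i). pvar j)"
      by (simp only: prod_pvar pmon_add mult.commute)
    then show "pmon a \<in> Q_ideal A v m g"
      using ideal_mult[OF Q_ideal_ideal Polys_UNIV G_prod_in_Q_ideal[of i m, OF G_set_sub(1)]] by metis
  qed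
qed

lemma G_prod_in_sr_ideal:
  assumes "i < m"
  shows "(\<Prod>j\<in>G_set v (g i). pvar j) \<in> sr_ideal (- nsupp v) (link_complex A w v)"
proof -
  have "G_set v (g i) \<notin> link_complex A w v"
    using link_complex_iff_G_free[of "G_set v (g i)" v] G_set_sub[of v "g i"] assms
    unfolding G_free_def by blast
  then show ?thesis
    unfolding sr_ideal_def using G_set_sub[of v "g i"] by (intro Idl_gen[OF sr_ideal_gens_sub]) auto
qed

context
  fixes v L ell
  assumes row_red: "row_reduction A v L ell"
begin

lemma row_reduction_gens_in_Q_ideal:
  "p \<in> nsupp v \<Longrightarrow> pvar p - L p \<in> Q_ideal A v m g"
  "q < CARD('d) - card (nsupp v) \<Longrightarrow> ell q \<in> Q_ideal A v m g"
proof -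
  let ?X = "(\<lambda>p. pvar p - L p) ` nsupp v \<union> ell ` {..<CARD('d) - card (nsupp v)}"
  have "?X \<subseteq> Polys UNIV" by auto
  then have "?X \<subseteq> Idl\<^bsub>poly_ring UNIV\<^esub> (range (row_form A))"
    unfolding row_reductionD(3)[OF row_red, symmetric] using Idl_gen by blast
  also have "\<dots> \<subseteq> Q_ideal A v m g"
    using row_form_in_Q_ideal by (intro Idl_least[OF Q_ideal_ideal]) auto
  finally show "p \<in> nsupp v \<Longrightarrow> pvar p - L p \<in> Q_ideal A v m g"
    "q < CARD('d) - card (nsupp v) \<Longrightarrow> ell q \<in> Q_ideal A v m g"
    by auto
qed

lemma eliminate_row_form_in_link_ideal: "eliminate (nsupp v) L (row_form A k) \<in> link_ideal A w v ell"
proof -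
  let ?I = "Idl\<^bsub>poly_ring UNIV\<^esub> (range (row_form A))" and ?x = "row_form A k"
  note L_linear = row_reductionD(1)[OF row_red]
  have "(\<lambda>p. pvar p - L p) ` nsupp v \<union> ell ` {..<CARD('d) - card (nsupp v)} \<subseteq> Polys UNIV" by auto
  then have "pvar p - L p \<in> ?I" if "p \<in> nsupp v" for p
    using Idl_gen that unfolding row_reductionD(3)[OF row_red, symmetric] by blast
  then have "?x - eliminate (nsupp v) L ?x \<in> ?I"
    by (rule ideal_diff_eliminate[OF Idl_ideal[OF row_forms_sub_Polys]])
  moreover have "?x \<in> ?I" using Idl_gen[OF row_forms_sub_Polys] by blast
  ultimately have "?x - (?x - eliminate (nsupp v) L ?x) \<in> ?I"
    by (rule ideal_diff[OF Idl_ideal[OF row_forms_sub_Polys], rotated])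
  then have "eliminate (nsupp v) L ?x \<in> ?I" by simp
  then have "eliminate (nsupp v) L ?x \<in> cpoly.span (range (row_form A))"
    using homog_eliminate[OF L_linear row_form_homog] row_form_homog
    by (intro Idl_degree_1[OF row_forms_sub_Polys]) auto
  then show ?thesis using eliminate_Polys[OF L_linear] by (rule row_span_sub_link_ideal[OF row_red])
qed

lemma hilbert_series_Q_ideal: "hilbert_series UNIV (Q_ideal A v m g) = H_series A w v ell"
  unfolding H_series_link_ideal
proof (rule hilbert_series_eliminate[OF row_reductionD(1)[OF row_red] Q_ideal_ideal
  row_reduction_gens_in_Q_ideal(1)])
  note ideal_link = link_ideal_ideal[OF row_red, of w]
  show "link_ideal A w v ell \<subseteq> Polys (- nsupp v)" using ideal_sub_Polys[OF ideal_link] by blast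
  show "link_ideal A w v ell \<subseteq> Q_ideal A v m g"
  proof
    fix p assume "p \<in> link_ideal A w v ell"
    from this[unfolded link_ideal_def] link_ideal_gens_sub[OF row_red] show "p \<in> Q_ideal A v m g"
    proof (induction rule: Idl_induct)
      case (mult c s)
      then have "s \<in> Q_ideal A v m g" using sr_ideal_sub_Q_ideal row_reduction_gens_in_Q_ideal(2) by blast
      then show ?case by (intro ideal_mult[OF Q_ideal_ideal]) auto
    qed (auto intro: ideal_0[OF Q_ideal_ideal] ideal_add[OF Q_ideal_ideal])
  qed
  show "eliminate (nsupp v) L p \<in> link_ideal A w v ell" if "p \<in> Q_ideal A v m g" for p
    using that[unfolded Q_ideal_def] Q_ideal_gens_sub
  proof (induction rule: Idl_induct)
    case (mult c s)
    then consider (row) k where "s = row_form A k" | (monomial) i where "i < m" "s = (\<Prod>j\<in>G_set v (g i). pvar j)"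
      by blast
    then have "eliminate (nsupp v) L s \<in> link_ideal A w v ell"
    proof cases
      case row
      then show ?thesis using eliminate_row_form_in_link_ideal by simp
    next
      case monomial
      then have "s \<in> link_ideal A w v ell"
        using G_prod_in_sr_ideal sr_ideal_sub_link_ideal[OF row_red] by blast
      then show ?thesis using ideal_sub_Polys[OF ideal_link] by (simp add: eliminate_id)
    qed
    then have "eliminate (nsupp v) L c * eliminate (nsupp v) L s \<in> link_ideal A w v ell"
      by (intro ideal_mult[OF ideal_link] eliminate_Polys[OF row_reductionD(1)[OF row_red]])
    then show ?case by (simp add: eliminate_def psubst_mult)
  qed (auto simp: eliminate_def psubst_add intro: ideal_0[OF ideal_link] ideal_add[OF ideal_link])
qed

end

lemma Q_perp_has_hilbert_poly:
  assumes std_pair: "(a, \<sigma>) \<in> std_pairs_at A w v" "card \<sigma> = CARD('d)"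
    and cohen_mac: "cohen_macaulay (sr_ring (- nsupp v) (link_complex A w v))"
  shows "has_hilbert_poly (Q_perp A v m g) (h_poly (- nsupp v) (link_complex A w v))"
proof -
  obtain L ell where row_red: "row_reduction A v L ell"
    using row_reduction_exists independent_columns_mono[OF std_pairs_at_independent_columns
      nsupp_sub_std_pairs_at] std_pair(1) by blast
  have "int (cpoly.dim (graded_part (Q_perp A v m g) q)) = coeff (h_poly (- nsupp v) (link_complex A w v)) q"
    for q
    unfolding Q_perp_inverse_system dim_graded_inverse_system[OF Q_ideal_ideal Q_ideal_homog_closed]
      hilbert_series_Q_ideal[OF row_red] H_series_eq_h_poly[OF std_pair cohen_mac row_red] by simp
  then show ?thesis
    by (simp add: has_hilbert_poly_def Q_perp_inverse_system inverse_system_subspace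
      inverse_system_homog_closed Q_ideal_homog_closed)
qed

lemma one_in_Q_perp:
  assumes "(a, \<sigma>) \<in> std_pairs_at A w v"
  shows "1 \<in> Q_perp A v m g"
  unfolding Q_perp_inverse_system
proof (rule one_in_inverse_system)
  have irrelevant: "sr_ideal UNIV {{}} = {p :: 'n cpoly. 0 \<notin> keys p}"
    using sr_ideal_Pow[of UNIV "{}"] by auto
  have "{} \<in> link_complex A w v" unfolding link_complex_iff
    using assms nsupp_sub_std_pairs_at[OF assms] by blast
  then have "G_set v (g i) \<noteq> {}" if "i < m" for i
    using link_complex_iff_G_free[of "{}" v] that by (auto simp: G_free_def)
  then have "0 \<notin> keys (\<Prod>j\<in>G_set v (g i). pvar j)" if "i < m" for i
    using homog_prod_pvar[of "G_set v (g i)"] that by (auto simp: homog_def card_eq_0_iff)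
  moreover have "0 \<notin> keys (row_form A k)" for k using row_form_homog[of A k] by (auto simp: homog_def)
  ultimately have "range (row_form A) \<union> {\<Prod>j\<in>G_set v (g i). pvar j | i. i < m} \<subseteq> sr_ideal UNIV {{}}"
    unfolding irrelevant by blast
  then have "Q_ideal A v m g \<subseteq> sr_ideal UNIV {{}}"
    unfolding Q_ideal_def by (rule Idl_least[OF sr_ideal_ideal])
  then show "lookup \<phi> 0 = 0" if "\<phi> \<in> Q_ideal A v m g" for \<phi>
    using that unfolding irrelevant by (auto simp: in_keys_iff)
qed

end

section \<open>The action of the Weyl algebra on series\<close>

definition deriv_factor :: "complex ^ 'n::finite \<Rightarrow> ('n \<Rightarrow>\<^sub>0 nat) \<Rightarrow> int ^ 'n \<Rightarrow> 'n cpoly" where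
  "deriv_factor v b y = (\<Prod>j\<in>UNIV. \<Prod>k\<in>{1..lookup b j}. pconst (v $ j + of_int (y $ j + int k)) + pvar j)"

definition monomial_act :: "complex ^ 'n::finite \<Rightarrow> ('n \<Rightarrow>\<^sub>0 nat) \<times> ('n \<Rightarrow>\<^sub>0 nat) \<Rightarrow>
    (int ^ 'n \<Rightarrow> 'n cpoly) \<Rightarrow> int ^ 'n \<Rightarrow> 'n cpoly" where
  "monomial_act v s F u =
    pdiff (deriv_factor v (snd s) (u - exp_vec (fst s))) (F (u - exp_vec (fst s) + exp_vec (snd s)))"

lemma weyl_act_eq: "weyl_act v P F u = (\<Sum>s\<in>keys P. cscale (lookup P s) (monomial_act v s F u))"
  unfolding weyl_act_def by (intro sum.cong refl) (auto simp: monomial_act_def deriv_factor_def)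

lemma weyl_act_add: "weyl_act v (P + Q) F u = weyl_act v P F u + weyl_act v Q F u"
  unfolding weyl_act_eq by (rule setsum_keys_plus_distrib) (auto simp: cpoly.scale_left_distrib)

lemma weyl_act_single: "weyl_act v (single s c) F u = cscale c (monomial_act v s F u)"
  by (cases "c = 0") (auto simp: weyl_act_eq)

lemma weyl_act_0 [simp]: "weyl_act v 0 F u = 0"
  by (simp add: weyl_act_eq)

lemma weyl_act_sum: "weyl_act v (sum f X) F u = (\<Sum>x\<in>X. weyl_act v (f x) F u)"
  by (induction X rule: infinite_finite_induct) (auto simp: weyl_act_add)

lemma weyl_act_uminus: "weyl_act v (- P) F u = - weyl_act v P F u"
  by (rule sym) (simp only: neg_eq_iff_add_eq_0 weyl_act_add[symmetric] right_minus weyl_act_0)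

lemma weyl_act_diff: "weyl_act v (P - Q) F u = weyl_act v P F u - weyl_act v Q F u"
  using weyl_act_add[of v P "- Q" F u] by (simp add: weyl_act_uminus)

lemma weyl_scale_single: "weyl_scale c (single s d) = single s (c * d)"
  by (simp add: weyl_scale_def)

lemma weyl_scale_eq: "weyl_scale c P = (\<Sum>s\<in>keys P. single s (c * lookup P s))"
proof (rule poly_mapping_eqI)
  fix k
  have "lookup (weyl_scale c P) k = c * lookup P k"
    unfolding weyl_scale_def by (simp add: Poly_Mapping.map.rep_eq when_def)
  also have "\<dots> = lookup (\<Sum>s\<in>keys P. single s (c * lookup P s)) k"
    by (simp add: lookup_sum lookup_single when_def in_keys_iff sum.delta)
  finally show "lookup (weyl_scale c P) k = lookup (\<Sum>s\<in>keys P. single s (c * lookup P s)) k" .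
qed

lemma weyl_act_scale: "weyl_act v (weyl_scale c P) F u = cscale c (weyl_act v P F u)"
  unfolding weyl_scale_eq weyl_act_sum weyl_act_single
  by (simp add: weyl_act_eq cpoly.scale_sum_right)

lemma monomial_act_sum: "monomial_act v s (\<lambda>u. \<Sum>x\<in>X. f x u) u = (\<Sum>x\<in>X. monomial_act v s (f x) u)"
  by (simp add: monomial_act_def pdiff_sum_right)

lemma monomial_act_cscale: "monomial_act v s (\<lambda>u. cscale c (F u)) u = cscale c (monomial_act v s F u)"
  by (simp add: monomial_act_def pdiff_cscale_right)

lemma pochhammer_minus_of_nat:
  "pochhammer (- of_nat c) k = (- 1) ^ k * (of_nat (fact k * (c choose k)) :: 'a::comm_ring_1)"
proof (induction k)
  case (Suc k)
  have "(of_nat k - of_nat c) * of_nat (c choose k) = - (of_nat ((c - k) * (c choose k)) :: 'a)"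
    by (cases "k \<le> c") (simp_all add: of_nat_diff left_diff_distrib binomial_eq_0)
  also have "(c - k) * (c choose k) = Suc k * (c choose Suc k)"
    by (simp only: binomial_absorb_comp binomial_absorption)
  finally have step: "(of_nat k - of_nat c) * of_nat (c choose k) =
    - (of_nat (Suc k * (c choose Suc k)) :: 'a)" .
  have "pochhammer (- of_nat c) (Suc k) =
      (- 1) ^ k * of_nat (fact k) * ((of_nat k - of_nat c) * (of_nat (c choose k) :: 'a))"
    unfolding pochhammer_Suc Suc.IH by (simp add: algebra_simps)
  also have "\<dots> = (- 1) ^ Suc k * of_nat (fact (Suc k) * (c choose Suc k))"
    unfolding step by (simp add: algebra_simps)
  finally show ?case .
qed simp

text \<open>Vandermonde's identity for falling factorials, the one-variable case of
  \<open>\<partial>\<^sup>b x\<^sup>c = (\<Sum>k. k! binom(b, k) binom(c, k) x\<^bsup>c-k\<^esup> \<partial>\<^bsup>b-k\<^esup>)\<close>.\<close>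

lemma pochhammer_leibniz:
  fixes x :: "'a::comm_ring_1"
  shows "pochhammer (x + 1) b =
    (\<Sum>k\<le>b. of_nat (fact k * (b choose k) * (c choose k)) * pochhammer (x - of_nat c + of_nat k + 1) (b - k))"
proof -
  let ?z = "x + of_nat b"
  have "pochhammer (x + 1) b = (- 1) ^ b * pochhammer (- of_nat c + - (?z - of_nat c)) b"
    using pochhammer_minus'[of ?z b] by simp
  also have "\<dots> = (\<Sum>k\<le>b. (- 1) ^ b *
      (of_nat (b choose k) * pochhammer (- of_nat c) k * pochhammer (- (?z - of_nat c)) (b - k)))"
    unfolding pochhammer_binomial_sum by (rule sum_distrib_left)
  also have "\<dots> = (\<Sum>k\<le>b. of_nat (fact k * (b choose k) * (c choose k)) *
      pochhammer (x - of_nat c + of_nat k + 1) (b - k))"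
  proof (rule sum.cong[OF refl])
    fix k assume "k \<in> {..b}"
    then have k_le: "k \<le> b" by simp
    have "pochhammer (- (?z - of_nat c)) (b - k) =
        (- 1) ^ (b - k) * pochhammer (x - of_nat c + of_nat k + 1) (b - k)"
      unfolding pochhammer_minus[of "?z - of_nat c"] using k_le by (simp add: of_nat_diff algebra_simps)
    moreover have "(- 1) ^ b = (- 1) ^ k * ((- 1) ^ (b - k) :: 'a)"
      using k_le by (simp add: power_add[symmetric])
    moreover have "(- 1) ^ n * ((- 1) ^ n * y) = y" for n and y :: 'a by (simp add: mult.assoc[symmetric])
    ultimately show "(- 1) ^ b *
      (of_nat (b choose k) * pochhammer (- of_nat c) k * pochhammer (- (?z - of_nat c)) (b - k)) =
      of_nat (fact k * (b choose k) * (c choose k)) * pochhammer (x - of_nat c + of_nat k + 1) (b - k)"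
      by (simp add: pochhammer_minus_of_nat mult_ac)
  qed
  finally show ?thesis .
qed

lemma pconst_of_nat: "pconst (of_nat k) = of_nat k"
  by (simp add: pconst_def single_of_nat)

lemma deriv_factor_pochhammer: "deriv_factor v b y =
  (\<Prod>j\<in>UNIV. pochhammer (pconst (v $ j + of_int (y $ j)) + pvar j + 1) (lookup b j))"
  unfolding deriv_factor_def
proof (rule prod.cong[OF refl])
  fix j
  have "(\<Prod>k\<in>{1..lookup b j}. pconst (v $ j + of_int (y $ j + int k)) + pvar j) =
    (\<Prod>k\<in>{0..<lookup b j}. pconst (v $ j + of_int (y $ j + int (Suc k))) + pvar j)"
    by (rule prod.reindex_bij_witness[of _ Suc "\<lambda>k. k - 1"]) auto
  also have "\<dots> = (\<Prod>k\<in>{0..<lookup b j}. pconst (v $ j + of_int (y $ j)) + pvar j + 1 + of_nat k)"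
    by (intro prod.cong refl) (simp add: pconst_add pconst_of_nat[symmetric] add_ac)
  finally show "(\<Prod>k\<in>{1..lookup b j}. pconst (v $ j + of_int (y $ j + int k)) + pvar j) =
    pochhammer (pconst (v $ j + of_int (y $ j)) + pvar j + 1) (lookup b j)"
    by (simp add: pochhammer_prod)
qed

lemma deriv_factor_add: "deriv_factor v (b + e) y = deriv_factor v b y * deriv_factor v e (y + exp_vec b)"
  unfolding deriv_factor_pochhammer prod.distrib[symmetric]
proof (rule prod.cong[OF refl])
  fix j
  let ?X = "pconst (v $ j + of_int (y $ j)) + pvar j + 1"
  have "pochhammer ?X (lookup (b + e) j) =
    pochhammer ?X (lookup b j) * pochhammer (?X + of_nat (lookup b j)) (lookup e j)"
    using pochhammer_product[of "lookup b j" "lookup (b + e) j" ?X] by (simp add: lookup_add)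
  also have "?X + of_nat (lookup b j) = pconst (v $ j + of_int ((y + exp_vec b) $ j)) + pvar j + 1"
    by (simp add: pconst_add pconst_of_nat add_ac)
  finally show "pochhammer ?X (lookup (b + e) j) =
    pochhammer ?X (lookup b j) *
      pochhammer (pconst (v $ j + of_int ((y + exp_vec b) $ j)) + pvar j + 1) (lookup e j)" .
qed

lemma pconst_prod: "pconst (prod f X) = (\<Prod>x\<in>X. pconst (f x))"
  by (induction X rule: infinite_finite_induct) (auto simp: pconst_mult)

definition leibniz_indices :: "('n \<Rightarrow>\<^sub>0 nat) \<Rightarrow> ('n \<Rightarrow>\<^sub>0 nat) \<Rightarrow> ('n \<Rightarrow>\<^sub>0 nat) set" where
  "leibniz_indices b c = {k. \<forall>j. lookup k j \<le> lookup b j \<and> lookup k j \<le> lookup c j}"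

definition leibniz_coeff :: "('n::finite \<Rightarrow>\<^sub>0 nat) \<Rightarrow> ('n \<Rightarrow>\<^sub>0 nat) \<Rightarrow> ('n \<Rightarrow>\<^sub>0 nat) \<Rightarrow> complex" where
  "leibniz_coeff b c k =
     (\<Prod>j\<in>UNIV. fact (lookup k j) * of_nat (lookup b j choose lookup k j) *
       of_nat (lookup c j choose lookup k j))"

lemma weyl_mult_mon_leibniz:
  "weyl_mult_mon (a, b) (c, e) =
    (\<Sum>k\<in>leibniz_indices b c. single (a + (c - k), (b - k) + e) (leibniz_coeff b c k))"
  by (simp add: weyl_mult_mon_def leibniz_indices_def leibniz_coeff_def)

lemma deriv_factor_leibniz:
  fixes b c :: "'n::finite \<Rightarrow>\<^sub>0 nat"
  shows "deriv_factor v b y =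
    (\<Sum>k\<in>leibniz_indices b c. cscale (leibniz_coeff b c k) (deriv_factor v (b - k) (y - exp_vec c + exp_vec k)))"
proof -
  define S where "S j = {k. k \<le> lookup b j \<and> k \<le> lookup c j}" for j
  define t where "t j k = of_nat (fact k * (lookup b j choose k) * (lookup c j choose k)) *
     pochhammer (pconst (v $ j + of_int (y $ j)) + pvar j - of_nat (lookup c j) + of_nat k + 1)
       (lookup b j - k)" for j k
  have "deriv_factor v b y = (\<Prod>j\<in>UNIV. \<Sum>k\<le>lookup b j. t j k)"
    unfolding deriv_factor_pochhammer t_def by (intro prod.cong refl pochhammer_leibniz)
  also have "\<dots> = (\<Prod>j\<in>UNIV. \<Sum>k\<in>S j. t j k)"
  proof (intro prod.cong refl sum.mono_neutral_right ballI)
    fix j k assume "k \<in> {..lookup b j} - S j"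
    then have "lookup c j < k" by (auto simp: S_def)
    then show "t j k = 0" by (simp add: t_def binomial_eq_0)
  qed (auto simp: S_def)
  also have "\<dots> = (\<Sum>\<kappa>\<in>PiE UNIV S. \<Prod>j\<in>UNIV. t j (\<kappa> j))"
    by (rule prod_sum_PiE) (auto simp: S_def)
  also have "\<dots> = (\<Sum>k\<in>leibniz_indices b c. \<Prod>j\<in>UNIV. t j (lookup k j))"
    by (rule sum.reindex_bij_witness[of _ lookup exponent_of])
      (auto simp: leibniz_indices_def S_def PiE_def intro: poly_mapping_eqI)
  also have "\<dots> = (\<Sum>k\<in>leibniz_indices b c.
      cscale (leibniz_coeff b c k) (deriv_factor v (b - k) (y - exp_vec c + exp_vec k)))"
  proof (rule sum.cong[OF refl])
    fix k
    have coeff: "of_nat (fact (lookup k j) * (lookup b j choose lookup k j) * (lookup c j choose lookup k j)) =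
      (pconst (fact (lookup k j) * of_nat (lookup b j choose lookup k j) *
        of_nat (lookup c j choose lookup k j)) :: 'n cpoly)" for j
      unfolding pconst_of_nat[symmetric] by simp
    have base: "pconst (v $ j + of_int (y $ j)) + pvar j - of_nat (lookup c j) + of_nat (lookup k j) + 1 =
      pconst (v $ j + of_int ((y - exp_vec c + exp_vec k) $ j)) + pvar j + 1" for j
      by (simp add: pconst_add pconst_diff pconst_of_nat)
    show "(\<Prod>j\<in>UNIV. t j (lookup k j)) =
      cscale (leibniz_coeff b c k) (deriv_factor v (b - k) (y - exp_vec c + exp_vec k))"
      unfolding t_def cscale_def leibniz_coeff_def deriv_factor_pochhammer pconst_prod prod.distrib[symmetric]
      by (intro prod.cong refl) (simp only: coeff base lookup_minus)
  qed
  finally show ?thesis .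
qed

lemma monomial_act_leibniz_term:
  assumes "k \<in> leibniz_indices b c"
  shows "monomial_act v (a + (c - k), (b - k) + e) F u =
    pdiff (deriv_factor v (b - k) (u - exp_vec a - exp_vec c + exp_vec k))
      (monomial_act v (c, e) F (u - exp_vec a + exp_vec b))"
proof -
  have k_le: "lookup k j \<le> lookup b j" "lookup k j \<le> lookup c j" for j
    using assms by (auto simp: leibniz_indices_def)
  have minus: "exp_vec (c - k) = exp_vec c - exp_vec k" "exp_vec (b - k) = exp_vec b - exp_vec k"
    using k_le by (simp_all add: vec_eq_iff lookup_minus of_nat_diff)
  let ?y = "u - exp_vec a - exp_vec c + exp_vec k" and ?x = "u - exp_vec a + exp_vec b"
  have "u - exp_vec (a + (c - k)) = ?y" by (simp add: exp_vec_add minus algebra_simps)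
  moreover have "?y + exp_vec ((b - k) + e) = ?x - exp_vec c + exp_vec e" by (simp add: exp_vec_add minus)
  moreover have "?y + exp_vec (b - k) = ?x - exp_vec c" by (simp add: minus)
  ultimately show ?thesis by (simp only: monomial_act_def fst_conv snd_conv deriv_factor_add pdiff_mult)
qed

lemma weyl_act_mult_mon: "weyl_act v (weyl_mult_mon s t) F u = monomial_act v s (monomial_act v t F) u"
proof (cases s, cases t)
  fix a b c e assume s_eq: "s = (a, b)" and t_eq: "t = (c, e)"
  let ?G = "monomial_act v (c, e) F (u - exp_vec a + exp_vec b)"
  have "weyl_act v (weyl_mult_mon s t) F u =
    (\<Sum>k\<in>leibniz_indices b c. cscale (leibniz_coeff b c k) (monomial_act v (a + (c - k), (b - k) + e) F u))"
    unfolding s_eq t_eq weyl_mult_mon_leibniz weyl_act_sum weyl_act_single ..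
  also have "\<dots> = (\<Sum>k\<in>leibniz_indices b c. pdiff (cscale (leibniz_coeff b c k)
      (deriv_factor v (b - k) (u - exp_vec a - exp_vec c + exp_vec k))) ?G)"
    by (intro sum.cong refl) (simp only: monomial_act_leibniz_term pdiff_cscale_left)
  also have "\<dots> = pdiff (deriv_factor v b (u - exp_vec a)) ?G"
    by (subst deriv_factor_leibniz[of v b _ c]) (simp only: pdiff_sum_left)
  finally show ?thesis by (simp only: s_eq t_eq monomial_act_def fst_conv snd_conv)
qed

lemma weyl_act_mult: "weyl_act v (weyl_mult P Q) F u = weyl_act v P (weyl_act v Q F) u"
proof -
  have "weyl_act v (weyl_mult P Q) F u =
    (\<Sum>s\<in>keys P. \<Sum>t\<in>keys Q. cscale (lookup P s * lookup Q t) (monomial_act v s (monomial_act v t F) u))"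
    unfolding weyl_mult_def weyl_act_sum weyl_act_scale weyl_act_mult_mon ..
  also have "\<dots> =
    (\<Sum>s\<in>keys P. cscale (lookup P s)
      (monomial_act v s (\<lambda>u. \<Sum>t\<in>keys Q. cscale (lookup Q t) (monomial_act v t F u)) u))"
    unfolding monomial_act_sum monomial_act_cscale by (simp add: cpoly.scale_sum_right)
  also have "\<dots> = weyl_act v P (weyl_act v Q F) u"
    by (simp add: weyl_act_eq[abs_def])
  finally show ?thesis .
qed

lemma weyl_act_zero_fun: "weyl_act v P (\<lambda>u. 0) u = 0"
  by (simp add: weyl_act_eq monomial_act_def)

lemma weyl_mult_one: "weyl_mult (weyl_const 1) Q = Q"
proof -
  have mult_mon_one: "weyl_mult_mon (0, 0) t = single t 1" for t :: "('n::finite \<Rightarrow>\<^sub>0 nat) \<times> ('n \<Rightarrow>\<^sub>0 nat)"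
  proof (cases t)
    case (Pair c e)
    have indices_0: "{k. \<forall>j. lookup k j \<le> lookup (0 :: 'n \<Rightarrow>\<^sub>0 nat) j \<and> lookup k j \<le> lookup c j} = {0}"
      by (auto intro: poly_mapping_eqI)
    show ?thesis unfolding Pair weyl_mult_mon_def prod.case indices_0 by simp
  qed
  have "weyl_mult (weyl_const 1) Q = (\<Sum>t\<in>keys Q. single t (lookup Q t))"
    by (simp add: weyl_mult_def weyl_const_def mult_mon_one weyl_scale_single)
  then show ?thesis using poly_sum_single by metis
qed

lemma weyl_left_ideal_gen: "Q \<in> S \<Longrightarrow> Q \<in> weyl_left_ideal S"
  using weyl_left_ideal.mult[of Q S "weyl_const 1"] by (simp add: weyl_mult_one)

lemma weyl_left_ideal_annihilates:
  "(\<forall>P\<in>weyl_left_ideal S. weyl_act v P F = (\<lambda>u. 0)) \<longleftrightarrow> (\<forall>Q\<in>S. weyl_act v Q F = (\<lambda>u. 0))"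
proof
  assume "\<forall>P\<in>weyl_left_ideal S. weyl_act v P F = (\<lambda>u. 0)"
  then show "\<forall>Q\<in>S. weyl_act v Q F = (\<lambda>u. 0)" using weyl_left_ideal_gen by blast
next
  assume gens_annihilate: "\<forall>Q\<in>S. weyl_act v Q F = (\<lambda>u. 0)"
  show "\<forall>P\<in>weyl_left_ideal S. weyl_act v P F = (\<lambda>u. 0)"
  proof
    fix P assume "P \<in> weyl_left_ideal S"
    then show "weyl_act v P F = (\<lambda>u. 0)"
    proof (induction rule: weyl_left_ideal.induct)
      case (mult Q P)
      then have "weyl_act v Q F = (\<lambda>u. 0)" using gens_annihilate by blast
      then show ?case by (intro ext) (simp only: weyl_act_mult weyl_act_zero_fun)
    qed (simp_all add: fun_eq_iff weyl_act_add)
  qed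
qed

lemma exp_vec_0: "exp_vec 0 = 0"
  by (simp add: vec_eq_iff)

lemma weyl_act_partial: "weyl_act v (weyl_of_partial p) F u =
    (\<Sum>b\<in>keys p. cscale (lookup p b) (pdiff (deriv_factor v b u) (F (u + exp_vec b))))"
  unfolding weyl_of_partial_def weyl_act_sum weyl_act_single by (simp add: monomial_act_def exp_vec_0)

lemma weyl_act_theta: "weyl_act v (weyl_scale c (weyl_theta j)) F u =
    cscale c (pdiff (pconst (v $ j + of_int (u $ j)) + pvar j) (F u))"
proof -
  have "deriv_factor v (single j 1) (u - exp_vec (single j 1)) =
    (\<Prod>i\<in>UNIV. if i = j then pconst (v $ j + of_int (u $ j)) + pvar j else 1)"
    unfolding deriv_factor_def by (intro prod.cong refl) (auto simp: lookup_single when_def)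
  also have "\<dots> = pconst (v $ j + of_int (u $ j)) + pvar j" by simp
  finally have "monomial_act v (single j 1, single j 1) F u =
    pdiff (pconst (v $ j + of_int (u $ j)) + pvar j) (F u)"
    unfolding monomial_act_def by simp
  then show ?thesis unfolding weyl_act_scale weyl_theta_def weyl_act_single by (simp add: cpoly.scale_one)
qed

lemma weyl_act_const: "weyl_act v (weyl_const c) F u = cscale c (F u)"
  by (simp add: weyl_const_def weyl_act_single monomial_act_def deriv_factor_def exp_vec_0)

lemma weyl_act_euler:
  "weyl_act v (euler_op A \<beta> i) F u = pdiff (row_form A i) (F u) +
    cscale ((\<Sum>j\<in>UNIV. of_int (A $ i $ j) * (v $ j + of_int (u $ j))) - \<beta> $ i) (F u)"
proof -
  have "weyl_act v (euler_op A \<beta> i) F u =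
      (\<Sum>j\<in>UNIV. cscale (of_int (A $ i $ j)) (pdiff (pconst (v $ j + of_int (u $ j)) +
        pvar j) (F u))) - cscale (\<beta> $ i) (F u)"
    unfolding euler_op_def weyl_act_diff weyl_act_sum weyl_act_theta weyl_act_const ..
  also have "\<dots> = (\<Sum>j\<in>UNIV. cscale (of_int (A $ i $ j)) (pdiff (pvar j) (F u))) +
      cscale ((\<Sum>j\<in>UNIV. of_int (A $ i $ j) * (v $ j + of_int (u $ j))) - \<beta> $ i) (F u)"
    by (simp add: pdiff_add_left pdiff_pconst cpoly.scale_right_distrib sum.distrib cpoly.scale_sum_left
      cpoly.scale_left_diff_distrib)
  also have "(\<Sum>j\<in>UNIV. cscale (of_int (A $ i $ j)) (pdiff (pvar j) (F u))) = pdiff (row_form A i) (F u)"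
    unfolding row_form_def cscale_def[symmetric] by (simp add: pdiff_sum_left pdiff_cscale_left)
  finally show ?thesis .
qed

lemma weyl_act_euler_on_kernel:
  assumes Av_eq_\<beta>: "(\<Sum>j\<in>UNIV. of_int (A $ i $ j) * v $ j) = \<beta> $ i" and supp: "F u \<noteq> 0 \<Longrightarrow> u \<in> int_kernel A"
  shows "weyl_act v (euler_op A \<beta> i) F u = pdiff (row_form A i) (F u)"
proof (cases "F u = 0")
  case False
  then have "(\<Sum>j\<in>UNIV. of_int (A $ i $ j) * (v $ j + of_int (u $ j))) = \<beta> $ i"
    using int_kernel_of_int[OF supp, of i] by (simp add: distrib_left sum.distrib Av_eq_\<beta>)
  then show ?thesis by (simp add: weyl_act_euler)
qed (simp add: weyl_act_euler)

lemma linear_weyl_act_partial: "Vector_Spaces.linear cscale cscale (\<lambda>p. weyl_act v (weyl_of_partial p) F u)"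
  unfolding weyl_act_partial by (rule linear_sum_keys)

lemma weyl_annihilates_toric_iff:
  fixes A :: "int ^ 'n::finite ^ 'd::finite"
  shows "(\<forall>p\<in>toric_ideal A. weyl_act v (weyl_of_partial p) F = (\<lambda>u. 0)) \<longleftrightarrow>
    (\<forall>a b y. A *v exp_vec a = A *v exp_vec b \<longrightarrow>
       pdiff (deriv_factor v a y) (F (y + exp_vec a)) = pdiff (deriv_factor v b y) (F (y + exp_vec b)))"
         (is "?L \<longleftrightarrow> ?R")
proof -
  let ?W = "\<lambda>p y. weyl_act v (weyl_of_partial p) F y"
  let ?S = "{pmon a - pmon b | a b. A *v exp_vec a = A *v exp_vec b}"
  have binomial: "?W (pmon a - pmon b) y =
      pdiff (deriv_factor v a y) (F (y + exp_vec a)) - pdiff (deriv_factor v b y) (F (y + exp_vec b))" for a b y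
    unfolding cpoly_pair.linear_diff[OF linear_weyl_act_partial]
    by (simp add: weyl_act_partial pmon_def cpoly.scale_one)
  have "?L \<longleftrightarrow> (\<forall>s\<in>?S. \<forall>y. ?W s y = 0)"
  proof
    assume ?L
    then show "\<forall>s\<in>?S. \<forall>y. ?W s y = 0" using toric_ideal_binomial by (auto dest: fun_cong)
  next
    assume binomials_annihilate: "\<forall>s\<in>?S. \<forall>y. ?W s y = 0"
    have "?W p y = 0" if "p \<in> toric_ideal A" for p y
      using binomials_annihilate
      by (intro cpoly_pair.linear_eq_0_on_span[OF linear_weyl_act_partial _ toric_ideal_span[OF that],
        of v F y]) blast
    then show ?L by (simp add: fun_eq_iff)
  qed
  also have "\<dots> \<longleftrightarrow> (\<forall>a b y. A *v exp_vec a = A *v exp_vec b \<longrightarrow> ?W (pmon a - pmon b) y = 0)" by blast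
  finally show ?thesis by (simp only: binomial right_minus_eq)
qed

lemma hypergeometric_solution_iff:
  fixes A :: "int ^ 'n::finite ^ 'd::finite"
  assumes Av_eq_\<beta>: "\<And>i. (\<Sum>j\<in>UNIV. of_int (A $ i $ j) * v $ j) = \<beta> $ i"
    and supp: "\<forall>u. F u \<noteq> 0 \<longrightarrow> u \<in> int_kernel A"
  shows "(\<forall>P\<in>hypergeometric_ideal A \<beta>. weyl_act v P F = (\<lambda>u. 0)) \<longleftrightarrow>
    (\<forall>i u. pdiff (row_form A i) (F u) = 0) \<and>
    (\<forall>a b y. A *v exp_vec a = A *v exp_vec b \<longrightarrow>
       pdiff (deriv_factor v a y) (F (y + exp_vec a)) = pdiff (deriv_factor v b y) (F (y + exp_vec b)))"
proof -
  have "weyl_act v (euler_op A \<beta> i) F u = pdiff (row_form A i) (F u)" for i u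
    using supp by (intro weyl_act_euler_on_kernel[OF Av_eq_\<beta>]) blast
  then have "(\<forall>Q\<in>range (euler_op A \<beta>). weyl_act v Q F = (\<lambda>u. 0)) \<longleftrightarrow> (\<forall>i u. pdiff (row_form A i) (F u) = 0)"
    by (simp add: fun_eq_iff)
  then show ?thesis
    unfolding hypergeometric_ideal_def weyl_left_ideal_annihilates ball_Un
    by (simp add: weyl_annihilates_toric_iff conj_commute)
qed

section \<open>Leading coefficients are solutions of \<open>Q\<close>\<close>

text \<open>\<open>\<theta>\<^sub>j\<close> is the only factor of \<open>deriv_factor\<close> that acts non-invertibly on polynomials;
  \<open>unit_factor\<close> leaves it out.\<close>

definition unit_factor :: "complex ^ 'n::finite \<Rightarrow> 'n \<Rightarrow> int \<Rightarrow> 'n cpoly" where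
  "unit_factor v j t = (if v $ j + of_int t = 0 then 1 else pconst (v $ j + of_int t) + pvar j)"

lemma nsupp_shift_iff: "j \<in> nsupp_shift v y \<longleftrightarrow> (\<exists>k<0. v $ j + of_int (y $ j) = of_int k)"
  by (auto simp: nsupp_shift_def nsupp_def cvec_def)

lemma nsupp_shift_0: "nsupp_shift v 0 = nsupp v"
  by (auto simp: nsupp_shift_iff nsupp_def)

lemma nsupp_shift_mono: "nsupp_shift v (y + exp_vec a) \<subseteq> nsupp_shift v y"
proof
  fix j assume "j \<in> nsupp_shift v (y + exp_vec a)"
  then obtain k where negative_k: "k < 0" "v $ j + of_int (y $ j + int (lookup a j)) = of_int k"
    unfolding nsupp_shift_iff by auto
  then have "v $ j + of_int (y $ j) = of_int (k - int (lookup a j))" by (simp add: algebra_simps)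
  then show "j \<in> nsupp_shift v y" unfolding nsupp_shift_iff
    using negative_k(1) by (intro exI[of _ "k - int (lookup a j)"]) auto
qed

lemma zero_factor_iff:
  "(\<exists>k\<in>{1..lookup a j}. v $ j + of_int (y $ j + int k) = 0) \<longleftrightarrow>
   j \<in> nsupp_shift v y - nsupp_shift v (y + exp_vec a)"
proof
  assume "\<exists>k\<in>{1..lookup a j}. v $ j + of_int (y $ j + int k) = 0"
  then obtain k where zero_at_k: "1 \<le> k" "k \<le> lookup a j" "v $ j + of_int (y $ j + int k) = 0" by auto
  then have "v $ j = - of_int (y $ j + int k)" by (simp only: eq_neg_iff_add_eq_0)
  then have v_j_eq: "v $ j = of_int (- (y $ j + int k))" by simp
  have "j \<in> nsupp_shift v y"
    unfolding nsupp_shift_iff using zero_at_k(1) by (intro exI[of _ "- int k"]) (auto simp: v_j_eq)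
  moreover have "j \<notin> nsupp_shift v (y + exp_vec a)"
  proof
    assume "j \<in> nsupp_shift v (y + exp_vec a)"
    then obtain l where negative_l: "l < 0" "v $ j + of_int ((y + exp_vec a) $ j) = of_int l"
      unfolding nsupp_shift_iff by blast
    then have "of_int (int (lookup a j) - int k) = (of_int l :: complex)" by (simp add: v_j_eq)
    then have "int (lookup a j) - int k = l" by (simp only: of_int_eq_iff)
    then show False using zero_at_k negative_l by simp
  qed
  ultimately show "j \<in> nsupp_shift v y - nsupp_shift v (y + exp_vec a)" by simp
next
  assume j_in: "j \<in> nsupp_shift v y - nsupp_shift v (y + exp_vec a)"
  then have "j \<in> nsupp_shift v y" and j_notin: "j \<notin> nsupp_shift v (y + exp_vec a)" by simp_all
  then obtain l where negative_l: "l < 0" "v $ j + of_int (y $ j) = of_int l" unfolding nsupp_shift_iff by blast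
  have "v $ j + of_int ((y + exp_vec a) $ j) = of_int (l + int (lookup a j))" using negative_l(2) by simp
  then have "\<not> l + int (lookup a j) < 0" using j_notin unfolding nsupp_shift_iff by blast
  moreover have "v $ j + of_int (y $ j + int (nat (- l))) = 0" using negative_l by (simp add: add_diff_eq)
  ultimately show "\<exists>k\<in>{1..lookup a j}. v $ j + of_int (y $ j + int k) = 0"
    using negative_l(1) by (intro bexI[of _ "nat (- l)"]) auto
qed

lemma prod_linear_factors_split:
  "(\<Prod>k\<in>{1..n}. pconst (v $ j + of_int (s + int k)) + pvar j) =
    (if \<exists>k\<in>{1..n}. v $ j + of_int (s + int k) = 0 then pvar j else 1) *
      (\<Prod>k\<in>{1..n}. unit_factor v j (s + int k))"
proof (cases "\<exists>k\<in>{1..n}. v $ j + of_int (s + int k) = 0")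
  case True
  then obtain k where zero_at_k: "k \<in> {1..n}" "v $ j + of_int (s + int k) = 0" by blast
  have unique: "v $ j + of_int (s + int l) \<noteq> 0" if "l \<noteq> k" for l
  proof
    assume "v $ j + of_int (s + int l) = 0"
    then have "of_int (s + int l) = (of_int (s + int k) :: complex)"
      using zero_at_k(2) by (metis add_left_cancel)
    then show False using that by (simp only: of_int_eq_iff)
  qed
  have "(\<Prod>k\<in>{1..n}. pconst (v $ j + of_int (s + int k)) + pvar j) =
      (pconst (v $ j + of_int (s + int k)) + pvar j) *
      (\<Prod>l\<in>{1..n} - {k}. pconst (v $ j + of_int (s + int l)) + pvar j)"
    by (rule prod.remove) (use zero_at_k(1) in auto)
  also have "\<dots> = pvar j * (unit_factor v j (s + int k) * (\<Prod>l\<in>{1..n} - {k}. unit_factor v j (s + int l)))"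
    using unique zero_at_k(2) by (simp add: unit_factor_def)
  also have "unit_factor v j (s + int k) * (\<Prod>l\<in>{1..n} - {k}. unit_factor v j (s + int l)) =
    (\<Prod>l\<in>{1..n}. unit_factor v j (s + int l))"
    by (rule prod.remove[symmetric]) (use zero_at_k(1) in auto)
  finally show ?thesis using True by simp
qed (auto simp: unit_factor_def intro!: prod.cong)

lemma deriv_factor_split:
  "deriv_factor v a y = (\<Prod>j\<in>nsupp_shift v y - nsupp_shift v (y + exp_vec a). pvar j) *
     (\<Prod>j\<in>UNIV. \<Prod>k\<in>{1..lookup a j}. unit_factor v j (y $ j + int k))"
proof -
  let ?D = "nsupp_shift v y - nsupp_shift v (y + exp_vec a)"
  have "deriv_factor v a y =
    (\<Prod>j\<in>UNIV. (if j \<in> ?D then pvar j else 1) * (\<Prod>k\<in>{1..lookup a j}. unit_factor v j (y $ j + int k)))"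
    unfolding deriv_factor_def prod_linear_factors_split zero_factor_iff ..
  moreover have "(\<Prod>j\<in>UNIV. if j \<in> ?D then pvar j else 1) = (\<Prod>j\<in>?D. pvar j)"
    by (rule prod.mono_neutral_cong_right) auto
  ultimately show ?thesis by (simp only: prod.distrib)
qed

definition injective_operator :: "'n::finite cpoly \<Rightarrow> bool" where
  "injective_operator \<phi> \<longleftrightarrow> (\<forall>f. pdiff \<phi> f = 0 \<longrightarrow> f = 0)"

lemma injective_operator_prod: "(\<And>x. x \<in> X \<Longrightarrow> injective_operator (h x)) \<Longrightarrow> injective_operator (prod h X)"
proof (induction X rule: infinite_finite_induct)
  case (insert x X)
  then have "injective_operator (h x)" "injective_operator (prod h X)" by simp_all
  then show ?case unfolding prod.insert[OF insert.hyps] injective_operator_def pdiff_mult by blast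
qed (simp_all add: injective_operator_def)

lemma injective_operator_unit_factor: "injective_operator (unit_factor v j t)"
proof (cases "v $ j + of_int t = 0")
  case False
  define c where "c = v $ j + of_int t"
  have "f = 0" if f_killed: "pdiff (pconst c + pvar j) f = 0" for f
  proof -
    have "pdiff (pvar j) f = cscale (- c) f"
      using f_killed by (simp add: pdiff_add_left pdiff_pconst add_eq_0_iff)
    then have power_eigen: "pdiff (pvar j ^ k) f = cscale ((- c) ^ k) f" for k
      by (induction k) (auto simp: cpoly.scale_one pdiff_mult pdiff_cscale_right mult.commute)
    obtain N where "\<forall>m\<in>keys f. mdeg m \<le> N" using keys_mdeg_bound by blast
    then have "pdiff (pvar j ^ Suc N) f = 0" by (rule pdiff_power_eq_0)
    then have "cscale ((- c) ^ Suc N) f = 0" using power_eigen[of "Suc N"] by metis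
    moreover have "(- c) ^ Suc N \<noteq> 0"
      using False by (simp only: c_def power_eq_0_iff neg_equal_0_iff_equal) simp
    ultimately show "f = 0" using cpoly.scale_eq_0_iff by blast
  qed
  then show ?thesis using False by (auto simp: injective_operator_def unit_factor_def c_def)
qed (simp add: injective_operator_def unit_factor_def)

lemma series_solution_eq_0:
  assumes solution_F: "series_solution A \<beta> w v F" and u_nonpos: "u \<noteq> 0" "w \<bullet> rvec u \<le> 0"
  shows "F u = 0"
proof (rule ccontr)
  assume "F u \<noteq> 0"
  then have "rvec u \<noteq> 0 \<longrightarrow> w \<bullet> rvec u > 0" using solution_F unfolding series_solution_def by blast
  moreover have "rvec u \<noteq> 0" using u_nonpos(1) by (simp add: rvec_def vec_eq_iff)
  ultimately show False using u_nonpos(2) by simp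
qed

lemma series_solutionD:
  assumes Av_eq_\<beta>: "\<And>i. (\<Sum>j\<in>UNIV. of_int (A $ i $ j) * v $ j) = \<beta> $ i"
    and solution_F: "series_solution A \<beta> w v F"
  shows "pdiff (row_form A i) (F u) = 0"
    "A *v exp_vec a = A *v exp_vec b \<Longrightarrow>
      pdiff (deriv_factor v a y) (F (y + exp_vec a)) = pdiff (deriv_factor v b y) (F (y + exp_vec b))"
proof -
  have "\<forall>u. F u \<noteq> 0 \<longrightarrow> u \<in> int_kernel A" "\<forall>P\<in>hypergeometric_ideal A \<beta>. weyl_act v P F = (\<lambda>u. 0)"
    using solution_F by (auto simp: series_solution_def)
  note solution = this(2)[unfolded hypergeometric_solution_iff[OF Av_eq_\<beta> this(1)]]
  show "pdiff (row_form A i) (F u) = 0" using solution by blast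
  show "A *v exp_vec a = A *v exp_vec b \<Longrightarrow>
      pdiff (deriv_factor v a y) (F (y + exp_vec a)) = pdiff (deriv_factor v b y) (F (y + exp_vec b))"
    using solution by blast
qed

context toric_groebner
begin

lemma inner_g_pos: "i < m \<Longrightarrow> w \<bullet> rvec (g i) > 0"
proof -
  assume i_less: "i < m"
  have "rvec (g i) = rvec (exp_vec (gp i)) - rvec (exp_vec (gm i))"
    using g_def i_less by (simp add: rvec_def vec_eq_iff)
  then show ?thesis using weight_gp[OF i_less] by (simp add: weight_def inner_diff_right)
qed

lemma nsupp_shift_minus_gp:
  assumes i_less: "i < m"
  shows "nsupp_shift v (- exp_vec (gp i)) - nsupp v = G_set v (g i)"
proof (rule Set.set_eqI)
  fix j
  let ?a = "lookup (gp i) j"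
  have "j \<in> nsupp_shift v (- exp_vec (gp i)) - nsupp v \<longleftrightarrow> (\<exists>k\<in>{1..?a}. v $ j + of_int (int k - int ?a) = 0)"
    using zero_factor_iff[of "gp i" j v "- exp_vec (gp i)"] by (simp add: nsupp_shift_0)
  also have "\<dots> \<longleftrightarrow> j \<in> nat_part v \<and> nat_val v j < ?a"
  proof
    assume "\<exists>k\<in>{1..?a}. v $ j + of_int (int k - int ?a) = 0"
    then obtain k where zero_at_k: "1 \<le> k" "k \<le> ?a" "v $ j + of_int (int k - int ?a) = 0" by auto
    then have v_j_eq: "v $ j = of_nat (?a - k)" by (simp add: of_nat_diff add_eq_0_iff algebra_simps)
    then have "j \<in> nat_part v" unfolding nat_part_def by blast
    then show "j \<in> nat_part v \<and> nat_val v j < ?a" unfolding nat_val_eq[OF v_j_eq] using zero_at_k(1,2) by simp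
  next
    assume small_nat_val: "j \<in> nat_part v \<and> nat_val v j < ?a"
    then have "v $ j + of_int (int (?a - nat_val v j) - int ?a) = 0"
      using of_nat_nat_val[of j v] by (simp add: of_nat_diff)
    then show "\<exists>k\<in>{1..?a}. v $ j + of_int (int k - int ?a) = 0"
      using small_nat_val by (intro bexI[of _ "?a - nat_val v j"]) auto
  qed
  finally show "j \<in> nsupp_shift v (- exp_vec (gp i)) - nsupp v \<longleftrightarrow> j \<in> G_set v (g i)"
    by (simp add: G_set_eq[OF i_less])
qed

context
  fixes v \<beta> F
  assumes Av_eq_\<beta>: "\<And>i. (\<Sum>j\<in>UNIV. of_int (A $ i $ j) * v $ j) = \<beta> $ i"
    and solution_F: "series_solution A \<beta> w v F"
begin

lemma G_prod_annihilates_leading_coeff: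
  assumes i_less: "i < m"
  shows "pdiff (\<Prod>j\<in>G_set v (g i). pvar j) (F 0) = 0"
proof -
  let ?y = "- exp_vec (gp i)"
    and ?u = "\<Prod>j\<in>UNIV. \<Prod>k\<in>{1..lookup (gp i) j}. unit_factor v j ((- exp_vec (gp i)) $ j + int k)"
  have "w \<bullet> rvec (- g i) < 0" using inner_g_pos[OF i_less] by (simp add: rvec_def inner_vec_def sum_negf)
  moreover from this have "- g i \<noteq> 0" by (auto simp: rvec_def inner_vec_def)
  ultimately have "F (- g i) = 0" by (intro series_solution_eq_0[OF solution_F]) auto
  moreover have "?y + exp_vec (gm i) = - g i" using g_def i_less by simp
  ultimately have "pdiff (deriv_factor v (gp i) ?y) (F 0) = 0"
    using series_solutionD(2)[OF Av_eq_\<beta> solution_F gp_gm_kernel[OF i_less], of ?y] by simp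
  moreover have "deriv_factor v (gp i) ?y = ?u * (\<Prod>j\<in>G_set v (g i). pvar j)"
    unfolding deriv_factor_split by (simp add: nsupp_shift_0 nsupp_shift_minus_gp[OF i_less] mult.commute)
  ultimately have "pdiff ?u (pdiff (\<Prod>j\<in>G_set v (g i). pvar j) (F 0)) = 0" by (simp only: pdiff_mult)
  moreover have "injective_operator ?u" by (intro injective_operator_prod injective_operator_unit_factor)
  ultimately show ?thesis unfolding injective_operator_def by blast
qed

lemma leading_coeff_in_Q_perp: "F 0 \<in> Q_perp A v m g"
proof -
  have "pdiff \<phi> (F 0) = 0" if "\<phi> \<in> Q_ideal A v m g" for \<phi>
    using that[unfolded Q_ideal_def] Q_ideal_gens_sub
  proof (induction rule: Idl_induct)
    case (mult c s)
    then have "pdiff s (F 0) = 0"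
      using series_solutionD(1)[OF Av_eq_\<beta> solution_F] G_prod_annihilates_leading_coeff by auto
    then show ?case by (simp add: pdiff_mult)
  qed (auto simp: pdiff_add_left)
  then show ?thesis by (simp add: Q_perp_def)
qed

end

end

section \<open>Polynomial solutions of the Euler equations\<close>

lemma pdiff_pvar_mult_linear_form: "pdiff (pvar i) (linear_form d * f) =
  cscale (d i) f + linear_form d * pdiff (pvar i) f"
proof -
  have "pdiff (pvar i) (linear_form d * f) =
      (\<Sum>k\<in>UNIV. cscale (d k) (if i = k then f else 0)) + (\<Sum>k\<in>UNIV. cscale (d k) (pvar k) * pdiff (pvar i) f)"
    by (simp add: linear_form_def sum_distrib_right cscale_mult_left pdiff_sum_right pdiff_cscale_right
      pdiff_pvar_mult_pvar cpoly.scale_right_distrib sum.distrib)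
  then show ?thesis by (simp add: linear_form_def sum_distrib_right if_distrib[of "cscale _"] cong: if_cong)
qed

lemma pdiff_linear_form: "pdiff (linear_form c) f = (\<Sum>i\<in>UNIV. cscale (c i) (pdiff (pvar i) f))"
  by (simp add: linear_form_def pdiff_sum_left pdiff_cscale_left)

lemma pdiff_linear_form_mult_linear_form:
  "pdiff (linear_form c) (linear_form d * f) =
    cscale (\<Sum>i\<in>UNIV. c i * d i) f + linear_form d * pdiff (linear_form c) f"
  by (simp add: pdiff_linear_form pdiff_pvar_mult_linear_form cpoly.scale_right_distrib sum.distrib
    cpoly.scale_sum_left
    sum_distrib_left cscale_mult_right)

lemma pdiff_pvar_mult_linear_form_power:
  "pdiff (pvar j) (linear_form d ^ Suc k * f) =
    cscale (of_nat (Suc k) * d j) (linear_form d ^ k * f) + linear_form d ^ Suc k * pdiff (pvar j) f"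
proof (induction k)
  case (Suc k)
  have "pdiff (pvar j) (linear_form d ^ Suc (Suc k) * f) =
      cscale (d j) (linear_form d ^ Suc k * f) + linear_form d * pdiff (pvar j) (linear_form d ^ Suc k * f)"
    unfolding power_Suc[of _ "Suc k"] mult.assoc by (rule pdiff_pvar_mult_linear_form)
  also have "\<dots> =
    cscale (d j + of_nat (Suc k) * d j) (linear_form d ^ Suc k * f) +
    linear_form d ^ Suc (Suc k) * pdiff (pvar j) f"
    unfolding Suc.IH by (simp add: distrib_left cscale_mult_right cpoly.scale_left_distrib mult.assoc add.assoc)
  finally show ?case by (simp add: algebra_simps)
qed (simp add: pdiff_pvar_mult_linear_form)

text \<open>Multiplication by the linear form has the nonzero scalar \<open>d j\<close> as commutator with the locally
  nilpotent \<open>\<partial>\<^sub>j\<close>; hence \<open>\<partial>\<^sub>j\<close> is surjective.\<close>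

lemma antiderivative_exists:
  assumes subspace_W: "cpoly.subspace W" and commutator_d: "d j \<noteq> 0" "\<And>f. f \<in> W \<Longrightarrow> linear_form d * f \<in> W"
    and closed: "\<And>f. f \<in> W \<Longrightarrow> pdiff (pvar j) f \<in> W" and f_in: "f \<in> W"
  shows "\<exists>q\<in>W. pdiff (pvar j) q = f"
proof -
  have power: "linear_form d ^ k * f \<in> W" if "f \<in> W" for f k
    by (induction k) (use that commutator_d(2) in \<open>auto simp: mult.assoc\<close>)
  have "\<exists>q\<in>W. pdiff (pvar j) q = linear_form d ^ k * f" if "pdiff (pvar j ^ n) f = 0" "f \<in> W" for n k f
    using that
  proof (induction n arbitrary: k f)
    case 0
    then show ?case using cpoly.subspace_0[OF subspace_W] by (intro bexI[of _ 0]) auto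
  next
    case (Suc n)
    have "pdiff (pvar j ^ n) (pdiff (pvar j) f) = 0"
      using Suc.prems(1) by (simp add: pdiff_mult[symmetric] mult.commute)
    then obtain q where antiderivative_q: "q \<in> W" "pdiff (pvar j) q = linear_form d ^ Suc k * pdiff (pvar j) f"
      using Suc.IH[of "pdiff (pvar j) f" "Suc k"] closed[OF Suc.prems(2)] by blast
    define c where "c = of_nat (Suc k) * d j"
    have "c \<noteq> 0" using commutator_d(1) unfolding c_def by (simp del: of_nat_Suc)
    then have "pdiff (pvar j) (cscale (inverse c) (linear_form d ^ Suc k * f - q)) = linear_form d ^ k * f"
      unfolding pdiff_cscale_right pdiff_diff_right pdiff_pvar_mult_linear_form_power antiderivative_q(2)
        c_def[symmetric]
      by (simp add: cpoly.scale_one)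
    moreover have "cscale (inverse c) (linear_form d ^ Suc k * f - q) \<in> W"
      by (intro cpoly.subspace_scale[OF subspace_W] cpoly.subspace_diff[OF subspace_W] power[OF Suc.prems(2)]
        antiderivative_q(1))
    ultimately show ?case by (rule bexI)
  qed
  moreover obtain N where "\<forall>m\<in>keys f. mdeg m \<le> N" using keys_mdeg_bound by blast
  then have "pdiff (pvar j ^ Suc N) f = 0" by (rule pdiff_power_eq_0)
  ultimately have "\<exists>q\<in>W. pdiff (pvar j) q = linear_form d ^ 0 * f" using f_in by blast
  then show ?thesis by simp
qed

definition row_perp :: "int ^ 'n::finite ^ 'd::finite \<Rightarrow> 'n cpoly set" where
  "row_perp A = {q. \<forall>i. pdiff (row_form A i) q = 0}"

lemma row_perp_subspace: "cpoly.subspace (row_perp A)"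
  unfolding row_perp_def cpoly.subspace_def by (auto simp: pdiff_add_right pdiff_cscale_right)

lemma row_perp_pdiff: "q \<in> row_perp A \<Longrightarrow> pdiff \<phi> q \<in> row_perp A"
  unfolding row_perp_def by (auto simp: pdiff_commute[of _ \<phi>])

lemma row_perp_span: "q \<in> row_perp A \<Longrightarrow> \<phi> \<in> cpoly.span (range (row_form A)) \<Longrightarrow> pdiff \<phi> q = 0"
proof -
  assume q_in: "q \<in> row_perp A" and \<phi>_in: "\<phi> \<in> cpoly.span (range (row_form A))"
  have "cpoly.subspace {\<phi>. pdiff \<phi> q = 0}"
    by (auto simp: cpoly.subspace_def pdiff_add_left pdiff_cscale_left)
  moreover have "range (row_form A) \<subseteq> {\<phi>. pdiff \<phi> q = 0}" using q_in by (auto simp: row_perp_def)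
  ultimately show ?thesis using cpoly.span_minimal \<phi>_in by blast
qed

lemma row_perp_mult_linear_form:
  assumes "u \<in> int_kernel A" "f \<in> row_perp A"
  shows "linear_form (\<lambda>i. of_int (u $ i)) * f \<in> row_perp A"
  using assms(2) int_kernel_of_int[OF assms(1), where ?'a = complex]
  by (simp add: row_perp_def row_form_linear_form pdiff_linear_form_mult_linear_form)

lemma row_perp_antiderivative:
  assumes "u \<in> int_kernel A" "u $ j \<noteq> 0" "f \<in> row_perp A"
  shows "\<exists>q\<in>row_perp A. pdiff (pvar j) q = f"
  using assms by (intro antiderivative_exists[OF row_perp_subspace _ row_perp_mult_linear_form
    row_perp_pdiff]) auto

lemma row_perp_antiderivative_set:
  fixes A :: "int ^ 'n::finite ^ 'd::finite"
  assumes moving_X: "\<And>j. j \<in> X \<Longrightarrow> \<exists>u\<in>int_kernel A. u $ j \<noteq> 0" and f_in: "f \<in> row_perp A"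
  shows "\<exists>q\<in>row_perp A. pdiff (\<Prod>j\<in>X. pvar j) q = f"
proof -
  have "\<exists>q\<in>row_perp A. pdiff (\<Prod>j\<in>Y. pvar j) q = f" if "finite Y" "Y \<subseteq> X" for Y
    using that
  proof (induction Y rule: finite_induct)
    case empty
    then show ?case using f_in by auto
  next
    case (insert j Y)
    then obtain q where antiderivative_q: "q \<in> row_perp A" "pdiff (\<Prod>j\<in>Y. pvar j) q = f" by auto
    obtain u where "u \<in> int_kernel A" "u $ j \<noteq> 0" using moving_X insert.prems by blast
    then obtain q' where antiderivative_q': "q' \<in> row_perp A" "pdiff (pvar j) q' = q"
      using row_perp_antiderivative[OF _ _ antiderivative_q(1)] by blast
    have "pdiff (\<Prod>j\<in>insert j Y. pvar j) q' = f"
      using insert.hyps antiderivative_q antiderivative_q' by (simp add: pdiff_mult pdiff_commute[of "pvar j"])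
    then show ?case using antiderivative_q'(1) by blast
  qed
  then show ?thesis by simp
qed

lemma row_comb_kernel:
  assumes "u \<in> int_kernel A"
  shows "(\<Sum>l\<in>UNIV. linear_coeff (row_comb A r) l * of_int (u $ l)) = 0"
proof -
  have "(\<Sum>l\<in>UNIV. linear_coeff (row_comb A r) l * of_int (u $ l)) =
      (\<Sum>l\<in>UNIV. \<Sum>k\<in>UNIV. r k * (of_int (A $ k $ l) * of_int (u $ l)))"
    unfolding linear_coeff_row_comb by (simp add: sum_distrib_right mult.assoc)
  also have "\<dots> = (\<Sum>k\<in>UNIV. r k * (\<Sum>l\<in>UNIV. of_int (A $ k $ l) * of_int (u $ l)))"
    by (subst sum.swap) (simp add: sum_distrib_left)
  finally show ?thesis by (simp add: int_kernel_of_int[OF assms])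
qed

definition circuit_form :: "'n set \<Rightarrow> ('n \<Rightarrow> int ^ 'n) \<Rightarrow> 'n \<Rightarrow> 'n::finite cpoly" where
  "circuit_form \<sigma> U i = (\<Sum>j\<in>- \<sigma>. cscale (of_int (U j $ i) / of_int (U j $ j)) (pvar j))"

lemma homog_circuit_form: "homog 1 (circuit_form \<sigma> U i)"
  unfolding circuit_form_def by (intro homog_sum homog_cscale homog_pvar)

lemma linear_coeff_circuit_form:
  "linear_coeff (circuit_form \<sigma> U i) j = (if j \<in> \<sigma> then 0 else of_int (U j $ i) / of_int (U j $ j))"
  unfolding circuit_form_def by (subst linear_coeff_sum_pvar) auto

text \<open>\<open>U j\<close> is the circuit through \<open>j\<close> and the basis \<open>\<sigma>\<close>.\<close>

context
  fixes A :: "int ^ 'n::finite ^ 'd::finite" and \<sigma> U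
  assumes indep: "independent_columns A \<sigma>"
    and circuit_U: "\<And>j. j \<notin> \<sigma> \<Longrightarrow> U j \<in> int_kernel A" "\<And>j. j \<notin> \<sigma> \<Longrightarrow> U j $ j \<noteq> 0"
    "\<And>i j. j \<notin> \<sigma> \<Longrightarrow> i \<notin> insert j \<sigma> \<Longrightarrow> U j $ i = 0"
begin

lemma linear_coeff_pivot_row_comb:
  assumes pivot_r: "\<And>j. j \<in> \<sigma> \<Longrightarrow> linear_coeff (row_comb A r) j = (if j = i then 1 else 0)" and "i \<in> \<sigma>" "j \<notin> \<sigma>"
  shows "linear_coeff (row_comb A r) j = - of_int (U j $ i) / of_int (U j $ j)"
proof -
  have "i \<noteq> j" using assms(2,3) by blast
  have "linear_coeff (row_comb A r) l * of_int (U j $ l) = 0" if "l \<notin> {i, j}" for l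
    using pivot_r[of l] circuit_U(3)[OF assms(3), of l] that by (cases "l \<in> \<sigma>") auto
  then have "(\<Sum>l\<in>UNIV. linear_coeff (row_comb A r) l * of_int (U j $ l)) =
      (\<Sum>l\<in>{i, j}. linear_coeff (row_comb A r) l * of_int (U j $ l))"
    by (intro sum.mono_neutral_right) auto
  then have "of_int (U j $ i) + linear_coeff (row_comb A r) j * of_int (U j $ j) = 0"
    using row_comb_kernel[OF circuit_U(1)[OF assms(3)], of r] pivot_r[OF assms(2)] \<open>i \<noteq> j\<close> by simp
  then show ?thesis using circuit_U(2)[OF assms(3)] by (simp add: field_simps add_eq_0_iff)
qed

lemma pvar_diff_circuit_form: "pvar i - circuit_form \<sigma> U i \<in> cpoly.span (range (row_form A))"
proof (cases "i \<in> \<sigma>")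
  case True
  obtain r where pivot_r: "\<And>j. j \<in> \<sigma> \<Longrightarrow> linear_coeff (row_comb A r) j = (if j = i then 1 else 0)"
    by (rule pivot_row_comb[OF indep True]) blast
  have "row_comb A r = pvar i - circuit_form \<sigma> U i"
  proof (rule linear_form_eqI[OF row_comb_homog])
    show "linear_coeff (row_comb A r) j = linear_coeff (pvar i - circuit_form \<sigma> U i) j" for j
      using pivot_r[of j] linear_coeff_pivot_row_comb[OF pivot_r True, of j] True
      by (auto simp: linear_coeff_diff linear_coeff_circuit_form)
  qed (intro homog_diff homog_pvar homog_circuit_form)
  then show ?thesis using row_comb_span by metis
next
  case False
  have "pvar i = circuit_form \<sigma> U i"
  proof (rule linear_form_eqI[OF homog_pvar homog_circuit_form])
    show "linear_coeff (pvar i) j = linear_coeff (circuit_form \<sigma> U i) j" for j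
      using False circuit_U(2)[of j] circuit_U(3)[of j i] by (auto simp: linear_coeff_circuit_form)
  qed
  then show ?thesis by (simp add: cpoly.span_zero)
qed

lemma pdiff_circuit_form:
  assumes "f \<in> row_perp A"
  shows "pdiff (circuit_form \<sigma> U i) f = pdiff (pvar i) f"
  using row_perp_span[OF assms pvar_diff_circuit_form, of i] by (simp add: pdiff_diff_left)

lemma pdiff_prod_circuit_form:
  assumes "f \<in> row_perp A"
  shows "pdiff (\<Prod>i\<in>X. circuit_form \<sigma> U i) f = pdiff (\<Prod>i\<in>X. pvar i) f"
proof (induction X rule: infinite_finite_induct)
  case (insert i X)
  then show ?case using pdiff_circuit_form[OF row_perp_pdiff[OF assms]] by (simp add: pdiff_mult)
qed simp_all

end

text \<open>The substitution \<open>s\<^sub>k \<mapsto> \<tau> k\<close> inverts \<open>\<theta>\<^sub>j \<mapsto> (Bs)\<^sub>j\<close> modulo the row forms of \<open>A\<close>.\<close>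

definition inverts_lattice_substitution ::
    "int ^ 'n::finite ^ 'd::finite \<Rightarrow> nat \<Rightarrow> (nat \<Rightarrow> int ^ 'n) \<Rightarrow> (nat \<Rightarrow> 'n cpoly) \<Rightarrow> bool" where
  "inverts_lattice_substitution A h B \<tau> \<longleftrightarrow>
     (\<forall>f\<in>row_perp A. \<forall>X. pdiff (psubst \<tau> (Bs_prod h B X)) f = pdiff (\<Prod>j\<in>X. pvar j) f)"

lemma inverts_lattice_substitutionD:
  "inverts_lattice_substitution A h B \<tau> \<Longrightarrow> f \<in> row_perp A \<Longrightarrow>
    pdiff (psubst \<tau> (Bs_prod h B X)) f = pdiff (\<Prod>j\<in>X. pvar j) f"
  by (simp add: inverts_lattice_substitution_def)

lemma lattice_substitution_inverse_exists:
  fixes A :: "int ^ 'n::finite ^ 'd::finite"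
  assumes indep_\<sigma>: "independent_columns A \<sigma>" "card \<sigma> = CARD('d)"
    and basis_B: "int_kernel A = {\<Sum>k<h. c k *s B k | c :: nat \<Rightarrow> int. True}"
  shows "\<exists>\<tau>. inverts_lattice_substitution A h B \<tau>"
proof -
  have "\<forall>j\<in>- \<sigma>. \<exists>u. u \<in> int_kernel A \<and> u $ j \<noteq> 0 \<and> (\<forall>i. i \<notin> insert j \<sigma> \<longrightarrow> u $ i = 0)"
    using circuit_through[OF indep_\<sigma>] by (metis ComplD)
  from bchoice[OF this] obtain U where circuit_U: "\<And>j. j \<notin> \<sigma> \<Longrightarrow> U j \<in> int_kernel A" "\<And>j. j \<notin> \<sigma> \<Longrightarrow> U j $ j \<noteq> 0"
    "\<And>i j. j \<notin> \<sigma> \<Longrightarrow> i \<notin> insert j \<sigma> \<Longrightarrow> U j $ i = 0" by auto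
  have "\<forall>j\<in>- \<sigma>. \<exists>z. U j = (\<Sum>k<h. z k *s B k)" using circuit_U(1) basis_B by auto
  from bchoice[OF this] obtain z where lattice_coords_z: "\<And>j. j \<notin> \<sigma> \<Longrightarrow> U j = (\<Sum>k<h. z j k *s B k)" by auto
  define \<tau> :: "nat \<Rightarrow> 'n cpoly" where "\<tau> k = (\<Sum>j\<in>- \<sigma>. cscale (of_int (z j k) / of_int (U j $ j)) (pvar j))" for k
  have "(\<Sum>k<h. cscale (of_int (B k $ i)) (\<tau> k)) = circuit_form \<sigma> U i" for i
  proof -
    have coeff: "(\<Sum>k<h. of_int (B k $ i) * (of_int (z j k) / of_int (U j $ j))) =
      of_int (U j $ i) / (of_int (U j $ j) :: complex)"
      if "j \<notin> \<sigma>" for j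
    proof -
      have "of_int (U j $ i) = (\<Sum>k<h. of_int (z j k) * of_int (B k $ i) :: complex)"
        using lattice_coords_z[OF that] by simp
      then show ?thesis by (simp add: sum_divide_distrib mult.commute)
    qed
    have "(\<Sum>k<h. cscale (of_int (B k $ i)) (\<tau> k)) =
        (\<Sum>j\<in>- \<sigma>. cscale (\<Sum>k<h. of_int (B k $ i) * (of_int (z j k) / of_int (U j $ j))) (pvar j))"
      unfolding \<tau>_def cpoly.scale_sum_right cpoly.scale_sum_left by (subst sum.swap) simp
    also have "\<dots> = circuit_form \<sigma> U i"
      unfolding circuit_form_def by (intro sum.cong refl arg_cong2[of _ _ _ _ cscale] coeff) simp
    finally show ?thesis .
  qed
  then have "psubst \<tau> (Bs_prod h B X) = (\<Prod>i\<in>X. circuit_form \<sigma> U i)" for X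
    by (simp add: Bs_prod_def psubst_prod psubst_sum psubst_mult cscale_def)
  then have "inverts_lattice_substitution A h B \<tau>"
    using pdiff_prod_circuit_form[OF indep_\<sigma>(1) circuit_U] by (simp add: inverts_lattice_substitution_def)
  then show ?thesis by blast
qed

section \<open>The Frobenius method\<close>

definition agree_upto :: "nat \<Rightarrow> 'n::finite cpoly \<Rightarrow> 'n cpoly \<Rightarrow> bool" where
  "agree_upto N \<phi> \<psi> \<longleftrightarrow> (\<forall>f. (\<forall>m\<in>keys f. mdeg m \<le> N) \<longrightarrow> pdiff \<phi> f = pdiff \<psi> f)"

lemma agree_upto_refl: "agree_upto N \<phi> \<phi>"
  by (simp add: agree_upto_def)

lemma agree_upto_trans [trans]: "agree_upto N \<phi> \<psi> \<Longrightarrow> agree_upto N \<psi> \<rho> \<Longrightarrow> agree_upto N \<phi> \<rho>"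
  by (simp add: agree_upto_def)

lemma agree_upto_mult:
  fixes \<phi> :: "'n::finite cpoly"
  assumes "agree_upto N \<phi> \<psi>" "agree_upto N \<phi>' \<psi>'"
  shows "agree_upto N (\<phi> * \<phi>') (\<psi> * \<psi>')"
  unfolding agree_upto_def
proof (intro allI impI)
  fix f :: "'n cpoly" assume f_bound: "\<forall>m\<in>keys f. mdeg m \<le> N"
  have "pdiff (\<phi> * \<phi>') f = pdiff \<phi> (pdiff \<psi>' f)"
    using assms(2) f_bound by (simp add: agree_upto_def pdiff_mult)
  also have "\<dots> = pdiff \<psi> (pdiff \<psi>' f)"
    using assms(1) keys_pdiff_bound[OF f_bound] by (simp add: agree_upto_def)
  finally show "pdiff (\<phi> * \<phi>') f = pdiff (\<psi> * \<psi>') f" by (simp add: pdiff_mult)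
qed

lemma agree_upto_prod:
  "(\<And>x. x \<in> X \<Longrightarrow> agree_upto N (\<phi> x) (\<psi> x)) \<Longrightarrow> agree_upto N (prod \<phi> X) (prod \<psi> X)"
  by (induction X rule: infinite_finite_induct) (simp_all add: agree_upto_refl agree_upto_mult)

lemma unit_factor_inverse: "\<exists>r. agree_upto N (unit_factor v j t * r) 1"
proof (cases "v $ j + of_int t = 0")
  case True
  then show ?thesis by (intro exI[of _ 1]) (simp add: unit_factor_def agree_upto_refl)
next
  case False
  define c where "c = v $ j + of_int t"
  define x where "x = pconst (- inverse c) * pvar j"
  define r where "r = pconst (inverse c) * (\<Sum>i<Suc N. x ^ i)"
  have "pconst c * (1 - x) = pconst c + pconst (c * inverse c) * pvar j"
    by (simp add: x_def distrib_left pconst_mult pconst_uminus mult.assoc)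
  then have "unit_factor v j t = pconst c * (1 - x)" using False by (simp add: unit_factor_def c_def)
  then have "unit_factor v j t * r = (pconst c * pconst (inverse c)) * ((1 - x) * (\<Sum>i<Suc N. x ^ i))"
    by (simp add: r_def mult_ac)
  also have "\<dots> = 1 - x ^ Suc N"
    unfolding one_diff_power_eq[symmetric] using False by (simp add: pconst_mult[symmetric] c_def)
  finally have geometric_sum: "unit_factor v j t * r = 1 - x ^ Suc N" .
  have "pdiff (x ^ Suc N) f = 0" if "\<forall>m\<in>keys f. mdeg m \<le> N" for f
  proof -
    have "x ^ Suc N = pconst (- inverse c) ^ Suc N * pvar j ^ Suc N"
      unfolding x_def by (rule power_mult_distrib)
    then show ?thesis using pdiff_power_eq_0[OF that, of j] by (simp only: pdiff_mult pdiff_0_right)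
  qed
  then have "agree_upto N (unit_factor v j t * r) 1"
    unfolding agree_upto_def geometric_sum pdiff_diff_left by simp
  then show ?thesis by blast
qed

text \<open>Truncations of \<open>\<Gamma>(v\<^sub>j + \<theta>\<^sub>j + 1) / \<Gamma>(v\<^sub>j + \<theta>\<^sub>j + t + 1)\<close> with the factors \<open>\<theta>\<^sub>j\<close> removed.\<close>
definition gamma_quotients :: "complex ^ 'n::finite \<Rightarrow> nat \<Rightarrow> ('n \<Rightarrow> int \<Rightarrow> 'n cpoly) \<Rightarrow> bool" where
  "gamma_quotients v N E \<longleftrightarrow>
     (\<forall>j. E j 0 = 1) \<and> (\<forall>j t. agree_upto N (unit_factor v j t * E j t) (E j (t - 1)))"

lemma gamma_quotients_exist: "\<exists>E. gamma_quotients v N E"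
proof -
  have "\<forall>j t. \<exists>r. agree_upto N (unit_factor v j t * r) 1" using unit_factor_inverse by blast
  then obtain r where inverse_r: "\<And>j t. agree_upto N (unit_factor v j t * r j t) 1" by metis
  define E where "E j t =
    (if t \<ge> 0 then \<Prod>i<nat t. r j (int (Suc i)) else \<Prod>i<nat (- t). unit_factor v j (- int i))" for j t
  have E_nonneg: "E j (int k) = (\<Prod>i<k. r j (int (Suc i)))"
    and E_nonpos: "E j (- int k) = (\<Prod>i<k. unit_factor v j (- int i))" for j k
    by (simp_all add: E_def)
  have "agree_upto N (unit_factor v j t * E j t) (E j (t - 1))" for j t
  proof (cases "t \<ge> 1")
    case True
    then obtain n where n: "t - 1 = int n" using zero_le_imp_eq_int[of "t - 1"] by auto
    then have "t = int (Suc n)" by simp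
    then have "E j t = E j (t - 1) * r j t" unfolding n by (simp only: E_nonneg prod.lessThan_Suc)
    then have "unit_factor v j t * E j t = E j (t - 1) * (unit_factor v j t * r j t)" by (simp add: mult_ac)
    moreover have "agree_upto N (E j (t - 1) * (unit_factor v j t * r j t)) (E j (t - 1) * 1)"
      by (intro agree_upto_mult agree_upto_refl inverse_r)
    ultimately show ?thesis by simp
  next
    case False
    define n where "n = nat (- t)"
    have t: "t = - int n" "t - 1 = - int (Suc n)" using False by (simp_all add: n_def)
    have "E j (t - 1) = E j t * unit_factor v j t"
      unfolding t(2) E_nonpos prod.lessThan_Suc unfolding t(1) E_nonpos ..
    then show ?thesis by (simp add: mult.commute agree_upto_refl)
  qed
  moreover have "E j 0 = 1" for j by (simp add: E_def)
  ultimately show ?thesis unfolding gamma_quotients_def by blast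
qed

lemma gamma_quotients_deriv_factor:
  assumes E: "gamma_quotients v N E"
  shows "agree_upto N (deriv_factor v a y * (\<Prod>j\<in>UNIV. E j ((y + exp_vec a) $ j)))
    ((\<Prod>j\<in>nsupp_shift v y - nsupp_shift v (y + exp_vec a). pvar j) * (\<Prod>j\<in>UNIV. E j (y $ j)))"
proof -
  have one_variable: "agree_upto N ((\<Prod>k\<in>{1..n}. unit_factor v j (s + int k)) * E j (s + int n)) (E j s)"
    for n j s
  proof (induction n)
    case (Suc n)
    let ?P = "\<Prod>k\<in>{1..n}. unit_factor v j (s + int k)"
    have "agree_upto N (unit_factor v j (s + int (Suc n)) * E j (s + int (Suc n))) (E j (s + int (Suc n) - 1))"
      using E by (simp only: gamma_quotients_def)
    then have "agree_upto N (?P * (unit_factor v j (s + int (Suc n)) * E j (s + int (Suc n))))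
      (?P * E j (s + int n))"
      by (intro agree_upto_mult agree_upto_refl) simp
    from agree_upto_trans[OF this Suc.IH] show ?case by (simp add: mult.assoc)
  qed (simp add: agree_upto_refl)
  have "deriv_factor v a y * (\<Prod>j\<in>UNIV. E j ((y + exp_vec a) $ j)) =
    (\<Prod>j\<in>nsupp_shift v y - nsupp_shift v (y + exp_vec a). pvar j) *
    (\<Prod>j\<in>UNIV. (\<Prod>k\<in>{1..lookup a j}. unit_factor v j (y $ j + int k)) * E j (y $ j + int (lookup a j)))"
    unfolding deriv_factor_split prod.distrib by (simp add: mult.assoc)
  then show ?thesis by (simp only: agree_upto_mult agree_upto_refl agree_upto_prod one_variable)
qed

lemma rational_cone_pos:
  assumes R_pos: "finite R" "\<And>r. r \<in> R \<Longrightarrow> w \<bullet> rvec r > 0" and x_in_cone: "x \<in> rational_cone R" "x \<noteq> 0"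
  shows "w \<bullet> x > 0"
proof -
  obtain c where cone_coeffs: "x = (\<Sum>r\<in>R. c r *\<^sub>R rvec r)" "\<forall>r\<in>R. 0 \<le> c r"
    using x_in_cone(1) unfolding rational_cone_def by blast
  obtain r where positive_term: "r \<in> R" "c r \<noteq> 0"
    using x_in_cone(2) unfolding cone_coeffs(1) by (metis (no_types, lifting) scaleR_zero_left sum.neutral)
  have "0 < c r * (w \<bullet> rvec r)"
    using cone_coeffs(2) positive_term R_pos(2) by (intro mult_pos_pos) (auto simp: less_le)
  moreover have "0 \<le> c s * (w \<bullet> rvec s)" if "s \<in> R" for s
    using cone_coeffs(2) R_pos(2)[OF that] that by (intro mult_nonneg_nonneg) auto
  ultimately show ?thesis
    unfolding cone_coeffs(1) inner_sum_right inner_scaleR_right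
    by (intro sum_pos2[OF R_pos(1) positive_term(1)])
qed

lemma rational_cone_pointed:
  assumes R_pos: "finite R" "\<And>r. r \<in> R \<Longrightarrow> w \<bullet> rvec r > 0"
    and x_in_cone: "x \<in> rational_cone R" "- x \<in> rational_cone R"
  shows "x = 0"
  using rational_cone_pos[OF R_pos x_in_cone(1)] rational_cone_pos[OF R_pos x_in_cone(2)] by force

lemma C_monoid_rational_cone:
  assumes "u \<in> C_monoid m g"
  shows "rvec u \<in> rational_cone (g ` {..<m})"
proof -
  obtain c where "u = (\<Sum>i<m. int (c i) *s g i)" using assms unfolding C_monoid_def by blast
  moreover have "rvec (\<Sum>i\<in>X. int (c i) *s g i) = (\<Sum>i\<in>X. real (c i) *\<^sub>R rvec (g i))" for X
    by (induction X rule: infinite_finite_induct) (auto simp: rvec_def vec_eq_iff)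
  ultimately have "rvec u = (\<Sum>i<m. real (c i) *\<^sub>R rvec (g i))" by simp
  also have "\<dots> = (\<Sum>r\<in>g ` {..<m}. \<Sum>i\<in>{i \<in> {..<m}. g i = r}. real (c i) *\<^sub>R rvec (g i))"
    by (rule sum.image_gen) simp
  also have "\<dots> = (\<Sum>r\<in>g ` {..<m}. (\<Sum>i\<in>{i \<in> {..<m}. g i = r}. real (c i)) *\<^sub>R rvec r)"
    by (intro sum.cong refl) (simp add: scaleR_sum_left)
  finally show ?thesis
    unfolding rational_cone_def
    by (intro CollectI exI[of _ "\<lambda>r. \<Sum>i\<in>{i \<in> {..<m}. g i = r}. real (c i)"]) (auto intro: sum_nonneg)
qed

context toric_groebner
begin

lemma nsupp_in_NS:
  assumes "(a, \<sigma>) \<in> std_pairs_at A w v"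
  shows "nsupp v \<in> NS A v m g"
  unfolding NS_def
proof (intro CollectI exI conjI ballI impI)
  show "nsupp v = nsupp_shift v 0" by (simp add: nsupp_shift_0)
  show "0 \<in> int_kernel A" by (simp add: int_kernel_def)
  fix u' assume "u' \<in> int_kernel A" "nsupp_shift v u' = nsupp_shift v 0"
  then show "u' \<in> C_monoid m g" using same_nsupp_C_monoid[OF assms] by (simp add: nsupp_shift_0)
qed

end

text \<open>For \<open>q\<close> with logarithmic terms high enough that \<open>\<partial>\<^bsup>nsupp v - K\<^esup> q\<close> is a prescribed leading
  coefficient, the operators \<open>E j\<close> replace the Gamma quotients in the coefficients of a Frobenius series.\<close>

locale frobenius_series = toric_groebner A w m gp gm g
  for A :: "int ^ 'n::finite ^ 'd::finite" and w m gp gm g +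
  fixes \<beta> :: "complex ^ 'd" and v :: "complex ^ 'n" and q :: "'n cpoly" and N :: nat
    and E :: "'n \<Rightarrow> int \<Rightarrow> 'n cpoly"
  assumes Av_eq_\<beta>: "\<And>i. (\<Sum>j\<in>UNIV. of_int (A $ i $ j) * v $ j) = \<beta> $ i"
    and q_in_row_perp: "q \<in> row_perp A" and keys_q_bound: "\<forall>a\<in>keys q. mdeg a \<le> N"
    and q_annihilated: "\<And>I J. I \<in> NS A v m g \<Longrightarrow> J \<in> NS_compl A v m g \<Longrightarrow>
      pdiff (\<Prod>j\<in>(I \<union> J) - K_set A v m g. pvar j) q = 0"
    and gamma_E: "gamma_quotients v N E"
begin

definition frobenius_coeff :: "int ^ 'n \<Rightarrow> 'n cpoly" where
  "frobenius_coeff u = pdiff ((\<Prod>j\<in>nsupp_shift v u - K_set A v m g. pvar j) * (\<Prod>j\<in>UNIV. E j (u $ j))) q"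

definition frobenius :: "int ^ 'n \<Rightarrow> 'n cpoly" where
  "frobenius u = (if u \<in> int_kernel A \<and> nsupp_shift v u \<in> NS A v m g then frobenius_coeff u else 0)"

lemma frobenius_coeff_step:
  assumes "nsupp_shift v (y + exp_vec a) \<in> NS A v m g"
  shows "pdiff (deriv_factor v a y) (frobenius_coeff (y + exp_vec a)) = frobenius_coeff y"
proof -
  let ?K = "K_set A v m g" and ?x = "y + exp_vec a"
  let ?X = "nsupp_shift v ?x - ?K" and ?Y = "nsupp_shift v y - nsupp_shift v ?x"
  have "pdiff (deriv_factor v a y) (frobenius_coeff ?x) =
      pdiff (\<Prod>j\<in>?X. pvar j) (pdiff (deriv_factor v a y * (\<Prod>j\<in>UNIV. E j (?x $ j))) q)"
    by (simp add: frobenius_coeff_def pdiff_mult[symmetric] mult_ac)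
  also have "\<dots> = pdiff (\<Prod>j\<in>?X. pvar j) (pdiff ((\<Prod>j\<in>?Y. pvar j) * (\<Prod>j\<in>UNIV. E j (y $ j))) q)"
    using gamma_quotients_deriv_factor[OF gamma_E, of a y] keys_q_bound by (simp add: agree_upto_def)
  also have "\<dots> = pdiff (((\<Prod>j\<in>?X. pvar j) * (\<Prod>j\<in>?Y. pvar j)) * (\<Prod>j\<in>UNIV. E j (y $ j))) q"
    by (simp add: pdiff_mult)
  also have "(\<Prod>j\<in>?X. pvar j) * (\<Prod>j\<in>?Y. pvar j) = (\<Prod>j\<in>?X \<union> ?Y. pvar j)"
    by (rule prod.union_disjoint[symmetric]) auto
  also have "?X \<union> ?Y = nsupp_shift v y - ?K"
    using assms nsupp_shift_mono[of v y a] by (auto simp: K_set_def)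
  finally show ?thesis by (simp only: frobenius_coeff_def)
qed

lemma frobenius_coeff_eq_0:
  assumes "nsupp_shift v (y + exp_vec a) \<in> NS A v m g"
    and "nsupp_shift v (y + exp_vec b) \<notin> NS A v m g" "y + exp_vec b \<in> int_kernel A"
  shows "frobenius_coeff y = 0"
proof -
  let ?X = "(nsupp_shift v (y + exp_vec a) \<union> nsupp_shift v (y + exp_vec b)) - K_set A v m g"
  have "?X \<subseteq> nsupp_shift v y - K_set A v m g"
    using nsupp_shift_mono[of v y a] nsupp_shift_mono[of v y b] by blast
  then have "(\<Prod>j\<in>nsupp_shift v y - K_set A v m g. pvar j) =
      (\<Prod>j\<in>(nsupp_shift v y - K_set A v m g) - ?X. pvar j) * (\<Prod>j\<in>?X. pvar j)"
    by (rule prod.subset_diff) simp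
  then have "frobenius_coeff y =
      pdiff ((\<Prod>j\<in>(nsupp_shift v y - K_set A v m g) - ?X. pvar j) *
        (\<Prod>j\<in>UNIV. E j (y $ j))) (pdiff (\<Prod>j\<in>?X. pvar j) q)"
    by (simp only: frobenius_coeff_def pdiff_mult[symmetric] mult_ac)
  then show ?thesis using q_annihilated[OF assms(1), of "nsupp_shift v (y + exp_vec b)"] assms(2,3)
    by (simp add: NS_compl_def)
qed

lemma frobenius_shift:
  assumes "y + exp_vec a \<in> int_kernel A" "y + exp_vec b \<in> int_kernel A"
    "nsupp_shift v (y + exp_vec b) \<in> NS A v m g"
  shows "pdiff (deriv_factor v a y) (frobenius (y + exp_vec a)) = frobenius_coeff y"
proof (cases "nsupp_shift v (y + exp_vec a) \<in> NS A v m g")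
  case True
  then show ?thesis using frobenius_coeff_step assms(1) by (simp add: frobenius_def)
next
  case False
  then show ?thesis using frobenius_coeff_eq_0[OF assms(3) False assms(1)] by (simp add: frobenius_def)
qed

lemma frobenius_toric:
  assumes "A *v exp_vec a = A *v exp_vec b"
  shows "pdiff (deriv_factor v a y) (frobenius (y + exp_vec a)) =
    pdiff (deriv_factor v b y) (frobenius (y + exp_vec b))"
proof -
  have kernel: "y + exp_vec a \<in> int_kernel A \<longleftrightarrow> y + exp_vec b \<in> int_kernel A"
    using assms by (simp add: int_kernel_def matrix_vector_right_distrib)
  consider (supported) c where "c \<in> {a, b}" "y + exp_vec c \<in> int_kernel A"
    "nsupp_shift v (y + exp_vec c) \<in> NS A v m g"
    | (unsupported) "frobenius (y + exp_vec a) = 0" "frobenius (y + exp_vec b) = 0"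
    unfolding frobenius_def by (metis insertCI)
  then show ?thesis
  proof cases
    case supported
    then have "y + exp_vec a \<in> int_kernel A" "y + exp_vec b \<in> int_kernel A" using kernel by auto
    then show ?thesis using frobenius_shift[OF _ supported(2,3)] by simp
  qed simp
qed

lemma series_solution_frobenius:
  assumes "frobenius 0 \<noteq> 0"
  shows "series_solution A \<beta> w v frobenius"
  unfolding series_solution_def
proof (intro conjI)
  show support: "\<forall>u. frobenius u \<noteq> 0 \<longrightarrow> u \<in> int_kernel A" by (auto simp: frobenius_def split: if_splits)
  have "\<forall>a\<in>keys (frobenius u). mdeg a \<le> N" for u
    using keys_pdiff_bound[OF keys_q_bound] by (auto simp: frobenius_def frobenius_coeff_def)
  then show "\<exists>N. \<forall>u. \<forall>m\<in>keys (frobenius u). mdeg m \<le> N" by blast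
  have "u \<in> C_monoid m g" if "frobenius u \<noteq> 0" for u
    using that by (auto simp: frobenius_def NS_def split: if_splits)
  moreover have "w \<bullet> rvec r > 0" if "r \<in> g ` {..<m}" for r using that inner_g_pos by auto
  ultimately show "\<exists>R. finite R \<and> (\<forall>x. x \<in> rational_cone R \<and> - x \<in> rational_cone R \<longrightarrow> x = 0) \<and>
      (\<forall>x\<in>rational_cone R. x \<noteq> 0 \<longrightarrow> 0 < w \<bullet> x) \<and> (\<forall>u. frobenius u \<noteq> 0 \<longrightarrow> rvec u \<in> rational_cone R)"
    using rational_cone_pos[of "g ` {..<m}" w] rational_cone_pointed[of "g ` {..<m}" w]
    by (intro exI[of _ "g ` {..<m}"]) (simp add: C_monoid_rational_cone)
  have "frobenius u \<in> row_perp A" for u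
    using row_perp_pdiff[OF q_in_row_perp] cpoly.subspace_0[OF row_perp_subspace[of A]]
    by (simp add: frobenius_def frobenius_coeff_def)
  then have "\<forall>i u. pdiff (row_form A i) (frobenius u) = 0" by (simp add: row_perp_def)
  then show "\<forall>P\<in>hypergeometric_ideal A \<beta>. weyl_act v P frobenius = (\<lambda>u. 0)"
    using hypergeometric_solution_iff[OF Av_eq_\<beta> support] frobenius_toric by blast
qed (use assms in simp)

end

context toric_groebner
begin

lemma Q_perp_sub_row_perp: "f \<in> Q_perp A v m g \<Longrightarrow> f \<in> row_perp A"
  using row_form_in_Q_ideal[of A _ v m g] by (auto simp: row_perp_def Q_perp_def)

lemma Bs_prod_Polys: "Bs_prod h B X \<in> Polys {..<h}"
  unfolding Bs_prod_def by (intro Polys_prod Polys_sum Polys_mult Polys_pconst) simp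

lemma PB_ideal_annihilates_Q_perp:
  assumes \<tau>_inverts: "inverts_lattice_substitution A h B \<tau>"
    and f_in: "f \<in> Q_perp A v m g" and p_in: "p \<in> PB_ideal v m g h B"
  shows "pdiff (psubst \<tau> p) f = 0"
proof -
  have "{Bs_prod h B (G_set v (g i)) | i. i < m} \<subseteq> Polys {..<h}" using Bs_prod_Polys by auto
  with p_in[unfolded PB_ideal_def] show ?thesis
  proof (induction rule: Idl_induct)
    case (mult c s)
    then obtain i where s_eq: "i < m" "s = Bs_prod h B (G_set v (g i))" by blast
    have "pdiff (psubst \<tau> s) f = 0"
      unfolding s_eq(2) inverts_lattice_substitutionD[OF \<tau>_inverts Q_perp_sub_row_perp[OF f_in]]
      using f_in G_prod_in_Q_ideal[OF s_eq(1)] by (auto simp: Q_perp_def)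
    then show ?case by (simp add: psubst_mult pdiff_mult)
  qed (auto simp: psubst_add pdiff_add_left)
qed

lemma P_products_annihilate:
  assumes \<tau>_inverts: "inverts_lattice_substitution A h B \<tau>"
    and P_eq: "P_ideal A v m g h B = (*) (m_elem A v m g h B) ` PB_ideal v m g h B"
    and q_antiderivative: "q \<in> row_perp A" "pdiff (\<Prod>j\<in>nsupp v - K_set A v m g. pvar j) q \<in> Q_perp A v m g"
    and IJ_in: "I \<in> NS A v m g" "J \<in> NS_compl A v m g"
  shows "pdiff (\<Prod>j\<in>(I \<union> J) - K_set A v m g. pvar j) q = 0"
proof -
  let ?X = "(I \<union> J) - K_set A v m g" and ?m = "m_elem A v m g h B"
  have "{Bs_prod h B ((I \<union> J) - K_set A v m g) | I J. I \<in> NS A v m g \<and> J \<in> NS_compl A v m g} \<subseteq> Polys {..<h}"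
    using Bs_prod_Polys by auto
  then have "Bs_prod h B ?X \<in> P_ideal A v m g h B"
    unfolding P_ideal_def using IJ_in by (intro Idl_gen) auto
  then obtain p where factor_p: "p \<in> PB_ideal v m g h B" "Bs_prod h B ?X = ?m * p" unfolding P_eq by blast
  have "pdiff (\<Prod>j\<in>?X. pvar j) q = pdiff (psubst \<tau> (?m * p)) q"
    using inverts_lattice_substitutionD[OF \<tau>_inverts q_antiderivative(1), of ?X] factor_p(2) by simp
  also have "\<dots> = pdiff (psubst \<tau> p * psubst \<tau> ?m) q"
    by (simp only: psubst_mult mult.commute)
  also have "\<dots> = pdiff (psubst \<tau> p) (pdiff (\<Prod>j\<in>nsupp v - K_set A v m g. pvar j) q)"
    by (simp only: pdiff_mult m_elem_def inverts_lattice_substitutionD[OF \<tau>_inverts q_antiderivative(1)])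
  also have "\<dots> = 0" by (rule PB_ideal_annihilates_Q_perp[OF \<tau>_inverts q_antiderivative(2) factor_p(1)])
  finally show ?thesis .
qed

lemma kernel_moves_outside_K:
  assumes "j \<in> nsupp v - K_set A v m g"
  shows "\<exists>u\<in>int_kernel A. u $ j \<noteq> 0"
proof -
  obtain u where u_moves: "u \<in> int_kernel A" "j \<notin> nsupp_shift v u"
    using assms unfolding K_set_def NS_def by auto
  then have "u $ j \<noteq> 0" using assms by (auto simp: nsupp_shift_iff nsupp_def)
  then show ?thesis using u_moves(1) by blast
qed

lemma Q_perp_leading_coeff:
  fixes \<beta> v
  assumes Av_eq_\<beta>: "\<And>i. (\<Sum>j\<in>UNIV. of_int (A $ i $ j) * v $ j) = \<beta> $ i"
    and std_pair: "(a, \<sigma>) \<in> std_pairs_at A w v" "card \<sigma> = CARD('d)"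
    and basis_B: "int_kernel A = {\<Sum>k<h. c k *s B k | c :: nat \<Rightarrow> int. True}"
    and P_eq: "P_ideal A v m g h B = (*) (m_elem A v m g h B) ` PB_ideal v m g h B"
    and f_in: "f \<in> Q_perp A v m g" "f \<noteq> 0"
  obtains F where "series_solution A \<beta> w v F" "F 0 = f"
proof -
  have "\<exists>q\<in>row_perp A. pdiff (\<Prod>j\<in>nsupp v - K_set A v m g. pvar j) q = f"
    by (rule row_perp_antiderivative_set[OF kernel_moves_outside_K Q_perp_sub_row_perp[OF f_in(1)]])
  then obtain q where q_antiderivative: "q \<in> row_perp A" "pdiff (\<Prod>j\<in>nsupp v - K_set A v m g. pvar j) q = f" ..
  obtain \<tau> where \<tau>_inverts: "inverts_lattice_substitution A h B \<tau>"
    using lattice_substitution_inverse_exists[OF std_pairs_at_independent_columns[OF std_pair(1)] std_pair(2)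
      basis_B] by blast
  obtain N where mdeg_bound: "\<forall>a\<in>keys q. mdeg a \<le> N" using keys_mdeg_bound by blast
  obtain E where gamma_E: "gamma_quotients v N E" using gamma_quotients_exist by blast
  interpret frobenius_series A w m gp gm g \<beta> v q N E
  proof unfold_locales
    show "pdiff (\<Prod>j\<in>(I \<union> J) - K_set A v m g. pvar j) q = 0" if "I \<in> NS A v m g" "J \<in> NS_compl A v m g" for I J
      by (rule P_products_annihilate[OF \<tau>_inverts P_eq q_antiderivative(1) _ that])
        (simp_all add: q_antiderivative(2) f_in(1))
  qed (use Av_eq_\<beta> q_antiderivative(1) mdeg_bound gamma_E in auto)
  have "frobenius 0 = f"
    using nsupp_in_NS[OF std_pair(1)] q_antiderivative(2) gamma_E
    by (simp add: frobenius_def frobenius_coeff_def gamma_quotients_def nsupp_shift_0 int_kernel_def)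
  then show ?thesis using that series_solution_frobenius f_in(2) by metis
qed

end

section \<open>Fake exponents\<close>

lemma peval_add: "peval z (p + q) = peval z p + peval z q"
  unfolding peval_def by (rule setsum_keys_plus_distrib) (auto simp: distrib_right)

lemma peval_sum: "peval z (sum f X) = (\<Sum>x\<in>X. peval z (f x))"
  by (induction X rule: infinite_finite_induct) (auto simp: peval_add, simp_all add: peval_def)

lemma peval_single: "peval z (single a c) = c * (\<Prod>j\<in>keys a. z j ^ lookup a j)"
  by (cases "c = 0") (auto simp: peval_def)

lemma fake_exponent_beta:
  fixes A :: "int ^ 'n::finite ^ 'd::finite"
  assumes "fake_exponent A \<beta> w v"
  shows "(\<Sum>j\<in>UNIV. of_int (A $ i $ j) * v $ j) = \<beta> $ i"
proof -
  have "row_form A i - pconst (\<beta> $ i) \<in> fake_indicial_ideal A \<beta> w"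
    unfolding fake_indicial_ideal_def by (rule Idl_gen) auto
  then have peval_euler: "peval (($) v) (row_form A i - pconst (\<beta> $ i)) = 0"
    using assms by (simp add: fake_exponent_def)
  have "peval (($) v) (row_form A i) = (\<Sum>j\<in>UNIV. of_int (A $ i $ j) * v $ j)"
    unfolding row_form_def peval_sum
    by (simp add: pvar_def single_eq_pconst_pmon[symmetric] peval_single)
  moreover have "peval (($) v) (pconst (\<beta> $ i)) = \<beta> $ i" by (simp add: pconst_def peval_single)
  moreover have "peval (($) v) (row_form A i) =
    peval (($) v) (row_form A i - pconst (\<beta> $ i)) + peval (($) v) (pconst (\<beta> $ i))"
    by (simp add: peval_add[symmetric])
  ultimately show ?thesis using peval_euler by simp
qed

context toric_groebner
begin

lemma leading_coeffs_eq_Q_perp: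
  assumes fake: "fake_exponent A \<beta> w v" and std_pair: "(a, \<sigma>) \<in> std_pairs_at A w v" "card \<sigma> = CARD('d)"
    and basis_B: "is_Z_basis h B (int_kernel A)"
    and P_eq: "P_ideal A v m g h B = (*) (m_elem A v m g h B) ` PB_ideal v m g h B"
  shows "leading_coeffs A \<beta> w v = Q_perp A v m g"
proof (intro equalityI subsetI)
  note Av_eq_\<beta> = fake_exponent_beta[OF fake]
  show "f \<in> Q_perp A v m g" if "f \<in> leading_coeffs A \<beta> w v" for f
    using that leading_coeff_in_Q_perp[OF Av_eq_\<beta>] by (auto simp: leading_coeffs_def Q_perp_def)
  show "f \<in> leading_coeffs A \<beta> w v" if f_in: "f \<in> Q_perp A v m g" for f
  proof (cases "f = 0")
    case False
    have "int_kernel A = {\<Sum>k<h. c k *s B k | c :: nat \<Rightarrow> int. True}"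
      using basis_B by (simp only: is_Z_basis_def)
    then obtain F where "series_solution A \<beta> w v F" "F 0 = f"
      using Q_perp_leading_coeff[OF Av_eq_\<beta> std_pair _ P_eq f_in False] by blast
    then show ?thesis by (auto simp: leading_coeffs_def)
  qed (simp add: leading_coeffs_def)
qed

end

theorem corollary5p2:
  fixes A :: "int ^ 'n::finite ^ 'd::finite"
    and \<beta> :: "complex ^ 'd"
    and w :: "real ^ 'n"
    and v :: "complex ^ 'n"
    and m :: nat
    and gp gm :: "nat \<Rightarrow> ('n \<Rightarrow>\<^sub>0 nat)"
    and g :: "nat \<Rightarrow> int ^ 'n"
  assumes "rank (map_matrix of_int A :: rat ^ 'n ^ 'd) = CARD('d)"
    and "columns_in_affine_hyperplane A"
    and "generic_weight A w"
    and "fake_exponent A \<beta> w v"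
    and "reduced_groebner_basis w (toric_ideal A) {pmon (gp i) - pmon (gm i) | i. i < m}"
    and "\<forall>i<m. pmon (gp i) \<in> init_ideal w (toric_ideal A)"
    and "\<forall>i<m. g i = exp_vec (gp i) - exp_vec (gm i)"
    and "\<exists>(a, \<sigma>)\<in>std_pairs_at A w v. card \<sigma> = CARD('d)"
    and "cohen_macaulay (sr_ring (- nsupp v) (link_complex A w v))"
  shows
    "(\<exists>L ell. row_reduction A v L ell) \<and>
     (\<forall>L ell. row_reduction A v L ell \<longrightarrow>
        H_series A w v ell = fps_of_poly (h_poly (- nsupp v) (link_complex A w v))) \<and>
     Abs_fps (\<lambda>q. int (cpoly.dim (graded_part (Q_perp A v m g) q))) =
       fps_of_poly (h_poly (- nsupp v) (link_complex A w v)) \<and>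
     fin_dim (Q_perp A v m g) \<and>
     int (frank A v m g) = poly (h_poly (- nsupp v) (link_complex A w v)) 1 \<and>
     (\<forall>B. is_Z_basis (CARD('n) - CARD('d)) B (int_kernel A) \<and>
        P_ideal A v m g (CARD('n) - CARD('d)) B =
          (*) (m_elem A v m g (CARD('n) - CARD('d)) B) ` PB_ideal v m g (CARD('n) - CARD('d)) B \<longrightarrow>
        Abs_fps (\<lambda>q. int (cpoly.dim (graded_part (leading_coeffs A \<beta> w v) q))) =
          fps_of_poly (h_poly (- nsupp v) (link_complex A w v)) \<and>
        finite {q. graded_part (leading_coeffs A \<beta> w v) q \<noteq> {0}} \<and>
        {q. graded_part (leading_coeffs A \<beta> w v) q \<noteq> {0}} \<noteq> {} \<and>
        Max {q. graded_part (leading_coeffs A \<beta> w v) q \<noteq> {0}} =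
          degree (h_poly (- nsupp v) (link_complex A w v)) \<and>
        fin_dim (leading_coeffs A \<beta> w v) \<and>
        int (cpoly.dim (leading_coeffs A \<beta> w v)) =
          poly (h_poly (- nsupp v) (link_complex A w v)) 1)"
proof -
  interpret toric_groebner A w m gp gm g
    by (rule toric_groebner.intro[OF assms(2,3,5,7)])
  obtain a \<sigma> where std_pair: "(a, \<sigma>) \<in> std_pairs_at A w v" "card \<sigma> = CARD('d)"
    using assms(8) by blast
  have "independent_columns A (nsupp v)"
    by (rule independent_columns_mono[OF std_pairs_at_independent_columns nsupp_sub_std_pairs_at, OF std_pair(1,1)])
  then have reduction: "\<exists>L ell. row_reduction A v L ell" by (rule row_reduction_exists)
  have Q_hilbert: "has_hilbert_poly (Q_perp A v m g) (h_poly (- nsupp v) (link_complex A w v))"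
    by (rule Q_perp_has_hilbert_poly[OF std_pair assms(9)])
  have "Q_perp A v m g \<noteq> {0}" using one_in_Q_perp[OF std_pair(1)] by (metis singletonD zero_neq_one)
  note hilbert = hilbert_poly_series[OF Q_hilbert] hilbert_poly_fin_dim[OF Q_hilbert]
    hilbert_poly_dim[OF Q_hilbert] hilbert_poly_support[OF Q_hilbert this]
  have leading: "leading_coeffs A \<beta> w v = Q_perp A v m g"
    if "is_Z_basis h B (int_kernel A) \<and>
      P_ideal A v m g h B = (*) (m_elem A v m g h B) ` PB_ideal v m g h B" for h B
    using leading_coeffs_eq_Q_perp[OF assms(4) std_pair] that by blast
  show ?thesis
    unfolding frank_def
    by (intro conjI allI impI reduction hilbert H_series_eq_h_poly[OF std_pair assms(9)])
      (assumption | subst leading, assumption, rule hilbert)+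
qed

end
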